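(* Let $0<q<1$. The map $\nu\mapsto\mathcal E^\nu$ from $\overline{\mathcal N}$ to $\varprojlim\mathcal M(\overline{\mathbb{GT}}_N)$, where the latter is equipped with the weak topology, is a homeomorphism onto its image.
   Context: Fix $0<q<1$. $\mathcal M(W)$ denotes the space of finite signed (Borel) measures on $W$ with total variation norm. $\mathbb{GT}_N=\{\lambda=(\lambda_1\ge\dots\ge\lambda_N):\lambda_i\in\mathbb Z\}$, $\mathbb{GT}_0=\{\varnothing\}$, $|\lambda|=\sum_i\lambda_i$; $s_\lambda(x_1,\dots,x_N)=\det[x_i^{\lambda_j+N-j}]_{i,j=1}^N/\prod_{i<j}(x_i-x_j)$. Links: $P_N^\downarrow(\lambda\to\mu)=q^{(1-N)(|\lambda|-|\mu|)}s_\mu(1,\dots,q^{2-N})/s_\lambda(1,\dots,q^{1-N})$ for $\lambda\in\mathbb{GT}_N,\mu\in\mathbb{GT}_{N-1}$ with $\lambda_1\ge\mu_1\ge\lambda_2\ge\dots\ge\mu_{N-1}\ge\lambda_N$, and $0$ otherwise. $\overline{\mathbb{GT}}_N=\{\lambda_1\ge\dots\ge\lambda_N:\lambda_i\in\mathbb Z\cup\{+\infty\}\}=\bigsqcup_{k=0}^N\mathbb{GT}_N^{(k)}$, where $\mathbb{GT}_N^{(k)}$ consists of those $\lambda$ with exactly $k$ finite coordinates (the last $k$), identified with $\mathbb{GT}_k$ by dropping infinite coordinates. $\overline{\mathbb{GT}}_N$ carries the topology of coordinate-wise convergence, where $\mathbb Z$ is discrete and the sets $\{m\ge\ell\}\cup\{+\infty\}$,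 $\ell\in\mathbb Z$, form a neighborhood base of $+\infty$. Extended links $\overline P_N^\downarrow$ from $\overline{\mathbb{GT}}_N$ to $\overline{\mathbb{GT}}_{N-1}$: for $\lambda\in\mathbb{GT}_N^{(N)}=\mathbb{GT}_N$, $\overline P_N^\downarrow(\lambda\to\mu)=P_N^\downarrow(\lambda\to\mu)$ if $\mu\in\mathbb{GT}_{N-1}^{(N-1)}$, $0$ otherwise; for $\lambda\in\mathbb{GT}_N^{(k)}\simeq\mathbb{GT}_k$, $k<N$, $\overline P_N^\downarrow(\lambda\to\mu)=0$ unless $\mu\in\mathbb{GT}_{N-1}^{(k)}\simeq\mathbb{GT}_k$, in which case $$\overline P_N^\downarrow(\lambda\to\mu)=\prod_{i=1}^k(1-q^{N-i})\ \det_{i,j=1,\dots,k}[c_{\mu_i-i-\lambda_j+j}]\ \frac{s_\mu(1,\dots,q^{1-k})}{s_\lambda(1,\dots,q^{1-k})},\quad c_m=q^{(N-1)m}\ (m\ge0),\ c_m=0\ (m<0)$$ (for $k=0$ this is $1$). $\varprojlim\mathcal M(\overline{\mathbb{GT}}_N)$ is the space of sequences $(M_N)_{N\ge0}$, $M_N\in\mathcal M(\overline{\mathbb{GT}}_N)$, with $M_{N-1}(\mu)=\sum_\lambda M_N(\lambda)\overline P_N^\downarrow(\lambda\to\mu)$ for all $N\ge1$ and $\sup_N\|M_N\|<\infty$. Its weak topology is the minimal topology such that for every $N\ge0$ and every bounded continuous function $f$ on $\overline{\mathbb{GT}}_N$ the map $(M_N)\mapsto\sum_{w}f(w)M_N(w)$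 is continuous. $\overline{\mathcal N}=\{\nu_1\le\nu_2\le\dots:\nu_i\in\mathbb Z\cup\{+\infty\}\}$, with the topology whose base consists of the sets $\{\nu:\nu_1=\eta_1,\dots,\nu_k=\eta_k\}$ and $\{\nu:\nu_1=\eta_1,\dots,\nu_k=\eta_k,\nu_{k+1}\ge\ell\}$ ($\eta_i,\ell\in\mathbb Z$, $k\ge0$), i.e. coordinate-wise convergence. $\mathcal N\subset\overline{\mathcal N}$ is the subset of sequences with all $\nu_i$ finite; $\mathbb{GT}_k$ is embedded in $\overline{\mathcal N}$ by $\lambda\mapsto(\lambda_k,\lambda_{k-1},\dots,\lambda_1,+\infty,+\infty,\dots)$, so $\overline{\mathcal N}=\mathcal N\sqcup\bigsqcup_{k\ge0}\mathbb{GT}_k$. The sequences $\mathcal E^\nu=(\mathcal E^\nu_N)_{N\ge0}$ of probability measures, elements of $\varprojlim\mathcal M(\overline{\mathbb{GT}}_N)$: (a) For $\nu\in\mathcal N$, $\mathcal E^\nu_N$ is supported on $\mathbb{GT}_N=\mathbb{GT}_N^{(N)}$ and $\mathcal E^\nu_N(\mu)=\lim_{M\to\infty}(P_M^\downarrow\cdots P_{N+1}^\downarrow)((\nu_M,\dots,\nu_1)\to\mu)$ (it is known that these limits exist and that $\nu\mapsto\mathcal E^\nu$ is a homeomorphism of $\mathcal N$ onto the set of extreme points of the convex set of sequences of probability measures on the $\mathbb{GT}_N$ compatible with the links $P_N^\downarrow$, with the weak topology). (b) For $\nu\in\mathbb{GT}_k\subset\overline{\mathcal N}$ (written as a signature $\lambda\in\mathbb{GT}_k$)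 and $N\ge k$, $\mathcal E^\nu_N$ is the probability measure supported on $\mathbb{GT}_N^{(k)}\simeq\mathbb{GT}_k$ determined by $$\sum_{\mu\in\mathbb{GT}_k}\mathcal E^\nu_N(\mu)\frac{s_\mu(x_1,\dots,x_k)}{s_\mu(1,\dots,q^{1-k})}=\frac{s_\lambda(x_1,\dots,x_k)}{s_\lambda(1,\dots,q^{1-k})}\prod_{n=N+1}^\infty\prod_{i=1}^k\frac{1-q^{n-i}}{1-q^{n-1}x_i},\qquad|x_i|=q^{1-i};$$ for $N<k$, $\mathcal E^\nu_N$ is the image of $\mathcal E^\nu_k$ (a measure on $\mathbb{GT}_k$) under the links $P_k^\downarrow,\dots,P_{N+1}^\downarrow$. *)

theory Defs
  imports "HOL-Probability.Probability" "Jordan_Normal_Form.Determinant"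
begin

section \<open>The integers with $+\infty$ adjoined\<close>

datatype eint = Fin (the_int: int) | PInf

instantiation eint :: linorder
begin

definition less_eq_eint :: "eint \<Rightarrow> eint \<Rightarrow> bool" where
  "x \<le> y \<longleftrightarrow> (case y of PInf \<Rightarrow> True | Fin b \<Rightarrow> (case x of PInf \<Rightarrow> False | Fin a \<Rightarrow> a \<le> b))"

definition less_eint :: "eint \<Rightarrow> eint \<Rightarrow> bool" where
  "x < y \<longleftrightarrow> x \<le> y \<and> \<not> y \<le> (x::eint)"

instance
  by standard (auto simp: less_eq_eint_def less_eint_def split: eint.splits)

end

instantiation eint :: topological_space
begin

definition open_eint :: "eint set \<Rightarrow> bool" where
  "open U \<longleftrightarrow> (PInf \<in> U \<longrightarrow> (\<exists>l. \<forall>m\<ge>l. Fin m \<in> U))"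

instance
proof
  fix S T :: "eint set" assume "open S" "open T"
  then show "open (S \<inter> T)"
    unfolding open_eint_def by (metis IntD1 IntD2 IntI linorder_le_cases order_trans)
next
  fix K :: "eint set set" assume "\<forall>S\<in>K. open S"
  then show "open (\<Union>K)"
    unfolding open_eint_def by (metis UnionE UnionI)
qed (simp add: open_eint_def)

end


section \<open>Signatures\<close>

text \<open>Coordinates are indexed by \<open>{1..N}\<close>; functions are extensional, so that each signature is
  represented by exactly one function and there is exactly one signature of length \<open>0\<close>.\<close>

definition signatures :: "nat \<Rightarrow> (nat \<Rightarrow> 'a::linorder) set" where
  "signatures N = {l \<in> {1..N} \<rightarrow>\<^sub>E UNIV. \<forall>i\<in>{1..N}. \<forall>j\<in>{1..N}. i \<le> j \<longrightarrow> l j \<le> l i}"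

abbreviation GT :: "nat \<Rightarrow> (nat \<Rightarrow> int) set" where
  "GT \<equiv> signatures"

abbreviation GTbar :: "nat \<Rightarrow> (nat \<Rightarrow> eint) set" where
  "GTbar \<equiv> signatures"

definition GTbar_topology :: "nat \<Rightarrow> (nat \<Rightarrow> eint) topology" where
  "GTbar_topology N = subtopology (product_topology (\<lambda>_. euclidean) {1..N}) (GTbar N)"

definition num_finite :: "nat set \<Rightarrow> (nat \<Rightarrow> eint) \<Rightarrow> nat" where
  "num_finite I l = card {i\<in>I. l i \<noteq> PInf}"

text \<open>The identification of the stratum of \<open>GTbar N\<close> with \<open>k\<close> finite coordinates with \<open>GT k\<close>,
  in both directions.\<close>

definition drop_inf :: "nat \<Rightarrow> nat \<Rightarrow> (nat \<Rightarrow> eint) \<Rightarrow> (nat \<Rightarrow> int)" where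
  "drop_inf N k l = (\<lambda>i\<in>{1..k}. the_int (l (N - k + i)))"

definition add_inf :: "nat \<Rightarrow> nat \<Rightarrow> (nat \<Rightarrow> int) \<Rightarrow> (nat \<Rightarrow> eint)" where
  "add_inf N k l = (\<lambda>i\<in>{1..N}. if i \<le> N - k then PInf else Fin (l (i - (N - k))))"


section \<open>Schur functions and links\<close>

text \<open>Matrix indices of \<^const>\<open>Matrix.mat\<close> start from \<open>0\<close>. The quotient below is only meaningful at
  points with pairwise distinct coordinates; the points used here have \<open>\<bar>x\<^sub>i\<bar> = q\<^bsup>1-i\<^esup>\<close>,
  \<open>0 < q < 1\<close>.\<close>

definition schur :: "nat \<Rightarrow> (nat \<Rightarrow> int) \<Rightarrow> (nat \<Rightarrow> 'a::field) \<Rightarrow> 'a" where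
  "schur N l x =
     Determinant.det (Matrix.mat N N
       (\<lambda>(i, j). x (i + 1) powi (l (j + 1) + int N - int (j + 1))))
     / (\<Prod>(i, j)\<in>{(i, j). 1 \<le> i \<and> i < j \<and> j \<le> N}. x i - x j)"

definition schur_princ :: "real \<Rightarrow> nat \<Rightarrow> (nat \<Rightarrow> int) \<Rightarrow> real" where
  "schur_princ q N l = schur N l (\<lambda>i. q powi (1 - int i))"

definition sig_size :: "nat \<Rightarrow> (nat \<Rightarrow> int) \<Rightarrow> int" where
  "sig_size N l = (\<Sum>i=1..N. l i)"

definition interlaces :: "nat \<Rightarrow> (nat \<Rightarrow> int) \<Rightarrow> (nat \<Rightarrow> int) \<Rightarrow> bool" where
  "interlaces N l m \<longleftrightarrow> (\<forall>i\<in>{1..<N}. l i \<ge> m i \<and> m i \<ge> l (i + 1))"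

definition link :: "real \<Rightarrow> nat \<Rightarrow> (nat \<Rightarrow> int) \<Rightarrow> (nat \<Rightarrow> int) \<Rightarrow> real" where
  "link q N l m =
     (if interlaces N l m
      then q powi ((1 - int N) * (sig_size N l - sig_size (N - 1) m))
           * schur_princ q (N - 1) m / schur_princ q N l
      else 0)"

text \<open>The composition of the links from \<open>GT (N + d)\<close> down to \<open>GT N\<close>.\<close>

primrec link_comp :: "real \<Rightarrow> nat \<Rightarrow> nat \<Rightarrow> (nat \<Rightarrow> int) \<Rightarrow> (nat \<Rightarrow> int) \<Rightarrow> real" where
  "link_comp q N 0 l m = (if l = m then 1 else 0)"
| "link_comp q N (Suc d) l m =
     (\<Sum>\<^sub>\<infinity>k\<in>GT (N + d). link q (N + Suc d) l k * link_comp q N d k m)"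

definition link_coeff :: "real \<Rightarrow> nat \<Rightarrow> int \<Rightarrow> real" where
  "link_coeff q N m = (if m \<ge> 0 then q powi ((int N - 1) * m) else 0)"

definition ext_link :: "real \<Rightarrow> nat \<Rightarrow> (nat \<Rightarrow> eint) \<Rightarrow> (nat \<Rightarrow> eint) \<Rightarrow> real" where
  "ext_link q N l m =
     (let k = num_finite {1..N} l; k' = num_finite {1..N - 1} m in
      if k = N then
        (if k' = N - 1 then link q N (drop_inf N N l) (drop_inf (N - 1) (N - 1) m) else 0)
      else if k' = k then
        (let l' = drop_inf N k l; m' = drop_inf (N - 1) k m in
           (\<Prod>i=1..k. 1 - q ^ (N - i))
           * Determinant.det (Matrix.mat k k (\<lambda>(i, j).
               link_coeff q N (m' (i + 1) - int (i + 1) - l' (j + 1) + int (j + 1))))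
           * schur_princ q k m' / schur_princ q k l')
      else 0)"


section \<open>Finite signed Borel measures and the projective limit\<close>

definition borel_sets_of :: "'a topology \<Rightarrow> 'a set set" where
  "borel_sets_of X = sigma_sets (topspace X) {U. openin X U}"

text \<open>A finite signed measure is a countably additive real function on Borel sets, extended by
  \<open>0\<close> to the other sets so that equal measures are equal functions. (The value at \<open>{}\<close> is \<open>0\<close> by
  convergence of the constant series.)\<close>

definition signed_measures :: "'a topology \<Rightarrow> ('a set \<Rightarrow> real) set" where
  "signed_measures X =
     {m. (\<forall>A. A \<notin> borel_sets_of X \<longrightarrow> m A = 0) \<and>
         (\<forall>A :: nat \<Rightarrow> 'a set. range A \<subseteq> borel_sets_of X \<longrightarrow> disjoint_family A \<longrightarrow>
            (\<lambda>i. m (A i)) sums m (\<Union>i. A i))}"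

definition tv_norm :: "'a topology \<Rightarrow> ('a set \<Rightarrow> real) \<Rightarrow> ennreal" where
  "tv_norm X m =
     (SUP F\<in>{F. finite F \<and> F \<subseteq> borel_sets_of X \<and> disjoint F}. \<Sum>A\<in>F. ennreal \<bar>m A\<bar>)"

definition proj_limit :: "real \<Rightarrow> (nat \<Rightarrow> (nat \<Rightarrow> eint) set \<Rightarrow> real) set" where
  "proj_limit q =
     {M. (\<forall>N. M N \<in> signed_measures (GTbar_topology N)) \<and>
         (\<forall>N\<ge>1. \<forall>m\<in>GTbar (N - 1).
            M (N - 1) {m} = (\<Sum>\<^sub>\<infinity>l\<in>GTbar N. M N {l} * ext_link q N l m)) \<and>
         (SUP N. tv_norm (GTbar_topology N) (M N)) < \<infinity>}"

definition weak_topology :: "real \<Rightarrow> (nat \<Rightarrow> (nat \<Rightarrow> eint) set \<Rightarrow> real) topology" where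
  "weak_topology q = topology_generated_by
     {{M \<in> proj_limit q. (\<Sum>\<^sub>\<infinity>w\<in>GTbar N. f w * M N {w}) \<in> U} | N f U.
        continuous_map (GTbar_topology N) euclideanreal f \<and> bounded (f ` GTbar N) \<and> open U}"


section \<open>The boundary\<close>

definition Nbar :: "(nat \<Rightarrow> eint) set" where
  "Nbar = {\<nu> \<in> {1..} \<rightarrow>\<^sub>E UNIV. \<forall>i\<ge>1. \<forall>j\<ge>i. \<nu> i \<le> \<nu> j}"

definition Nfin :: "(nat \<Rightarrow> eint) set" where
  "Nfin = {\<nu> \<in> Nbar. \<forall>i\<ge>1. \<nu> i \<noteq> PInf}"

text \<open>The generating family is a base of the topology of coordinate-wise convergence; its members
  with \<open>k = 0\<close> make \<^const>\<open>Nbar\<close> the whole space.\<close>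

definition Nbar_topology :: "(nat \<Rightarrow> eint) topology" where
  "Nbar_topology = topology_generated_by
     ({{\<nu> \<in> Nbar. \<forall>i\<in>{1..k}. \<nu> i = Fin (\<eta> i)} | k \<eta>. True} \<union>
      {{\<nu> \<in> Nbar. (\<forall>i\<in>{1..k}. \<nu> i = Fin (\<eta> i)) \<and> \<nu> (k + 1) \<ge> Fin l} | k \<eta> l. True})"

text \<open>The signature \<open>(\<nu>\<^sub>k, \<dots>, \<nu>\<^sub>1)\<close>. When exactly the first \<open>k\<close> coordinates of \<open>\<nu>\<close> are finite, this
  is the element of \<open>GT k\<close> which is embedded into \<^const>\<open>Nbar\<close> as \<open>\<nu>\<close>.\<close>

definition rev_sig :: "nat \<Rightarrow> (nat \<Rightarrow> eint) \<Rightarrow> (nat \<Rightarrow> int)" where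
  "rev_sig k \<nu> = (\<lambda>i\<in>{1..k}. the_int (\<nu> (k + 1 - i)))"

text \<open>The law on \<open>GT k\<close> characterized by its normalized Schur generating function
  \<open>\<Sum>\<^sub>m p(m) s\<^sub>m(x) / s\<^sub>m(1, \<dots>, q\<^bsup>1-k\<^esup>)\<close> on the torus \<open>\<bar>x\<^sub>i\<bar> = q\<^bsup>1-i\<^esup>\<close>. The infinite product
  runs over \<open>n = N + 1 + r\<close> with \<open>r \<ge> 0\<close>.\<close>

definition stable_measure :: "real \<Rightarrow> nat \<Rightarrow> nat \<Rightarrow> (nat \<Rightarrow> int) \<Rightarrow> (nat \<Rightarrow> int) pmf" where
  "stable_measure q k N l = (THE p. set_pmf p \<subseteq> GT k \<and>
     (\<forall>x :: nat \<Rightarrow> complex. (\<forall>i\<in>{1..k}. norm (x i) = q powi (1 - int i)) \<longrightarrow>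
        ((\<lambda>m. of_real (pmf p m) * (schur k m x / of_real (schur_princ q k m))) has_sum
          (schur k l x / of_real (schur_princ q k l)
           * (\<Prod>r. \<Prod>i=1..k. of_real (1 - q ^ (N + 1 + r - i)) / (1 - of_real (q ^ (N + r)) * x i))))
        (GT k)))"

text \<open>\<open>\<E>\<^sup>\<nu>\<^sub>N\<close> is supported on the stratum of \<open>GTbar N\<close> with \<open>E_rank \<nu> N\<close> finite coordinates;
  \<open>E_mass\<close> is its mass function there, under the identification of the stratum with
  \<open>GT (E_rank \<nu> N)\<close>.\<close>

definition E_rank :: "(nat \<Rightarrow> eint) \<Rightarrow> nat \<Rightarrow> nat" where
  "E_rank \<nu> N = (if \<nu> \<in> Nfin then N else min N (num_finite {1..} \<nu>))"

definition E_mass :: "real \<Rightarrow> (nat \<Rightarrow> eint) \<Rightarrow> nat \<Rightarrow> (nat \<Rightarrow> int) \<Rightarrow> real" where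
  "E_mass q \<nu> N m =
     (if \<nu> \<in> Nfin then lim (\<lambda>d. link_comp q N d (rev_sig (N + d) \<nu>) m)
      else let k = num_finite {1..} \<nu>; l = rev_sig k \<nu> in
        if k \<le> N then pmf (stable_measure q k N l) m
        else (\<Sum>\<^sub>\<infinity>p\<in>GT k. pmf (stable_measure q k k l) p * link_comp q N (k - N) p m))"

definition E_measure :: "real \<Rightarrow> (nat \<Rightarrow> eint) \<Rightarrow> nat \<Rightarrow> (nat \<Rightarrow> eint) set \<Rightarrow> real" where
  "E_measure q \<nu> N A =
     (if A \<in> borel_sets_of (GTbar_topology N)
      then \<Sum>\<^sub>\<infinity>m\<in>{m \<in> GT (E_rank \<nu> N). add_inf N (E_rank \<nu> N) m \<in> A}. E_mass q \<nu> N m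
      else 0)"

end

theory Submission
  imports Defs
begin

text \<open>
  All links are instances of one kernel on strictly increasing sequences: the probability of \<open>m\<close> given \<open>L\<close>
  is proportional to \<open>q\<^bsup>N \<Sum>m\<^esup>\<close> times an alternant, on the sequences interlacing with \<open>L\<close>. Place
  the points \<open>y\<^sub>j = q\<^bsup>L j\<^esup>\<close>, with \<open>y\<^sub>j = 0\<close> for an infinite coordinate. Then every Schur
  polynomial in \<open>y\<close> is an eigenfunction of the kernels up to an explicit constant. By the dual Pieri
  rule and Stone--Weierstrass, Schur polynomials span a dense subspace of the continuous functions on
  the compact space of configurations bounded below. Their expectations converge as the starting level
  tends to infinity, so the limit measures exist for every \<open>\<nu>\<close>, finite or not, and depend continuously on
  \<open>\<nu>\<close>. No mass is lost because the mean displacement of the \<open>n\<close>-th coordinate between the infinite level and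
  level \<open>N\<close> is \<open>O(q\<^bsup>N-n\<^esup>)\<close>. The same bound shows that on high levels the measures concentrate at the
  coordinates of \<open>\<nu>\<close>, which gives injectivity and continuity of the inverse. The measures defined
  by a generating function are identified with the limits by Fourier uniqueness on a torus.
\<close>

section \<open>Determinants and sums over interlacing boxes\<close>

text \<open>The obstacle is escape to infinity. Compactness of the configuration space is bought by
  admitting y_j = 0, so convergence of the expectations of all continuous functions would still
  allow a coordinate that is finite in \<nu> to become infinite in the limit law. The displacement
  bound excludes this because it does not depend on the level at which the chain starts. It depends
  on n and N but not on \<nu>, so for each n one level N serves all \<nu> at once when a coordinate
  is read off, and the inverse map needs no compactness argument. Compactness also requires a common
  lower bound. With coordinates listed in increasing order the kernels never move a coordinate down,
  so a bound \<nu>_1 >= l passes to all laws. The sets of \<nu> with such a bound are open and cover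
  the boundary, which is enough for continuity. The limit in the starting level is explicit: the
  constants telescope along a chain and tend to 1, so the expectation of a Schur polynomial at level
  N is a constant times its value at the whole sequence q^(\<nu>_(j+1) + j), and this value is
  approached geometrically fast and uniformly on each such set.\<close>

definition detf :: "nat \<Rightarrow> (nat \<Rightarrow> nat \<Rightarrow> 'a::comm_ring_1) \<Rightarrow> 'a" where
  "detf k a = Determinant.det (Matrix.mat k k (\<lambda>(i, j). a i j))"

lemma detf_rows:
  "detf k a = (\<Sum>p | p permutes {0..<k}. signof p * (\<Prod>i<k. a i (p i)))"
  unfolding detf_def by (subst det_def'[of _ k]) (auto intro!: sum.cong prod.cong simp: atLeast0LessThan permutes_in_image)

lemma detf_cols:
  "detf k a = (\<Sum>p | p permutes {0..<k}. signof p * (\<Prod>j<k. a (p j) j))"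
proof -
  have "p j < k" if "p permutes {0..<k}" "j < k" for p j
    using permutes_in_image[OF that(1), of j] that(2) by simp
  then show ?thesis
    unfolding detf_def by (subst det_col[of _ k]) (auto intro!: sum.cong prod.cong)
qed

lemma detf_cong: "(\<And>i j. i < k \<Longrightarrow> j < k \<Longrightarrow> a i j = b i j) \<Longrightarrow> detf k a = detf k b"
  unfolding detf_def by (rule arg_cong[of _ _ Determinant.det], rule eq_matI) auto

lemma detf_transpose: "detf k (\<lambda>i j. a j i) = detf k a"
  unfolding detf_rows[of k "\<lambda>i j. a j i"] detf_cols[of k a] by simp

lemma detf_scale_rows: "detf k (\<lambda>i j. c i * a i j) = (\<Prod>i<k. c i) * detf k a"
  unfolding detf_rows by (simp add: prod.distrib sum_distrib_left mult_ac)

lemma detf_scale_cols: "detf k (\<lambda>i j. c j * a i j) = (\<Prod>j<k. c j) * detf k a"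
  unfolding detf_cols by (simp add: prod.distrib sum_distrib_left mult_ac)

lemma detf_equal_cols:
  assumes "i < k" "j < k" "i \<noteq> j" "\<And>r. r < k \<Longrightarrow> a r i = a r j"
  shows "detf k a = 0"
  unfolding detf_def
  by (rule det_identical_columns[of _ k i j]) (use assms in \<open>auto intro!: eq_vecI\<close>)

lemma detf_equal_rows:
  assumes "i < k" "j < k" "i \<noteq> j" "\<And>r. r < k \<Longrightarrow> a i r = a j r"
  shows "detf k a = 0"
  using detf_equal_cols[of i k j "\<lambda>i j. a j i"] assms by (simp add: detf_transpose[of k a])

lemma detf_lower_triangular:
  assumes "\<And>i j. i < j \<Longrightarrow> j < k \<Longrightarrow> a i j = 0"
  shows "detf k a = (\<Prod>i<k. a i i)"
proof -
  let ?A = "Matrix.mat k k (\<lambda>(i, j). a i j)"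
  have "detf k a = prod_list (diag_mat ?A)"
    unfolding detf_def by (rule det_lower_triangular[of k]) (use assms in auto)
  also have "\<dots> = (\<Prod>i<k. a i i)"
    by (subst prod_list_diag_prod) (auto intro!: prod.cong simp: atLeast0LessThan)
  finally show ?thesis .
qed

lemma detf_mult: "detf k (\<lambda>i j. \<Sum>l<k. a i l * b l j) = detf k a * detf k b"
proof -
  have "Matrix.mat k k (\<lambda>(i, j). \<Sum>l<k. a i l * b l j) =
      Matrix.mat k k (\<lambda>(i, j). a i j) * Matrix.mat k k (\<lambda>(i, j). b i j)"
    by (rule eq_matI) (auto simp: scalar_prod_def atLeast0LessThan)
  then show ?thesis unfolding detf_def by (simp add: det_mult[of _ k])
qed

lemma detf_last_row_unit:
  assumes "\<And>j. j < k \<Longrightarrow> a k j = 0" "a k k = 1"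
  shows "detf (Suc k) a = detf k a"
proof -
  let ?A = "Matrix.mat (Suc k) (Suc k) (\<lambda>(i, j). a i j)"
  have "detf (Suc k) a = (\<Sum>j<Suc k. ?A $$ (k, j) * cofactor ?A k j)"
    unfolding detf_def by (rule laplace_expansion_row) auto
  also have "\<dots> = cofactor ?A k k"
    using assms by (simp add: sum.neutral)
  also have "mat_delete ?A k k = Matrix.mat k k (\<lambda>(i, j). a i j)"
    by (rule eq_matI) (auto simp: mat_delete_def)
  then have "cofactor ?A k k = detf k a"
    by (simp add: cofactor_def detf_def)
  finally show ?thesis .
qed

text \<open>Right multiplication by a lower bidiagonal matrix with ones on the diagonal and -1 below
  it.\<close>

lemma detf_column_differences:
  "detf k (\<lambda>i j. a i j - (if Suc j < k then a i (Suc j) else 0)) = detf k a"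
proof -
  let ?b = "\<lambda>l j. if l = j then 1 else if l = Suc j then -1 else (0::'a)"
  have "(\<Sum>l<k. a i l * ?b l j) = a i j - (if Suc j < k then a i (Suc j) else 0)" if "j < k" for i j
  proof -
    have "(\<Sum>l<k. a i l * ?b l j) = (\<Sum>l<k. (if l = j then a i l else 0) + (if l = Suc j then - a i l else 0))"
      by (rule sum.cong) auto
    then show ?thesis using that by (simp add: sum.distrib)
  qed
  then have "detf k (\<lambda>i j. a i j - (if Suc j < k then a i (Suc j) else 0)) = detf k a * detf k ?b"
    by (subst detf_mult[symmetric]) (auto intro!: detf_cong)
  then show ?thesis
    by (subst (asm) detf_lower_triangular[of k ?b]) auto
qed

text \<open>Taking differences turns the row of ones into a unit vector. Read from left to right, k
  differences of adjacent columns become a determinant of size k + 1; this is how interlacing with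
  one more coordinate adds a variable.\<close>

lemma detf_column_differences_unit_row:
  assumes "\<And>j. j \<le> k \<Longrightarrow> a k j = 1"
  shows "detf k (\<lambda>i j. a i j - a i (Suc j)) = detf (Suc k) a"
proof -
  have "detf (Suc k) a = detf (Suc k) (\<lambda>i j. a i j - (if Suc j < Suc k then a i (Suc j) else 0))"
    by (simp only: detf_column_differences)
  also have "\<dots> = detf k (\<lambda>i j. a i j - (if Suc j < Suc k then a i (Suc j) else 0))"
    by (rule detf_last_row_unit) (use assms in auto)
  also have "\<dots> = detf k (\<lambda>i j. a i j - a i (Suc j))"
    by (rule detf_cong) auto
  finally show ?thesis by simp
qed

text \<open>\<open>infsum_prod_PiE_abs\<close> gives the value of the sum but not its convergence.
  Since \<open>infsum\<close> is 0 on families that are not summable, a nonzero sum of the norms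
  proves summability; the nonzero term required in each factor makes that sum nonzero.\<close>

lemma has_sum_prod_PiE:
  fixes f :: "'i \<Rightarrow> 'b \<Rightarrow> 'c :: {banach, real_normed_field}"
  assumes "finite A" and summ: "\<And>x. x \<in> A \<Longrightarrow> f x abs_summable_on B x"
    and nz: "\<And>x. x \<in> A \<Longrightarrow> \<exists>y\<in>B x. f x y \<noteq> 0"
  shows "((\<lambda>g. \<Prod>x\<in>A. f x (g x)) has_sum (\<Prod>x\<in>A. infsum (f x) (B x))) (PiE A B)"
proof -
  have "infsum (\<lambda>g. \<Prod>x\<in>A. norm (f x (g x))) (PiE A B) = (\<Prod>x\<in>A. infsum (\<lambda>y. norm (f x y)) (B x))"
    by (rule infsum_prod_PiE_abs) (use assms in auto)
  moreover have "infsum (\<lambda>y. norm (f x y)) (B x) \<noteq> 0" if "x \<in> A" for x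
  proof -
    obtain y where y: "y \<in> B x" "f x y \<noteq> 0" using nz \<open>x \<in> A\<close> by blast
    have "sum (\<lambda>y. norm (f x y)) {y} \<le> infsum (\<lambda>y. norm (f x y)) (B x)"
      by (rule finite_sum_le_infsum) (use y summ that in auto)
    then show ?thesis using y by auto
  qed
  ultimately have "infsum (\<lambda>g. \<Prod>x\<in>A. norm (f x (g x))) (PiE A B) \<noteq> 0"
    using \<open>finite A\<close> by simp
  then have "(\<lambda>g. norm (\<Prod>x\<in>A. f x (g x))) summable_on PiE A B"
    using infsum_not_exists by (fastforce simp: prod_norm)
  then have "(\<lambda>g. \<Prod>x\<in>A. f x (g x)) summable_on PiE A B"
    by (rule abs_summable_summable)
  moreover have "infsum (\<lambda>g. \<Prod>x\<in>A. f x (g x)) (PiE A B) = (\<Prod>x\<in>A. infsum (f x) (B x))"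
    by (rule infsum_prod_PiE_abs) (use assms in auto)
  ultimately show ?thesis by (metis has_sum_infsum)
qed

lemma has_sum_sum':
  fixes f :: "'i \<Rightarrow> 'b \<Rightarrow> 'c :: topological_comm_monoid_add"
  assumes "\<And>i. i \<in> I \<Longrightarrow> (f i has_sum s i) A"
  shows "((\<lambda>x. \<Sum>i\<in>I. f i x) has_sum (\<Sum>i\<in>I. s i)) A"
  using assms by (induction I rule: infinite_finite_induct) (auto intro: has_sum_add)

text \<open>The Leibniz expansion by columns puts the variable m_j into a single factor of each
  product, so every column is summed over its own index set.\<close>

lemma has_sum_detf:
  fixes f :: "nat \<Rightarrow> 'b \<Rightarrow> 'c :: {banach, real_normed_field}"
  assumes "\<And>i j. i < k \<Longrightarrow> j < k \<Longrightarrow> f i abs_summable_on B j"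
    and "\<And>i j. i < k \<Longrightarrow> j < k \<Longrightarrow> \<exists>y\<in>B j. f i y \<noteq> 0"
  shows "((\<lambda>m. detf k (\<lambda>i j. f i (m j))) has_sum detf k (\<lambda>i j. infsum (f i) (B j))) (PiE {..<k} B)"
  unfolding detf_cols
proof (rule has_sum_sum', rule has_sum_cmult_right)
  fix p assume "p \<in> {p. p permutes {0..<k}}"
  then have "p j < k" if "j < k" for j
    using permutes_in_image[of p "{0..<k}" j] that by simp
  then show "((\<lambda>m. \<Prod>j<k. f (p j) (m j)) has_sum (\<Prod>j<k. infsum (f (p j)) (B j))) (PiE {..<k} B)"
    by (intro has_sum_prod_PiE) (use assms in auto)
qed

lemma has_sum_powi_ge:
  fixes z :: "'a :: {banach, real_normed_field}"
  assumes "z \<noteq> 0" "norm z < 1"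
  shows "((\<lambda>m. z powi m) has_sum (z powi a / (1 - z))) {m::int. a \<le> m}" "(\<lambda>m. z powi m) abs_summable_on {m::int. a \<le> m}"
proof -
  have inj: "inj (\<lambda>n. a + int n)" by (auto intro: injI)
  have img: "(\<lambda>n. a + int n) ` UNIV = {m::int. a \<le> m}"
    by (auto simp: image_iff) (metis zle_iff_zadd)
  have "(\<lambda>n. norm (z ^ n)) summable_on UNIV"
    by (rule norm_summable_imp_summable_on) (use assms in \<open>simp add: norm_power summable_geometric\<close>)
  then have "(\<lambda>n. norm (z powi a) * norm (z ^ n)) summable_on UNIV"
    by (rule summable_on_cmult_right)
  then have abs: "(\<lambda>n. norm (z powi (a + int n))) summable_on UNIV"
    using assms by (simp add: power_int_add norm_mult)
  then show "(\<lambda>m. z powi m) abs_summable_on {m::int. a \<le> m}"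
    unfolding img[symmetric] summable_on_reindex[OF inj] by (simp add: o_def)
  have "(\<lambda>n. z ^ n) sums (1 / (1 - z))" using assms by (simp add: geometric_sums)
  then have "((\<lambda>n. z ^ n) has_sum (1 / (1 - z))) UNIV"
    by (intro norm_summable_imp_has_sum) (use assms in \<open>auto simp: norm_power summable_geometric\<close>)
  then have "((\<lambda>n. z powi a * z ^ n) has_sum (z powi a * (1 / (1 - z)))) UNIV"
    by (rule has_sum_cmult_right)
  then show "((\<lambda>m. z powi m) has_sum (z powi a / (1 - z))) {m::int. a \<le> m}"
    unfolding img[symmetric] has_sum_reindex[OF inj] using assms by (simp add: o_def power_int_add)
qed

lemma sum_powi_interval:
  fixes z :: "'a :: field"
  assumes "z \<noteq> 0" "z \<noteq> 1" "a \<le> b"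
  shows "(\<Sum>m\<in>{m::int. a \<le> m \<and> m < b}. z powi m) = (z powi a - z powi b) / (1 - z)"
  using \<open>a \<le> b\<close>
proof (induction b rule: int_ge_induct)
  case base
  have empty: "{m::int. a \<le> m \<and> m < a} = {}" by auto
  show ?case unfolding empty by simp
next
  case (step b)
  have "{m. a \<le> m \<and> m < b + 1} = insert b {m::int. a \<le> m \<and> m < b}" using step.hyps by auto
  moreover have "finite {m::int. a \<le> m \<and> m < b}"
    by (rule finite_subset[of _ "{a..b}"]) auto
  ultimately have "sum ((powi) z) {m. a \<le> m \<and> m < b + 1} = z powi b + sum ((powi) z) {m. a \<le> m \<and> m < b}"
    by simp
  also have "\<dots> = (z powi a - z powi (b + 1)) / (1 - z)"
    unfolding step.IH using assms by (simp add: power_int_add divide_simps) (simp add: algebra_simps)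
  finally show ?case .
qed

text \<open>A signature \<open>\<lambda>\<close> with \<open>r\<close> coordinates is encoded by the strictly increasing sequence
  \<open>L j = \<lambda>\<^bsub>r-j\<^esub> + j\<close>, \<open>j < r\<close>. In these terms the interlacing of \<open>m\<close> (\<open>k\<close> coordinates) with \<open>L\<close>
  (\<open>u\<close> coordinates) says that \<open>m\<close> lies in a box; it is bounded for \<open>u = k + 1\<close>, and its last side
  is infinite for \<open>u = k\<close>.\<close>

definition strict_seqs :: "nat \<Rightarrow> (nat \<Rightarrow> int) set" where
  "strict_seqs k = {L \<in> extensional {..<k}. strict_mono_on {..<k} L}"

definition box :: "nat \<Rightarrow> nat \<Rightarrow> (nat \<Rightarrow> int) \<Rightarrow> (nat \<Rightarrow> int) set" where
  "box k u L = PiE {..<k} (\<lambda>j. {m. L j \<le> m \<and> (Suc j < u \<longrightarrow> m < L (Suc j))})"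

text \<open>The numerator of the bialternant formula: for distinct variables, division by
  \<open>vdm k x\<close> gives the Schur function of the signature encoded by
  \<open>L\<close>.\<close>

definition alternant :: "nat \<Rightarrow> (nat \<Rightarrow> 'a::field) \<Rightarrow> (nat \<Rightarrow> int) \<Rightarrow> 'a" where
  "alternant k x L = detf k (\<lambda>i j. x i powi L j)"

lemma alternant_cong:
  "(\<And>i. i < k \<Longrightarrow> x i = y i) \<Longrightarrow> (\<And>i. i < k \<Longrightarrow> L i = M i) \<Longrightarrow> alternant k x L = alternant k y M"
  unfolding alternant_def by (rule detf_cong) auto

lemma prod_powi: "x \<noteq> 0 \<Longrightarrow> (\<Prod>j\<in>J. x powi f j) = (x::'a::field) powi (\<Sum>j\<in>J. f j)"
  by (induction J rule: infinite_finite_induct) (auto simp: power_int_add)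

lemma alternant_scale:
  assumes "c \<noteq> 0"
  shows "alternant k (\<lambda>i. c * x i) L = c powi (\<Sum>j<k. L j) * alternant k x L"
  unfolding alternant_def power_int_mult_distrib detf_scale_cols
  using assms by (simp add: prod_powi)

lemma strict_seqs_less: "L \<in> strict_seqs u \<Longrightarrow> i < j \<Longrightarrow> j < u \<Longrightarrow> L i < L j"
  unfolding strict_seqs_def by (auto simp: strict_mono_on_def)

lemma strict_seqs_diff: "L \<in> strict_seqs u \<Longrightarrow> i \<le> j \<Longrightarrow> j < u \<Longrightarrow> L i + int (j - i) \<le> L j"
proof (induction j)
  case (Suc j)
  then show ?case using strict_seqs_less[of L u j "Suc j"] by (cases "i = Suc j") (auto simp: Suc_diff_le)
qed auto

lemma strict_seqs_SucI:
  assumes "L \<in> extensional {..<u}" "\<And>j. Suc j < u \<Longrightarrow> L j < L (Suc j)"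
  shows "L \<in> strict_seqs u"
proof -
  have "L i < L j" if "i < j" "j < u" for i j
    using that(1,2)
  proof (induction j)
    case (Suc j)
    then show ?case using assms(2)[of j] by (cases "i = j") force+
  qed auto
  then show ?thesis unfolding strict_seqs_def using assms(1) by (auto intro!: strict_mono_onI)
qed

lemma box_subset: "k \<le> u \<Longrightarrow> m \<in> box k u L \<Longrightarrow> m \<in> strict_seqs k"
proof (rule strict_seqs_SucI)
  fix j assume "k \<le> u" "m \<in> box k u L" "Suc j < k"
  then have "m j < L (Suc j)" "L (Suc j) \<le> m (Suc j)"
    unfolding box_def PiE_def Pi_def by auto
  then show "m j < m (Suc j)" by simp
qed (auto simp: box_def PiE_def)

text \<open>Each column is summed separately; the geometric sum over one side of the box is a difference of
  two adjacent columns, up to a factor depending only on the row.\<close>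

lemma has_sum_box1:
  fixes x :: "nat \<Rightarrow> 'a :: {banach, real_normed_field}"
  assumes L: "L \<in> strict_seqs u" and u: "u = k \<or> u = Suc k"
    and x: "\<And>i. i < k \<Longrightarrow> x i \<noteq> 0" "\<And>i. i < k \<Longrightarrow> x i \<noteq> 1" "\<And>i. i < k \<Longrightarrow> u = k \<Longrightarrow> norm (x i) < 1"
  shows "((\<lambda>m. alternant k x m) has_sum (alternant u (x(k := 1)) L / (\<Prod>i<k. 1 - x i))) (box k u L)"
proof -
  define B where "B j = {m. L j \<le> m \<and> (Suc j < u \<longrightarrow> m < L (Suc j))}" for j
  have Bne: "L j \<in> B j" if "j < k" for j
    using that strict_seqs_less[OF L, of j "Suc j"] by (auto simp: B_def)
  have B: "(\<lambda>m. x i powi m) abs_summable_on B j \<and>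
      infsum (\<lambda>m. x i powi m) (B j) = inverse (1 - x i) * (x i powi L j - (if Suc j < u then x i powi L (Suc j) else 0))"
    if "i < k" "j < k" for i j
  proof (cases "Suc j < u")
    case True
    have "finite (B j)" by (rule finite_subset[of _ "{L j..L (Suc j)}"]) (use True in \<open>auto simp: B_def\<close>)
    then show ?thesis
      using sum_powi_interval[of "x i" "L j" "L (Suc j)"] strict_seqs_less[OF L, of j "Suc j"] x that True
      by (simp add: B_def field_simps)
  next
    case False
    then have "u = k" using u that by auto
    then show ?thesis
      using has_sum_powi_ge[of "x i" "L j"] x that False by (auto simp: B_def field_simps dest!: infsumI)
  qed
  have "((\<lambda>m. detf k (\<lambda>i j. x i powi m j)) has_sum detf k (\<lambda>i j. infsum (\<lambda>m. x i powi m) (B j))) (PiE {..<k} B)"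
  proof (rule has_sum_detf)
    fix i j assume "i < k" "j < k"
    then show "\<exists>m\<in>B j. x i powi m \<noteq> 0"
      using Bne x(1) by (metis power_int_not_zero)
  qed (use B in auto)
  moreover have "detf k (\<lambda>i j. infsum (\<lambda>m. x i powi m) (B j)) = alternant u (x(k := 1)) L / (\<Prod>i<k. 1 - x i)"
  proof -
    have "detf k (\<lambda>i j. infsum (\<lambda>m. x i powi m) (B j)) =
        detf k (\<lambda>i j. inverse (1 - x i) * (x i powi L j - (if Suc j < u then x i powi L (Suc j) else 0)))"
      by (rule detf_cong) (simp only: B[THEN conjunct2])
    also have "\<dots> = (\<Prod>i<k. inverse (1 - x i)) * detf k (\<lambda>i j. x i powi L j - (if Suc j < u then x i powi L (Suc j) else 0))"
      by (rule detf_scale_rows)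
    also have "detf k (\<lambda>i j. x i powi L j - (if Suc j < u then x i powi L (Suc j) else 0)) = alternant u (x(k := 1)) L"
    proof (cases "u = k")
      case True
      have "alternant k (x(k := 1)) L = detf k (\<lambda>i j. x i powi L j)"
        unfolding alternant_def by (rule detf_cong) auto
      then show ?thesis
        unfolding True using detf_column_differences[of k "\<lambda>i j. x i powi L j"] by simp
    next
      case False
      then have [simp]: "u = Suc k" using u by simp
      have "detf k (\<lambda>i j. x i powi L j - (if Suc j < u then x i powi L (Suc j) else 0)) =
          detf k (\<lambda>i j. (x(k := 1)) i powi L j - (x(k := 1)) i powi L (Suc j))"
        by (rule detf_cong) auto
      also have "\<dots> = alternant u (x(k := 1)) L"
        unfolding alternant_def \<open>u = Suc k\<close> by (rule detf_column_differences_unit_row) auto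
      finally show ?thesis .
    qed
    finally show ?thesis by (simp add: field_simps prod_dividef inverse_eq_divide)
  qed
  ultimately show ?thesis unfolding alternant_def box_def B_def by simp
qed

text \<open>The weight is absorbed into the alternant by scaling all variables by c. Scaling back
  turns the extra variable 1 of \<open>has_sum_box1\<close> into 1 / c.\<close>

lemma has_sum_box:
  fixes x :: "nat \<Rightarrow> 'a :: {banach, real_normed_field}"
  assumes L: "L \<in> strict_seqs u" and u: "u = k \<or> u = Suc k" and c: "c \<noteq> 0"
    and x: "\<And>i. i < k \<Longrightarrow> x i \<noteq> 0" "\<And>i. i < k \<Longrightarrow> c * x i \<noteq> 1" "\<And>i. i < k \<Longrightarrow> u = k \<Longrightarrow> norm (c * x i) < 1"
  shows "((\<lambda>m. c powi (\<Sum>j<k. m j) * alternant k x m) has_sum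
     (c powi (\<Sum>j<u. L j) * alternant u (x(k := 1 / c)) L / (\<Prod>i<k. 1 - c * x i))) (box k u L)"
proof -
  have "(\<lambda>i. c * x i)(k := 1) = (\<lambda>i. c * (x(k := 1 / c)) i)" using c by (auto simp: fun_eq_iff)
  then have "alternant u ((\<lambda>i. c * x i)(k := 1)) L = c powi (\<Sum>j<u. L j) * alternant u (x(k := 1 / c)) L"
    by (simp only: alternant_scale[OF c])
  then show ?thesis
    using has_sum_box1[OF L u, of "\<lambda>i. c * x i"] c x by (simp add: alternant_scale)
qed

section \<open>Schur polynomials\<close>

definition parts :: "nat \<Rightarrow> (nat \<Rightarrow> nat) set" where
  "parts N = {\<kappa>. antimono \<kappa> \<and> (\<forall>i\<ge>N. \<kappa> i = 0)}"

text \<open>For a partition \<open>\<kappa>\<close> these are the partitions \<open>\<eta>\<close>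
  such that \<open>\<kappa>\<close> / \<open>\<eta>\<close> is a horizontal strip.\<close>

definition below :: "(nat \<Rightarrow> nat) \<Rightarrow> (nat \<Rightarrow> nat) set" where
  "below \<kappa> = {\<eta>. \<forall>i. \<kappa> (Suc i) \<le> \<eta> i \<and> \<eta> i \<le> \<kappa> i}"

text \<open>The Schur polynomial of the partition \<open>\<kappa>\<close> in \<open>n\<close> variables, by the branching rule. Unlike a quotient of
  alternants it makes sense when several variables vanish.\<close>

primrec spoly :: "nat \<Rightarrow> nat \<Rightarrow> (nat \<Rightarrow> nat) \<Rightarrow> (nat \<Rightarrow> real) \<Rightarrow> real" where
  "spoly N 0 \<kappa> y = (if \<kappa> = (\<lambda>_. 0) then 1 else 0)"
| "spoly N (Suc n) \<kappa> y = (\<Sum>\<eta>\<in>below \<kappa>. spoly N n \<eta> y * y n ^ (\<Sum>i<N. \<kappa> i - \<eta> i))"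

lemma below_parts: "\<kappa> \<in> parts N \<Longrightarrow> \<eta> \<in> below \<kappa> \<Longrightarrow> \<eta> \<in> parts N"
  unfolding parts_def below_def antimono_iff_le_Suc by (auto intro: order_trans) (metis le_0_eq)

lemma finite_below: "\<kappa> \<in> parts N \<Longrightarrow> finite (below \<kappa>)"
proof (rule finite_subset)
  assume \<kappa>: "\<kappa> \<in> parts N"
  show "below \<kappa> \<subseteq> {f. \<forall>x. (x \<in> {..<N} \<longrightarrow> f x \<in> {..\<kappa> 0}) \<and> (x \<notin> {..<N} \<longrightarrow> f x = 0)}"
  proof
    fix \<eta> assume "\<eta> \<in> below \<kappa>"
    then have le: "\<eta> x \<le> \<kappa> x" for x by (auto simp: below_def)
    moreover have "\<kappa> x \<le> \<kappa> 0" for x using \<kappa> by (auto simp: parts_def antimono_def)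
    ultimately have "\<eta> x \<le> \<kappa> 0" for x by (rule order_trans)
    moreover have "\<eta> x = 0" if "x \<ge> N" for x using le[of x] \<kappa> that by (auto simp: parts_def)
    ultimately show "\<eta> \<in> {f. \<forall>x. (x \<in> {..<N} \<longrightarrow> f x \<in> {..\<kappa> 0}) \<and> (x \<notin> {..<N} \<longrightarrow> f x = 0)}"
      by auto
  qed
  show "finite {f. \<forall>x. (x \<in> {..<N} \<longrightarrow> f x \<in> {..\<kappa> 0}) \<and> (x \<notin> {..<N} \<longrightarrow> f x = 0)}"
    by (rule finite_set_of_finite_funs) auto
qed

lemma self_below: "\<kappa> \<in> parts N \<Longrightarrow> \<kappa> \<in> below \<kappa>"
  by (auto simp: below_def parts_def antimono_iff_le_Suc)

text \<open>Parts are numbered from 0, so the hypothesis says that a partition has more than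
  \<open>n\<close> parts. A horizontal strip removes at most one part, and with no variables only
  the empty partition survives.\<close>

lemma spoly_long: "\<kappa> n \<noteq> 0 \<Longrightarrow> spoly N n \<kappa> y = 0"
proof (induction n arbitrary: \<kappa>)
  case (Suc n)
  have "spoly N n \<eta> y = 0" if "\<eta> \<in> below \<kappa>" for \<eta>
    by (rule Suc.IH) (use that Suc.prems in \<open>auto simp: below_def dest!: spec[of _ n]\<close>)
  then show ?case by simp
qed auto

lemma below_size_pos:
  assumes "\<kappa> \<in> parts N" "\<eta> \<in> below \<kappa>" "\<eta> \<noteq> \<kappa>"
  shows "(\<Sum>i<N. \<kappa> i - \<eta> i) > 0" "(\<Sum>i<N. \<eta> i) < (\<Sum>i<N. \<kappa> i)"
proof -
  obtain i where i: "\<eta> i \<noteq> \<kappa> i" using assms by auto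
  have le: "\<eta> j \<le> \<kappa> j" for j using assms by (auto simp: below_def)
  have "i < N"
  proof (rule ccontr)
    assume "\<not> i < N"
    then have "\<kappa> i = 0" using assms(1) by (auto simp: parts_def)
    then show False using le[of i] i by simp
  qed
  moreover have "\<eta> i < \<kappa> i" using le[of i] i by simp
  ultimately show "(\<Sum>i<N. \<kappa> i - \<eta> i) > 0"
    by (metis finite_lessThan gr0I lessThan_iff sum_eq_0_iff zero_less_diff nat_less_le)
  show "(\<Sum>i<N. \<eta> i) < (\<Sum>i<N. \<kappa> i)"
    by (rule sum_strict_mono_ex1) (use le \<open>\<eta> i < \<kappa> i\<close> \<open>i < N\<close> in auto)
qed

lemma spoly_Suc:
  assumes "\<kappa> \<in> parts N"
  shows "spoly N (Suc n) \<kappa> y = spoly N n \<kappa> y +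
    (\<Sum>\<eta>\<in>below \<kappa> - {\<kappa>}. spoly N n \<eta> y * y n ^ (\<Sum>i<N. \<kappa> i - \<eta> i))"
  using finite_below[OF assms] self_below[OF assms] by (simp add: sum.remove[of "below \<kappa>" \<kappa>])

text \<open>Every nonempty horizontal strip contributes a positive power of the vanishing variable.
  This stability is what allows infinite coordinates to be encoded by zeros.\<close>

lemma spoly_zero:
  assumes "\<kappa> \<in> parts N" "y n = 0"
  shows "spoly N (Suc n) \<kappa> y = spoly N n \<kappa> y"
proof -
  have "spoly N n \<eta> y * y n ^ (\<Sum>i<N. \<kappa> i - \<eta> i) = 0" if "\<eta> \<in> below \<kappa> - {\<kappa>}" for \<eta>
  proof -
    have "(\<Sum>i<N. \<kappa> i - \<eta> i) > 0" using below_size_pos(1)[OF assms(1), of \<eta>] that by blast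
    then show ?thesis using assms(2) by (simp only: zero_power mult_zero_right)
  qed
  then show ?thesis unfolding spoly_Suc[OF assms(1)] by (simp add: sum.neutral)
qed

lemma spoly_trunc:
  assumes "\<kappa> \<in> parts N" "\<And>j. k \<le> j \<Longrightarrow> j < n \<Longrightarrow> y j = 0" "k \<le> n"
  shows "spoly N n \<kappa> y = spoly N k \<kappa> y"
  using assms(3,2)
proof (induction n rule: dec_induct)
  case (step n)
  then show ?case using spoly_zero[OF assms(1), of y n] by simp
qed simp

lemma spoly_cong: "(\<And>j. j < n \<Longrightarrow> y j = z j) \<Longrightarrow> spoly N n \<kappa> y = spoly N n \<kappa> z"
  by (induction n arbitrary: \<kappa>) auto

lemma parts_zero [simp]: "(\<lambda>_. 0) \<in> parts N" by (auto simp: parts_def antimono_def)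

lemma below_zero: "below (\<lambda>_. 0) = {\<lambda>_. 0}" by (auto simp: below_def)

lemma spoly_empty [simp]: "spoly N n (\<lambda>_. 0) y = 1"
  by (induction n) (auto simp: below_zero)

section \<open>Schur polynomials as quotients of alternants\<close>

definition vdm :: "nat \<Rightarrow> (nat \<Rightarrow> 'a::comm_ring_1) \<Rightarrow> 'a" where
  "vdm k x = (\<Prod>j<k. \<Prod>i<j. x j - x i)"

definition Lpart :: "nat \<Rightarrow> (nat \<Rightarrow> nat) \<Rightarrow> nat \<Rightarrow> int" where
  "Lpart n \<kappa> = (\<lambda>j\<in>{..<n}. int (\<kappa> (n - Suc j)) + int j)"

lemma Lpart_strict: "\<kappa> \<in> parts N \<Longrightarrow> Lpart n \<kappa> \<in> strict_seqs n"
proof (rule strict_seqs_SucI)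
  fix j assume "\<kappa> \<in> parts N" "Suc j < n"
  then have "\<kappa> (n - Suc j) \<le> \<kappa> (n - Suc (Suc j))"
    by (auto simp: parts_def antimono_def)
  then show "Lpart n \<kappa> j < Lpart n \<kappa> (Suc j)" using \<open>Suc j < n\<close> by (simp add: Lpart_def)
qed (auto simp: Lpart_def)

lemma sum_Lpart: "(\<Sum>j<n. Lpart n \<kappa> j) = int (\<Sum>i<n. \<kappa> i) + int (\<Sum>i<n. i)"
proof -
  have "(\<Sum>j<n. Lpart n \<kappa> j) = (\<Sum>j<n. int (\<kappa> (n - Suc j))) + (\<Sum>j<n. int j)"
    unfolding sum.distrib[symmetric] by (rule sum.cong) (auto simp: Lpart_def)
  also have "(\<Sum>j<n. int (\<kappa> (n - Suc j))) = (\<Sum>j<n. int (\<kappa> j))"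
    by (rule sum.nat_diff_reindex)
  finally show ?thesis by simp
qed

text \<open>\<open>has_sum_box\<close> with c = 1 / x_n: the extra variable 1 / c is then x_n
  itself. This is the branching rule in terms of alternants.\<close>

lemma alternant_recursion:
  fixes x :: "nat \<Rightarrow> 'a :: {banach, real_normed_field}"
  assumes L: "L \<in> strict_seqs (Suc n)" and x: "inj_on x {..n}" "\<And>i. i \<le> n \<Longrightarrow> x i \<noteq> 0"
  shows "alternant (Suc n) x L = (\<Prod>i<n. x n - x i) *
     (\<Sum>m\<in>box n (Suc n) L. x n powi ((\<Sum>j<Suc n. L j) - (\<Sum>j<n. m j) - int n) * alternant n x m)"
proof -
  have xn: "x n \<noteq> 0" using x by simp
  have fin: "finite (box n (Suc n) L)"
  proof -
    have "finite {m. L j \<le> m \<and> (Suc j < Suc n \<longrightarrow> m < L (Suc j))}" if "j < n" for j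
      by (rule finite_subset[of _ "{L j..L (Suc j)}"]) (use that in auto)
    then show ?thesis unfolding box_def by (intro finite_PiE) auto
  qed
  have ne: "x n - x i \<noteq> 0" if "i < n" for i using inj_onD[OF x(1), of n i] that by auto
  have ne': "x i \<noteq> x n" if "i < n" for i using ne[OF that] by auto
  have "((\<lambda>m. (1 / x n) powi (\<Sum>j<n. m j) * alternant n x m) has_sum
     ((1 / x n) powi (\<Sum>j<Suc n. L j) * alternant (Suc n) (x(n := 1 / (1 / x n))) L / (\<Prod>i<n. 1 - 1 / x n * x i)))
     (box n (Suc n) L)"
    by (rule has_sum_box[OF L]) (use x ne' in \<open>auto simp: field_simps\<close>)
  then have "(\<Sum>m\<in>box n (Suc n) L. (1 / x n) powi (\<Sum>j<n. m j) * alternant n x m) =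
     (1 / x n) powi (\<Sum>j<Suc n. L j) * alternant (Suc n) x L / (\<Prod>i<n. 1 - 1 / x n * x i)" (is "?S = _")
    using fin by (auto dest!: infsumI simp: fun_upd_idem)
  moreover have "(\<Prod>i<n. 1 - 1 / x n * x i) = (\<Prod>i<n. x n - x i) / x n ^ n"
  proof -
    have "(\<Prod>i<n. 1 - 1 / x n * x i) = (\<Prod>i<n. (x n - x i) / x n)"
      by (rule prod.cong) (use xn in \<open>auto simp: field_simps\<close>)
    then show ?thesis by (simp add: prod_dividef)
  qed
  moreover have "(\<Prod>i<n. x n - x i) \<noteq> 0" using ne by auto
  moreover have "A = P * (z powi e * s / z ^ n)"
    if "s = (1 / z) powi e * A / R" "R = P / z ^ n" "P \<noteq> 0" "z \<noteq> 0" for A P s R z :: 'a and e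
    using that by (simp add: power_int_one_over field_simps)
  ultimately have "alternant (Suc n) x L = (\<Prod>i<n. x n - x i) * (x n powi (\<Sum>j<Suc n. L j) * ?S / x n ^ n)"
    using xn by blast
  also have "x n powi (\<Sum>j<Suc n. L j) * ?S / x n ^ n =
    (\<Sum>m\<in>box n (Suc n) L. x n powi ((\<Sum>j<Suc n. L j) - (\<Sum>j<n. m j) - int n) * alternant n x m)"
    unfolding sum_distrib_left sum_divide_distrib
    by (rule sum.cong) (use xn in \<open>auto simp: power_int_diff power_int_add power_int_one_over field_simps simp del: sum.lessThan_Suc\<close>)
  finally show ?thesis .
qed

text \<open>The staircase shift makes the inequality \<open>\<eta> i \<le> \<kappa> i\<close>
  strict, so horizontal strips become points of the box. The condition \<open>\<eta> n = 0\<close>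
  keeps the partitions with at most \<open>n\<close> parts, the only ones whose Schur polynomial in
  \<open>n\<close> variables can be nonzero.\<close>

lemma below_box_bij:
  assumes \<kappa>: "\<kappa> \<in> parts N" "\<kappa> (Suc n) = 0"
  shows "bij_betw (Lpart n) {\<eta> \<in> below \<kappa>. \<eta> n = 0} (box n (Suc n) (Lpart (Suc n) \<kappa>))"
proof (rule bij_betw_byWitness[where f' = "\<lambda>m i. if i < n then nat (m (n - Suc i) - int (n - Suc i)) else 0"])
  have z: "\<kappa> i = 0" if "i > n" for i
    using \<kappa> that by (auto simp: parts_def antimono_def) (metis Suc_leI le_zero_eq)
  have z2: "\<eta> i = 0" if "\<eta> \<in> below \<kappa>" "\<eta> n = 0" "i \<ge> n" for \<eta> i
    using that z[of i] by (cases "i = n") (auto simp: below_def dest!: spec[of _ i])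
  show "\<forall>\<eta>\<in>{\<eta> \<in> below \<kappa>. \<eta> n = 0}. (\<lambda>i. if i < n then nat (Lpart n \<eta> (n - Suc i) - int (n - Suc i)) else 0) = \<eta>"
    by (auto simp: fun_eq_iff Lpart_def z2)
  have box: "int (\<kappa> (n - j)) + int j \<le> m j" "m j < int (\<kappa> (n - Suc j)) + int (Suc j)" "m \<in> extensional {..<n}"
    if "m \<in> box n (Suc n) (Lpart (Suc n) \<kappa>)" "j < n" for m j
    using that by (auto simp: box_def PiE_def Pi_def Lpart_def)
  show "\<forall>m\<in>box n (Suc n) (Lpart (Suc n) \<kappa>). Lpart n (\<lambda>i. if i < n then nat (m (n - Suc i) - int (n - Suc i)) else 0) = m"
  proof
    fix m assume m: "m \<in> box n (Suc n) (Lpart (Suc n) \<kappa>)"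
    show "Lpart n (\<lambda>i. if i < n then nat (m (n - Suc i) - int (n - Suc i)) else 0) = m"
    proof (rule extensionalityI)
      fix j assume "j \<in> {..<n}"
      then show "Lpart n (\<lambda>i. if i < n then nat (m (n - Suc i) - int (n - Suc i)) else 0) j = m j"
        using box(1)[OF m, of j] by (auto simp: Lpart_def)
    qed (use m in \<open>auto simp: Lpart_def box_def PiE_def\<close>)
  qed
  show "Lpart n ` {\<eta> \<in> below \<kappa>. \<eta> n = 0} \<subseteq> box n (Suc n) (Lpart (Suc n) \<kappa>)"
  proof (safe, unfold box_def, rule PiE_I)
    fix \<eta> j assume \<eta>: "\<eta> \<in> below \<kappa>" "\<eta> n = 0" and "j \<in> {..<n}"
    then have j: "Suc (n - Suc j) = n - j" by simp
    have "\<kappa> (n - j) \<le> \<eta> (n - Suc j)" "\<eta> (n - Suc j) \<le> \<kappa> (n - Suc j)"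
      using \<eta> by (auto simp: below_def j[symmetric])
    then show "Lpart n \<eta> j \<in> {m. Lpart (Suc n) \<kappa> j \<le> m \<and> (Suc j < Suc n \<longrightarrow> m < Lpart (Suc n) \<kappa> (Suc j))}"
      using \<open>j \<in> {..<n}\<close> by (auto simp: Lpart_def)
  qed (auto simp: Lpart_def)
  show "(\<lambda>m i. if i < n then nat (m (n - Suc i) - int (n - Suc i)) else 0) ` box n (Suc n) (Lpart (Suc n) \<kappa>)
     \<subseteq> {\<eta> \<in> below \<kappa>. \<eta> n = 0}"
  proof (safe, unfold below_def, safe)
    fix m i assume m: "m \<in> box n (Suc n) (Lpart (Suc n) \<kappa>)"
    show "\<kappa> (Suc i) \<le> (if i < n then nat (m (n - Suc i) - int (n - Suc i)) else 0)"
      using box(1)[OF m, of "n - Suc i"] z[of "Suc i"] by auto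
    show "(if i < n then nat (m (n - Suc i) - int (n - Suc i)) else 0) \<le> \<kappa> i"
      using box(2)[OF m, of "n - Suc i"] by auto
  qed auto
qed

text \<open>The bialternant formula. Both sides obey the same branching recursion: partitions that
  are too long drop out by \<open>spoly_long\<close>, the others are matched by
  \<open>below_box_bij\<close>, and the size of the strip is the exponent in
  \<open>alternant_recursion\<close>.\<close>

lemma spoly_alternant:
  assumes "\<kappa> \<in> parts N" "\<kappa> n = 0" "inj_on y {..<n}" "\<And>j. j < n \<Longrightarrow> y j \<noteq> 0"
  shows "spoly N n \<kappa> y * vdm n y = alternant n y (Lpart n \<kappa>)"
  using assms
proof (induction n arbitrary: \<kappa>)
  case 0
  then have "\<kappa> = (\<lambda>_. 0)" by (auto simp: parts_def antimono_def fun_eq_iff) (metis le_zero_eq zero_le)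
  then show ?case by (simp add: vdm_def alternant_def detf_def)
next
  case (Suc n)
  note \<kappa> = Suc.prems(1,2)
  have z: "\<kappa> i = 0" if "i > n" for i
    using \<kappa> that by (auto simp: parts_def antimono_def) (metis Suc_leI le_zero_eq)
  have "spoly N (Suc n) \<kappa> y = (\<Sum>\<eta>\<in>{\<eta> \<in> below \<kappa>. \<eta> n = 0}. spoly N n \<eta> y * y n ^ (\<Sum>i<N. \<kappa> i - \<eta> i))"
    unfolding spoly.simps
    by (rule sum.mono_neutral_right) (use finite_below[OF \<kappa>(1)] spoly_long in auto)
  then have "spoly N (Suc n) \<kappa> y * vdm (Suc n) y = (\<Prod>i<n. y n - y i) *
      (\<Sum>\<eta>\<in>{\<eta> \<in> below \<kappa>. \<eta> n = 0}. y n ^ (\<Sum>i<N. \<kappa> i - \<eta> i) * (spoly N n \<eta> y * vdm n y))"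
    by (simp add: vdm_def sum_distrib_left sum_distrib_right mult_ac)
  also have "(\<Sum>\<eta>\<in>{\<eta> \<in> below \<kappa>. \<eta> n = 0}. y n ^ (\<Sum>i<N. \<kappa> i - \<eta> i) * (spoly N n \<eta> y * vdm n y)) =
     (\<Sum>\<eta>\<in>{\<eta> \<in> below \<kappa>. \<eta> n = 0}.
        y n powi ((\<Sum>j<Suc n. Lpart (Suc n) \<kappa> j) - (\<Sum>j<n. Lpart n \<eta> j) - int n) * alternant n y (Lpart n \<eta>))"
  proof (rule sum.cong[OF refl])
    fix \<eta> assume "\<eta> \<in> {\<eta> \<in> below \<kappa>. \<eta> n = 0}"
    then have \<eta>: "\<eta> \<in> below \<kappa>" "\<eta> n = 0" by auto
    have IH: "spoly N n \<eta> y * vdm n y = alternant n y (Lpart n \<eta>)"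
      by (rule Suc.IH) (use below_parts[OF \<kappa>(1) \<eta>(1)] \<eta> Suc.prems(3,4) in \<open>auto simp: inj_on_def\<close>)
    have le: "\<eta> i \<le> \<kappa> i" for i using \<eta> by (auto simp: below_def)
    have "(\<Sum>i<N. \<kappa> i - \<eta> i) = (\<Sum>i<Suc n. \<kappa> i - \<eta> i)"
      using \<kappa>(1) z by (intro sum.mono_neutral_cong) (auto simp: parts_def not_less)
    also have "int \<dots> = (\<Sum>i<Suc n. int (\<kappa> i) - int (\<eta> i))"
      unfolding of_nat_sum by (rule sum.cong) (use le in auto)
    also have "\<dots> = (\<Sum>j<Suc n. Lpart (Suc n) \<kappa> j) - (\<Sum>j<n. Lpart n \<eta> j) - int n"
      unfolding sum_Lpart sum_subtractf using \<eta>(2) by simp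
    finally show "y n ^ (\<Sum>i<N. \<kappa> i - \<eta> i) * (spoly N n \<eta> y * vdm n y) =
       y n powi ((\<Sum>j<Suc n. Lpart (Suc n) \<kappa> j) - (\<Sum>j<n. Lpart n \<eta> j) - int n) * alternant n y (Lpart n \<eta>)"
      unfolding IH by (metis power_int_of_nat)
  qed
  also have "\<dots> = (\<Sum>m\<in>box n (Suc n) (Lpart (Suc n) \<kappa>).
        y n powi ((\<Sum>j<Suc n. Lpart (Suc n) \<kappa> j) - (\<Sum>j<n. m j) - int n) * alternant n y m)"
    by (rule sum.reindex_bij_betw[OF below_box_bij[OF \<kappa>]])
  also have "(\<Prod>i<n. y n - y i) * \<dots> = alternant (Suc n) y (Lpart (Suc n) \<kappa>)"
    by (rule alternant_recursion[symmetric, OF Lpart_strict[OF \<kappa>(1)]])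
       (use Suc.prems(3,4) in \<open>auto simp: lessThan_Suc_atMost\<close>)
  finally show ?case .
qed

text \<open>The case of the empty partition in \<open>spoly_alternant\<close>.\<close>

lemma vandermonde_det:
  fixes y :: "nat \<Rightarrow> real"
  assumes "inj_on y {..<n}" "\<And>j. j < n \<Longrightarrow> y j \<noteq> 0"
  shows "detf n (\<lambda>i j. y i ^ j) = vdm n y"
proof -
  have "detf n (\<lambda>i j. y i ^ j) = alternant n y (Lpart n (\<lambda>_. 0))"
    unfolding alternant_def by (rule detf_cong) (simp add: Lpart_def)
  then show ?thesis using spoly_alternant[of "\<lambda>_. 0" 0 n y] assms by simp
qed

text \<open>Induction on the size of \<open>\<kappa>\<close>. The variable y_n contributes
  polynomials of strictly smaller partitions, which are bounded uniformly in n, times a positive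
  power of y_n, which is O(q^n). Summing the geometric series then bounds the polynomials of
  \<open>\<kappa>\<close> itself.\<close>

lemma spoly_cauchy_bound:
  fixes q Q :: real
  assumes q: "0 < q" "q < 1" and Q: "Q \<ge> 0" and \<kappa>: "\<kappa> \<in> parts N"
  shows "\<exists>C\<ge>0. \<forall>n y. (\<forall>j. 0 \<le> y j \<and> y j \<le> Q * q ^ j) \<longrightarrow>
     \<bar>spoly N n \<kappa> y\<bar> \<le> C \<and> \<bar>spoly N (Suc n) \<kappa> y - spoly N n \<kappa> y\<bar> \<le> C * q ^ n"
  using \<kappa>
proof (induction "\<Sum>i<N. \<kappa> i" arbitrary: \<kappa> rule: less_induct)
  case less
  note \<kappa> = less.prems
  have "\<exists>C\<ge>0. \<forall>n y. (\<forall>j. 0 \<le> y j \<and> y j \<le> Q * q ^ j) \<longrightarrow> \<bar>spoly N n \<eta> y\<bar> \<le> C" if "\<eta> \<in> below \<kappa> - {\<kappa>}" for \<eta>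
    using less.hyps[of \<eta>] below_size_pos(2)[OF \<kappa>, of \<eta>] below_parts[OF \<kappa>, of \<eta>] that by blast
  then obtain C where C: "\<And>\<eta>. \<eta> \<in> below \<kappa> - {\<kappa>} \<Longrightarrow> C \<eta> \<ge> 0"
    "\<And>\<eta> n y. \<eta> \<in> below \<kappa> - {\<kappa>} \<Longrightarrow> (\<forall>j. 0 \<le> y j \<and> y j \<le> Q * q ^ j) \<Longrightarrow> \<bar>spoly N n \<eta> y\<bar> \<le> C \<eta>"
    by metis
  define Q' where "Q' = max 1 Q"
  define D where "D = (\<Sum>\<eta>\<in>below \<kappa> - {\<kappa>}. C \<eta> * Q' ^ (\<Sum>i<N. \<kappa> i - \<eta> i))"
  have D: "D \<ge> 0" unfolding D_def by (intro sum_nonneg mult_nonneg_nonneg C(1)) (auto simp: Q'_def)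
  have step: "\<bar>spoly N (Suc n) \<kappa> y - spoly N n \<kappa> y\<bar> \<le> D * q ^ n"
    if y: "\<forall>j. 0 \<le> y j \<and> y j \<le> Q * q ^ j" for n y
  proof -
    have "\<bar>spoly N (Suc n) \<kappa> y - spoly N n \<kappa> y\<bar> \<le>
       (\<Sum>\<eta>\<in>below \<kappa> - {\<kappa>}. \<bar>spoly N n \<eta> y * y n ^ (\<Sum>i<N. \<kappa> i - \<eta> i)\<bar>)"
      unfolding spoly_Suc[OF \<kappa>] by simp
    also have "\<dots> \<le> (\<Sum>\<eta>\<in>below \<kappa> - {\<kappa>}. C \<eta> * Q' ^ (\<Sum>i<N. \<kappa> i - \<eta> i) * q ^ n)"
    proof (rule sum_mono)
      fix \<eta> assume \<eta>: "\<eta> \<in> below \<kappa> - {\<kappa>}"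
      define d where "d = (\<Sum>i<N. \<kappa> i - \<eta> i)"
      have d: "d \<ge> 1" using below_size_pos(1)[OF \<kappa>, of \<eta>] \<eta> by (auto simp: d_def)
      have "Q * q ^ n \<le> Q' * q ^ n"
        using q by (auto simp: Q'_def)
      then have "y n ^ d \<le> (Q' * q ^ n) ^ d"
        using y order_trans by (intro power_mono) blast+
      also have "\<dots> = Q' ^ d * (q ^ n) ^ d" by (simp add: power_mult_distrib)
      also have "\<dots> \<le> Q' ^ d * q ^ n"
      proof (intro mult_left_mono)
        show "(q ^ n) ^ d \<le> q ^ n"
          using power_decreasing[of 1 d "q ^ n"] q d by (simp add: power_le_one)
      qed (auto simp: Q'_def)
      finally have "y n ^ d \<le> Q' ^ d * q ^ n" .
      then have "\<bar>spoly N n \<eta> y\<bar> * y n ^ d \<le> C \<eta> * (Q' ^ d * q ^ n)"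
        by (intro mult_mono C(2)[OF \<eta> y] C(1)[OF \<eta>]) (use y in auto)
      then show "\<bar>spoly N n \<eta> y * y n ^ (\<Sum>i<N. \<kappa> i - \<eta> i)\<bar> \<le> C \<eta> * Q' ^ (\<Sum>i<N. \<kappa> i - \<eta> i) * q ^ n"
        using y unfolding d_def[symmetric] by (simp add: abs_mult mult.assoc)
    qed
    finally show ?thesis by (simp add: D_def sum_distrib_right)
  qed
  have bound: "\<bar>spoly N n \<kappa> y\<bar> \<le> 1 + D * (\<Sum>j<n. q ^ j)" if y: "\<forall>j. 0 \<le> y j \<and> y j \<le> Q * q ^ j" for n y
  proof (induction n)
    case (Suc n)
    then show ?case using step[OF y, of n] by (simp add: algebra_simps)
  qed auto
  have "(\<Sum>j<n. q ^ j) \<le> 1 / (1 - q)" for n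
  proof -
    have "(\<Sum>j<n. q ^ j) = (1 - q ^ n) / (1 - q)" using q by (simp add: sum_gp_strict)
    then show ?thesis using q by (simp add: divide_right_mono)
  qed
  then have "\<bar>spoly N n \<kappa> y\<bar> \<le> 1 + D * (1 / (1 - q))" if y: "\<forall>j. 0 \<le> y j \<and> y j \<le> Q * q ^ j" for n y
    using bound[OF y, of n] mult_left_mono[OF _ D, of "\<Sum>j<n. q ^ j" "1 / (1 - q)"] by fastforce
  moreover have "D \<le> 1 + D * (1 / (1 - q))"
  proof -
    have "D * 1 \<le> D * (1 / (1 - q))" by (rule mult_left_mono) (use q D in auto)
    then show ?thesis by simp
  qed
  then have "\<bar>spoly N (Suc n) \<kappa> y - spoly N n \<kappa> y\<bar> \<le> (1 + D * (1 / (1 - q))) * q ^ n"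
    if y: "\<forall>j. 0 \<le> y j \<and> y j \<le> Q * q ^ j" for n y
    by (rule order_trans[OF step[OF y] mult_right_mono]) (use \<open>D \<le> _\<close> q in auto)
  moreover have "0 \<le> 1 + D * (1 / (1 - q))" using D q by simp
  ultimately show ?case by (intro exI[of _ "1 + D * (1 / (1 - q))"]) auto
qed

lemma continuous_on_spoly: "continuous_on A (\<lambda>y. spoly N n \<kappa> y)"
  by (induction n arbitrary: \<kappa>) (auto intro!: continuous_intros continuous_on_subset[OF continuous_on_product_coordinates])

section \<open>The one-step kernel\<close>

lemma integrable_pmf_iff:
  fixes f :: "'a \<Rightarrow> 'b::{banach, second_countable_topology}"
  shows "integrable (measure_pmf Q) f \<longleftrightarrow> integrable (count_space UNIV) (\<lambda>x. pmf Q x *\<^sub>R f x)"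
    "integral\<^sup>L (measure_pmf Q) f = integral\<^sup>L (count_space UNIV) (\<lambda>x. pmf Q x *\<^sub>R f x)"
proof -
  show "integrable (measure_pmf Q) f \<longleftrightarrow> integrable (count_space UNIV) (\<lambda>x. pmf Q x *\<^sub>R f x)"
    by (subst measure_pmf_eq_density, subst integrable_density) auto
  show "integral\<^sup>L (measure_pmf Q) f = integral\<^sup>L (count_space UNIV) (\<lambda>x. pmf Q x *\<^sub>R f x)"
    by (subst measure_pmf_eq_density, subst integral_density) auto
qed

lemma has_sum_pmf_integral:
  fixes f :: "'a \<Rightarrow> 'b::{banach, second_countable_topology}"
  assumes "integrable (measure_pmf Q) f" "set_pmf Q \<subseteq> A"
  shows "((\<lambda>x. pmf Q x *\<^sub>R f x) has_sum integral\<^sup>L (measure_pmf Q) f) A"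
proof -
  have i: "Infinite_Set_Sum.abs_summable_on (\<lambda>x. pmf Q x *\<^sub>R f x) UNIV"
    using assms(1) by (simp add: Infinite_Set_Sum.abs_summable_on_def integrable_pmf_iff)
  then have "Infinite_Sum.abs_summable_on (\<lambda>x. pmf Q x *\<^sub>R f x) UNIV"
    by (simp only: abs_summable_equivalent)
  then have "((\<lambda>x. pmf Q x *\<^sub>R f x) has_sum infsum (\<lambda>x. pmf Q x *\<^sub>R f x) UNIV) UNIV"
    by (rule has_sum_infsum[OF abs_summable_summable])
  also have "infsum (\<lambda>x. pmf Q x *\<^sub>R f x) UNIV = integral\<^sup>L (measure_pmf Q) f"
    using infsetsum_infsum[OF i] by (simp add: infsetsum_def integrable_pmf_iff)
  finally show ?thesis
    by (rule has_sum_cong_neutral[THEN iffD1, rotated -1]) (use assms(2) in \<open>auto simp: set_pmf_iff\<close>)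
qed

text \<open>For real series unconditional and absolute convergence coincide, so a value of the sum
  already gives integrability.\<close>

lemma integral_pmf_has_sum:
  fixes f :: "'a \<Rightarrow> real"
  assumes "((\<lambda>x. pmf Q x * f x) has_sum s) A" "set_pmf Q \<subseteq> A"
  shows "integrable (measure_pmf Q) f" "integral\<^sup>L (measure_pmf Q) f = s"
proof -
  have s: "((\<lambda>x. pmf Q x * f x) has_sum s) UNIV"
    by (rule has_sum_cong_neutral[THEN iffD1, rotated -1, OF assms(1)]) (use assms(2) in \<open>auto simp: set_pmf_iff\<close>)
  then have "(\<lambda>x. pmf Q x * f x) summable_on UNIV" by (rule has_sum_imp_summable)
  then have "Infinite_Sum.abs_summable_on (\<lambda>x. pmf Q x * f x) UNIV"
    by (rule summable_on_iff_abs_summable_on_real[THEN iffD1])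
  then have "Infinite_Set_Sum.abs_summable_on (\<lambda>x. pmf Q x * f x) UNIV"
    by (rule abs_summable_equivalent[THEN iffD1])
  then show int: "integrable (measure_pmf Q) f"
    by (simp add: Infinite_Set_Sum.abs_summable_on_def integrable_pmf_iff)
  show "integral\<^sup>L (measure_pmf Q) f = s"
    by (rule has_sum_unique[OF has_sum_pmf_integral[OF int subset_UNIV, unfolded real_scaleR_def] s])
qed

lemma embed_pmf_has_sum:
  assumes nn: "\<And>x. f x \<ge> 0" and s: "(f has_sum (1::real)) A" and z: "\<And>x. x \<notin> A \<Longrightarrow> f x = 0"
  shows "pmf (embed_pmf f) x = f x"
proof -
  have "(f has_sum 1) UNIV"
  proof (rule has_sum_cong_neutral[THEN iffD1, rotated -1, OF s])
    show "f x = 0" if "x \<in> UNIV - A" for x using z that by simp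
  qed simp_all
  note s1 = this
  have i: "Infinite_Set_Sum.abs_summable_on f UNIV"
    by (rule abs_summable_equivalent[THEN iffD1, OF summable_on_iff_abs_summable_on_real[THEN iffD1, OF has_sum_imp_summable[OF s1]]])
  have "infsetsum f UNIV = 1"
    using infsetsum_infsum[OF i] infsumI[OF s1] by simp
  then have "(\<integral>\<^sup>+x. f x \<partial>count_space UNIV) = 1"
    using i nn by (subst nn_integral_eq_integral) (auto simp: infsetsum_def Infinite_Set_Sum.abs_summable_on_def)
  then show ?thesis by (rule pmf_embed_pmf[OF nn])
qed

text \<open>The sign (-1)^(k(k-1)/2) of reversing k columns. It is kept as a determinant because it
  always meets a second copy of itself and cancels by \<open>revdet_square\<close>.\<close>

definition revdet :: "nat \<Rightarrow> 'a::comm_ring_1" where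
  "revdet k = detf k (\<lambda>l j. if l = k - Suc j then 1 else 0)"

lemma detf_rev: "detf k (\<lambda>i j. a i (k - Suc j)) = detf k a * revdet k"
proof -
  have "(\<Sum>l<k. a i l * (if l = k - Suc j then 1 else 0)) = a i (k - Suc j)" if "j < k" for i j
    using that by (simp add: if_distrib[of "\<lambda>z. _ * z"] cong: if_cong)
  then show ?thesis unfolding revdet_def detf_mult[symmetric] by (intro detf_cong) simp
qed

lemma revdet_square: "revdet k * revdet k = (1::'a::comm_ring_1)"
proof -
  have "detf k (\<lambda>i j. if i = j then 1 else (0::'a)) = (\<Prod>i<k. 1)"
    by (subst detf_lower_triangular) auto
  moreover have "detf k (\<lambda>i j. if i = j then 1 else (0::'a)) = revdet k * revdet k"
    using detf_rev[of k "\<lambda>l j. if l = k - Suc j then 1 else (0::'a)"]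
    unfolding revdet_def by (auto intro!: detf_cong simp: fun_eq_iff elim!: trans[rotated])
  ultimately show ?thesis by simp
qed

section \<open>The principal point and the transition probabilities\<close>

locale qpar =
  fixes q :: real
  assumes q0: "0 < q" and q1: "q < 1"
begin

text \<open>The principal point (1, q^(-1), q^(-2), ...), numbered from 0.\<close>

definition pr :: "nat \<Rightarrow> real" where "pr i = q powi (- int i)"

lemma pr_pos [simp]: "pr i > 0" "pr i \<noteq> 0"
  using q0 by (auto simp: pr_def)

lemma powi_less: "a < b \<Longrightarrow> q powi b < q powi a"
  using q0 q1 by (auto intro!: power_int_strict_decreasing)

lemma powi_le: "a \<le> b \<Longrightarrow> q powi b \<le> q powi a"
  using q0 q1 by (auto intro!: power_int_decreasing)

lemma qpow_less: "0 < n \<Longrightarrow> q ^ n < 1"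
  using q0 q1 by (simp add: power_less_one_iff)

lemma q_pr: "i \<le> N \<Longrightarrow> q ^ N * pr i = q ^ (N - i)"
  using q0 by (simp add: pr_def power_int_minus power_diff field_simps)

lemma q_pr_bounds:
  assumes "i < N"
  shows "q ^ N * pr i < 1" "q ^ N * pr i \<noteq> 1" "\<bar>q ^ N * pr i\<bar> < 1"
proof -
  have "q ^ N * pr i = q ^ (N - i)" by (rule q_pr) (use assms in simp)
  moreover have "q ^ (N - i) < 1" by (rule qpow_less) (use assms in simp)
  ultimately show "q ^ N * pr i < 1" "q ^ N * pr i \<noteq> 1" "\<bar>q ^ N * pr i\<bar> < 1" using q0 by auto
qed

text \<open>The entries q^(-i m_j) are also powers of q^(-m_j) with exponents 0, ..., k - 1, so the
  alternant is a Vandermonde determinant in these numbers. They increase with j, hence the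
  positivity below.\<close>

lemma alternant_pr:
  assumes "m \<in> strict_seqs k"
  shows "alternant k pr m = vdm k (\<lambda>j. q powi (- m j))"
proof -
  have "alternant k pr m = detf k (\<lambda>i j. (q powi (- m j)) ^ i)"
    unfolding alternant_def pr_def
  proof (rule detf_cong)
    fix i j
    have "(q powi (- int i)) powi m j = q powi (- int i * m j)" by (simp only: power_int_mult)
    also have "- int i * m j = - m j * int i" by simp
    also have "q powi \<dots> = (q powi (- m j)) powi int i" by (simp only: power_int_mult)
    finally show "(q powi (- int i)) powi m j = (q powi (- m j)) ^ i" by (simp only: power_int_of_nat)
  qed
  also have "\<dots> = detf k (\<lambda>i j. (q powi (- m i)) ^ j)"
    by (rule detf_transpose[symmetric])
  also have "\<dots> = vdm k (\<lambda>j. q powi (- m j))"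
  proof (rule vandermonde_det)
    show "inj_on (\<lambda>j. q powi (- m j)) {..<k}"
    proof (rule linorder_inj_onI)
      fix x y assume "x < y" "y \<in> {..<k}"
      then have "m x < m y" using strict_seqs_less[OF assms] by auto
      then show "q powi (- m x) \<noteq> q powi (- m y)" using powi_less[of "- m y" "- m x"] by simp
    qed auto
  qed (use q0 in auto)
  finally show ?thesis .
qed

lemma alternant_pr_pos: "m \<in> strict_seqs k \<Longrightarrow> alternant k pr m > 0"
  unfolding alternant_pr vdm_def
  by (intro prod_pos) (auto intro!: powi_less dest: strict_seqs_less)

text \<open>With \<open>u\<close> finite coordinates upstairs, \<open>u = N + 1\<close> gives the links between ordinary signatures and
  \<open>u \<le> N\<close> the extended links on the strata at infinity.\<close>

definition step_wt :: "nat \<Rightarrow> nat \<Rightarrow> (nat \<Rightarrow> int) \<Rightarrow> (nat \<Rightarrow> int) \<Rightarrow> real" where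
  "step_wt N u L m = (let k = min u N in if m \<in> box k u L then
     (q ^ N) powi ((\<Sum>j<k. m j) - (\<Sum>j<u. L j)) * (\<Prod>i<k. 1 - q ^ (N - i)) * alternant k pr m / alternant u pr L
     else 0)"

definition step_pmf :: "nat \<Rightarrow> nat \<Rightarrow> (nat \<Rightarrow> int) \<Rightarrow> (nat \<Rightarrow> int) pmf" where
  "step_pmf N u L = embed_pmf (step_wt N u L)"

text \<open>For \<open>u = Suc N\<close> the inserted value is \<open>pr N\<close> and stands at its
  own place; for \<open>u \<le> N\<close> the place lies beyond the first \<open>u\<close>
  variables.\<close>

lemma alternant_upd_pr:
  assumes "u \<le> Suc N"
  shows "alternant u (pr(min u N := 1 / q ^ N)) L = alternant u pr L"
  by (rule alternant_cong) (use assms q0 in \<open>auto simp: pr_def min_def power_int_minus field_simps\<close>)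

text \<open>\<open>has_sum_box\<close> with c = q^N and the constants of \<open>step_wt\<close>
  pulled out. The kernel acts on normalized alternants by a scalar factor and, for
  \<open>u = Suc N\<close>, by appending the variable q^(-N). Real points x will give the
  eigenfunctions, points of a complex torus the generating functions.\<close>

lemma has_sum_step_wt:
  fixes x :: "nat \<Rightarrow> 'a :: {banach, real_normed_field}"
  assumes L: "L \<in> strict_seqs u" and u: "u \<le> Suc N" "k = min u N"
    and x: "\<And>i. i < k \<Longrightarrow> x i \<noteq> 0" "\<And>i. i < k \<Longrightarrow> of_real (q ^ N) * x i \<noteq> 1"
       "\<And>i. i < k \<Longrightarrow> u = k \<Longrightarrow> norm (of_real (q ^ N) * x i) < 1"
  shows "((\<lambda>m. of_real (step_wt N u L m) * (alternant k x m / of_real (alternant k pr m))) has_sum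
     ((\<Prod>i<k. of_real (1 - q ^ (N - i)) / (1 - of_real (q ^ N) * x i)) *
       (alternant u (x(k := of_real (1 / q ^ N))) L / of_real (alternant u pr L)))) (box k u L)"
proof -
  define c :: 'a where "c = of_real (q ^ N)"
  have c: "c \<noteq> 0" using q0 by (simp add: c_def)
  have uk: "u = k \<or> u = Suc k" "k \<le> u" using u by auto
  define P :: 'a where "P = of_real ((\<Prod>i<k. 1 - q ^ (N - i)) / alternant u pr L)"
  have "((\<lambda>m. P / c powi (\<Sum>j<u. L j) * (c powi (\<Sum>j<k. m j) * alternant k x m)) has_sum
     (P / c powi (\<Sum>j<u. L j) * (c powi (\<Sum>j<u. L j) * alternant u (x(k := 1 / c)) L / (\<Prod>i<k. 1 - c * x i)))) (box k u L)"
    by (intro has_sum_cmult_right has_sum_box L uk c) (use x in \<open>auto simp: c_def\<close>)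
  also have "P / c powi (\<Sum>j<u. L j) * (c powi (\<Sum>j<u. L j) * alternant u (x(k := 1 / c)) L / (\<Prod>i<k. 1 - c * x i))
     = (\<Prod>i<k. of_real (1 - q ^ (N - i)) / (1 - of_real (q ^ N) * x i)) *
       (alternant u (x(k := of_real (1 / q ^ N))) L / of_real (alternant u pr L))"
  proof -
    have "c powi (\<Sum>j<u. L j) \<noteq> 0" using c by simp
    then show ?thesis unfolding P_def by (use q0 in \<open>simp add: prod_dividef c_def\<close>)
  qed
  finally show ?thesis
  proof (rule has_sum_cong[THEN iffD1, rotated])
    fix m assume m: "m \<in> box k u L"
    have "alternant k pr m \<noteq> 0" using alternant_pr_pos[OF box_subset[OF uk(2) m]] by simp
    then show "P / c powi (\<Sum>j<u. L j) * (c powi (\<Sum>j<k. m j) * alternant k x m) =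
      of_real (step_wt N u L m) * (alternant k x m / of_real (alternant k pr m))"
      using m c u q0 by (simp add: step_wt_def Let_def P_def c_def power_int_diff field_simps)
  qed
qed

text \<open>At x = \<open>pr\<close> all factors in \<open>has_sum_step_wt\<close> are 1.\<close>

lemma step_wt_has_sum_1:
  assumes "L \<in> strict_seqs u" "u \<le> Suc N" "k = min u N"
  shows "(step_wt N u L has_sum 1) (box k u L)"
proof -
  have "((\<lambda>m. of_real (step_wt N u L m) * (alternant k pr m / of_real (alternant k pr m))) has_sum
     ((\<Prod>i<k. of_real (1 - q ^ (N - i)) / (1 - of_real (q ^ N) * pr i)) *
       (alternant u (pr(k := of_real (1 / q ^ N))) L / of_real (alternant u pr L)))) (box k u L)"
  proof (rule has_sum_step_wt[OF assms])
    fix i assume "i < k"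
    then have "i < N" using assms(3) by simp
    then show "pr i \<noteq> 0" "of_real (q ^ N) * pr i \<noteq> 1" "norm (of_real (q ^ N) * pr i) < 1"
      using q_pr_bounds[of i N] by simp_all
  qed
  also have "(\<Prod>i<k. of_real (1 - q ^ (N - i)) / (1 - of_real (q ^ N) * pr i)) = 1"
  proof (intro prod.neutral ballI)
    fix i assume "i \<in> {..<k}"
    then have "i < N" using assms(3) by simp
    then show "of_real (1 - q ^ (N - i)) / (1 - of_real (q ^ N) * pr i) = 1"
      using q_pr_bounds(2)[of i N] q_pr[of i N] by simp
  qed
  also have "alternant u (pr(k := of_real (1 / q ^ N))) L / of_real (alternant u pr L) = 1"
  proof -
    have "alternant u (pr(k := of_real (1 / q ^ N))) L = alternant u pr L"
      using alternant_upd_pr[OF assms(2), of L] unfolding assms(3) by simp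
    moreover have "alternant u pr L \<noteq> 0" using alternant_pr_pos[OF assms(1)] by simp
    ultimately show ?thesis by simp
  qed
  finally have "((\<lambda>m. of_real (step_wt N u L m) * (alternant k pr m / of_real (alternant k pr m))) has_sum 1) (box k u L)"
    by simp
  then show ?thesis
  proof (rule has_sum_cong[THEN iffD1, rotated])
    fix m assume "m \<in> box k u L"
    then have "alternant k pr m > 0" by (intro alternant_pr_pos box_subset[of k u m L]) (use assms(3) in auto)
    then show "of_real (step_wt N u L m) * (alternant k pr m / of_real (alternant k pr m)) = step_wt N u L m" by simp
  qed
qed

lemma step_wt_nonneg: "L \<in> strict_seqs u \<Longrightarrow> step_wt N u L m \<ge> 0"
proof (cases "m \<in> box (min u N) u L")
  case True
  assume L: "L \<in> strict_seqs u"
  have "0 \<le> (\<Prod>i<min u N. 1 - q ^ (N - i))"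
    using q0 q1 by (intro prod_nonneg) (simp add: power_le_one)
  moreover have "0 < alternant (min u N) pr m"
    by (intro alternant_pr_pos box_subset[OF _ True]) simp
  moreover have "0 \<le> (q ^ N) powi ((\<Sum>j<min u N. m j) - (\<Sum>j<u. L j))" using q0 by simp
  ultimately show ?thesis
    unfolding step_wt_def Let_def using True alternant_pr_pos[OF L] by simp
qed (simp add: step_wt_def)

lemma pmf_step:
  assumes "L \<in> strict_seqs u" "u \<le> Suc N"
  shows "pmf (step_pmf N u L) m = step_wt N u L m"
  unfolding step_pmf_def
  by (rule embed_pmf_has_sum[OF step_wt_nonneg[OF assms(1)] step_wt_has_sum_1[OF assms refl]])
     (simp add: step_wt_def Let_def)

lemma set_pmf_step:
  assumes "L \<in> strict_seqs u" "u \<le> Suc N"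
  shows "set_pmf (step_pmf N u L) \<subseteq> box (min u N) u L" "set_pmf (step_pmf N u L) \<subseteq> strict_seqs (min u N)"
proof -
  show "set_pmf (step_pmf N u L) \<subseteq> box (min u N) u L"
  proof
    fix m assume "m \<in> set_pmf (step_pmf N u L)"
    then have "step_wt N u L m \<noteq> 0" by (simp only: set_pmf_iff pmf_step[OF assms] not_False_eq_True)
    then show "m \<in> box (min u N) u L" by (simp add: step_wt_def Let_def split: if_splits)
  qed
  then show "set_pmf (step_pmf N u L) \<subseteq> strict_seqs (min u N)"
    using box_subset[of "min u N" u] by auto
qed


lemma has_sum_step:
  fixes x :: "nat \<Rightarrow> 'a :: {banach, real_normed_field}"
  assumes L: "L \<in> strict_seqs u" and u: "u \<le> Suc N" "k = min u N"
    and x: "\<And>i. i < k \<Longrightarrow> x i \<noteq> 0" "\<And>i. i < k \<Longrightarrow> of_real (q ^ N) * x i \<noteq> 1"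
       "\<And>i. i < k \<Longrightarrow> u = k \<Longrightarrow> norm (of_real (q ^ N) * x i) < 1"
  shows "((\<lambda>m. of_real (pmf (step_pmf N u L) m) * (alternant k x m / of_real (alternant k pr m))) has_sum
     ((\<Prod>i<k. of_real (1 - q ^ (N - i)) / (1 - of_real (q ^ N) * x i)) *
       (alternant u (x(k := of_real (1 / q ^ N))) L / of_real (alternant u pr L)))) (strict_seqs k)"
  unfolding pmf_step[OF L u(1)]
proof (rule has_sum_cong_neutral[THEN iffD1, rotated -1, OF has_sum_step_wt[OF assms]])
  have sub: "box k u L \<subseteq> strict_seqs k" using u(2) by (intro subsetI box_subset[of k u]) simp_all
  show "of_real (step_wt N u L m) * (alternant k x m / of_real (alternant k pr m)) = 0"
    if "m \<in> strict_seqs k - box k u L" for m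
    using that u(2) by (simp add: step_wt_def Let_def)
  show "of_real (step_wt N u L m) * (alternant k x m / of_real (alternant k pr m)) = 0"
    if "m \<in> box k u L - strict_seqs k" for m
    using that sub by blast
qed simp_all

section \<open>Schur polynomials as eigenfunctions of the kernel\<close>

definition ysq :: "nat \<Rightarrow> (nat \<Rightarrow> int) \<Rightarrow> nat \<Rightarrow> real" where
  "ysq k m j = (if j < k then q powi m j else 0)"

text \<open>The variables of the second reading of the determinant; for the empty partition they are
  the points \<open>pr i\<close>.\<close>

definition wexp :: "(nat \<Rightarrow> nat) \<Rightarrow> nat \<Rightarrow> real" where
  "wexp \<kappa> i = q powi (int (\<kappa> i) - int i)"

text \<open>The determinant with entries \<open>q\<^bsup>(\<kappa> i - i) m j\<^esup>\<close> can be read as an alternant in \<open>q\<^bsup>m j\<^esup>\<close> or in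
  \<open>q\<^bsup>\<kappa> i - i\<^esup>\<close>. The kernel acts on the second reading by \<open>has_sum_step\<close>, which makes Schur polynomials in
  \<open>q\<^bsup>m j\<^esup>\<close> eigenfunctions.\<close>

lemma alternant_Lpart_dual:
  "alternant k (ysq k m) (Lpart k \<kappa>) = (\<Prod>i<k. q powi (m i * (int k - 1))) * alternant k (wexp \<kappa>) m * revdet k"
proof -
  have "alternant k (ysq k m) (Lpart k \<kappa>) =
     detf k (\<lambda>i j. (\<lambda>i j. q powi (m i * (int k - 1)) * wexp \<kappa> j powi m i) i (k - Suc j))"
    unfolding alternant_def
  proof (rule detf_cong)
    fix i j assume ij: "i < k" "j < k"
    have "ysq k m i powi Lpart k \<kappa> j = q powi (m i * (int (\<kappa> (k - Suc j)) + int j))"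
      using ij by (simp add: ysq_def Lpart_def power_int_mult)
    also have "m i * (int (\<kappa> (k - Suc j)) + int j) = m i * (int k - 1) + (int (\<kappa> (k - Suc j)) - int (k - Suc j)) * m i"
      using ij by (simp add: algebra_simps of_nat_diff)
    also have "q powi \<dots> = q powi (m i * (int k - 1)) * wexp \<kappa> (k - Suc j) powi m i"
      using q0 by (simp add: power_int_add power_int_mult wexp_def)
    finally show "ysq k m i powi Lpart k \<kappa> j = q powi (m i * (int k - 1)) * wexp \<kappa> (k - Suc j) powi m i" .
  qed
  also have "\<dots> = detf k (\<lambda>i j. q powi (m i * (int k - 1)) * wexp \<kappa> j powi m i) * revdet k"
    by (rule detf_rev)
  also have "detf k (\<lambda>i j. q powi (m i * (int k - 1)) * wexp \<kappa> j powi m i) =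
     (\<Prod>i<k. q powi (m i * (int k - 1))) * alternant k (wexp \<kappa>) m"
    unfolding detf_scale_rows alternant_def using detf_transpose[of k "\<lambda>i j. wexp \<kappa> i powi m j"] by simp
  finally show ?thesis .
qed

lemma ysq_inj: "m \<in> strict_seqs k \<Longrightarrow> inj_on (ysq k m) {..<k}"
proof (rule linorder_inj_onI)
  fix x y assume m: "m \<in> strict_seqs k" "x < y" "y \<in> {..<k}"
  then have "m x < m y" using strict_seqs_less by auto
  then show "ysq k m x \<noteq> ysq k m y" using powi_less[of "m x" "m y"] m by (simp add: ysq_def)
qed auto

text \<open>Divide the identity \<open>alternant_Lpart_dual\<close> for \<open>\<kappa>\<close> by
  the one for the empty partition: the row factors and the sign cancel, and \<open>wexp\<close>
  becomes \<open>pr\<close> in the denominator. The right-hand side is the normalized alternant that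
  the kernel sums.\<close>

lemma spoly_ysq:
  assumes "\<kappa> \<in> parts D" "\<kappa> k = 0" "m \<in> strict_seqs k" "k \<le> n"
  shows "spoly D n \<kappa> (ysq k m) = alternant k (wexp \<kappa>) m / alternant k pr m"
proof -
  have "spoly D n \<kappa> (ysq k m) = spoly D k \<kappa> (ysq k m)"
    by (rule spoly_trunc[OF assms(1)]) (use assms(4) in \<open>auto simp: ysq_def\<close>)
  moreover have "spoly D k \<kappa> (ysq k m) * vdm k (ysq k m) = alternant k (ysq k m) (Lpart k \<kappa>)"
    using assms ysq_inj[OF assms(3)] q0 by (intro spoly_alternant) (auto simp: ysq_def)
  moreover have "vdm k (ysq k m) = alternant k (ysq k m) (Lpart k (\<lambda>_. 0))"
    using spoly_alternant[of "\<lambda>_. 0" D k "ysq k m"] ysq_inj[OF assms(3)] q0 by (auto simp: ysq_def)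
  moreover have "alternant k (wexp (\<lambda>_. 0)) m = alternant k pr m"
    by (rule alternant_cong) (auto simp: wexp_def pr_def)
  moreover have "(\<Prod>i<k. q powi (m i * (int k - 1))) \<noteq> 0" "revdet k \<noteq> (0::real)" "alternant k pr m \<noteq> 0"
    using q0 revdet_square[of k, where 'a = real] alternant_pr_pos[OF assms(3)] by auto
  moreover have "s = w / a" if "s * v = P * w * R" "v = P * a * R" "P \<noteq> 0" "R \<noteq> 0" "a \<noteq> 0" for s v P w R a :: real
    using that by (simp add: field_simps)
  ultimately show ?thesis unfolding alternant_Lpart_dual by metis
qed

lemma spoly_ysq_long:
  assumes "\<kappa> \<in> parts D" "\<kappa> k \<noteq> 0" "k \<le> n"
  shows "spoly D n \<kappa> (ysq k m) = 0"
  using spoly_trunc[OF assms(1), of k n "ysq k m"] spoly_long[of \<kappa> k D "ysq k m"] assms by (auto simp: ysq_def)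

text \<open>The product of 1 - q^(N + c) over the boxes of \<open>\<kappa>\<close>, where c is the
  content (column minus row) of the box. Ratios of consecutive values are the eigenvalues of the
  kernel.\<close>

definition eigen_const :: "nat \<Rightarrow> (nat \<Rightarrow> nat) \<Rightarrow> real" where
  "eigen_const N \<kappa> = (\<Prod>i<N. \<Prod>a<\<kappa> i. 1 - q ^ (N - i + a))"

lemma eigen_const_pos: "eigen_const N \<kappa> > 0"
  unfolding eigen_const_def by (intro prod_pos) (auto intro!: qpow_less)

text \<open>Passing from N to N + 1 shifts all exponents of a row by one, so the quotient telescopes
  in each row. Empty rows give 1, which cuts the product down to the first k rows.\<close>

lemma eigen_const_ratio:
  assumes "\<kappa> \<in> parts N" "\<kappa> k = 0" "k \<le> N"
  shows "(\<Prod>i<k. (1 - q ^ (N - i)) / (1 - q ^ N * wexp \<kappa> i)) = eigen_const N \<kappa> / eigen_const (Suc N) \<kappa>"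
proof -
  have z: "\<kappa> i = 0" if "i \<ge> k" for i using assms that by (auto simp: parts_def antimono_def) (metis le_zero_eq)
  have tel: "(\<Prod>a<n. (1 - q ^ (r + a)) / (1 - q ^ (Suc r + a))) = (1 - q ^ r) / (1 - q ^ (r + n))" if "r > 0" for r n
  proof (induction n)
    case (Suc n)
    have "1 - q ^ (r + n) \<noteq> 0" using qpow_less[of "r + n"] that by simp
    then show ?case unfolding prod.lessThan_Suc Suc.IH by simp
  qed (use qpow_less[of r] that in auto)
  have "eigen_const N \<kappa> / eigen_const (Suc N) \<kappa> = (\<Prod>i<N. \<Prod>a<\<kappa> i. (1 - q ^ (N - i + a)) / (1 - q ^ (Suc N - i + a)))"
    using assms by (simp add: eigen_const_def prod_dividef z)
  also have "\<dots> = (\<Prod>i<N. (1 - q ^ (N - i)) / (1 - q ^ (N - i + \<kappa> i)))"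
    by (intro prod.cong refl) (subst tel[symmetric], auto simp: Suc_diff_le)
  also have "\<dots> = (\<Prod>i<k. (1 - q ^ (N - i)) / (1 - q ^ (N - i + \<kappa> i)))"
    proof (rule prod.mono_neutral_right)
    show "\<forall>i\<in>{..<N} - {..<k}. (1 - q ^ (N - i)) / (1 - q ^ (N - i + \<kappa> i)) = 1"
    proof
      fix i assume i: "i \<in> {..<N} - {..<k}"
      then have "q ^ (N - i) < 1" by (intro qpow_less) auto
      then show "(1 - q ^ (N - i)) / (1 - q ^ (N - i + \<kappa> i)) = 1" using z[of i] i by simp
    qed
  qed (use assms in auto)
  also have "\<dots> = (\<Prod>i<k. (1 - q ^ (N - i)) / (1 - q ^ N * wexp \<kappa> i))"
  proof (rule prod.cong[OF refl])
    fix i assume "i \<in> {..<k}"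
    then have "q ^ (N - i + \<kappa> i) = q ^ N * wexp \<kappa> i"
      using assms q0 by (simp add: wexp_def power_int_diff power_add power_diff)
    then show "(1 - q ^ (N - i)) / (1 - q ^ (N - i + \<kappa> i)) = (1 - q ^ (N - i)) / (1 - q ^ N * wexp \<kappa> i)" by simp
  qed
  finally show ?thesis by simp
qed

theorem step_spoly:
  assumes L: "L \<in> strict_seqs u" and u: "u \<le> Suc N" and D: "D \<le> N" "\<kappa> \<in> parts D"
  shows "integrable (measure_pmf (step_pmf N u L)) (\<lambda>m. spoly D N \<kappa> (ysq (min u N) m))"
    "measure_pmf.expectation (step_pmf N u L) (\<lambda>m. spoly D N \<kappa> (ysq (min u N) m)) =
       eigen_const N \<kappa> / eigen_const (Suc N) \<kappa> * spoly D (Suc N) \<kappa> (ysq u L)"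
proof -
  define k where "k = min u N"
  have \<kappa>N: "\<kappa> \<in> parts N" using D by (auto simp: parts_def)
  have "integrable (measure_pmf (step_pmf N u L)) (\<lambda>m. spoly D N \<kappa> (ysq k m)) \<and>
    measure_pmf.expectation (step_pmf N u L) (\<lambda>m. spoly D N \<kappa> (ysq k m)) =
       eigen_const N \<kappa> / eigen_const (Suc N) \<kappa> * spoly D (Suc N) \<kappa> (ysq u L)"
  proof (cases "\<kappa> k = 0")
    \<comment> \<open>A partition with more than k parts, where k < N and hence u = k: both Schur
      polynomials vanish.\<close>
    case False
    then have "k < N" using \<kappa>N unfolding parts_def by (cases "k < N") auto
    then have "k = u" by (simp add: k_def min_def split: if_splits)
    then show ?thesis
      using spoly_ysq_long[OF D(2) False, of N] spoly_ysq_long[OF D(2) False, of "Suc N"] \<open>k < N\<close> by simp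
  next
    case True
    have u0: "\<kappa> u = 0"
    proof (cases "u \<le> N")
      case False
      then show ?thesis using D by (auto simp: parts_def)
    qed (use True in \<open>simp add: k_def\<close>)
    have w: "q ^ N * wexp \<kappa> i < 1" "q ^ N * wexp \<kappa> i > 0" if "i < k" for i
    proof -
      have "q ^ N * wexp \<kappa> i = q ^ (N - i + \<kappa> i)"
        using that q0 by (simp add: k_def wexp_def power_int_diff power_add power_diff)
      then show "q ^ N * wexp \<kappa> i < 1" "q ^ N * wexp \<kappa> i > 0"
        using qpow_less[of "N - i + \<kappa> i"] that q0 by (auto simp: k_def)
    qed
    have "((\<lambda>m. of_real (pmf (step_pmf N u L) m) * (alternant k (wexp \<kappa>) m / of_real (alternant k pr m))) has_sum
     ((\<Prod>i<k. of_real (1 - q ^ (N - i)) / (1 - of_real (q ^ N) * wexp \<kappa> i)) *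
       (alternant u ((wexp \<kappa>)(k := of_real (1 / q ^ N))) L / of_real (alternant u pr L)))) (strict_seqs k)"
    proof (rule has_sum_step[OF L u k_def])
      fix i assume i: "i < k"
      show "wexp \<kappa> i \<noteq> 0" using q0 by (simp add: wexp_def)
      show "of_real (q ^ N) * wexp \<kappa> i \<noteq> 1" using w(1)[OF i] by simp
      show "norm (of_real (q ^ N) * wexp \<kappa> i) < 1" using w[OF i] by simp
    qed
    \<comment> \<open>If u = N + 1, the appended variable q^(-N) already equals
      \<open>wexp \<kappa> N\<close>, because \<open>\<kappa>\<close> has at most N parts.\<close>
    also have "alternant u ((wexp \<kappa>)(k := of_real (1 / q ^ N))) L = alternant u (wexp \<kappa>) L"
    proof (rule alternant_cong)
      fix i assume "i < u"
      show "((wexp \<kappa>)(k := of_real (1 / q ^ N))) i = wexp \<kappa> i"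
      proof (cases "i = k")
        case i: True
        then have "k = N" using u \<open>i < u\<close> by (simp add: k_def)
        then show ?thesis using True i by (simp add: wexp_def power_int_minus field_simps)
      qed simp
    qed simp
    also have "(\<Prod>i<k. of_real (1 - q ^ (N - i)) / (1 - of_real (q ^ N) * wexp \<kappa> i)) = eigen_const N \<kappa> / eigen_const (Suc N) \<kappa>"
      using eigen_const_ratio[OF \<kappa>N True] by (simp add: k_def)
    also have "alternant u (wexp \<kappa>) L / of_real (alternant u pr L) = spoly D (Suc N) \<kappa> (ysq u L)"
      using spoly_ysq[OF D(2) u0 L u] by simp
    finally have "((\<lambda>m. pmf (step_pmf N u L) m * spoly D N \<kappa> (ysq k m)) has_sum
        (eigen_const N \<kappa> / eigen_const (Suc N) \<kappa> * spoly D (Suc N) \<kappa> (ysq u L))) (strict_seqs k)"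
      by (rule has_sum_cong[THEN iffD1, rotated]) (use spoly_ysq[OF D(2) True, of _ N] in \<open>auto simp: k_def\<close>)
    note h = this
    have "set_pmf (step_pmf N u L) \<subseteq> strict_seqs k" using set_pmf_step(2)[OF L u] by (simp add: k_def)
    then show ?thesis using integral_pmf_has_sum[OF h] by blast
  qed
  then show "integrable (measure_pmf (step_pmf N u L)) (\<lambda>m. spoly D N \<kappa> (ysq (min u N) m))"
    "measure_pmf.expectation (step_pmf N u L) (\<lambda>m. spoly D N \<kappa> (ysq (min u N) m)) =
       eigen_const N \<kappa> / eigen_const (Suc N) \<kappa> * spoly D (Suc N) \<kappa> (ysq u L)"
    by (auto simp: k_def)
qed

end

lemma real_sum_bounded_has_sum:
  fixes f :: "'a \<Rightarrow> real"
  assumes "\<And>x. x \<in> A \<Longrightarrow> f x \<ge> 0" "\<And>F. finite F \<Longrightarrow> F \<subseteq> A \<Longrightarrow> sum f F \<le> B"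
  shows "f summable_on A" "infsum f A \<le> B"
proof -
  show s: "f summable_on A"
    by (rule nonneg_bdd_above_summable_on) (use assms in \<open>auto intro!: bdd_aboveI2[where M = B]\<close>)
  show "infsum f A \<le> B"
    by (rule infsum_le_finite_sums[OF s]) (use assms(2) in auto)
qed

lemma sum_nat_mult_power_le:
  fixes x :: real
  assumes "0 \<le> x" "x \<le> q" "q < 1" "finite R"
  shows "(\<Sum>r\<in>R. real r * x ^ r) \<le> x / (1 - q)\<^sup>2"
proof -
  have "(\<lambda>n. real (Suc n) * x ^ n) sums (1 / (1 - x)\<^sup>2)"
    using assms by (intro geometric_deriv_sums) auto
  then have "(\<lambda>n. x * (real (Suc n) * x ^ n)) sums (x * (1 / (1 - x)\<^sup>2))"
    by (rule sums_mult)
  then have s: "(\<lambda>n. real n * x ^ n) sums (x / (1 - x)\<^sup>2)"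
    by (subst sums_Suc_iff[symmetric, where f = "\<lambda>n. real n * x ^ n", simplified])
       (simp add: mult_ac)
  have "(\<Sum>r\<in>R. real r * x ^ r) \<le> x / (1 - x)\<^sup>2"
    using sum_le_suminf[OF sums_summable[OF s] assms(4)] sums_unique[OF s] assms by simp
  also have "\<dots> \<le> x / (1 - q)\<^sup>2"
    using assms by (intro divide_left_mono power_mono mult_pos_pos) auto
  finally show ?thesis .
qed

section \<open>Mean displacement\<close>

context qpar begin

text \<open>Bounds the product of v_n / (v_n - v_i) over i < n for v_j = q^(-m_j): strict
  monotonicity of integers gives v_i <= q^(n-i) v_n.\<close>

definition shift_const :: "nat \<Rightarrow> real" where "shift_const n = (\<Prod>i<n. 1 / (1 - q ^ (n - i)))"

lemma shift_const_pos: "shift_const n > 0"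
  unfolding shift_const_def by (intro prod_pos) (simp add: qpow_less)

text \<open>Lowering coordinate n by d multiplies v_n = q^(-m_n) by q^d. Each of the n factors v_n -
  v_i with i < n is at most v_n, hence at most q^(-d) / (1 - q^(n-i)) times the new factor. The
  factors v_j - v_n with j > n can only grow.\<close>

lemma vdm_shift:
  assumes m: "m \<in> strict_seqs k" and m': "m(n := l) \<in> strict_seqs k" and n: "n < k" and l: "l \<le> m n"
  shows "vdm k (\<lambda>j. q powi (- m j)) \<le> q powi (- (m n - l) * int n) * shift_const n * vdm k (\<lambda>j. q powi (- (m(n := l)) j))"
proof -
  define v where "v j = q powi (- m j)" for j
  define v' where "v' j = q powi (- (m(n := l)) j)" for j
  define d where "d = m n - l"
  have d: "d \<ge> 0" using l by (simp add: d_def)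
  define F where "F j = (if j = n then \<Prod>i<n. q powi (- d) * (1 / (1 - q ^ (n - i))) else 1)" for j
  have lt: "v i < v j" if "i < j" "j < k" for i j
    using strict_seqs_less[OF m that] by (auto simp: v_def intro: powi_less)
  have lt': "v' i < v' j" if "i < j" "j < k" for i j
    using strict_seqs_less[OF m' that] unfolding v'_def by (intro powi_less) simp
  have step: "(\<Prod>i<j. v j - v i) \<le> F j * (\<Prod>i<j. v' j - v' i)" if "j < k" for j
  proof (cases "j = n")
    case True
    have "(\<Prod>i<n. v n - v i) \<le> (\<Prod>i<n. (q powi (- d) * (1 / (1 - q ^ (n - i)))) * (v' n - v' i))"
    proof (rule prod_mono)
      fix i assume "i \<in> {..<n}"
      then have i: "i < n" by simp
      have "v' i \<le> v' n * q ^ (n - i)"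
      proof -
        have "(m(n := l)) i + int (n - i) \<le> (m(n := l)) n"
          by (rule strict_seqs_diff[OF m']) (use i n in auto)
        then have "q powi (- (m(n := l)) i) \<le> q powi (- (m(n := l)) n + int (n - i))"
          by (intro powi_le) simp
        also have "\<dots> = v' n * q ^ (n - i)"
          using q0 unfolding v'_def by (subst power_int_add) auto
        finally show ?thesis unfolding v'_def .
      qed
      then have a: "v' n * (1 - q ^ (n - i)) \<le> v' n - v' i" by (simp add: algebra_simps)
      have b: "1 - q ^ (n - i) > 0" using qpow_less[of "n - i"] i by simp
      have "v n - v i \<le> v n" using q0 by (simp add: v_def)
      also have "\<dots> = q powi (- d) * v' n"
        using q0 power_int_add[of q "- d" "- l"] by (simp add: v_def v'_def d_def)
      also have "v' n \<le> (1 / (1 - q ^ (n - i))) * (v' n - v' i)"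
        using a b by (simp add: pos_le_divide_eq)
      finally show "0 \<le> v n - v i \<and> v n - v i \<le> q powi (- d) * (1 / (1 - q ^ (n - i))) * (v' n - v' i)"
        using lt[of i n] i n q0 by (simp add: mult.assoc mult_left_mono)
    qed
    then show ?thesis unfolding True F_def prod.distrib by simp
  next
    case False
    have "(\<Prod>i<j. v j - v i) \<le> (\<Prod>i<j. v' j - v' i)"
    proof (rule prod_mono)
      fix i assume i: "i \<in> {..<j}"
      have "v' i \<le> v i" using l by (auto simp: v_def v'_def intro: powi_le)
      moreover have "v' j = v j" using False by (simp add: v_def v'_def)
      ultimately show "0 \<le> v j - v i \<and> v j - v i \<le> v' j - v' i" using lt[of i j] i that by simp
    qed
    then show ?thesis using False by (simp add: F_def)
  qed
  have "vdm k v \<le> (\<Prod>j<k. F j * (\<Prod>i<j. v' j - v' i))"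
    unfolding vdm_def using step lt by (intro prod_mono conjI prod_nonneg) (auto simp: less_imp_le)
  also have "\<dots> = (\<Prod>j<k. F j) * vdm k v'" by (simp add: vdm_def prod.distrib)
  also have "(\<Prod>j<k. F j) = (\<Prod>i<n. q powi (- d) * (1 / (1 - q ^ (n - i))))"
    unfolding F_def using n by (subst prod.delta) auto
  also have "\<dots> = q powi (- d * int n) * shift_const n"
    by (simp only: prod.distrib shift_const_def prod_constant card_lessThan power_int_mult power_int_of_nat)
  finally show ?thesis unfolding v_def v'_def d_def .
qed

text \<open>The box constrains each coordinate separately, so coordinate n may be reset to its
  minimum. A displacement d contributes q^(N d) to the weight and, by \<open>vdm_shift\<close>, at
  most a constant times q^(-n d) to the alternant, together q^((N-n) d).\<close>

lemma step_shift:
  assumes L: "L \<in> strict_seqs u" and u: "u \<le> Suc N" and n: "n < min u N" and m: "m \<in> box (min u N) u L"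
  shows "m(n := L n) \<in> box (min u N) u L"
    "pmf (step_pmf N u L) m \<le> shift_const n * (q ^ (N - n)) ^ nat (m n - L n) * pmf (step_pmf N u L) (m(n := L n))"
proof -
  define k where "k = min u N"
  have k: "k \<le> u" "n < k" "k \<le> N" using n by (auto simp: k_def)
  have mb: "m \<in> box k u L" using m by (simp add: k_def)
  have Ln: "L n \<le> m n" using mb k by (auto simp: box_def)
  show m': "m(n := L n) \<in> box (min u N) u L"
    using m n strict_seqs_less[OF L, of n "Suc n"] unfolding box_def
    by (auto simp: PiE_def Pi_def extensional_def)
  then have m'b: "m(n := L n) \<in> box k u L" by (simp add: k_def)
  define d where "d = nat (m n - L n)"
  have d: "m n - L n = int d" using Ln by (simp add: d_def)
  have sums: "(\<Sum>j<k. m j) = (\<Sum>j<k. (m(n := L n)) j) + int d"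
  proof -
    have "(\<Sum>j<k. m j) = (\<Sum>j<k. (m(n := L n)) j + (if j = n then int d else 0))"
      by (rule sum.cong) (use d in auto)
    then show ?thesis using k by (simp add: sum.distrib)
  qed
  have ms: "m \<in> strict_seqs k" "m(n := L n) \<in> strict_seqs k"
    using box_subset[OF k(1)] mb m'b by auto
  have "alternant k pr m \<le> q powi (- int d * int n) * shift_const n * alternant k pr (m(n := L n))"
    using vdm_shift[OF ms k(2) Ln] unfolding alternant_pr[OF ms(1)] alternant_pr[OF ms(2)] d .
  moreover define A where "A = (q ^ N) powi ((\<Sum>j<k. (m(n := L n)) j) - (\<Sum>j<u. L j)) * (\<Prod>i<k. 1 - q ^ (N - i)) / alternant u pr L"
  have "A \<ge> 0" unfolding A_def using q0 q1 alternant_pr_pos[OF L]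
    by (intro divide_nonneg_pos mult_nonneg_nonneg prod_nonneg) (auto simp: power_le_one)
  moreover have "(q ^ N) ^ d \<ge> 0" using q0 by simp
  ultimately have "A * (q ^ N) ^ d * alternant k pr m \<le> A * (q ^ N) ^ d * (q powi (- int d * int n) * shift_const n * alternant k pr (m(n := L n)))"
    by (intro mult_left_mono) auto
  moreover have "(q ^ N) ^ d * q powi (- int d * int n) = (q ^ (N - n)) ^ d"
  proof -
    have "(q ^ N) ^ d * q powi (- int d * int n) = q powi (int N * int d + (- int d * int n))"
      using q0 by (subst power_int_add) (auto simp: power_int_mult simp del: power_int_minus)
    also have "int N * int d + (- int d * int n) = int (N - n) * int d"
      using k by (simp add: of_nat_diff algebra_simps)
    also have "q powi \<dots> = (q ^ (N - n)) ^ d" by (simp only: power_int_mult power_int_of_nat)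
    finally show ?thesis .
  qed
  moreover have "pmf (step_pmf N u L) m = A * (q ^ N) ^ d * alternant k pr m"
    unfolding pmf_step[OF L u] step_wt_def Let_def k_def[symmetric] A_def sums
    using mb q0 by (simp add: power_int_add power_int_diff)
  moreover have "pmf (step_pmf N u L) (m(n := L n)) = A * alternant k pr (m(n := L n))"
    unfolding pmf_step[OF L u] step_wt_def Let_def k_def[symmetric] A_def
    using m'b by simp
  ultimately show "pmf (step_pmf N u L) m \<le> shift_const n * (q ^ (N - n)) ^ nat (m n - L n) * pmf (step_pmf N u L) (m(n := L n))"
    unfolding d_def[symmetric] by (metis (no_types, opaque_lifting) mult.assoc mult.commute)
qed

text \<open>The factor 1 / (1 - q)^2 comes from summing r x^r over r, see
  \<open>sum_nat_mult_power_le\<close>.\<close>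

definition mean_const :: "nat \<Rightarrow> real" where "mean_const n = shift_const n / (1 - q)\<^sup>2"

lemma mean_const_pos: "mean_const n > 0"
  using shift_const_pos[of n] q1 by (simp add: mean_const_def)

text \<open>Split m into its displacement r in coordinate n and the configuration with this
  coordinate reset; the pair determines m. By \<open>step_shift\<close> the sum is at most a product
  of two: the one over r is of order q^(N-n), the one over the reset configurations is at most
  1.\<close>

lemma step_mean:
  assumes L: "L \<in> strict_seqs u" and u: "u \<le> Suc N" and n: "n < min u N"
  shows "(\<integral>\<^sup>+m. ennreal (of_int (m n - L n)) \<partial>measure_pmf (step_pmf N u L)) \<le> ennreal (mean_const n * q ^ (N - n))"
proof -
  let ?B = "box (min u N) u L"
  let ?P = "pmf (step_pmf N u L)"
  have L0: "L n \<le> m n" if "m \<in> ?B" for m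
    using PiE_mem[OF that[unfolded box_def], of n] n by simp
  have fin: "(\<Sum>m\<in>F. ?P m * of_int (m n - L n)) \<le> mean_const n * q ^ (N - n)" if F: "finite F" "F \<subseteq> ?B" for F
  proof -
    define R where "R = (\<lambda>m. nat (m n - L n)) ` F"
    define F' where "F' = (\<lambda>m. m(n := L n)) ` F"
    define g where "g r m = real r * (shift_const n * (q ^ (N - n)) ^ r) * ?P m" for r m
    have inj: "inj_on (\<lambda>m. (nat (m n - L n), m(n := L n))) F"
    proof (rule inj_onI)
      fix m m' assume mm: "m \<in> F" "m' \<in> F" and eq: "(nat (m n - L n), m(n := L n)) = (nat (m' n - L n), m'(n := L n))"
      have "L n \<le> m n" "L n \<le> m' n" using L0 mm F by blast+
      then have "m n = m' n" using eq by (simp add: eq_nat_nat_iff)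
      moreover have "m j = m' j" if "j \<noteq> n" for j
      proof -
        have e: "m(n := L n) = m'(n := L n)" using eq by simp
        show ?thesis using fun_cong[OF e, of j] that by simp
      qed
      ultimately show "m = m'" by (intro ext) metis
    qed
    have gnn: "g r m \<ge> 0" for r m using shift_const_pos[of n] q0 by (simp add: g_def)
    have "(\<Sum>m\<in>F. ?P m * of_int (m n - L n)) \<le> (\<Sum>m\<in>F. g (nat (m n - L n)) (m(n := L n)))"
    proof (rule sum_mono)
      fix m assume "m \<in> F"
      then have m: "m \<in> ?B" using F by auto
      have "?P m * of_int (m n - L n) \<le> (shift_const n * (q ^ (N - n)) ^ nat (m n - L n) * ?P (m(n := L n))) * of_int (m n - L n)"
        by (rule mult_right_mono[OF step_shift(2)[OF L u n m]]) (use L0[OF m] in simp)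
      also have "\<dots> = g (nat (m n - L n)) (m(n := L n))"
        unfolding g_def using L0[OF m] by simp
      finally show "?P m * of_int (m n - L n) \<le> g (nat (m n - L n)) (m(n := L n))" .
    qed
    also have "\<dots> = (\<Sum>(r, m')\<in>(\<lambda>m. (nat (m n - L n), m(n := L n))) ` F. g r m')"
      by (subst sum.reindex[OF inj]) simp
    also have "\<dots> \<le> (\<Sum>(r, m')\<in>R \<times> F'. g r m')"
      by (rule sum_mono2) (use F gnn in \<open>auto simp: R_def F'_def\<close>)
    also have "\<dots> = shift_const n * (\<Sum>r\<in>R. real r * (q ^ (N - n)) ^ r) * (\<Sum>m\<in>F'. ?P m)"
      unfolding sum.cartesian_product[symmetric] g_def
      by (simp add: sum_distrib_left sum_distrib_right mult_ac)
    also have "\<dots> \<le> shift_const n * (q ^ (N - n) / (1 - q)\<^sup>2) * 1"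
    proof (intro mult_mono)
      have "q ^ (N - n) \<le> q ^ 1" by (rule power_decreasing) (use n q0 q1 in auto)
      then show "(\<Sum>r\<in>R. real r * (q ^ (N - n)) ^ r) \<le> q ^ (N - n) / (1 - q)\<^sup>2"
        using q0 q1 F by (intro sum_nat_mult_power_le) (auto simp: R_def)
      show "(\<Sum>m\<in>F'. ?P m) \<le> 1"
        using F by (subst measure_measure_pmf_finite[symmetric]) (auto simp: F'_def)
    qed (use shift_const_pos[of n] q0 q1 in \<open>auto intro!: mult_nonneg_nonneg sum_nonneg\<close>)
    finally show ?thesis by (simp add: mean_const_def)
  qed
  have nn: "?P m * of_int (m n - L n) \<ge> 0" if "m \<in> ?B" for m using L0[OF that] by simp
  note hs = real_sum_bounded_has_sum[of ?B "\<lambda>m. ?P m * of_int (m n - L n)", OF nn fin]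
  have hs': "((\<lambda>m. ?P m * of_int (m n - L n)) has_sum infsum (\<lambda>m. ?P m * of_int (m n - L n)) ?B) ?B"
    by (rule has_sum_infsum[OF hs(1)])
  note I = integral_pmf_has_sum[OF hs' set_pmf_step(1)[OF L u]]
  have "(\<integral>\<^sup>+m. ennreal (of_int (m n - L n)) \<partial>measure_pmf (step_pmf N u L)) =
      ennreal (measure_pmf.expectation (step_pmf N u L) (\<lambda>m. of_int (m n - L n)))"
    by (rule nn_integral_eq_integral[OF I(1)])
       (use set_pmf_step(1)[OF L u] L0 in \<open>auto intro!: AE_pmfI\<close>)
  also have "\<dots> \<le> ennreal (mean_const n * q ^ (N - n))"
    unfolding I(2) using hs(2) by (rule ennreal_leI)
  finally show ?thesis .
qed

section \<open>Chains of kernels\<close>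

primrec chain_pmf :: "nat \<Rightarrow> nat \<Rightarrow> nat \<Rightarrow> (nat \<Rightarrow> int) \<Rightarrow> (nat \<Rightarrow> int) pmf" where
  "chain_pmf N 0 u L = return_pmf L"
| "chain_pmf N (Suc d) u L = bind_pmf (step_pmf (N + d) u L) (chain_pmf N d (min u (N + d)))"

lemma set_pmf_chain:
  assumes "L \<in> strict_seqs u" "u \<le> N + d"
  shows "set_pmf (chain_pmf N d u L) \<subseteq> {m \<in> strict_seqs (min u N). \<forall>j<min u N. L j \<le> m j}"
  using assms
proof (induction d arbitrary: u L)
  case 0
  then show ?case by (simp add: min_absorb1)
next
  case (Suc d)
  show ?case
  proof
    fix m assume "m \<in> set_pmf (chain_pmf N (Suc d) u L)"
    then obtain m' where m': "m' \<in> set_pmf (step_pmf (N + d) u L)" "m \<in> set_pmf (chain_pmf N d (min u (N + d)) m')"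
      by auto
    have s: "m' \<in> strict_seqs (min u (N + d))" "m' \<in> box (min u (N + d)) u L"
      using set_pmf_step[OF Suc.prems(1), of "N + d"] Suc.prems(2) m'(1) by auto
    have "min (min u (N + d)) N = min u N" by simp
    then have "m \<in> strict_seqs (min u N)" "\<forall>j<min u N. m' j \<le> m j"
      using Suc.IH[OF s(1)] m'(2) by auto
    moreover have "L j \<le> m' j" if "j < min u N" for j
      using s(2) that unfolding box_def by (auto simp: PiE_def Pi_def)
    ultimately show "m \<in> {m \<in> strict_seqs (min u N). \<forall>j<min u N. L j \<le> m j}"
      by (auto intro: order_trans)
  qed
qed

text \<open>Coordinates only move up on the way down the levels, so the displacements of the single
  steps are nonnegative and add.\<close>

lemma chain_mean:
  assumes "L \<in> strict_seqs u" "u \<le> N + d" "n < min u N"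
  shows "(\<integral>\<^sup>+m. ennreal (of_int (m n - L n)) \<partial>measure_pmf (chain_pmf N d u L)) \<le> ennreal (mean_const n * (\<Sum>i<d. q ^ (N + i - n)))"
  using assms
proof (induction d arbitrary: u L)
  case (Suc d)
  define k where "k = min u (N + d)"
  have k: "k \<le> N + d" "n < min k N" "n < min u (N + d)" using Suc.prems by (auto simp: k_def)
  have u: "u \<le> Suc (N + d)" using Suc.prems by simp
  have s: "set_pmf (step_pmf (N + d) u L) \<subseteq> strict_seqs k" "set_pmf (step_pmf (N + d) u L) \<subseteq> box k u L"
    using set_pmf_step[OF Suc.prems(1) u] by (auto simp: k_def)
  have "(\<integral>\<^sup>+m. ennreal (of_int (m n - L n)) \<partial>measure_pmf (chain_pmf N (Suc d) u L)) =
     (\<integral>\<^sup>+m'. \<integral>\<^sup>+m. ennreal (of_int (m n - L n)) \<partial>measure_pmf (chain_pmf N d k m') \<partial>measure_pmf (step_pmf (N + d) u L))"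
    by (simp add: k_def)
  also have "\<dots> \<le> (\<integral>\<^sup>+m'. ennreal (mean_const n * (\<Sum>i<d. q ^ (N + i - n))) + ennreal (of_int (m' n - L n)) \<partial>measure_pmf (step_pmf (N + d) u L))"
  proof (rule nn_integral_mono_AE, rule AE_pmfI)
    fix m' assume m': "m' \<in> set_pmf (step_pmf (N + d) u L)"
    have ms: "m' \<in> strict_seqs k" using m' s by auto
    have "L n \<le> m' n" using m' s k unfolding box_def k_def by (auto simp: PiE_def Pi_def)
    then have "(\<integral>\<^sup>+m. ennreal (of_int (m n - L n)) \<partial>measure_pmf (chain_pmf N d k m')) \<le>
        (\<integral>\<^sup>+m. ennreal (of_int (m n - m' n)) + ennreal (of_int (m' n - L n)) \<partial>measure_pmf (chain_pmf N d k m'))"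
      using set_pmf_chain[OF ms k(1)] k
      by (intro nn_integral_mono_AE AE_pmfI) (auto simp flip: ennreal_plus)
    also have "\<dots> = (\<integral>\<^sup>+m. ennreal (of_int (m n - m' n)) \<partial>measure_pmf (chain_pmf N d k m')) + ennreal (of_int (m' n - L n))"
      by (subst nn_integral_add) auto
    also have "\<dots> \<le> ennreal (mean_const n * (\<Sum>i<d. q ^ (N + i - n))) + ennreal (of_int (m' n - L n))"
      by (intro add_right_mono Suc.IH ms k)
    finally show "(\<integral>\<^sup>+m. ennreal (of_int (m n - L n)) \<partial>measure_pmf (chain_pmf N d k m')) \<le>
        ennreal (mean_const n * (\<Sum>i<d. q ^ (N + i - n))) + ennreal (of_int (m' n - L n))" .
  qed
  also have "\<dots> = ennreal (mean_const n * (\<Sum>i<d. q ^ (N + i - n))) +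
      (\<integral>\<^sup>+m'. ennreal (of_int (m' n - L n)) \<partial>measure_pmf (step_pmf (N + d) u L))"
    by (subst nn_integral_add) auto
  also have "\<dots> \<le> ennreal (mean_const n * (\<Sum>i<d. q ^ (N + i - n))) + ennreal (mean_const n * q ^ (N + d - n))"
    by (intro add_left_mono step_mean Suc.prems u k)
  also have "\<dots> = ennreal (mean_const n * (\<Sum>i<Suc d. q ^ (N + i - n)))"
    using mean_const_pos[of n] q0 by (subst ennreal_plus[symmetric]) (auto simp: distrib_left intro!: mult_nonneg_nonneg sum_nonneg)
  finally show ?case .
qed simp

text \<open>The geometric series makes the bound independent of the starting level N + d and of the
  starting point.\<close>

lemma chain_mean_uniform:
  assumes "L \<in> strict_seqs u" "u \<le> N + d" "n < min u N"
  shows "(\<integral>\<^sup>+m. ennreal (of_int (m n - L n)) \<partial>measure_pmf (chain_pmf N d u L)) \<le> ennreal (mean_const n / (1 - q) * q ^ (N - n))"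
proof -
  have "(\<Sum>i<d. q ^ (N + i - n)) = q ^ (N - n) * (\<Sum>i<d. q ^ i)"
    using assms(3) unfolding sum_distrib_left by (intro sum.cong) (auto simp flip: power_add)
  also have "(\<Sum>i<d. q ^ i) \<le> 1 / (1 - q)"
  proof -
    have "(\<Sum>j<d. q ^ j) = (1 - q ^ d) / (1 - q)" using q1 by (simp add: sum_gp_strict)
    then show ?thesis using q0 q1 by (simp add: divide_right_mono)
  qed
  finally have "mean_const n * (\<Sum>i<d. q ^ (N + i - n)) \<le> mean_const n * (q ^ (N - n) * (1 / (1 - q)))"
    using mean_const_pos[of n] q0 by (intro mult_left_mono) auto
  then show ?thesis
    using chain_mean[OF assms] by (auto elim!: order_trans intro!: ennreal_leI simp: mult_ac)
qed

text \<open>Markov's inequality for the displacement of one coordinate.\<close>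

lemma prob_le_mean:
  assumes "n < k" "set_pmf Q \<subseteq> {m. l \<le> m n}" "(\<integral>\<^sup>+m. ennreal (of_int (m n - l)) \<partial>measure_pmf Q) \<le> ennreal b" "b \<ge> 0" "r > 0"
  shows "measure_pmf.prob Q {m. m n \<ge> l + int r} \<le> b / r"
proof -
  have "ennreal (real r) * emeasure (measure_pmf Q) {m. m n \<ge> l + int r} =
     (\<integral>\<^sup>+m. ennreal (real r) * indicator {m. m n \<ge> l + int r} m \<partial>measure_pmf Q)"
    by (simp add: nn_integral_cmult)
  also have "\<dots> \<le> (\<integral>\<^sup>+m. ennreal (of_int (m n - l)) \<partial>measure_pmf Q)"
  proof (intro nn_integral_mono_AE AE_pmfI)
    fix m assume "m \<in> set_pmf Q"
    have "real r \<le> of_int (m n - l)" if "m n \<ge> l + int r"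
    proof -
      have "int r \<le> m n - l" using that by simp
      then have "real_of_int (int r) \<le> real_of_int (m n - l)" by (simp only: of_int_le_iff)
      then show ?thesis by simp
    qed
    then show "ennreal (real r) * indicator {m. m n \<ge> l + int r} m \<le> ennreal (of_int (m n - l))"
      by (auto simp: indicator_def intro!: ennreal_leI)
  qed
  also note assms(3)
  finally have "ennreal (real r * measure_pmf.prob Q {m. m n \<ge> l + int r}) \<le> ennreal b"
    by (simp add: measure_pmf.emeasure_eq_measure ennreal_mult)
  then have "real r * measure_pmf.prob Q {m. m n \<ge> l + int r} \<le> b"
    using assms(4) by simp
  then show ?thesis using assms(5) by (simp add: field_simps)
qed

end

section \<open>Density of Schur polynomials\<close>

lemma abs_expectation_le:
  fixes f :: "'a \<Rightarrow> real"
  assumes "\<And>x. x \<in> set_pmf Q \<Longrightarrow> \<bar>f x\<bar> \<le> B"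
  shows "integrable (measure_pmf Q) f" "\<bar>measure_pmf.expectation Q f\<bar> \<le> B"
proof -
  show i: "integrable (measure_pmf Q) f"
    by (rule measure_pmf.integrable_const_bound[where B = B]) (use assms in \<open>auto intro!: AE_pmfI\<close>)
  have "\<bar>measure_pmf.expectation Q f\<bar> \<le> measure_pmf.expectation Q (\<lambda>x. \<bar>f x\<bar>)"
    by (rule integral_abs_bound)
  also have "\<dots> \<le> measure_pmf.expectation Q (\<lambda>x. B)"
    by (rule integral_mono_AE) (use i assms in \<open>auto intro!: AE_pmfI\<close>)
  finally show "\<bar>measure_pmf.expectation Q f\<bar> \<le> B" by simp
qed

lemma expectation_bind_pmf:
  fixes f :: "'a \<Rightarrow> real"
  assumes "\<And>x y. x \<in> set_pmf M \<Longrightarrow> y \<in> set_pmf (K x) \<Longrightarrow> \<bar>f y\<bar> \<le> B"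
  shows "measure_pmf.expectation (bind_pmf M K) f = measure_pmf.expectation M (\<lambda>x. measure_pmf.expectation (K x) f)"
proof -
  \<comment> \<open>Clipping makes g nonnegative everywhere while it equals f + B on the support, so
    the composition rule for nonnegative integrals applies.\<close>
  define g where "g y = max 0 (f y + B)" for y
  have g: "g y = f y + B" if "x \<in> set_pmf M" "y \<in> set_pmf (K x)" for x y
    using assms[OF that] by (auto simp: g_def)
  have gb: "\<bar>g y\<bar> \<le> 2 * B" if "x \<in> set_pmf M" "y \<in> set_pmf (K x)" for x y
    using assms[OF that] g[OF that] by (auto simp: g_def)
  have fi: "integrable (measure_pmf (K x)) f" if "x \<in> set_pmf M" for x
    by (rule abs_expectation_le) (use assms that in auto)
  have gi: "integrable (measure_pmf (K x)) g" if "x \<in> set_pmf M" for x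
    by (rule abs_expectation_le) (use gb that in auto)
  have Eg: "measure_pmf.expectation (K x) g = measure_pmf.expectation (K x) f + B" if "x \<in> set_pmf M" for x
  proof -
    have "measure_pmf.expectation (K x) g = measure_pmf.expectation (K x) (\<lambda>y. f y + B)"
      by (rule integral_cong_AE) (use g that in \<open>auto intro!: AE_pmfI\<close>)
    then show ?thesis using fi[OF that] by simp
  qed
  have "integrable (measure_pmf (bind_pmf M K)) f"
    by (rule abs_expectation_le(1)[of _ _ B]) (use assms in auto)
  then have "measure_pmf.expectation (bind_pmf M K) f + B = measure_pmf.expectation (bind_pmf M K) (\<lambda>y. f y + B)"
    by simp
  also have "\<dots> = measure_pmf.expectation (bind_pmf M K) g"
    by (rule integral_cong_AE) (use g in \<open>auto intro!: AE_pmfI\<close>)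
  finally have E1: "measure_pmf.expectation (bind_pmf M K) f + B = measure_pmf.expectation (bind_pmf M K) g" .
  have Ei: "integrable (measure_pmf M) (\<lambda>x. measure_pmf.expectation (K x) f)"
    by (rule abs_expectation_le(1)[of _ _ B], rule abs_expectation_le(2), rule assms)
  have Ei': "integrable (measure_pmf M) (\<lambda>x. measure_pmf.expectation (K x) g)"
    by (rule abs_expectation_le(1)[of _ _ "2 * B"], rule abs_expectation_le(2), rule gb)
  have gnn: "g y \<ge> 0" for y by (simp add: g_def)
  have "ennreal (measure_pmf.expectation (bind_pmf M K) g) = (\<integral>\<^sup>+y. ennreal (g y) \<partial>measure_pmf (bind_pmf M K))"
  proof (rule nn_integral_eq_integral[symmetric])
    show "integrable (measure_pmf (bind_pmf M K)) g"
      by (rule abs_expectation_le(1)[of _ _ "2 * B"]) (use gb in auto)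
  qed (use gnn in auto)
  also have "\<dots> = (\<integral>\<^sup>+x. \<integral>\<^sup>+y. ennreal (g y) \<partial>measure_pmf (K x) \<partial>measure_pmf M)" by simp
  also have "\<dots> = (\<integral>\<^sup>+x. ennreal (measure_pmf.expectation (K x) g) \<partial>measure_pmf M)"
    by (rule nn_integral_cong_AE) (use gi gnn in \<open>auto intro!: AE_pmfI nn_integral_eq_integral\<close>)
  also have "\<dots> = ennreal (measure_pmf.expectation M (\<lambda>x. measure_pmf.expectation (K x) g))"
    by (rule nn_integral_eq_integral[OF Ei']) (use gnn in \<open>auto intro!: integral_nonneg_AE\<close>)
  finally have "measure_pmf.expectation (bind_pmf M K) g = measure_pmf.expectation M (\<lambda>x. measure_pmf.expectation (K x) g)"
    using gnn by (subst (asm) ennreal_inj) (auto intro!: integral_nonneg_AE)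
  also have "\<dots> = measure_pmf.expectation M (\<lambda>x. measure_pmf.expectation (K x) f + B)"
    by (rule integral_cong_AE) (use Eg in \<open>auto intro!: AE_pmfI\<close>)
  also have "\<dots> = measure_pmf.expectation M (\<lambda>x. measure_pmf.expectation (K x) f) + B"
    using Ei by simp
  finally show ?thesis using E1 by simp
qed

lemma pmf_finite_approx:
  assumes "\<epsilon> > 0"
  shows "\<exists>F. finite F \<and> F \<subseteq> set_pmf Q \<and> measure_pmf.prob Q F > 1 - \<epsilon>"
proof -
  have "((\<lambda>x. pmf Q x *\<^sub>R (1::real)) has_sum measure_pmf.expectation Q (\<lambda>_. 1)) (set_pmf Q)"
    by (rule has_sum_pmf_integral) auto
  then have hs: "(pmf Q has_sum 1) (set_pmf Q)" by simp
  then obtain F where F: "finite F" "F \<subseteq> set_pmf Q" "dist (sum (pmf Q) F) 1 \<le> \<epsilon> / 2"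
    using has_sum_finite_approximation[OF hs, of "\<epsilon> / 2"] assms by auto
  then have "sum (pmf Q) F > 1 - \<epsilon>" using assms unfolding dist_real_def by linarith
  then show ?thesis using F by (auto simp: measure_measure_pmf_finite)
qed

text \<open>The pointwise limit is itself a probability, so a finite set carrying nearly all of its
  mass eventually carries nearly all mass of \<open>Qs n\<close>; on a finite set convergence is
  termwise.\<close>

lemma Scheffe_expectation:
  fixes f :: "'a \<Rightarrow> real"
  assumes lim: "\<And>x. (\<lambda>n. pmf (Qs n) x) \<longlonglongrightarrow> pmf Q x" and B: "\<And>x. \<bar>f x\<bar> \<le> B"
  shows "(\<lambda>n. measure_pmf.expectation (Qs n) f) \<longlonglongrightarrow> measure_pmf.expectation Q f"
proof (rule LIMSEQ_I)
  fix \<epsilon> :: real assume \<epsilon>: "\<epsilon> > 0"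
  have B0: "B \<ge> 0" using B[of undefined] by simp
  \<comment> \<open>B + 1 in place of B avoids division by zero. The part outside F then costs at
    most \<epsilon> / 4 for \<open>Q\<close> and for \<open>Qs n\<close>.\<close>
  define \<delta> where "\<delta> = \<epsilon> / (4 * (B + 1))"
  have \<delta>: "\<delta> > 0" using \<epsilon> B0 by (simp add: \<delta>_def)
  obtain F where F: "finite F" "measure_pmf.prob Q F > 1 - \<delta>"
    using pmf_finite_approx[OF \<delta>, of Q] by auto
  define h where "h x = f x * indicator F x" for x
  have split: "\<bar>measure_pmf.expectation R f - (\<Sum>x\<in>F. pmf R x * f x)\<bar> \<le> B * (1 - measure_pmf.prob R F)" for R
  proof -
    have "integrable (measure_pmf R) f" by (rule abs_expectation_le(1)[OF B])
    moreover have "integrable (measure_pmf R) h"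
      by (rule abs_expectation_le(1)[of _ _ B]) (use B B0 in \<open>simp add: h_def indicator_def\<close>)
    moreover have "integrable (measure_pmf R) (\<lambda>x. B * indicator (- F) x)"
      by (rule abs_expectation_le(1)[of _ _ B]) (use B0 in \<open>simp add: indicator_def\<close>)
    ultimately have int: "integrable (measure_pmf R) f" "integrable (measure_pmf R) h"
      "integrable (measure_pmf R) (\<lambda>x. B * indicator (- F) x)" .
    have "measure_pmf.expectation R h = (\<Sum>x\<in>F. pmf R x * f x)"
      unfolding h_def by (subst integral_measure_pmf_real[OF F(1)]) (auto simp: indicator_def mult.commute intro!: sum.cong split: if_splits)
    then have "\<bar>measure_pmf.expectation R f - (\<Sum>x\<in>F. pmf R x * f x)\<bar> = \<bar>measure_pmf.expectation R (\<lambda>x. f x - h x)\<bar>"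
      using int by simp
    also have "\<dots> \<le> measure_pmf.expectation R (\<lambda>x. \<bar>f x - h x\<bar>)" by (rule integral_abs_bound)
    also have "\<dots> \<le> measure_pmf.expectation R (\<lambda>x. B * indicator (- F) x)"
    proof (rule integral_mono)
      show "integrable (measure_pmf R) (\<lambda>x. \<bar>f x - h x\<bar>)"
        by (intro integrable_abs Bochner_Integration.integrable_diff int)
      show "\<bar>f x - h x\<bar> \<le> B * indicator (- F) x" for x
        using B[of x] by (simp add: h_def indicator_def)
    qed (rule int)
    also have "\<dots> = B * measure_pmf.prob R (- F)" by simp
    also have "measure_pmf.prob R (- F) = 1 - measure_pmf.prob R F"
      using measure_pmf.prob_compl[of F R] by (simp add: Compl_eq_Diff_UNIV)
    finally show ?thesis .
  qed
  have s1: "(\<lambda>n. \<Sum>x\<in>F. pmf (Qs n) x * f x) \<longlonglongrightarrow> (\<Sum>x\<in>F. pmf Q x * f x)"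
    by (intro tendsto_intros lim)
  have s2: "(\<lambda>n. \<Sum>x\<in>F. pmf (Qs n) x) \<longlonglongrightarrow> (\<Sum>x\<in>F. pmf Q x)"
    by (intro tendsto_intros lim)
  have p: "measure_pmf.prob R F = (\<Sum>x\<in>F. pmf R x)" for R using F(1) by (simp add: measure_measure_pmf_finite)
  have "\<forall>\<^sub>F n in sequentially. dist (\<Sum>x\<in>F. pmf (Qs n) x * f x) (\<Sum>x\<in>F. pmf Q x * f x) < \<epsilon> / 4"
    using tendstoD[OF s1, of "\<epsilon> / 4"] \<epsilon> by simp
  moreover have "\<forall>\<^sub>F n in sequentially. (\<Sum>x\<in>F. pmf (Qs n) x) > 1 - \<delta>"
    by (rule order_tendstoD[OF s2]) (use F(2) p in auto)
  ultimately have "\<forall>\<^sub>F n in sequentially. norm (measure_pmf.expectation (Qs n) f - measure_pmf.expectation Q f) < \<epsilon>"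
  proof eventually_elim
    case (elim n)
    have bd: "B * (1 - measure_pmf.prob R F) \<le> \<epsilon> / 4" if "measure_pmf.prob R F > 1 - \<delta>" for R
    proof -
      have "B * (1 - measure_pmf.prob R F) \<le> B * \<delta>" using that B0 by (intro mult_left_mono) auto
      also have "\<dots> \<le> \<epsilon> / 4" using \<epsilon> B0 by (simp add: \<delta>_def field_simps)
      finally show ?thesis .
    qed
    show ?case
      using split[of "Qs n"] split[of Q] bd[of "Qs n"] bd[of Q] elim F(2) p[of "Qs n"] \<epsilon>
      unfolding dist_real_def real_norm_def by linarith
  qed
  then show "\<exists>no. \<forall>n\<ge>no. norm (measure_pmf.expectation (Qs n) f - measure_pmf.expectation Q f) < \<epsilon>"
    by (simp add: eventually_sequentially)
qed

context qpar begin

text \<open>The lower bound l gives y_j <= q^l q^j, the hypothesis of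
  \<open>spoly_cauchy_bound\<close>, and confines the encodings to a compact set.\<close>

definition lbseqs :: "nat \<Rightarrow> int \<Rightarrow> (nat \<Rightarrow> int) set" where
  "lbseqs k l = {m \<in> strict_seqs k. \<forall>j<k. l \<le> m j}"

lemma ysq_nonneg: "0 \<le> ysq k m j"
  using q0 by (simp add: ysq_def)

lemma ysq_le:
  assumes "m \<in> lbseqs k l"
  shows "ysq k m j \<le> q powi l * q ^ j"
proof (cases "j < k")
  case True
  have "l + int j \<le> m j"
    using strict_seqs_diff[of m k 0 j] assms True by (force simp: lbseqs_def)
  then have "q powi m j \<le> q powi (l + int j)" by (rule powi_le)
  then show ?thesis using True q0 by (simp add: ysq_def power_int_add)
qed (use q0 in \<open>simp add: ysq_def\<close>)

lemma spoly_bounded: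
  assumes "\<kappa> \<in> parts D"
  shows "\<exists>C. \<forall>k n m. m \<in> lbseqs k l \<longrightarrow> \<bar>spoly D n \<kappa> (ysq k m)\<bar> \<le> C"
proof -
  obtain C where "\<forall>n y. (\<forall>j. 0 \<le> y j \<and> y j \<le> q powi l * q ^ j) \<longrightarrow> \<bar>spoly D n \<kappa> y\<bar> \<le> C"
    using spoly_cauchy_bound[OF q0 q1 _ assms, of "q powi l"] q0 by auto
  then show ?thesis using ysq_le ysq_nonneg by blast
qed

lemma chain_spoly:
  assumes L: "L \<in> strict_seqs u" and u: "u \<le> N + d" and D: "D \<le> N" "\<kappa> \<in> parts D"
  shows "measure_pmf.expectation (chain_pmf N d u L) (\<lambda>m. spoly D N \<kappa> (ysq (min u N) m)) =
       eigen_const N \<kappa> / eigen_const (N + d) \<kappa> * spoly D (N + d) \<kappa> (ysq u L)"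
  using L u
proof (induction d arbitrary: u L)
  case 0
  then show ?case using eigen_const_pos[of N \<kappa>] by (simp add: min_absorb1)
next
  case (Suc d)
  define k where "k = min u (N + d)"
  have kN: "min k N = min u N" "k \<le> N + d" by (auto simp: k_def)
  \<comment> \<open>A lower bound for L that all lower levels inherit, since coordinates only move
    up. It keeps the Schur polynomials bounded on the supports, as the exchange of expectations
    requires.\<close>
  define l where "l = (if u = 0 then 0 else L 0)"
  have Ll: "l \<le> L j" if "j < u" for j
    using strict_seqs_diff[OF Suc.prems(1), of 0 j] that by (auto simp: l_def)
  have u: "u \<le> Suc (N + d)" using Suc.prems by simp
  obtain C where C: "\<And>k n m. m \<in> lbseqs k l \<Longrightarrow> \<bar>spoly D n \<kappa> (ysq k m)\<bar> \<le> C"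
    using spoly_bounded[OF D(2)] by blast
  have lb1: "m \<in> lbseqs k l" if m: "m \<in> set_pmf (step_pmf (N + d) u L)" for m
  proof -
    have m': "m \<in> strict_seqs k" "m \<in> box k u L"
      using set_pmf_step[OF Suc.prems(1) u] m by (auto simp: k_def)
    have "l \<le> m j" if "j < k" for j
      using PiE_mem[OF m'(2)[unfolded box_def], of j] Ll[of j] that by (simp add: k_def)
    then show ?thesis using m' by (simp add: lbseqs_def)
  qed
  have lb2: "m' \<in> lbseqs (min u N) l" if "m \<in> set_pmf (step_pmf (N + d) u L)" "m' \<in> set_pmf (chain_pmf N d k m)" for m m'
  proof -
    have "m \<in> strict_seqs k" "\<forall>j<k. l \<le> m j" using lb1[OF that(1)] by (auto simp: lbseqs_def)
    moreover have "m' \<in> strict_seqs (min u N)" "\<forall>j<min u N. m j \<le> m' j"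
      using set_pmf_chain[of m k N d] calculation(1) kN that(2) by auto
    moreover have "l \<le> m' j" if "j < min u N" for j
      using calculation that by (intro order_trans[of l "m j" "m' j"]) (auto simp: k_def)
    ultimately show ?thesis unfolding lbseqs_def by simp
  qed
  have "measure_pmf.expectation (chain_pmf N (Suc d) u L) (\<lambda>m. spoly D N \<kappa> (ysq (min u N) m)) =
    measure_pmf.expectation (step_pmf (N + d) u L) (\<lambda>m. measure_pmf.expectation (chain_pmf N d k m) (\<lambda>m. spoly D N \<kappa> (ysq (min u N) m)))"
    unfolding chain_pmf.simps k_def[symmetric]
    by (rule expectation_bind_pmf[of _ _ _ C]) (use C lb2 in blast)
  also have "\<dots> = measure_pmf.expectation (step_pmf (N + d) u L) (\<lambda>m. eigen_const N \<kappa> / eigen_const (N + d) \<kappa> * spoly D (N + d) \<kappa> (ysq k m))"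
  proof (rule integral_cong_AE)
    show "AE m in measure_pmf (step_pmf (N + d) u L). measure_pmf.expectation (chain_pmf N d k m) (\<lambda>m. spoly D N \<kappa> (ysq (min u N) m)) =
       eigen_const N \<kappa> / eigen_const (N + d) \<kappa> * spoly D (N + d) \<kappa> (ysq k m)"
    proof (rule AE_pmfI)
      fix m assume "m \<in> set_pmf (step_pmf (N + d) u L)"
      then have "m \<in> strict_seqs k" using lb1 by (auto simp: lbseqs_def)
      then show "measure_pmf.expectation (chain_pmf N d k m) (\<lambda>m. spoly D N \<kappa> (ysq (min u N) m)) =
         eigen_const N \<kappa> / eigen_const (N + d) \<kappa> * spoly D (N + d) \<kappa> (ysq k m)"
        using Suc.IH[of m k] kN by simp
    qed
  qed auto
  also have "\<dots> = eigen_const N \<kappa> / eigen_const (N + d) \<kappa> * (eigen_const (N + d) \<kappa> / eigen_const (Suc (N + d)) \<kappa> * spoly D (Suc (N + d)) \<kappa> (ysq u L))"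
    using step_spoly[OF Suc.prems(1) u _ D(2)] D(1) by (simp add: k_def)
  finally show ?case using eigen_const_pos[of "N + d" \<kappa>] by simp
qed

text \<open>Configurations are encoded by the points \<open>y\<^sub>j = q\<^bsup>m j\<^esup>\<close>, with \<open>0\<close> for an infinite coordinate;
  the condition \<open>y\<^sub>j\<^sub>+\<^sub>1 \<le> q y\<^sub>j\<close> expresses strict monotonicity.\<close>

definition vals :: "int \<Rightarrow> real set" where
  "vals l = insert 0 (range (\<lambda>n. q powi (l + int n)))"

definition configs :: "nat \<Rightarrow> int \<Rightarrow> (nat \<Rightarrow> real) set" where
  "configs N l = {y. (\<forall>j. y j \<in> (if j < N then vals l else {0})) \<and> (\<forall>j. y (Suc j) \<le> q * y j)}"

lemma compact_vals: "compact (vals l)"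
proof -
  have "(\<lambda>n. q powi l * q ^ n) \<longlonglongrightarrow> q powi l * 0"
    by (intro tendsto_intros LIMSEQ_realpow_zero) (use q0 q1 in auto)
  then have "(\<lambda>n. q powi (l + int n)) \<longlonglongrightarrow> 0"
    using q0 by (simp add: power_int_add)
  then show ?thesis unfolding vals_def by (rule compact_sequence_with_limit)
qed

lemma compact_configs: "compact (configs N l)"
proof -
  have "compactin (product_topology (\<lambda>_. euclidean) UNIV) (PiE UNIV (\<lambda>j. if j < N then vals l else {0}))"
    by (subst compactin_PiE) (auto simp: compact_vals)
  then have c: "compact (PiE UNIV (\<lambda>j. if j < N then vals l else {0}))"
    by (simp add: euclidean_product_topology)
  have "closed {y :: nat \<Rightarrow> real. \<forall>j. y (Suc j) \<le> q * y j}"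
    by (intro closed_Collect_all closed_Collect_le continuous_intros
        continuous_on_product_coordinates)
  then have "compact (PiE UNIV (\<lambda>j. if j < N then vals l else {0}) \<inter> {y. \<forall>j. y (Suc j) \<le> q * y j})"
    by (rule compact_Int_closed[OF c])
  also have "PiE UNIV (\<lambda>j. if j < N then vals l else {0}) \<inter> {y. \<forall>j. y (Suc j) \<le> q * y j} = configs N l"
    by (auto simp: configs_def PiE_def Pi_def)
  finally show ?thesis .
qed

lemma ysq_configs:
  assumes "m \<in> lbseqs k l" "k \<le> N"
  shows "ysq k m \<in> configs N l"
proof -
  have "q powi m j \<in> vals l" if "j < k" for j
  proof -
    have "l \<le> m j" using assms that by (auto simp: lbseqs_def)
    then have "m j = l + int (nat (m j - l))" by simp
    then show ?thesis unfolding vals_def by (metis insertCI rangeI)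
  qed
  moreover have "q powi m (Suc j) \<le> q * q powi m j" if "Suc j < k" for j
  proof -
    have "m j + 1 \<le> m (Suc j)" using strict_seqs_less[of m k j "Suc j"] assms that by (force simp: lbseqs_def)
    then have "q powi m (Suc j) \<le> q powi (m j + 1)" by (rule powi_le)
    then show ?thesis using q0 by (simp add: power_int_add mult.commute)
  qed
  ultimately show ?thesis using assms q0 unfolding configs_def ysq_def by (auto simp: vals_def)
qed

lemma configs_nonneg: "y \<in> configs N l \<Longrightarrow> y j \<ge> 0"
  using q0 unfolding configs_def vals_def by (cases "j < N") (auto simp: image_iff dest!: spec[of _ j] split: if_splits)

lemma configs_less:
  assumes y: "y \<in> configs N l" and "i < j" "y j > 0"
  shows "y j < y i"
  using assms(2,3)
proof (induction j)
  case (Suc j)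
  have le: "y (Suc j) \<le> q * y j" using y by (auto simp: configs_def)
  then have "y j > 0"
    using Suc.prems configs_nonneg[OF y, of j] by (cases "y j = 0") auto
  have "q * y j < y j" using \<open>y j > 0\<close> q1 by simp
  then have "y (Suc j) < y j" using le by simp
  then show ?case using Suc \<open>y j > 0\<close> by (cases "i = j") auto
qed simp

text \<open>The condition y_(j+1) <= q y_j makes the zeros a final segment and the exponents before
  it strictly increasing, so the compact set contains nothing besides encodings.\<close>

lemma configs_ysq:
  assumes y: "y \<in> configs N l"
  shows "\<exists>k\<le>N. \<exists>m\<in>lbseqs k l. y = ysq k m"
proof -
  define k where "k = (LEAST j. y j = 0)"
  have yN: "y N = 0" using y by (auto simp: configs_def dest!: spec[of _ N])
  have yk: "y k = 0" unfolding k_def using yN by (rule LeastI)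
  have kN: "k \<le> N" unfolding k_def using yN by (rule Least_le)
  have pos: "y j > 0" if "j < k" for j
    using not_less_Least[of j "\<lambda>j. y j = 0"] that configs_nonneg[OF y, of j] by (auto simp: k_def)
  have zero: "y j = 0" if "j \<ge> k" for j
    using configs_less[OF y, of k j] configs_nonneg[OF y, of j] yk that by (cases "j = k") (auto simp: less_le)
  have "\<exists>a\<ge>l. y j = q powi a" if "j < k" for j
  proof -
    have "y j \<in> vals l" using y kN that by (auto simp: configs_def dest!: spec[of _ j])
    moreover have "y j > 0" by (rule pos[OF that])
    ultimately obtain n where "y j = q powi (l + int n)" unfolding vals_def by auto
    then show ?thesis by (intro exI[of _ "l + int n"]) simp
  qed
  then obtain a where a: "\<And>j. j < k \<Longrightarrow> a j \<ge> l \<and> y j = q powi a j" by metis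
  define m where "m = restrict a {..<k}"
  have "m \<in> strict_seqs k"
  proof (rule strict_seqs_SucI)
    fix j assume j: "Suc j < k"
    have "q powi a (Suc j) < q powi a j"
      using configs_less[OF y, of j "Suc j"] pos[OF j] a[of j] a[of "Suc j"] j by simp
    then have "a j < a (Suc j)" using powi_le[of "a (Suc j)" "a j"] by force
    then show "m j < m (Suc j)" using j by (simp add: m_def)
  qed (simp add: m_def)
  then have "m \<in> lbseqs k l" using a by (auto simp: lbseqs_def m_def)
  moreover have "y = ysq k m"
    using a zero by (auto simp: fun_eq_iff ysq_def m_def)
  ultimately show ?thesis using kN by blast
qed

text \<open>The clause \<open>agree\<close> makes membership depend only on the values on
  \<open>configs N l\<close>, where the dual Pieri rule is proved.\<close>

inductive_set schur_span :: "nat \<Rightarrow> int \<Rightarrow> ((nat \<Rightarrow> real) \<Rightarrow> real) set" for N l where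
  base: "\<kappa> \<in> parts N \<Longrightarrow> spoly N N \<kappa> \<in> schur_span N l"
| add: "f \<in> schur_span N l \<Longrightarrow> g \<in> schur_span N l \<Longrightarrow> (\<lambda>y. f y + g y) \<in> schur_span N l"
| scale: "f \<in> schur_span N l \<Longrightarrow> (\<lambda>y. c * f y) \<in> schur_span N l"
| agree: "f \<in> schur_span N l \<Longrightarrow> (\<And>y. y \<in> configs N l \<Longrightarrow> f y = g y) \<Longrightarrow> g \<in> schur_span N l"

lemma schur_span_const: "(\<lambda>_. c) \<in> schur_span N l"
  using schur_span.scale[OF schur_span.base[OF parts_zero, of N l], of c] by simp

lemma schur_span_sum:
  "finite I \<Longrightarrow> (\<And>i. i \<in> I \<Longrightarrow> f i \<in> schur_span N l) \<Longrightarrow> (\<lambda>y. \<Sum>i\<in>I. f i y) \<in> schur_span N l"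
  by (induction I rule: finite_induct) (auto intro: schur_span_const schur_span.add)

lemma continuous_on_schur_span: "f \<in> schur_span N l \<Longrightarrow> continuous_on (configs N l) f"
proof (induction rule: schur_span.induct)
  case (base \<kappa>)
  show ?case by (rule continuous_on_spoly)
next
  case (agree f g)
  then show ?case by (metis continuous_on_cong)
qed (intro continuous_intros | assumption)+

section \<open>Dual Pieri rule for the generating function of elementary symmetric
  polynomials\<close>

definition elem_prod :: "nat \<Rightarrow> real \<Rightarrow> (nat \<Rightarrow> real) \<Rightarrow> real" where
  "elem_prod N t y = (\<Prod>j<N. 1 + t * y j)"

text \<open>The product is symmetric in y, so in each Leibniz term it can be indexed by the
  permutation of that term. Expanding it over subsets I raises the exponents of the rows in I by
  one.\<close>

lemma detf_times_elem_prod: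
  fixes y :: "nat \<Rightarrow> real"
  assumes "\<And>j. j < k \<Longrightarrow> y j \<noteq> 0"
  shows "(\<Prod>j<k. 1 + t * y j) * detf k (\<lambda>i j. y j powi e i) =
    (\<Sum>I\<in>Pow {..<k}. t ^ card I * detf k (\<lambda>i j. y j powi (e i + (if i \<in> I then 1 else 0))))"
proof -
  have "(\<Prod>j<k. 1 + t * y j) * (\<Prod>i<k. y (p i) powi e i) =
     (\<Sum>I\<in>Pow {..<k}. t ^ card I * (\<Prod>i<k. y (p i) powi (e i + (if i \<in> I then 1 else 0))))"
    if p: "p permutes {0..<k}" for p
  proof -
    have pk: "p i < k" if "i < k" for i using permutes_in_image[OF p, of i] that by simp
    have "(\<Prod>j<k. 1 + t * y j) = (\<Prod>i<k. 1 + t * y (p i))"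
      using prod.permute[OF p, of "\<lambda>j. 1 + t * y j"] by (simp add: atLeast0LessThan o_def)
    then have "(\<Prod>j<k. 1 + t * y j) * (\<Prod>i<k. y (p i) powi e i) =
        (\<Prod>i<k. t * y (p i) powi (e i + 1) + y (p i) powi e i)"
    proof (simp only: prod.distrib[symmetric], intro prod.cong refl)
      fix i assume "i \<in> {..<k}"
      then have "y (p i) \<noteq> 0" using assms pk by simp
      then show "(1 + t * y (p i)) * y (p i) powi e i = t * y (p i) powi (e i + 1) + y (p i) powi e i"
        by (simp add: power_int_add algebra_simps)
    qed
    also have "\<dots> = (\<Sum>I\<in>Pow {..<k}. (\<Prod>i\<in>I. t * y (p i) powi (e i + 1)) * (\<Prod>i\<in>{..<k} - I. y (p i) powi e i))"
      by (rule prod_add) simp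
    also have "\<dots> = (\<Sum>I\<in>Pow {..<k}. t ^ card I * (\<Prod>i<k. y (p i) powi (e i + (if i \<in> I then 1 else 0))))"
    proof (rule sum.cong[OF refl])
      fix I assume I: "I \<in> Pow {..<k}"
      have "(\<Prod>i<k. y (p i) powi (e i + (if i \<in> I then 1 else 0))) =
         (\<Prod>i\<in>{..<k} - I. y (p i) powi (e i + (if i \<in> I then 1 else 0))) * (\<Prod>i\<in>I. y (p i) powi (e i + (if i \<in> I then 1 else 0)))"
        by (rule prod.subset_diff) (use I in auto)
      also have "(\<Prod>i\<in>{..<k} - I. y (p i) powi (e i + (if i \<in> I then 1 else 0))) = (\<Prod>i\<in>{..<k} - I. y (p i) powi e i)"
        by (rule prod.cong) auto
      also have "(\<Prod>i\<in>I. y (p i) powi (e i + (if i \<in> I then 1 else 0))) = (\<Prod>i\<in>I. y (p i) powi (e i + 1))"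
        by (rule prod.cong) auto
      finally show "(\<Prod>i\<in>I. t * y (p i) powi (e i + 1)) * (\<Prod>i\<in>{..<k} - I. y (p i) powi e i) =
        t ^ card I * (\<Prod>i<k. y (p i) powi (e i + (if i \<in> I then 1 else 0)))"
        by (simp add: prod.distrib)
    qed
    finally show ?thesis .
  qed
  then have "(\<Prod>j<k. 1 + t * y j) * detf k (\<lambda>i j. y j powi e i) =
     (\<Sum>p | p permutes {0..<k}. signof p * (\<Sum>I\<in>Pow {..<k}. t ^ card I * (\<Prod>i<k. y (p i) powi (e i + (if i \<in> I then 1 else 0)))))"
    unfolding detf_rows by (subst sum_distrib_left) (intro sum.cong refl, simp only: mult.left_commute mem_Collect_eq)
  also have "\<dots> = (\<Sum>I\<in>Pow {..<k}. t ^ card I * detf k (\<lambda>i j. y j powi (e i + (if i \<in> I then 1 else 0))))"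
    unfolding detf_rows sum_distrib_left by (subst sum.swap) (simp add: mult_ac)
  finally show ?thesis .
qed

text \<open>One box added in each row of I: a vertical strip whenever the result is a
  partition.\<close>

definition add_strip :: "(nat \<Rightarrow> nat) \<Rightarrow> nat set \<Rightarrow> nat \<Rightarrow> nat" where
  "add_strip \<kappa> I i = \<kappa> i + (if i \<in> I then 1 else 0)"

text \<open>With k nonzero coordinates of y both sides reduce to alternants of size k. Sets I that
  do not give a partition produce two equal rows, and partitions with more than k parts vanish at
  y.\<close>

lemma dual_Pieri:
  assumes y: "y \<in> configs N l" and \<kappa>: "\<kappa> \<in> parts N"
  shows "elem_prod N t y * spoly N N \<kappa> y =
    (\<Sum>I | I \<subseteq> {..<N} \<and> antimono (add_strip \<kappa> I). t ^ card I * spoly N N (add_strip \<kappa> I) y)"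
proof -
  obtain k m where k: "k \<le> N" and m: "m \<in> lbseqs k l" and ym: "y = ysq k m"
    using configs_ysq[OF y] by blast
  have ms: "m \<in> strict_seqs k" using m by (simp add: lbseqs_def)
  have parts: "add_strip \<kappa> I \<in> parts N" if "I \<subseteq> {..<N}" "antimono (add_strip \<kappa> I)" for I
    using that \<kappa> by (auto simp: parts_def add_strip_def)
  have zero: "spoly N N (add_strip \<kappa> I) y = 0"
    if "I \<subseteq> {..<N}" "antimono (add_strip \<kappa> I)" "add_strip \<kappa> I k \<noteq> 0" for I
    unfolding ym by (rule spoly_ysq_long[OF parts[OF that(1,2)] that(3) k])
  show ?thesis
  proof (cases "\<kappa> k = 0")
    case False
    then show ?thesis
      using spoly_ysq_long[OF \<kappa> False k] zero
      by (auto simp: ym add_strip_def intro!: sum.neutral)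
  next
    case True
    have E: "elem_prod N t y = (\<Prod>j<k. 1 + t * y j)"
      unfolding elem_prod_def by (rule prod.mono_neutral_right) (use k in \<open>auto simp: ym ysq_def\<close>)
    have alt: "alternant k (wexp \<eta>) m = detf k (\<lambda>i j. y j powi (int (\<eta> i) - int i))" for \<eta>
      unfolding alternant_def wexp_def ym
    proof (rule detf_cong)
      fix i j assume "i < k" "j < k"
      have "(q powi (int (\<eta> i) - int i)) powi m j = q powi ((int (\<eta> i) - int i) * m j)"
        by (simp only: power_int_mult)
      also have "\<dots> = q powi (m j * (int (\<eta> i) - int i))" by (simp only: mult.commute)
      finally show "(q powi (int (\<eta> i) - int i)) powi m j = ysq k m j powi (int (\<eta> i) - int i)"
        using \<open>j < k\<close> by (simp add: ysq_def power_int_mult)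
    qed
    have "elem_prod N t y * spoly N N \<kappa> y * alternant k pr m = (\<Prod>j<k. 1 + t * y j) * alternant k (wexp \<kappa>) m"
    proof -
      have "spoly N N \<kappa> y = alternant k (wexp \<kappa>) m / alternant k pr m"
        unfolding ym by (rule spoly_ysq[OF \<kappa> True ms k])
      then show ?thesis using alternant_pr_pos[OF ms] by (simp add: E)
    qed
    also have "\<dots> = (\<Sum>I\<in>Pow {..<k}. t ^ card I * alternant k (wexp (add_strip \<kappa> I)) m)"
    proof -
      have "(\<Prod>j<k. 1 + t * y j) * alternant k (wexp \<kappa>) m =
          (\<Sum>I\<in>Pow {..<k}. t ^ card I * detf k (\<lambda>i j. y j powi (int (\<kappa> i) - int i + (if i \<in> I then 1 else 0))))"
        unfolding alt by (rule detf_times_elem_prod) (use q0 in \<open>simp add: ym ysq_def\<close>)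
      also have "\<dots> = (\<Sum>I\<in>Pow {..<k}. t ^ card I * alternant k (wexp (add_strip \<kappa> I)) m)"
        unfolding alt
      proof (intro sum.cong refl arg_cong2[of _ _ _ _ "(*)"] detf_cong)
        fix I i j
        have "int (\<kappa> i) - int i + (if i \<in> I then 1 else 0) = int (add_strip \<kappa> I i) - int i"
          by (simp add: add_strip_def)
        then show "y j powi (int (\<kappa> i) - int i + (if i \<in> I then 1 else 0)) = y j powi (int (add_strip \<kappa> I i) - int i)"
          by (simp only:)
      qed
      finally show ?thesis .
    qed
    also have "\<dots> = (\<Sum>I | I \<subseteq> {..<k} \<and> antimono (add_strip \<kappa> I). t ^ card I * alternant k (wexp (add_strip \<kappa> I)) m)"
    proof (rule sum.mono_neutral_right)
      show "\<forall>I\<in>Pow {..<k} - {I. I \<subseteq> {..<k} \<and> antimono (add_strip \<kappa> I)}. t ^ card I * alternant k (wexp (add_strip \<kappa> I)) m = 0"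
      proof
        fix I assume I: "I \<in> Pow {..<k} - {I. I \<subseteq> {..<k} \<and> antimono (add_strip \<kappa> I)}"
        then obtain i where i: "add_strip \<kappa> I i < add_strip \<kappa> I (Suc i)" "I \<subseteq> {..<k}"
          by (auto simp: antimono_iff_le_Suc not_le)
        moreover have "\<kappa> (Suc i) \<le> \<kappa> i" using \<kappa> by (auto simp: parts_def antimono_iff_le_Suc)
        \<comment> \<open>Monotonicity can fail only at two equal parts of which just the second
          receives a box. Then \<open>\<kappa> i - i\<close> and
          \<open>\<kappa> (Suc i) + 1 - Suc i\<close> agree, so the two rows are equal.\<close>
        ultimately have *: "Suc i \<in> I" "i \<notin> I" "\<kappa> (Suc i) = \<kappa> i"
          by (auto simp: add_strip_def split: if_splits)
        then have "wexp (add_strip \<kappa> I) i = wexp (add_strip \<kappa> I) (Suc i)"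
          by (simp add: wexp_def add_strip_def)
        then have "alternant k (wexp (add_strip \<kappa> I)) m = 0"
          unfolding alternant_def using *(1) i(2) by (intro detf_equal_rows[of i _ "Suc i"]) auto
        then show "t ^ card I * alternant k (wexp (add_strip \<kappa> I)) m = 0" by simp
      qed
    qed auto
    also have "\<dots> = (\<Sum>I | I \<subseteq> {..<k} \<and> antimono (add_strip \<kappa> I). t ^ card I * spoly N N (add_strip \<kappa> I) y) * alternant k pr m"
      unfolding sum_distrib_right
    proof (rule sum.cong[OF refl])
      fix I assume I: "I \<in> {I. I \<subseteq> {..<k} \<and> antimono (add_strip \<kappa> I)}"
      then have p: "add_strip \<kappa> I \<in> parts N" using k by (intro parts) auto
      have z: "add_strip \<kappa> I k = 0" using I True by (auto simp: add_strip_def)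
      show "t ^ card I * alternant k (wexp (add_strip \<kappa> I)) m = t ^ card I * spoly N N (add_strip \<kappa> I) y * alternant k pr m"
        using alternant_pr_pos[OF ms] unfolding ym spoly_ysq[OF p z ms k] by simp
    qed
    also have "(\<Sum>I | I \<subseteq> {..<k} \<and> antimono (add_strip \<kappa> I). t ^ card I * spoly N N (add_strip \<kappa> I) y) =
       (\<Sum>I | I \<subseteq> {..<N} \<and> antimono (add_strip \<kappa> I). t ^ card I * spoly N N (add_strip \<kappa> I) y)"
    proof (rule sum.mono_neutral_left)
      show "\<forall>I\<in>{I. I \<subseteq> {..<N} \<and> antimono (add_strip \<kappa> I)} - {I. I \<subseteq> {..<k} \<and> antimono (add_strip \<kappa> I)}.
         t ^ card I * spoly N N (add_strip \<kappa> I) y = 0"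
      proof
        fix I assume I: "I \<in> {I. I \<subseteq> {..<N} \<and> antimono (add_strip \<kappa> I)} - {I. I \<subseteq> {..<k} \<and> antimono (add_strip \<kappa> I)}"
        then have "\<not> I \<subseteq> {..<k}" by auto
        then obtain i where i: "i \<in> I" "k \<le> i" by (auto simp: not_less subset_iff)
        then have "add_strip \<kappa> I i \<noteq> 0" by (simp add: add_strip_def)
        moreover have "add_strip \<kappa> I i \<le> add_strip \<kappa> I k" using I i by (auto simp: antimono_def)
        ultimately show "t ^ card I * spoly N N (add_strip \<kappa> I) y = 0"
          using zero[of I] I by auto
      qed
    qed (use k in auto)
    finally show ?thesis using alternant_pr_pos[OF ms] by simp
  qed
qed

lemma schur_span_elem_prod: "f \<in> schur_span N l \<Longrightarrow> (\<lambda>y. elem_prod N t y * f y) \<in> schur_span N l"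
proof (induction rule: schur_span.induct)
  case (base \<kappa>)
  have "(\<lambda>y. \<Sum>I | I \<subseteq> {..<N} \<and> antimono (add_strip \<kappa> I). t ^ card I * spoly N N (add_strip \<kappa> I) y) \<in> schur_span N l"
  proof (rule schur_span_sum)
    fix I assume "I \<in> {I. I \<subseteq> {..<N} \<and> antimono (add_strip \<kappa> I)}"
    then have "add_strip \<kappa> I \<in> parts N" using base by (auto simp: parts_def add_strip_def)
    then show "(\<lambda>y. t ^ card I * spoly N N (add_strip \<kappa> I) y) \<in> schur_span N l"
      by (intro schur_span.scale schur_span.base)
  qed auto
  then show ?case by (rule schur_span.agree) (simp add: dual_Pieri base)
next
  case (add f g)
  then show ?case using schur_span.add[OF add.IH] by (simp add: distrib_left)
next
  case (scale f c)
  then show ?case using schur_span.scale[OF scale.IH, of c] by (simp add: mult.left_commute)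
next
  case (agree f g)
  then show ?case by (auto intro: schur_span.agree)
qed

text \<open>The roots -1 / y_j in t determine the set of positive coordinates, and these are listed
  in decreasing order before the zeros.\<close>

lemma elem_prod_separates:
  assumes y: "y \<in> configs N l" and z: "z \<in> configs N l" and eq: "\<And>t. elem_prod N t y = elem_prod N t z"
  shows "y = z"
proof -
  have root: "(\<exists>j<N. y j = a) \<longleftrightarrow> elem_prod N (- 1 / a) y = 0" if "a > 0" for a and y :: "nat \<Rightarrow> real"
  proof -
    have "1 + - 1 / a * y j = 0 \<longleftrightarrow> y j = a" for j using that by (auto simp: field_simps)
    then show ?thesis by (auto simp: elem_prod_def)
  qed
  have in_range: "\<exists>i. z i = y j" if "y \<in> configs N l" "y j > 0" "\<And>t. elem_prod N t y = elem_prod N t z" for y z :: "nat \<Rightarrow> real" and j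
  proof -
    have "j < N" using that(1,2) by (cases "j < N") (auto simp: configs_def dest!: spec[of _ j])
    then have "elem_prod N (- 1 / y j) y = 0" using root[OF that(2), of y] by blast
    then show ?thesis using root[OF that(2), of z] that(3) by auto
  qed
  have le: "y i \<le> y j" if "y \<in> configs N l" "j \<le> i" for y i j
    using configs_less[OF that(1), of j i] configs_nonneg[OF that(1)] that(2)
    by (cases "i = j"; cases "y i = 0") (auto simp: less_le)
  have no: False if "y \<in> configs N l" "z \<in> configs N l" "\<And>t. elem_prod N t y = elem_prod N t z"
    "\<And>i. i < j \<Longrightarrow> y i = z i" "z j < y j" for y z j
  proof -
    have pos: "y j > 0" using that configs_nonneg[of z N l j] by simp
    have "\<exists>i. z i = y j" by (rule in_range[OF that(1) pos that(3)])
    then obtain i where i: "z i = y j" by blast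
    show False
    proof (cases "i < j")
      case True
      then show False using configs_less[OF that(1) True pos] that(4) i by simp
    next
      case False
      then show False using le[OF that(2), of j i] i that(5) by simp
    qed
  qed
  have "y j = z j" for j
  proof (induction j rule: less_induct)
    case (less j)
    have "\<not> z j < y j" using no[OF y z eq] less by blast
    moreover have "\<not> y j < z j" using no[OF z y eq[symmetric]] less[symmetric] by blast
    ultimately show ?case by simp
  qed
  then show ?thesis by auto
qed

text \<open>\<open>R\<close> consists of the elements of the span that multiply the span into
  itself. It is an algebra by construction, so products of Schur polynomials need not be expanded;
  the dual Pieri rule puts every \<open>elem_prod N t\<close> into it, and these separate
  points.\<close>

theorem schur_span_dense:
  assumes f: "continuous_on (configs N l) f" and \<epsilon>: "\<epsilon> > 0"
  shows "\<exists>g\<in>schur_span N l. \<forall>y\<in>configs N l. \<bar>f y - g y\<bar> < \<epsilon>"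
proof -
  define R where "R = {f \<in> schur_span N l. \<forall>g\<in>schur_span N l. (\<lambda>y. f y * g y) \<in> schur_span N l}"
  have "function_ring_on R (configs N l)"
  proof
    show "compact (configs N l)" by (rule compact_configs)
    show "continuous_on (configs N l) f" if "f \<in> R" for f
      using that continuous_on_schur_span by (auto simp: R_def)
    show "(\<lambda>x. f x + g x) \<in> R" if "f \<in> R" "g \<in> R" for f g
      using that unfolding R_def by (auto intro!: schur_span.add simp: distrib_right)
    show "(\<lambda>x. f x * g x) \<in> R" if "f \<in> R" "g \<in> R" for f g
      using that unfolding R_def by (auto simp: mult.assoc)
    show "(\<lambda>_. c) \<in> R" for c
      unfolding R_def by (auto intro!: schur_span.scale schur_span_const)
    have "elem_prod N t \<in> R" for t
      using schur_span_elem_prod[OF schur_span_const[of 1], of N t] schur_span_elem_prod by (simp add: R_def)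
    then show "\<exists>f\<in>R. f x \<noteq> f y" if "x \<in> configs N l" "y \<in> configs N l" "x \<noteq> y" for x y
      using elem_prod_separates[OF that(1,2)] that(3) by blast
  qed
  from function_ring_on.Stone_Weierstrass_basic[OF this f \<epsilon>] show ?thesis
    by (auto simp: R_def)
qed

end

lemma Scheffe_expectation_on:
  fixes f :: "'a \<Rightarrow> real"
  assumes lim: "\<And>x. (\<lambda>n. pmf (Qs n) x) \<longlonglongrightarrow> pmf Q x" and B: "\<And>x. x \<in> S \<Longrightarrow> \<bar>f x\<bar> \<le> B"
    and S: "\<And>n. set_pmf (Qs n) \<subseteq> S" "set_pmf Q \<subseteq> S"
  shows "(\<lambda>n. measure_pmf.expectation (Qs n) f) \<longlonglongrightarrow> measure_pmf.expectation Q f"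
proof -
  define g where "g x = (if x \<in> S then f x else 0)" for x
  obtain x0 where "x0 \<in> set_pmf Q" using set_pmf_not_empty[of Q] by blast
  then have B0: "B \<ge> 0" using B[of x0] S(2) by force
  have "measure_pmf.expectation R f = measure_pmf.expectation R g" if "set_pmf R \<subseteq> S" for R
    by (rule integral_cong_AE) (use that in \<open>auto intro!: AE_pmfI simp: g_def\<close>)
  moreover have "(\<lambda>n. measure_pmf.expectation (Qs n) g) \<longlonglongrightarrow> measure_pmf.expectation Q g"
    by (rule Scheffe_expectation[OF lim, of _ B]) (use B B0 in \<open>auto simp: g_def\<close>)
  ultimately show ?thesis using S by simp
qed

section \<open>The limit measures\<close>

context qpar begin

lemma continuous_configs_bounded:
  assumes "continuous_on (configs N l) (f :: _ \<Rightarrow> real)"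
  shows "\<exists>B. \<forall>y\<in>configs N l. \<bar>f y\<bar> \<le> B"
proof -
  have "bounded (f ` configs N l)"
    by (rule compact_imp_bounded[OF compact_continuous_image[OF assms compact_configs]])
  then show ?thesis by (auto simp: bounded_iff)
qed

text \<open>Convergence passes from Schur polynomials to their uniform limits: approximating f
  within e / 3 makes the expectations a Cauchy sequence.\<close>

lemma schur_span_convergent:
  fixes f :: "(nat \<Rightarrow> real) \<Rightarrow> real"
  assumes k: "k \<le> N" and sets: "\<And>n. set_pmf (Qs n) \<subseteq> lbseqs k l"
    and mom: "\<And>\<kappa>. \<kappa> \<in> parts N \<Longrightarrow> convergent (\<lambda>n. measure_pmf.expectation (Qs n) (\<lambda>m. spoly N N \<kappa> (ysq k m)))"
    and f: "continuous_on (configs N l) f"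
  shows "convergent (\<lambda>n. measure_pmf.expectation (Qs n) (\<lambda>m. f (ysq k m)))"
proof -
  have y: "ysq k m \<in> configs N l" if "m \<in> set_pmf (Qs n)" for m n
    using sets that by (intro ysq_configs k) auto
  have int: "integrable (measure_pmf (Qs n)) (\<lambda>m. f (ysq k m))" if "continuous_on (configs N l) f"
    for f :: "(nat \<Rightarrow> real) \<Rightarrow> real" and n
  proof -
    have "\<exists>B. \<forall>y\<in>configs N l. \<bar>f y\<bar> \<le> B" by (rule continuous_configs_bounded[OF that])
    then obtain B where "\<forall>y\<in>configs N l. \<bar>f y\<bar> \<le> B" by auto
    then show ?thesis by (intro abs_expectation_le(1)[of _ _ B]) (use y in auto)
  qed
  have span: "convergent (\<lambda>n. measure_pmf.expectation (Qs n) (\<lambda>m. g (ysq k m)))" if "g \<in> schur_span N l" for g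
    using that
  proof (induction rule: schur_span.induct)
    case (add f g)
    have "measure_pmf.expectation (Qs n) (\<lambda>m. f (ysq k m) + g (ysq k m)) =
       measure_pmf.expectation (Qs n) (\<lambda>m. f (ysq k m)) + measure_pmf.expectation (Qs n) (\<lambda>m. g (ysq k m))" for n
      by (rule Bochner_Integration.integral_add) (intro int continuous_on_schur_span add.hyps)+
    then show ?case using convergent_add[OF add.IH] by simp
  next
    case (scale f c)
    then show ?case using convergent_mult[OF convergent_const scale.IH] by simp
  next
    case (agree f g)
    have "measure_pmf.expectation (Qs n) (\<lambda>m. f (ysq k m)) = measure_pmf.expectation (Qs n) (\<lambda>m. g (ysq k m))" for n
      by (rule integral_cong_AE) (use agree.hyps y in \<open>auto intro!: AE_pmfI\<close>)
    then show ?case using agree.IH by simp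
  qed (rule mom)
  show ?thesis
  proof (rule Cauchy_convergent, rule CauchyI)
    fix e :: real assume e: "e > 0"
    obtain g where g: "g \<in> schur_span N l" "\<forall>y\<in>configs N l. \<bar>f y - g y\<bar> < e / 3"
      using schur_span_dense[OF f, of "e / 3"] e by auto
    have close: "\<bar>measure_pmf.expectation (Qs n) (\<lambda>m. f (ysq k m)) - measure_pmf.expectation (Qs n) (\<lambda>m. g (ysq k m))\<bar> \<le> e / 3" for n
    proof -
      have "measure_pmf.expectation (Qs n) (\<lambda>m. f (ysq k m)) - measure_pmf.expectation (Qs n) (\<lambda>m. g (ysq k m)) =
         measure_pmf.expectation (Qs n) (\<lambda>m. f (ysq k m) - g (ysq k m))"
        using int[OF f] int[OF continuous_on_schur_span[OF g(1)]] by simp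
      also have "\<bar>\<dots>\<bar> \<le> e / 3"
        by (rule abs_expectation_le(2)) (use g(2) y in \<open>auto intro: less_imp_le\<close>)
      finally show ?thesis .
    qed
    obtain n0 where n0: "\<And>a b. a \<ge> n0 \<Longrightarrow> b \<ge> n0 \<Longrightarrow> \<bar>measure_pmf.expectation (Qs a) (\<lambda>m. g (ysq k m)) - measure_pmf.expectation (Qs b) (\<lambda>m. g (ysq k m))\<bar> < e / 3"
      using CauchyD[OF convergent_Cauchy[OF span[OF g(1)]], of "e / 3"] e by auto
    show "\<exists>M. \<forall>a\<ge>M. \<forall>b\<ge>M. norm (measure_pmf.expectation (Qs a) (\<lambda>m. f (ysq k m)) - measure_pmf.expectation (Qs b) (\<lambda>m. f (ysq k m))) < e"
    proof (intro exI[of _ n0] allI impI)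
      fix a b assume "n0 \<le> a" "n0 \<le> b"
      from n0[OF this] close[of a] close[of b]
      show "norm (measure_pmf.expectation (Qs a) (\<lambda>m. f (ysq k m)) - measure_pmf.expectation (Qs b) (\<lambda>m. f (ysq k m))) < e"
        unfolding real_norm_def by linarith
    qed
  qed
qed

text \<open>A product of tents centred at the values q^(m0_j), each as wide as the gap in
  \<open>powi_separated\<close>. On sequences with k coordinates it is the indicator of
  \<open>m0\<close>, yet it is continuous on configurations.\<close>

definition point_fun :: "nat \<Rightarrow> (nat \<Rightarrow> int) \<Rightarrow> (nat \<Rightarrow> real) \<Rightarrow> real" where
  "point_fun k m0 y = (\<Prod>j<k. max 0 (1 - \<bar>y j - q powi m0 j\<bar> / (q powi m0 j * (1 - q))))"

lemma continuous_on_point_fun: "continuous_on A (point_fun k m0)"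
  unfolding point_fun_def using q0 q1
  by (intro continuous_intros continuous_on_subset[OF continuous_on_product_coordinates]) auto

text \<open>The nearest other power of q is q^(a+1), at distance exactly q^a (1 - q).\<close>

lemma powi_separated:
  assumes "a \<noteq> b"
  shows "\<bar>q powi b - q powi a\<bar> \<ge> q powi a * (1 - q)"
proof (cases "a < b")
  case True
  then have "q powi b \<le> q powi (a + 1)" by (intro powi_le) simp
  then show ?thesis using q0 by (simp add: power_int_add algebra_simps)
next
  case False
  then have "q powi a \<le> q powi (b + 1)" using assms by (intro powi_le) simp
  then have le: "q powi a \<le> q powi b * q" using q0 by (simp add: power_int_add)
  have "q powi a * (1 - q) = (1 - q) * q powi a" by simp
  also have "\<dots> \<le> (1 - q) * (q powi b * q)" using le q1 by (intro mult_left_mono) auto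
  also have "\<dots> \<le> (1 - q) * q powi b" using q0 q1 by (intro mult_left_mono mult_right_le_one_le) auto
  also have "\<dots> = q powi b - q powi b * q" by (simp add: algebra_simps)
  also have "\<dots> \<le> q powi b - q powi a" using le by simp
  finally show ?thesis by simp
qed

lemma point_fun_ysq:
  assumes "m \<in> strict_seqs k" "m0 \<in> strict_seqs k"
  shows "point_fun k m0 (ysq k m) = (if m = m0 then 1 else 0)"
proof (cases "m = m0")
  case True
  then show ?thesis by (simp add: point_fun_def ysq_def)
next
  case False
  have "\<exists>j<k. m j \<noteq> m0 j"
  proof (rule ccontr)
    assume "\<not> (\<exists>j<k. m j \<noteq> m0 j)"
    then have "m = m0" using assms by (intro extensionalityI[of _ "{..<k}"]) (auto simp: strict_seqs_def)
    then show False using False by simp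
  qed
  then obtain j where j: "j < k" "m j \<noteq> m0 j" by blast
  have "q powi m0 j * (1 - q) > 0" using q0 q1 by simp
  then have "max 0 (1 - \<bar>ysq k m j - q powi m0 j\<bar> / (q powi m0 j * (1 - q))) = 0"
    using powi_separated[of "m0 j" "m j"] j by (simp add: ysq_def pos_le_divide_eq)
  then have "point_fun k m0 (ysq k m) = 0" unfolding point_fun_def using j(1) by (intro prod_zero) auto
  then show ?thesis using False by simp
qed

text \<open>The functions \<open>point_fun\<close> give the pointwise limits. The hypothesis
  \<open>tight\<close> prevents coordinates from running off to infinity, which the compact space
  would permit: between the bounds l and r only finitely many sequences remain, so the limits still
  sum to 1.\<close>

theorem pmf_limit_exists:
  assumes sets: "\<And>n. set_pmf (Qs n) \<subseteq> lbseqs k l"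
    and mom: "\<And>\<kappa>. \<kappa> \<in> parts k \<Longrightarrow> convergent (\<lambda>n. measure_pmf.expectation (Qs n) (\<lambda>m. spoly k k \<kappa> (ysq k m)))"
    and tight: "\<And>e. e > 0 \<Longrightarrow> \<exists>r. \<forall>n. measure_pmf.prob (Qs n) {m. \<forall>j<k. m j \<le> r} \<ge> 1 - e"
  shows "\<exists>Q. set_pmf Q \<subseteq> lbseqs k l \<and> (\<forall>m. (\<lambda>n. pmf (Qs n) m) \<longlonglongrightarrow> pmf Q m)"
proof -
  have conv: "convergent (\<lambda>n. pmf (Qs n) m0)" for m0
  proof (cases "m0 \<in> lbseqs k l")
    case True
    have "measure_pmf.expectation (Qs n) (\<lambda>m. point_fun k m0 (ysq k m)) = pmf (Qs n) m0" for n
    proof -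
      have "measure_pmf.expectation (Qs n) (\<lambda>m. point_fun k m0 (ysq k m)) = measure_pmf.expectation (Qs n) (indicator {m0})"
        using True sets[of n]
        by (intro integral_cong_AE AE_pmfI) (auto simp: lbseqs_def point_fun_ysq indicator_def)
      then show ?thesis by (simp add: pmf.rep_eq)
    qed
    then show ?thesis
      using schur_span_convergent[OF order_refl sets mom continuous_on_point_fun[of _ k m0]] by simp
  next
    case False
    then have "pmf (Qs n) m0 = 0" for n using sets[of n] by (auto simp: set_pmf_iff)
    then show ?thesis by (simp add: convergent_const)
  qed
  define p where "p m = lim (\<lambda>n. pmf (Qs n) m)" for m
  have p: "(\<lambda>n. pmf (Qs n) m) \<longlonglongrightarrow> p m" for m
    using conv by (simp add: p_def convergent_LIMSEQ_iff)
  have pnn: "p m \<ge> 0" for m by (rule LIMSEQ_le_const[OF p]) auto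
  have ps: "(\<lambda>n. \<Sum>m\<in>F. pmf (Qs n) m) \<longlonglongrightarrow> (\<Sum>m\<in>F. p m)" for F by (intro tendsto_intros p)
  have ple: "sum p F \<le> 1" if "finite F" for F
    by (rule LIMSEQ_le_const2[OF ps]) (use that in \<open>auto simp flip: measure_measure_pmf_finite\<close>)
  have pz: "p m = 0" if "m \<notin> lbseqs k l" for m
  proof -
    have "pmf (Qs n) m = 0" for n using sets[of n] that by (auto simp: set_pmf_iff)
    then show ?thesis by (simp add: p_def)
  qed
  have big: "\<exists>F. finite F \<and> F \<subseteq> lbseqs k l \<and> sum p F \<ge> 1 - e" if "e > 0" for e
  proof -
    obtain r where r: "\<And>n. measure_pmf.prob (Qs n) {m. \<forall>j<k. m j \<le> r} \<ge> 1 - e" using tight[OF \<open>e > 0\<close>] by auto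
    define F where "F = {m \<in> lbseqs k l. \<forall>j<k. m j \<le> r}"
    have "F \<subseteq> PiE {..<k} (\<lambda>_. {l..r})"
      by (auto simp: F_def lbseqs_def strict_seqs_def PiE_def)
    then have fin: "finite F" by (rule finite_subset) (auto intro: finite_PiE)
    have "1 - e \<le> (\<Sum>m\<in>F. pmf (Qs n) m)" for n
    proof -
      have "measure_pmf.prob (Qs n) {m. \<forall>j<k. m j \<le> r} = measure_pmf.prob (Qs n) F"
        by (rule measure_eq_AE) (use sets[of n] in \<open>auto intro!: AE_pmfI simp: F_def\<close>)
      then show ?thesis using r[of n] fin by (simp add: measure_measure_pmf_finite)
    qed
    then have "sum p F \<ge> 1 - e" by (intro LIMSEQ_le_const[OF ps]) auto
    then show ?thesis using fin by (intro exI[of _ F]) (auto simp: F_def)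
  qed
  have s: "p summable_on lbseqs k l" "infsum p (lbseqs k l) \<le> 1"
    using real_sum_bounded_has_sum[of "lbseqs k l" p 1] pnn ple by auto
  have "infsum p (lbseqs k l) \<ge> 1"
  proof (rule field_le_epsilon)
    fix e :: real assume "e > 0"
    then obtain F where F: "finite F" "F \<subseteq> lbseqs k l" "sum p F \<ge> 1 - e" using big by blast
    have "sum p F \<le> infsum p (lbseqs k l)" by (rule finite_sum_le_infsum) (use F s pnn in auto)
    then show "1 \<le> infsum p (lbseqs k l) + e" using F by simp
  qed
  then have "(p has_sum 1) (lbseqs k l)" using s by (simp add: has_sum_iff)
  then have pmf: "pmf (embed_pmf p) m = p m" for m
    by (rule embed_pmf_has_sum[OF pnn _ pz])
  have "set_pmf (embed_pmf p) \<subseteq> lbseqs k l"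
  proof
    fix m assume "m \<in> set_pmf (embed_pmf p)"
    then have "p m \<noteq> 0" by (simp add: set_pmf_iff pmf)
    then show "m \<in> lbseqs k l" using pz by blast
  qed
  then show ?thesis using p pmf by (intro exI[of _ "embed_pmf p"]) auto
qed

lemma spoly_limit:
  assumes "Q \<ge> 0" "\<kappa> \<in> parts D"
  shows "\<exists>C. \<forall>y. (\<forall>j. 0 \<le> y j \<and> y j \<le> Q * q ^ j) \<longrightarrow> convergent (\<lambda>M. spoly D M \<kappa> y) \<and>
     (\<forall>M. \<bar>lim (\<lambda>M. spoly D M \<kappa> y) - spoly D M \<kappa> y\<bar> \<le> C * q ^ M)"
proof -
  obtain C where C0: "C \<ge> 0" and C: "\<And>n y. \<forall>j. 0 \<le> y j \<and> y j \<le> Q * q ^ j \<Longrightarrow> \<bar>spoly D (Suc n) \<kappa> y - spoly D n \<kappa> y\<bar> \<le> C * q ^ n"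
    using spoly_cauchy_bound[OF q0 q1 assms] by blast
  have diff: "\<bar>spoly D (M + p) \<kappa> y - spoly D M \<kappa> y\<bar> \<le> C / (1 - q) * q ^ M"
    if y: "\<forall>j. 0 \<le> y j \<and> y j \<le> Q * q ^ j" for M p y
  proof -
    have "\<bar>spoly D (M + p) \<kappa> y - spoly D M \<kappa> y\<bar> \<le> C * q ^ M * (\<Sum>i<p. q ^ i)"
    proof (induction p)
      case (Suc p)
      have "\<bar>spoly D (Suc (M + p)) \<kappa> y - spoly D (M + p) \<kappa> y\<bar> \<le> C * q ^ (M + p)" by (rule C[OF y])
      then show ?case using Suc by (simp add: power_add algebra_simps)
    qed simp
    also have "\<dots> \<le> C * q ^ M * (1 / (1 - q))"
    proof (rule mult_left_mono)
      have "(\<Sum>j<p. q ^ j) = (1 - q ^ p) / (1 - q)" using q1 by (simp add: sum_gp_strict)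
      then show "(\<Sum>i<p. q ^ i) \<le> 1 / (1 - q)" using q0 q1 by (simp add: divide_right_mono)
    qed (use C0 q0 in simp)
    finally show ?thesis by simp
  qed
  show ?thesis
  proof (intro exI[of _ "C / (1 - q)"] allI impI)
    fix y assume y: "\<forall>j. 0 \<le> y j \<and> y j \<le> Q * q ^ j"
    have z: "(\<lambda>M. C / (1 - q) * q ^ M) \<longlonglongrightarrow> C / (1 - q) * 0"
      by (intro tendsto_intros LIMSEQ_realpow_zero) (use q0 q1 in auto)
    have cv: "convergent (\<lambda>M. spoly D M \<kappa> y)"
    proof (rule Cauchy_convergent, rule CauchyI')
      fix e :: real assume "e > 0"
      then obtain M0 where M0: "\<And>M. M \<ge> M0 \<Longrightarrow> \<bar>C / (1 - q) * q ^ M\<bar> < e"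
        using LIMSEQ_D[OF z, of e] by auto
      show "\<exists>M. \<forall>m\<ge>M. \<forall>n>m. dist (spoly D m \<kappa> y) (spoly D n \<kappa> y) < e"
      proof (intro exI[of _ M0] allI impI)
        fix m n assume "M0 \<le> m" "m < n"
        then have "\<bar>spoly D n \<kappa> y - spoly D m \<kappa> y\<bar> \<le> C / (1 - q) * q ^ m"
          using diff[OF y, of m "n - m"] by simp
        also have "\<dots> < e" using M0[OF \<open>M0 \<le> m\<close>] by linarith
        finally show "dist (spoly D m \<kappa> y) (spoly D n \<kappa> y) < e" by (simp add: dist_real_def abs_minus_commute)
      qed
    qed
    moreover have "\<bar>lim (\<lambda>M. spoly D M \<kappa> y) - spoly D M \<kappa> y\<bar> \<le> C / (1 - q) * q ^ M" for M
    proof (rule LIMSEQ_le_const2)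
      have "(\<lambda>M. spoly D M \<kappa> y) \<longlonglongrightarrow> lim (\<lambda>M. spoly D M \<kappa> y)" using cv by (simp add: convergent_LIMSEQ_iff)
      then have "(\<lambda>p. spoly D (p + M) \<kappa> y) \<longlonglongrightarrow> lim (\<lambda>M. spoly D M \<kappa> y)" by (rule LIMSEQ_ignore_initial_segment)
      then show "(\<lambda>p. \<bar>spoly D (p + M) \<kappa> y - spoly D M \<kappa> y\<bar>) \<longlonglongrightarrow> \<bar>lim (\<lambda>M. spoly D M \<kappa> y) - spoly D M \<kappa> y\<bar>"
        by (intro tendsto_intros)
      show "\<exists>N. \<forall>n\<ge>N. \<bar>spoly D (n + M) \<kappa> y - spoly D M \<kappa> y\<bar> \<le> C / (1 - q) * q ^ M"
        using diff[OF y, of M] by (simp add: add.commute)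
    qed
    ultimately show "convergent (\<lambda>M. spoly D M \<kappa> y) \<and> (\<forall>M. \<bar>lim (\<lambda>M. spoly D M \<kappa> y) - spoly D M \<kappa> y\<bar> \<le> C / (1 - q) * q ^ M)" by blast
  qed
qed

text \<open>There is one factor for each box of \<open>\<kappa>\<close>, a fixed finite number, and
  each of them tends to 1.\<close>

lemma eigen_const_tendsto: "\<kappa> \<in> parts D \<Longrightarrow> (\<lambda>d. eigen_const (N + d) \<kappa>) \<longlonglongrightarrow> 1"
proof -
  assume \<kappa>: "\<kappa> \<in> parts D"
  have "(\<lambda>M. \<Prod>i<D. \<Prod>a<\<kappa> i. 1 - q ^ (M - i + a)) \<longlonglongrightarrow> (\<Prod>i<D. \<Prod>a<\<kappa> i. 1 - 0)"
  proof (intro tendsto_intros)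
    fix i a
    have "(\<lambda>M. q ^ M) \<longlonglongrightarrow> 0" using q0 q1 by (intro LIMSEQ_realpow_zero) auto
    then have "(\<lambda>M. q ^ a * q ^ M) \<longlonglongrightarrow> q ^ a * 0" by (rule tendsto_mult[OF tendsto_const])
    then have "(\<lambda>M. q ^ (M + i - i + a)) \<longlonglongrightarrow> 0" by (simp add: power_add mult.commute)
    then show "(\<lambda>M. q ^ (M - i + a)) \<longlonglongrightarrow> 0" by (rule LIMSEQ_offset)
  qed
  then have "(\<lambda>M. \<Prod>i<D. \<Prod>a<\<kappa> i. 1 - q ^ (M - i + a)) \<longlonglongrightarrow> 1" by simp
  moreover have "\<forall>\<^sub>F M in sequentially. (\<Prod>i<D. \<Prod>a<\<kappa> i. 1 - q ^ (M - i + a)) = eigen_const M \<kappa>"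
    using eventually_ge_at_top[of D]
  proof eventually_elim
    case (elim M)
    then show ?case unfolding eigen_const_def
      by (intro prod.mono_neutral_left) (use \<kappa> in \<open>auto simp: parts_def\<close>)
  qed
  ultimately have "(\<lambda>M. eigen_const M \<kappa>) \<longlonglongrightarrow> 1" by (rule Lim_transform_eventually)
  then have "(\<lambda>d. eigen_const (d + N) \<kappa>) \<longlonglongrightarrow> 1" by (rule LIMSEQ_ignore_initial_segment)
  then show ?thesis by (simp add: add.commute)
qed

text \<open>The definition splits off the top level; splitting off the bottom level instead gives
  the coherence of the limits.\<close>

lemma chain_last_step:
  "u \<le> Suc (N + d) \<Longrightarrow> chain_pmf N (Suc d) u L = bind_pmf (chain_pmf (Suc N) d u L) (step_pmf N (min u (Suc N)))"
proof (induction d arbitrary: u L)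
  case 0
  have "chain_pmf N 0 v = return_pmf" for v by (intro ext) simp
  then show ?case using 0 by (simp add: bind_return_pmf bind_return_pmf' min_absorb1)
next
  case (Suc d)
  define k where "k = min u (Suc N + d)"
  have k: "k \<le> Suc (N + d)" "min k (Suc N) = min u (Suc N)" by (auto simp: k_def)
  have "chain_pmf N (Suc (Suc d)) u L = bind_pmf (step_pmf (Suc N + d) u L) (chain_pmf N (Suc d) k)"
    by (simp add: k_def)
  also have "\<dots> = bind_pmf (step_pmf (Suc N + d) u L) (\<lambda>m. bind_pmf (chain_pmf (Suc N) d k m) (step_pmf N (min u (Suc N))))"
    by (intro bind_pmf_cong refl) (simp only: Suc.IH[OF k(1)] k(2))
  also have "\<dots> = bind_pmf (chain_pmf (Suc N) (Suc d) u L) (step_pmf N (min u (Suc N)))"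
    by (simp add: bind_assoc_pmf k_def)
  finally show ?case .
qed

end

section \<open>Coordinates of boundary points\<close>

lemma eint_le_simps [simp]: "x \<le> PInf" "Fin a \<le> Fin b \<longleftrightarrow> a \<le> b" "\<not> PInf \<le> Fin a"
  by (auto simp: less_eq_eint_def split: eint.splits)

lemma Nbar_mono: "\<nu> \<in> Nbar \<Longrightarrow> 1 \<le> i \<Longrightarrow> i \<le> j \<Longrightarrow> \<nu> i \<le> \<nu> j"
  by (auto simp: Nbar_def)

lemma Nbar_finite_mono: "\<nu> \<in> Nbar \<Longrightarrow> 1 \<le> i \<Longrightarrow> i \<le> j \<Longrightarrow> \<nu> j \<noteq> PInf \<Longrightarrow> \<nu> i \<noteq> PInf"
  using Nbar_mono[of \<nu> i j] by (cases "\<nu> j") auto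

text \<open>Selects the stratum: at level M the law attached to \<open>\<nu>\<close> has this number
  of finite coordinates, whether or not \<open>\<nu>\<close> is finite (see
  \<open>E_rank_rk\<close>).\<close>

definition rk :: "(nat \<Rightarrow> eint) \<Rightarrow> nat \<Rightarrow> nat" where
  "rk \<nu> M = num_finite {1..M} \<nu>"

lemma rk_set:
  assumes "\<nu> \<in> Nbar"
  shows "{i \<in> {1..M}. \<nu> i \<noteq> PInf} = {1..rk \<nu> M}" "rk \<nu> M \<le> M"
proof -
  have "{i \<in> {1..M}. \<nu> i \<noteq> PInf} = {1..rk \<nu> M} \<and> rk \<nu> M \<le> M"
  proof (induction M)
    case (Suc M)
    show ?case
    proof (cases "\<nu> (Suc M) = PInf")
      case True
      then have "{i \<in> {1..Suc M}. \<nu> i \<noteq> PInf} = {i \<in> {1..M}. \<nu> i \<noteq> PInf}"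
        by (auto simp: le_Suc_eq)
      then show ?thesis using Suc by (simp add: rk_def num_finite_def)
    next
      case False
      have "{i \<in> {1..Suc M}. \<nu> i \<noteq> PInf} = {1..Suc M}"
        using Nbar_finite_mono[OF assms _ _ False] by auto
      then show ?thesis by (simp add: rk_def num_finite_def)
    qed
  qed (simp add: rk_def num_finite_def)
  then show "{i \<in> {1..M}. \<nu> i \<noteq> PInf} = {1..rk \<nu> M}" "rk \<nu> M \<le> M" by auto
qed

lemma rk_iff: "\<nu> \<in> Nbar \<Longrightarrow> j < M \<Longrightarrow> j < rk \<nu> M \<longleftrightarrow> \<nu> (Suc j) \<noteq> PInf"
  using rk_set(1)[of \<nu> M] by (auto simp: set_eq_iff Suc_le_eq dest!: spec[of _ "Suc j"])

lemma rk_min: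
  assumes "\<nu> \<in> Nbar" "N \<le> M"
  shows "rk \<nu> N = min (rk \<nu> M) N"
proof -
  have "{1..rk \<nu> N} = {i \<in> {1..M}. \<nu> i \<noteq> PInf} \<inter> {1..N}"
    unfolding rk_set(1)[OF assms(1), of N, symmetric] using assms(2) by auto
  also have "\<dots> = {1..min (rk \<nu> M) N}"
    unfolding rk_set(1)[OF assms(1), of M] by auto
  finally have "{1..rk \<nu> N} = {1..min (rk \<nu> M) N}" .
  then have "card {1..rk \<nu> N} = card {1..min (rk \<nu> M) N}" by (simp only:)
  then show ?thesis by simp
qed

definition Nbar_coords :: "(nat \<Rightarrow> eint) \<Rightarrow> nat \<Rightarrow> nat \<Rightarrow> int" where
  "Nbar_coords \<nu> M = (\<lambda>j\<in>{..<rk \<nu> M}. the_int (\<nu> (Suc j)) + int j)"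

lemma Nbar_coords_strict:
  assumes "\<nu> \<in> Nbar"
  shows "Nbar_coords \<nu> M \<in> strict_seqs (rk \<nu> M)"
proof (rule strict_seqs_SucI)
  fix j assume j: "Suc j < rk \<nu> M"
  then have "\<nu> (Suc j) \<noteq> PInf" "\<nu> (Suc (Suc j)) \<noteq> PInf"
    using rk_iff[OF assms, of j M] rk_iff[OF assms, of "Suc j" M] rk_set(2)[OF assms, of M] by auto
  then have "the_int (\<nu> (Suc j)) \<le> the_int (\<nu> (Suc (Suc j)))"
    using Nbar_mono[OF assms, of "Suc j" "Suc (Suc j)"] by (cases "\<nu> (Suc j)"; cases "\<nu> (Suc (Suc j))") auto
  then show "Nbar_coords \<nu> M j < Nbar_coords \<nu> M (Suc j)" using j by (simp add: Nbar_coords_def)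
qed (simp add: Nbar_coords_def)

lemma Nbar_coords_eq:
  assumes "\<nu> \<in> Nbar" "N \<le> M" "j < rk \<nu> N"
  shows "Nbar_coords \<nu> M j = Nbar_coords \<nu> N j"
  using rk_min[OF assms(1,2)] assms(3) by (simp add: Nbar_coords_def)

lemma Nbar_lower: "\<exists>l. Fin l \<le> \<nu> (1::nat)"
  by (cases "\<nu> 1") auto

context qpar begin

lemma Nbar_coords_lower:
  assumes "\<nu> \<in> Nbar" "Fin l \<le> \<nu> 1"
  shows "Nbar_coords \<nu> M \<in> lbseqs (rk \<nu> M) l"
proof -
  have "l \<le> Nbar_coords \<nu> M j" if "j < rk \<nu> M" for j
  proof -
    have "\<nu> (Suc j) \<noteq> PInf" using rk_iff[OF assms(1), of j M] rk_set(2)[OF assms(1), of M] that by simp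
    moreover have "Fin l \<le> \<nu> (Suc j)" using assms(2) Nbar_mono[OF assms(1), of 1 "Suc j"] by simp
    ultimately show ?thesis using that by (cases "\<nu> (Suc j)") (auto simp: Nbar_coords_def)
  qed
  then show ?thesis using Nbar_coords_strict[OF assms(1)] by (auto simp: lbseqs_def)
qed

definition Nbar_point :: "(nat \<Rightarrow> eint) \<Rightarrow> nat \<Rightarrow> real" where
  "Nbar_point \<nu> j = (case \<nu> (Suc j) of Fin a \<Rightarrow> q powi (a + int j) | PInf \<Rightarrow> 0)"

lemma ysq_Nbar_coords: "\<nu> \<in> Nbar \<Longrightarrow> j < M \<Longrightarrow> ysq (rk \<nu> M) (Nbar_coords \<nu> M) j = Nbar_point \<nu> j"
  using rk_iff[of \<nu> j M] by (cases "\<nu> (Suc j)") (auto simp: ysq_def Nbar_coords_def Nbar_point_def)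

lemma Nbar_point_bounds:
  assumes "\<nu> \<in> Nbar" "Fin l \<le> \<nu> 1"
  shows "0 \<le> Nbar_point \<nu> j" "Nbar_point \<nu> j \<le> q powi l * q ^ j"
  using ysq_Nbar_coords[OF assms(1), of j "Suc j"] ysq_nonneg ysq_le[OF Nbar_coords_lower[OF assms], of "Suc j" j] by (metis lessI)+

text \<open>The start consists of the finite ones among the first N + d coordinates of
  \<open>\<nu>\<close>. One definition thus covers finite and infinite \<open>\<nu>\<close>; for the
  latter the size of the start stays constant once N + d is large.\<close>

definition pre_E :: "(nat \<Rightarrow> eint) \<Rightarrow> nat \<Rightarrow> nat \<Rightarrow> (nat \<Rightarrow> int) pmf" where
  "pre_E \<nu> N d = chain_pmf N d (rk \<nu> (N + d)) (Nbar_coords \<nu> (N + d))"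

lemma set_pre_E:
  assumes "\<nu> \<in> Nbar"
  shows "set_pmf (pre_E \<nu> N d) \<subseteq> {m \<in> strict_seqs (rk \<nu> N). \<forall>j<rk \<nu> N. Nbar_coords \<nu> N j \<le> m j}"
  using set_pmf_chain[OF Nbar_coords_strict[OF assms] rk_set(2)[OF assms], of N d] rk_min[OF assms, of N "N + d"]
    Nbar_coords_eq[OF assms, of N "N + d"]
  by (auto simp: pre_E_def)

lemma set_pre_E_lb:
  assumes "\<nu> \<in> Nbar" "Fin l \<le> \<nu> 1"
  shows "set_pmf (pre_E \<nu> N d) \<subseteq> lbseqs (rk \<nu> N) l"
  using set_pre_E[OF assms(1), of N d] Nbar_coords_lower[OF assms, of N]
  unfolding lbseqs_def by (auto intro: order_trans)

lemma pre_E_mean: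
  assumes "\<nu> \<in> Nbar" "n < rk \<nu> N"
  shows "(\<integral>\<^sup>+m. ennreal (of_int (m n - Nbar_coords \<nu> N n)) \<partial>measure_pmf (pre_E \<nu> N d)) \<le> ennreal (mean_const n / (1 - q) * q ^ (N - n))"
  using chain_mean_uniform[OF Nbar_coords_strict[OF assms(1)] rk_set(2)[OF assms(1)], of n N d] assms(2)
    rk_min[OF assms(1), of N "N + d"] Nbar_coords_eq[OF assms(1), of N "N + d" n]
  by (simp add: pre_E_def)

lemma pre_E_tail:
  assumes "\<nu> \<in> Nbar" "n < rk \<nu> N" "r > 0"
  shows "measure_pmf.prob (pre_E \<nu> N d) {m. m n \<ge> Nbar_coords \<nu> N n + int r} \<le> mean_const n / (1 - q) * q ^ (N - n) / r"
proof (rule prob_le_mean[OF lessI])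
  show "set_pmf (pre_E \<nu> N d) \<subseteq> {m. Nbar_coords \<nu> N n \<le> m n}"
    using set_pre_E[OF assms(1), of N d] assms(2) by auto
  show "0 \<le> mean_const n / (1 - q) * q ^ (N - n)" using mean_const_pos[of n] q0 q1 by simp
qed (use pre_E_mean[OF assms(1,2)] assms(3) in auto)

lemma pre_E_spoly:
  assumes "\<nu> \<in> Nbar" "D \<le> N" "\<kappa> \<in> parts D"
  shows "measure_pmf.expectation (pre_E \<nu> N d) (\<lambda>m. spoly D N \<kappa> (ysq (rk \<nu> N) m)) =
       eigen_const N \<kappa> / eigen_const (N + d) \<kappa> * spoly D (N + d) \<kappa> (Nbar_point \<nu>)"
proof -
  have "spoly D (N + d) \<kappa> (ysq (rk \<nu> (N + d)) (Nbar_coords \<nu> (N + d))) = spoly D (N + d) \<kappa> (Nbar_point \<nu>)"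
    by (rule spoly_cong) (rule ysq_Nbar_coords[OF assms(1)])
  then show ?thesis
    using chain_spoly[OF Nbar_coords_strict[OF assms(1)] rk_set(2)[OF assms(1)] assms(2,3), of d] rk_min[OF assms(1), of N "N + d"]
    by (simp add: pre_E_def)
qed

text \<open>For given \<open>D\<close> and \<open>\<kappa>\<close> the constant depends on the lower
  bound l but not on \<open>\<nu>\<close>, so the convergence is uniform in
  \<open>\<nu>\<close>.\<close>

lemma spoly_Nbar_point_limit:
  assumes "\<kappa> \<in> parts D"
  shows "\<exists>C. \<forall>\<nu>\<in>Nbar. Fin l \<le> \<nu> 1 \<longrightarrow> (\<lambda>M. spoly D M \<kappa> (Nbar_point \<nu>)) \<longlonglongrightarrow> lim (\<lambda>M. spoly D M \<kappa> (Nbar_point \<nu>)) \<and>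
     (\<forall>M. \<bar>lim (\<lambda>M. spoly D M \<kappa> (Nbar_point \<nu>)) - spoly D M \<kappa> (Nbar_point \<nu>)\<bar> \<le> C * q ^ M)"
proof -
  have "0 \<le> q powi l" using q0 by simp
  from spoly_limit[OF this assms] obtain C where C: "\<And>y. \<forall>j. 0 \<le> y j \<and> y j \<le> q powi l * q ^ j \<Longrightarrow>
     convergent (\<lambda>M. spoly D M \<kappa> y) \<and> (\<forall>M. \<bar>lim (\<lambda>M. spoly D M \<kappa> y) - spoly D M \<kappa> y\<bar> \<le> C * q ^ M)"
    by blast
  show ?thesis
  proof (intro exI[of _ C] ballI impI)
    fix \<nu> assume "\<nu> \<in> Nbar" "Fin l \<le> \<nu> 1"
    then have "\<forall>j. 0 \<le> Nbar_point \<nu> j \<and> Nbar_point \<nu> j \<le> q powi l * q ^ j" using Nbar_point_bounds by blast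
    from C[OF this]
    show "(\<lambda>M. spoly D M \<kappa> (Nbar_point \<nu>)) \<longlonglongrightarrow> lim (\<lambda>M. spoly D M \<kappa> (Nbar_point \<nu>)) \<and>
       (\<forall>M. \<bar>lim (\<lambda>M. spoly D M \<kappa> (Nbar_point \<nu>)) - spoly D M \<kappa> (Nbar_point \<nu>)\<bar> \<le> C * q ^ M)"
      by (simp add: convergent_LIMSEQ_iff)
  qed
qed

lemma pre_E_spoly_tendsto:
  assumes "\<nu> \<in> Nbar" "D \<le> N" "\<kappa> \<in> parts D"
  shows "(\<lambda>d. measure_pmf.expectation (pre_E \<nu> N d) (\<lambda>m. spoly D N \<kappa> (ysq (rk \<nu> N) m)))
     \<longlonglongrightarrow> eigen_const N \<kappa> * lim (\<lambda>M. spoly D M \<kappa> (Nbar_point \<nu>))"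
proof -
  obtain l where "Fin l \<le> \<nu> 1" using Nbar_lower by blast
  then have "(\<lambda>M. spoly D M \<kappa> (Nbar_point \<nu>)) \<longlonglongrightarrow> lim (\<lambda>M. spoly D M \<kappa> (Nbar_point \<nu>))"
    using spoly_Nbar_point_limit[OF assms(3), of l] assms(1) by blast
  then have "(\<lambda>d. spoly D (d + N) \<kappa> (Nbar_point \<nu>)) \<longlonglongrightarrow> lim (\<lambda>M. spoly D M \<kappa> (Nbar_point \<nu>))"
    by (rule LIMSEQ_ignore_initial_segment)
  then have "(\<lambda>d. eigen_const N \<kappa> / eigen_const (N + d) \<kappa> * spoly D (N + d) \<kappa> (Nbar_point \<nu>)) \<longlonglongrightarrow> eigen_const N \<kappa> / 1 * lim (\<lambda>M. spoly D M \<kappa> (Nbar_point \<nu>))"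
    by (intro tendsto_intros eigen_const_tendsto[OF assms(3)]) (simp_all add: add.commute)
  then show ?thesis using pre_E_spoly[OF assms] by simp
qed

lemma Ebar_exists:
  assumes "\<nu> \<in> Nbar"
  shows "\<exists>Q. \<forall>m. (\<lambda>d. pmf (pre_E \<nu> N d) m) \<longlonglongrightarrow> pmf Q m"
proof -
  define k where "k = rk \<nu> N"
  have kN: "k \<le> N" unfolding k_def by (rule rk_set(2)[OF assms])
  obtain l where l: "Fin l \<le> \<nu> 1" using Nbar_lower by blast
  have "\<exists>Q. set_pmf Q \<subseteq> lbseqs k l \<and> (\<forall>m. (\<lambda>d. pmf (pre_E \<nu> N d) m) \<longlonglongrightarrow> pmf Q m)"
  proof (rule pmf_limit_exists)
    show "set_pmf (pre_E \<nu> N d) \<subseteq> lbseqs k l" for d unfolding k_def by (rule set_pre_E_lb[OF assms l])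
  next
    fix \<kappa> assume \<kappa>: "\<kappa> \<in> parts k"
    have "spoly k k \<kappa> (ysq k m) = spoly k N \<kappa> (ysq k m)" for m
      by (rule spoly_trunc[OF \<kappa> _ kN, symmetric]) (simp add: ysq_def)
    then show "convergent (\<lambda>d. measure_pmf.expectation (pre_E \<nu> N d) (\<lambda>m. spoly k k \<kappa> (ysq k m)))"
      using pre_E_spoly_tendsto[OF assms kN \<kappa>] unfolding k_def[symmetric] convergent_def by auto
  next
    fix e :: real assume e: "e > 0"
    \<comment> \<open>The sum of the mean displacement bounds. By Markov's inequality and a union
      bound, the probability that some coordinate moves by at least \<open>r0\<close> is at most b /
      r0.\<close>
    define b where "b = (\<Sum>j<k. mean_const j / (1 - q) * q ^ (N - j))"
    have bnn: "mean_const j / (1 - q) * q ^ (N - j) \<ge> 0" for j using mean_const_pos[of j] q0 q1 by simp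
    obtain r0 :: nat where r0: "b / e < real r0" using reals_Archimedean2 by blast
    have "b \<ge> 0" unfolding b_def by (intro sum_nonneg bnn)
    then have "0 \<le> b / e" using e by simp
    then have r0p: "r0 > 0" using r0 by linarith
    define r where "r = (\<Sum>j<k. \<bar>Nbar_coords \<nu> N j\<bar>) + int r0"
    have "measure_pmf.prob (pre_E \<nu> N d) {m. \<forall>j<k. m j \<le> r} \<ge> 1 - e" for d
    proof -
      let ?P = "pre_E \<nu> N d"
      have sub: "- {m. \<forall>j<k. m j \<le> r} \<subseteq> (\<Union>j<k. {m. m j \<ge> Nbar_coords \<nu> N j + int r0})"
      proof
        fix m assume "m \<in> - {m. \<forall>j<k. m j \<le> r}"
        then obtain j where j: "j < k" "m j > r" by (auto simp: not_le)
        have "\<bar>Nbar_coords \<nu> N j\<bar> \<le> (\<Sum>j<k. \<bar>Nbar_coords \<nu> N j\<bar>)" by (rule member_le_sum) (use j in auto)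
        then have "Nbar_coords \<nu> N j + int r0 \<le> m j" using j(2) by (simp add: r_def)
        then show "m \<in> (\<Union>j<k. {m. m j \<ge> Nbar_coords \<nu> N j + int r0})" using j by auto
      qed
      have "measure_pmf.prob ?P (- {m. \<forall>j<k. m j \<le> r}) \<le> measure_pmf.prob ?P (\<Union>j<k. {m. m j \<ge> Nbar_coords \<nu> N j + int r0})"
        by (rule measure_pmf.finite_measure_mono[OF sub]) simp
      also have "\<dots> \<le> (\<Sum>j<k. measure_pmf.prob ?P {m. m j \<ge> Nbar_coords \<nu> N j + int r0})"
        by (rule measure_pmf.finite_measure_subadditive_finite) auto
      also have "\<dots> \<le> (\<Sum>j<k. mean_const j / (1 - q) * q ^ (N - j) / r0)"
        by (intro sum_mono pre_E_tail[OF assms _ r0p]) (simp add: k_def)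
      also have "\<dots> = b / r0" by (simp add: b_def sum_divide_distrib)
      also have "\<dots> \<le> e" using r0 r0p e by (simp add: field_simps)
      finally have "measure_pmf.prob ?P (- {m. \<forall>j<k. m j \<le> r}) \<le> e" .
      then show ?thesis
        using measure_pmf.prob_compl[of "{m. \<forall>j<k. m j \<le> r}" ?P] by (simp add: Compl_eq_Diff_UNIV)
    qed
    then show "\<exists>r. \<forall>d. measure_pmf.prob (pre_E \<nu> N d) {m. \<forall>j<k. m j \<le> r} \<ge> 1 - e" by blast
  qed
  then show ?thesis by blast
qed

definition Ebar :: "(nat \<Rightarrow> eint) \<Rightarrow> nat \<Rightarrow> (nat \<Rightarrow> int) pmf" where
  "Ebar \<nu> N = (SOME Q. \<forall>m. (\<lambda>d. pmf (pre_E \<nu> N d) m) \<longlonglongrightarrow> pmf Q m)"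

lemma Ebar_tendsto: "\<nu> \<in> Nbar \<Longrightarrow> (\<lambda>d. pmf (pre_E \<nu> N d) m) \<longlonglongrightarrow> pmf (Ebar \<nu> N) m"
  unfolding Ebar_def using someI_ex[OF Ebar_exists] by blast

lemma Ebar_eqI:
  assumes "\<nu> \<in> Nbar" "\<And>m. (\<lambda>d. pmf (pre_E \<nu> N d) m) \<longlonglongrightarrow> pmf Q m"
  shows "Ebar \<nu> N = Q"
  by (rule pmf_eqI) (rule LIMSEQ_unique[OF Ebar_tendsto[OF assms(1)] assms(2)])

lemma set_Ebar:
  assumes "\<nu> \<in> Nbar"
  shows "set_pmf (Ebar \<nu> N) \<subseteq> {m \<in> strict_seqs (rk \<nu> N). \<forall>j<rk \<nu> N. Nbar_coords \<nu> N j \<le> m j}"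
proof
  fix m assume m: "m \<in> set_pmf (Ebar \<nu> N)"
  show "m \<in> {m \<in> strict_seqs (rk \<nu> N). \<forall>j<rk \<nu> N. Nbar_coords \<nu> N j \<le> m j}"
  proof (rule ccontr)
    assume n: "m \<notin> {m \<in> strict_seqs (rk \<nu> N). \<forall>j<rk \<nu> N. Nbar_coords \<nu> N j \<le> m j}"
    have "pmf (pre_E \<nu> N d) m = 0" for d
      using n set_pre_E[OF assms, of N d] by (auto simp: set_pmf_iff)
    then have "pmf (Ebar \<nu> N) m = 0"
      using Ebar_tendsto[OF assms, of N m] by (simp add: LIMSEQ_const_iff)
    then show False using m by (simp add: set_pmf_iff)
  qed
qed

lemma set_Ebar_lb:
  assumes "\<nu> \<in> Nbar" "Fin l \<le> \<nu> 1"
  shows "set_pmf (Ebar \<nu> N) \<subseteq> lbseqs (rk \<nu> N) l"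
  using set_Ebar[OF assms(1), of N] Nbar_coords_lower[OF assms, of N]
  unfolding lbseqs_def by (auto intro: order_trans)

text \<open>The limit on the right is the Schur polynomial of infinitely many variables at the
  points of \<open>\<nu>\<close>. The constant of the starting level has disappeared because it
  tends to 1.\<close>

lemma Ebar_spoly:
  assumes "\<nu> \<in> Nbar" "D \<le> N" "\<kappa> \<in> parts D"
  shows "measure_pmf.expectation (Ebar \<nu> N) (\<lambda>m. spoly D N \<kappa> (ysq (rk \<nu> N) m)) =
     eigen_const N \<kappa> * lim (\<lambda>M. spoly D M \<kappa> (Nbar_point \<nu>))"
proof (rule LIMSEQ_unique[OF _ pre_E_spoly_tendsto[OF assms]])
  obtain l where l: "Fin l \<le> \<nu> 1" using Nbar_lower by blast
  obtain C where C: "\<And>k n m. m \<in> lbseqs k l \<Longrightarrow> \<bar>spoly D n \<kappa> (ysq k m)\<bar> \<le> C"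
    using spoly_bounded[OF assms(3)] by blast
  show "(\<lambda>d. measure_pmf.expectation (pre_E \<nu> N d) (\<lambda>m. spoly D N \<kappa> (ysq (rk \<nu> N) m))) \<longlonglongrightarrow>
     measure_pmf.expectation (Ebar \<nu> N) (\<lambda>m. spoly D N \<kappa> (ysq (rk \<nu> N) m))"
    by (rule Scheffe_expectation_on[OF Ebar_tendsto[OF assms(1)] C set_pre_E_lb[OF assms(1) l] set_Ebar_lb[OF assms(1) l]])
qed

text \<open>Displacements are nonnegative integers, so a coordinate that is not at its minimum has
  moved by at least 1, and the mean bounds the probability of that.\<close>

lemma Ebar_concentration:
  assumes "\<nu> \<in> Nbar" "n < rk \<nu> N"
  shows "measure_pmf.prob (Ebar \<nu> N) {m. m n = Nbar_coords \<nu> N n} \<ge> 1 - mean_const n / (1 - q) * q ^ (N - n)"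
proof -
  have "(\<lambda>d. measure_pmf.expectation (pre_E \<nu> N d) (indicator {m. m n = Nbar_coords \<nu> N n})) \<longlonglongrightarrow>
     measure_pmf.expectation (Ebar \<nu> N) (indicator {m. m n = Nbar_coords \<nu> N n} :: _ \<Rightarrow> real)"
    by (rule Scheffe_expectation[OF Ebar_tendsto[OF assms(1)], of _ 1]) (simp add: indicator_def)
  then have "(\<lambda>d. measure_pmf.prob (pre_E \<nu> N d) {m. m n = Nbar_coords \<nu> N n}) \<longlonglongrightarrow> measure_pmf.prob (Ebar \<nu> N) {m. m n = Nbar_coords \<nu> N n}"
    by simp
  then show ?thesis
  proof (rule LIMSEQ_le_const, intro exI allI impI)
    fix d
    have "measure_pmf.prob (pre_E \<nu> N d) {m. m n = Nbar_coords \<nu> N n} = measure_pmf.prob (pre_E \<nu> N d) (UNIV - {m. m n \<ge> Nbar_coords \<nu> N n + int 1})"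
      by (rule measure_eq_AE) (use set_pre_E[OF assms(1), of N d] assms(2) in \<open>force intro!: AE_pmfI\<close>)+
    also have "\<dots> = 1 - measure_pmf.prob (pre_E \<nu> N d) {m. m n \<ge> Nbar_coords \<nu> N n + int 1}"
      using measure_pmf.prob_compl[of "{m. m n \<ge> Nbar_coords \<nu> N n + int 1}" "pre_E \<nu> N d"] by simp
    also have "\<dots> \<ge> 1 - mean_const n / (1 - q) * q ^ (N - n)"
      using pre_E_tail[OF assms, of 1 d] by simp
    finally show "1 - mean_const n / (1 - q) * q ^ (N - n) \<le> measure_pmf.prob (pre_E \<nu> N d) {m. m n = Nbar_coords \<nu> N n}" .
  qed
qed

lemma Ebar_coherent:
  assumes "\<nu> \<in> Nbar"
  shows "Ebar \<nu> N = bind_pmf (Ebar \<nu> (Suc N)) (step_pmf N (rk \<nu> (Suc N)))"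
proof (rule Ebar_eqI[OF assms])
  fix m
  let ?K = "step_pmf N (rk \<nu> (Suc N))"
  have eq: "pre_E \<nu> N (Suc d) = bind_pmf (pre_E \<nu> (Suc N) d) ?K" for d
    unfolding pre_E_def
    using chain_last_step[of "rk \<nu> (N + Suc d)" N d "Nbar_coords \<nu> (N + Suc d)"] rk_set(2)[OF assms, of "N + Suc d"]
      rk_min[OF assms, of "Suc N" "N + Suc d"] by (simp del: chain_pmf.simps)
  have "(\<lambda>d. measure_pmf.expectation (pre_E \<nu> (Suc N) d) (\<lambda>x. pmf (?K x) m)) \<longlonglongrightarrow>
      measure_pmf.expectation (Ebar \<nu> (Suc N)) (\<lambda>x. pmf (?K x) m)"
    by (rule Scheffe_expectation[OF Ebar_tendsto[OF assms], of _ 1]) (simp add: pmf_le_1)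
  then have "(\<lambda>d. pmf (pre_E \<nu> N (Suc d)) m) \<longlonglongrightarrow> pmf (bind_pmf (Ebar \<nu> (Suc N)) ?K) m"
    unfolding eq pmf_bind .
  then show "(\<lambda>d. pmf (pre_E \<nu> N d) m) \<longlonglongrightarrow> pmf (bind_pmf (Ebar \<nu> (Suc N)) ?K) m"
    by (rule LIMSEQ_imp_Suc)
qed

lemma Ebar_chain:
  assumes "\<nu> \<in> Nbar"
  shows "Ebar \<nu> N = bind_pmf (Ebar \<nu> (N + d)) (chain_pmf N d (rk \<nu> (N + d)))"
proof (induction d)
  case 0
  have "chain_pmf N 0 v = return_pmf" for v by (intro ext) simp
  then show ?case by (simp add: bind_return_pmf')
next
  case (Suc d)
  have "Ebar \<nu> N = bind_pmf (bind_pmf (Ebar \<nu> (Suc (N + d))) (step_pmf (N + d) (rk \<nu> (Suc (N + d))))) (chain_pmf N d (rk \<nu> (N + d)))"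
    using Suc Ebar_coherent[OF assms, of "N + d"] by simp
  also have "\<dots> = bind_pmf (Ebar \<nu> (N + Suc d)) (\<lambda>L. chain_pmf N (Suc d) (rk \<nu> (N + Suc d)) L)"
    using rk_min[OF assms, of "N + d" "Suc (N + d)"] by (simp add: bind_assoc_pmf)
  finally show ?case .
qed

end

section \<open>Continuity of the limit measures\<close>

lemma continuous_map_realI:
  assumes "\<And>x e. x \<in> topspace X \<Longrightarrow> e > 0 \<Longrightarrow> \<exists>U. openin X U \<and> x \<in> U \<and> (\<forall>y\<in>U. \<bar>f y - f x\<bar> < e)"
  shows "continuous_map X euclideanreal f"
  unfolding continuous_map_def
proof (intro conjI allI impI)
  fix V :: "real set" assume "openin euclideanreal V"
  then have V: "open V" by simp
  show "openin X {x \<in> topspace X. f x \<in> V}"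
  proof (subst openin_subopen, safe)
    fix x assume x: "x \<in> topspace X" "f x \<in> V"
    obtain e where e: "e > 0" "\<And>z. dist z (f x) < e \<Longrightarrow> z \<in> V"
      using V x(2) by (meson open_dist)
    obtain U where U: "openin X U" "x \<in> U" "\<forall>y\<in>U. \<bar>f y - f x\<bar> < e" using assms[OF x(1) e(1)] by blast
    then have "U \<subseteq> {x \<in> topspace X. f x \<in> V}"
      using e(2) openin_subset[OF U(1)] by (auto simp: dist_real_def)
    then show "\<exists>T. openin X T \<and> x \<in> T \<and> T \<subseteq> {x \<in> topspace X. f x \<in> V}" using U by blast
  qed
qed auto

lemma continuous_map_real_uniform_approx:
  assumes "\<And>e. e > 0 \<Longrightarrow> \<exists>g. continuous_map X euclideanreal g \<and> (\<forall>x\<in>topspace X. \<bar>f x - g x\<bar> < e)"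
  shows "continuous_map X euclideanreal f"
proof (rule continuous_map_realI)
  fix x and e :: real assume x: "x \<in> topspace X" and e: "e > 0"
  obtain g where g: "continuous_map X euclideanreal g" "\<forall>x\<in>topspace X. \<bar>f x - g x\<bar> < e / 3"
    using assms[of "e / 3"] e by auto
  define U where "U = {y \<in> topspace X. g y \<in> ball (g x) (e / 3)}"
  have "openin X U" unfolding U_def by (rule openin_continuous_map_preimage[OF g(1)]) simp
  moreover have "x \<in> U" using x e by (simp add: U_def)
  moreover have "\<bar>f y - f x\<bar> < e" if "y \<in> U" for y
  proof -
    have "\<bar>g x - g y\<bar> < e / 3" "\<bar>f y - g y\<bar> < e / 3" "\<bar>f x - g x\<bar> < e / 3"
      using that x g(2) by (auto simp: U_def dist_real_def)
    then show ?thesis by linarith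
  qed
  ultimately show "\<exists>U. openin X U \<and> x \<in> U \<and> (\<forall>y\<in>U. \<bar>f y - f x\<bar> < e)" by blast
qed

section \<open>Neighbourhoods in the boundary and continuity in the parameter\<close>

lemma openin_Nbar_cylinder: "openin Nbar_topology {\<nu> \<in> Nbar. \<forall>i\<in>{1..k}. \<nu> i = Fin (\<eta> i)}"
  unfolding Nbar_topology_def
  by (rule topology_generated_by_Basis) (rule UnI1, rule CollectI, rule exI[of _ k], rule exI[of _ \<eta>], simp)

lemma openin_Nbar_cylinder_tail:
  "openin Nbar_topology {\<nu> \<in> Nbar. (\<forall>i\<in>{1..k}. \<nu> i = Fin (\<eta> i)) \<and> \<nu> (k + 1) \<ge> Fin l}"
  unfolding Nbar_topology_def
  by (rule topology_generated_by_Basis) (rule UnI2, rule CollectI, rule exI[of _ k], rule exI[of _ \<eta>], rule exI[of _ l], simp)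

lemma topspace_Nbar [simp]: "topspace Nbar_topology = Nbar"
proof
  show "Nbar \<subseteq> topspace Nbar_topology"
    using openin_subset[OF openin_Nbar_cylinder[of 0]] by auto
  show "topspace Nbar_topology \<subseteq> Nbar"
    unfolding Nbar_topology_def topology_generated_by_topspace by auto
qed

text \<open>All coordinates before a finite one are finite, so a cylinder of the base can fix this
  coordinate.\<close>

lemma Nbar_fin_nhd:
  assumes "\<nu> \<in> Nbar" "\<nu> (Suc j) \<noteq> PInf"
  shows "\<exists>U. openin Nbar_topology U \<and> \<nu> \<in> U \<and> (\<forall>\<nu>'\<in>U. \<nu>' (Suc j) = \<nu> (Suc j))"
proof (intro exI[of _ "{\<nu>' \<in> Nbar. \<forall>i\<in>{1..Suc j}. \<nu>' i = Fin (the_int (\<nu> i))}"] conjI)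
  have fin: "\<nu> i = Fin (the_int (\<nu> i))" if "i \<in> {1..Suc j}" for i
    using Nbar_finite_mono[OF assms(1), of i "Suc j"] assms(2) that by (cases "\<nu> i") auto
  show "\<nu> \<in> {\<nu>' \<in> Nbar. \<forall>i\<in>{1..Suc j}. \<nu>' i = Fin (the_int (\<nu> i))}"
    using fin assms(1) by blast
  have "\<nu> (Suc j) = Fin (the_int (\<nu> (Suc j)))" by (rule fin) simp
  then show "\<forall>\<nu>'\<in>{\<nu>' \<in> Nbar. \<forall>i\<in>{1..Suc j}. \<nu>' i = Fin (the_int (\<nu> i))}. \<nu>' (Suc j) = \<nu> (Suc j)"
    by simp
qed (rule openin_Nbar_cylinder)

lemma Nbar_ge_nhd:
  assumes "\<nu> \<in> Nbar" "Fin l \<le> \<nu> (Suc j)"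
  shows "\<exists>U. openin Nbar_topology U \<and> \<nu> \<in> U \<and> (\<forall>\<nu>'\<in>U. Fin l \<le> \<nu>' (Suc j))"
proof (cases "\<nu> (Suc j) = PInf")
  case False
  then show ?thesis using Nbar_fin_nhd[OF assms(1) False] assms(2) by metis
next
  case True
  \<comment> \<open>Coordinate k + 1 is the first infinite one. The base can bound only this
    coordinate from below, and monotonicity passes the bound on to coordinate j + 1.\<close>
  define k where "k = rk \<nu> (Suc j)"
  have kj: "k \<le> j" using rk_iff[OF assms(1), of j "Suc j"] True by (simp add: k_def)
  let ?U = "{\<nu>' \<in> Nbar. (\<forall>i\<in>{1..k}. \<nu>' i = Fin (the_int (\<nu> i))) \<and> \<nu>' (k + 1) \<ge> Fin l}"
  show ?thesis
  proof (intro exI[of _ ?U] conjI ballI)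
    have "\<nu> i = Fin (the_int (\<nu> i))" if "i \<in> {1..k}" for i
    proof -
      have "\<nu> i \<noteq> PInf" using rk_set(1)[OF assms(1), of "Suc j"] that unfolding k_def by blast
      then show ?thesis by (cases "\<nu> i") auto
    qed
    moreover have "\<nu> (k + 1) = PInf"
      using rk_iff[OF assms(1), of k "Suc j"] kj by (simp add: k_def)
    ultimately show "\<nu> \<in> ?U" using assms(1) by simp
    fix \<nu>' assume "\<nu>' \<in> ?U"
    then show "Fin l \<le> \<nu>' (Suc j)"
      using Nbar_mono[of \<nu>' "k + 1" "Suc j"] kj by auto
  qed (rule openin_Nbar_cylinder_tail)
qed

context qpar begin

lemma continuous_map_Nbar_point: "continuous_map Nbar_topology euclideanreal (\<lambda>\<nu>. Nbar_point \<nu> j)"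
proof (rule continuous_map_realI)
  fix \<nu> and e :: real assume "\<nu> \<in> topspace Nbar_topology" and e: "e > 0"
  then have \<nu>: "\<nu> \<in> Nbar" by simp
  show "\<exists>U. openin Nbar_topology U \<and> \<nu> \<in> U \<and> (\<forall>\<nu>'\<in>U. \<bar>Nbar_point \<nu>' j - Nbar_point \<nu> j\<bar> < e)"
  proof (cases "\<nu> (Suc j) = PInf")
    case False
    then obtain U where U: "openin Nbar_topology U" "\<nu> \<in> U" "\<forall>\<nu>'\<in>U. \<nu>' (Suc j) = \<nu> (Suc j)"
      using Nbar_fin_nhd[OF \<nu> False] by blast
    have "\<bar>Nbar_point \<nu>' j - Nbar_point \<nu> j\<bar> < e" if "\<nu>' \<in> U" for \<nu>'
    proof -
      have "Nbar_point \<nu>' j = Nbar_point \<nu> j" unfolding Nbar_point_def bspec[OF U(3) that] ..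
      then show ?thesis using e by simp
    qed
    then show ?thesis using U(1,2) by blast
  next
    case True
    have "(\<lambda>n. q ^ n) \<longlonglongrightarrow> 0" using q0 q1 by (intro LIMSEQ_realpow_zero) auto
    then obtain n where n: "q ^ n < e" using order_tendstoD(2)[OF _ e] by (metis eventually_sequentially order_refl)
    obtain U where U: "openin Nbar_topology U" "\<nu> \<in> U" "\<forall>\<nu>'\<in>U. Fin (int n) \<le> \<nu>' (Suc j)"
      using Nbar_ge_nhd[OF \<nu>, of "int n" j] True by auto
    have "\<bar>Nbar_point \<nu>' j - Nbar_point \<nu> j\<bar> < e" if "\<nu>' \<in> U" for \<nu>'
    proof (cases "\<nu>' (Suc j)")
      case (Fin a)
      then have "int n \<le> a" using U(3) that by auto
      then have "q powi (a + int j) \<le> q powi (int n)" by (intro powi_le) simp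
      then show ?thesis using n q0 True Fin by (simp add: Nbar_point_def)
    qed (use e True in \<open>simp add: Nbar_point_def\<close>)
    then show ?thesis using U by blast
  qed
qed

text \<open>On this open part of the boundary all estimates in terms of \<open>l\<close> are
  uniform; as \<open>l\<close> varies these parts cover the boundary.\<close>

definition lower_Nbar :: "int \<Rightarrow> (nat \<Rightarrow> eint) topology" where
  "lower_Nbar l = subtopology Nbar_topology {\<nu>. Fin l \<le> \<nu> 1}"

lemma topspace_lower_Nbar: "\<nu> \<in> topspace (lower_Nbar l) \<longleftrightarrow> \<nu> \<in> Nbar \<and> Fin l \<le> \<nu> 1"
  by (auto simp: lower_Nbar_def topspace_subtopology)

lemma continuous_map_spoly_Nbar_point: "continuous_map (lower_Nbar l) euclideanreal (\<lambda>\<nu>. spoly D M \<kappa> (Nbar_point \<nu>))"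
proof (induction M arbitrary: \<kappa>)
  case (Suc M)
  have "continuous_map (lower_Nbar l) euclideanreal (\<lambda>\<nu>. Nbar_point \<nu> M)"
    unfolding lower_Nbar_def by (rule continuous_map_from_subtopology[OF continuous_map_Nbar_point])
  then have c: "continuous_map (lower_Nbar l) euclideanreal (\<lambda>\<nu>. spoly D M \<eta> (Nbar_point \<nu>) * Nbar_point \<nu> M ^ e)" for \<eta> e
    by (intro continuous_map_real_mult Suc.IH continuous_map_real_pow)
  show ?case
  proof (cases "finite (below \<kappa>)")
    case True
    then show ?thesis unfolding spoly.simps by (intro continuous_map_sum c)
  qed simp
qed simp

text \<open>A uniform limit of polynomials in finitely many of the numbers
  \<open>Nbar_point \<nu> j\<close>, each of which is continuous in \<open>\<nu>\<close>.\<close>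

lemma continuous_map_Ebar_spoly:
  assumes "\<kappa> \<in> parts N"
  shows "continuous_map (lower_Nbar l) euclideanreal
     (\<lambda>\<nu>. measure_pmf.expectation (Ebar \<nu> N) (\<lambda>m. spoly N N \<kappa> (ysq (rk \<nu> N) m)))"
proof (rule continuous_map_real_uniform_approx)
  fix e :: real assume e: "e > 0"
  obtain C where C: "\<And>\<nu> M. \<nu> \<in> Nbar \<Longrightarrow> Fin l \<le> \<nu> 1 \<Longrightarrow> \<bar>lim (\<lambda>M. spoly N M \<kappa> (Nbar_point \<nu>)) - spoly N M \<kappa> (Nbar_point \<nu>)\<bar> \<le> C * q ^ M"
    using spoly_Nbar_point_limit[OF assms, of l] by blast
  have "(\<lambda>M. eigen_const N \<kappa> * (C * q ^ M)) \<longlonglongrightarrow> eigen_const N \<kappa> * (C * 0)"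
    by (intro tendsto_intros LIMSEQ_realpow_zero) (use q0 q1 in auto)
  then have "\<forall>\<^sub>F M in sequentially. eigen_const N \<kappa> * (C * q ^ M) < e" by (rule order_tendstoD) (use e in simp)
  then obtain M where M: "eigen_const N \<kappa> * (C * q ^ M) < e" by (auto simp: eventually_sequentially)
  show "\<exists>g. continuous_map (lower_Nbar l) euclideanreal g \<and>
     (\<forall>\<nu>\<in>topspace (lower_Nbar l). \<bar>measure_pmf.expectation (Ebar \<nu> N) (\<lambda>m. spoly N N \<kappa> (ysq (rk \<nu> N) m)) - g \<nu>\<bar> < e)"
  proof (intro exI[of _ "\<lambda>\<nu>. eigen_const N \<kappa> * spoly N M \<kappa> (Nbar_point \<nu>)"] conjI ballI)
    show "continuous_map (lower_Nbar l) euclideanreal (\<lambda>\<nu>. eigen_const N \<kappa> * spoly N M \<kappa> (Nbar_point \<nu>))"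
      by (intro continuous_map_real_mult continuous_map_spoly_Nbar_point) simp
    fix \<nu> assume "\<nu> \<in> topspace (lower_Nbar l)"
    then have \<nu>: "\<nu> \<in> Nbar" "Fin l \<le> \<nu> 1" by (auto simp: topspace_lower_Nbar)
    have "\<bar>measure_pmf.expectation (Ebar \<nu> N) (\<lambda>m. spoly N N \<kappa> (ysq (rk \<nu> N) m)) - eigen_const N \<kappa> * spoly N M \<kappa> (Nbar_point \<nu>)\<bar> =
        eigen_const N \<kappa> * \<bar>lim (\<lambda>M. spoly N M \<kappa> (Nbar_point \<nu>)) - spoly N M \<kappa> (Nbar_point \<nu>)\<bar>"
      unfolding Ebar_spoly[OF \<nu>(1) order_refl assms] using eigen_const_pos[of N \<kappa>]
      by (simp add: abs_mult flip: right_diff_distrib)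
    also have "\<dots> \<le> eigen_const N \<kappa> * (C * q ^ M)"
      by (intro mult_left_mono C \<nu>) (use eigen_const_pos[of N \<kappa>] in simp)
    also note M
    finally show "\<bar>measure_pmf.expectation (Ebar \<nu> N) (\<lambda>m. spoly N N \<kappa> (ysq (rk \<nu> N) m)) - eigen_const N \<kappa> * spoly N M \<kappa> (Nbar_point \<nu>)\<bar> < e" .
  qed
qed

theorem continuous_map_Ebar:
  fixes f :: "(nat \<Rightarrow> real) \<Rightarrow> real"
  assumes f: "continuous_on (configs N l) f"
  shows "continuous_map (lower_Nbar l) euclideanreal (\<lambda>\<nu>. measure_pmf.expectation (Ebar \<nu> N) (\<lambda>m. f (ysq (rk \<nu> N) m)))"
proof -
  have y: "ysq (rk \<nu> N) m \<in> configs N l" if "\<nu> \<in> topspace (lower_Nbar l)" "m \<in> set_pmf (Ebar \<nu> N)" for \<nu> m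
    using set_Ebar_lb[of \<nu> l N] rk_set(2)[of \<nu> N] that by (intro ysq_configs) (auto simp: topspace_lower_Nbar)
  have int: "integrable (measure_pmf (Ebar \<nu> N)) (\<lambda>m. f (ysq (rk \<nu> N) m))"
    if "continuous_on (configs N l) f" "\<nu> \<in> topspace (lower_Nbar l)" for f :: "(nat \<Rightarrow> real) \<Rightarrow> real" and \<nu>
  proof -
    have "\<exists>B. \<forall>y\<in>configs N l. \<bar>f y\<bar> \<le> B" by (rule continuous_configs_bounded[OF that(1)])
    then obtain B where "\<forall>y\<in>configs N l. \<bar>f y\<bar> \<le> B" by auto
    then show ?thesis by (intro abs_expectation_le(1)[of _ _ B]) (use y that(2) in auto)
  qed
  have span: "continuous_map (lower_Nbar l) euclideanreal (\<lambda>\<nu>. measure_pmf.expectation (Ebar \<nu> N) (\<lambda>m. g (ysq (rk \<nu> N) m)))"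
    if "g \<in> schur_span N l" for g
    using that
  proof (induction rule: schur_span.induct)
    case (base \<kappa>)
    then show ?case by (rule continuous_map_Ebar_spoly)
  next
    case (add f g)
    have "measure_pmf.expectation (Ebar \<nu> N) (\<lambda>m. f (ysq (rk \<nu> N) m) + g (ysq (rk \<nu> N) m)) =
       measure_pmf.expectation (Ebar \<nu> N) (\<lambda>m. f (ysq (rk \<nu> N) m)) + measure_pmf.expectation (Ebar \<nu> N) (\<lambda>m. g (ysq (rk \<nu> N) m))"
      if "\<nu> \<in> topspace (lower_Nbar l)" for \<nu>
      by (rule Bochner_Integration.integral_add) (intro int continuous_on_schur_span add.hyps that)+
    then show ?case
      using continuous_map_eq[OF continuous_map_add[OF add.IH]] by (simp add: fun_eq_iff)
  next
    case (scale f c)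
    then show ?case using continuous_map_real_mult[OF _ scale.IH, of "\<lambda>_. c"] by simp
  next
    case (agree f g)
    have "measure_pmf.expectation (Ebar \<nu> N) (\<lambda>m. f (ysq (rk \<nu> N) m)) = measure_pmf.expectation (Ebar \<nu> N) (\<lambda>m. g (ysq (rk \<nu> N) m))"
      if "\<nu> \<in> topspace (lower_Nbar l)" for \<nu>
      by (rule integral_cong_AE) (use agree.hyps y[OF that] in \<open>auto intro!: AE_pmfI\<close>)
    then show ?case using continuous_map_eq[OF agree.IH] by simp
  qed
  show ?thesis
  proof (rule continuous_map_real_uniform_approx)
    fix e :: real assume e: "e > 0"
    obtain g where g: "g \<in> schur_span N l" "\<forall>y\<in>configs N l. \<bar>f y - g y\<bar> < e / 2"
      using schur_span_dense[OF f, of "e / 2"] e by auto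
    have "\<bar>measure_pmf.expectation (Ebar \<nu> N) (\<lambda>m. f (ysq (rk \<nu> N) m)) - measure_pmf.expectation (Ebar \<nu> N) (\<lambda>m. g (ysq (rk \<nu> N) m))\<bar> < e"
      if \<nu>: "\<nu> \<in> topspace (lower_Nbar l)" for \<nu>
    proof -
      have "measure_pmf.expectation (Ebar \<nu> N) (\<lambda>m. f (ysq (rk \<nu> N) m)) - measure_pmf.expectation (Ebar \<nu> N) (\<lambda>m. g (ysq (rk \<nu> N) m)) =
         measure_pmf.expectation (Ebar \<nu> N) (\<lambda>m. f (ysq (rk \<nu> N) m) - g (ysq (rk \<nu> N) m))"
        using int[OF f \<nu>] int[OF continuous_on_schur_span[OF g(1)] \<nu>] by simp
      also have "\<bar>\<dots>\<bar> \<le> e / 2"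
        by (rule abs_expectation_le(2)) (use g(2) y[OF \<nu>] in \<open>auto intro: less_imp_le\<close>)
      finally show ?thesis using e by simp
    qed
    then show "\<exists>g. continuous_map (lower_Nbar l) euclideanreal g \<and>
       (\<forall>\<nu>\<in>topspace (lower_Nbar l). \<bar>measure_pmf.expectation (Ebar \<nu> N) (\<lambda>m. f (ysq (rk \<nu> N) m)) - g \<nu>\<bar> < e)"
      using span[OF g(1)] by blast
  qed
qed

end

section \<open>Generating functions\<close>

lemma complex_expectation_bounded:
  fixes f :: "'a \<Rightarrow> complex"
  assumes "\<And>x. x \<in> set_pmf Q \<Longrightarrow> norm (f x) \<le> B"
  shows "integrable (measure_pmf Q) f"
  by (rule measure_pmf.integrable_const_bound[where B = B]) (use assms in \<open>auto intro!: AE_pmfI\<close>)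

lemma expectation_bind_pmf_complex:
  fixes f :: "'a \<Rightarrow> complex"
  assumes B: "\<And>x y. x \<in> set_pmf M \<Longrightarrow> y \<in> set_pmf (K x) \<Longrightarrow> norm (f y) \<le> B"
  shows "measure_pmf.expectation (bind_pmf M K) f = measure_pmf.expectation M (\<lambda>x. measure_pmf.expectation (K x) f)"
proof -
  have i1: "integrable (measure_pmf (bind_pmf M K)) f"
    by (rule complex_expectation_bounded[of _ _ B]) (use B in auto)
  have i2: "integrable (measure_pmf (K x)) f" if "x \<in> set_pmf M" for x
    by (rule complex_expectation_bounded[of _ _ B]) (use B that in auto)
  have i3: "integrable (measure_pmf M) (\<lambda>x. measure_pmf.expectation (K x) f)"
  proof (rule complex_expectation_bounded[of _ _ B])
    fix x assume x: "x \<in> set_pmf M"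
    have "norm (measure_pmf.expectation (K x) f) \<le> measure_pmf.expectation (K x) (\<lambda>y. norm (f y))"
      by (rule integral_norm_bound)
    also have "\<dots> \<le> B"
      using abs_expectation_le(2)[of "K x" "\<lambda>y. norm (f y)" B] B[OF x] by (simp add: abs_le_iff)
    finally show "norm (measure_pmf.expectation (K x) f) \<le> B" .
  qed
  have part: "measure_pmf.expectation (bind_pmf M K) (\<lambda>y. g (f y)) = measure_pmf.expectation M (\<lambda>x. measure_pmf.expectation (K x) (\<lambda>y. g (f y)))"
    if "\<And>z. \<bar>g z\<bar> \<le> norm z" for g :: "complex \<Rightarrow> real"
    by (rule expectation_bind_pmf[of _ _ _ B]) (use B that order_trans in blast)
  have Re: "measure_pmf.expectation (K x) (\<lambda>y. Re (f y)) = Re (measure_pmf.expectation (K x) f)"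
    and Im: "measure_pmf.expectation (K x) (\<lambda>y. Im (f y)) = Im (measure_pmf.expectation (K x) f)" if "x \<in> set_pmf M" for x
    using i2[OF that] by simp_all
  show ?thesis
  proof (rule complex_eqI)
    have "Re (measure_pmf.expectation (bind_pmf M K) f) = measure_pmf.expectation (bind_pmf M K) (\<lambda>y. Re (f y))"
      using i1 by simp
    also have "\<dots> = measure_pmf.expectation M (\<lambda>x. measure_pmf.expectation (K x) (\<lambda>y. Re (f y)))"
      by (rule part) (rule abs_Re_le_cmod)
    also have "\<dots> = measure_pmf.expectation M (\<lambda>x. Re (measure_pmf.expectation (K x) f))"
      by (rule integral_cong_AE) (use Re in \<open>auto intro!: AE_pmfI\<close>)
    also have "\<dots> = Re (measure_pmf.expectation M (\<lambda>x. measure_pmf.expectation (K x) f))"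
      using i3 by simp
    finally show "Re (measure_pmf.expectation (bind_pmf M K) f) = Re (measure_pmf.expectation M (\<lambda>x. measure_pmf.expectation (K x) f))" .
    have "Im (measure_pmf.expectation (bind_pmf M K) f) = measure_pmf.expectation (bind_pmf M K) (\<lambda>y. Im (f y))"
      using i1 by simp
    also have "\<dots> = measure_pmf.expectation M (\<lambda>x. measure_pmf.expectation (K x) (\<lambda>y. Im (f y)))"
      by (rule part) (rule abs_Im_le_cmod)
    also have "\<dots> = measure_pmf.expectation M (\<lambda>x. Im (measure_pmf.expectation (K x) f))"
      by (rule integral_cong_AE) (use Im in \<open>auto intro!: AE_pmfI\<close>)
    also have "\<dots> = Im (measure_pmf.expectation M (\<lambda>x. measure_pmf.expectation (K x) f))"
      using i3 by simp
    finally show "Im (measure_pmf.expectation (bind_pmf M K) f) = Im (measure_pmf.expectation M (\<lambda>x. measure_pmf.expectation (K x) f))" .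
  qed
qed

lemma Scheffe_expectation_complex:
  fixes f :: "'a \<Rightarrow> complex"
  assumes lim: "\<And>x. (\<lambda>n. pmf (Qs n) x) \<longlonglongrightarrow> pmf Q x" and B: "\<And>x. x \<in> S \<Longrightarrow> norm (f x) \<le> B"
    and S: "\<And>n. set_pmf (Qs n) \<subseteq> S" "set_pmf Q \<subseteq> S"
  shows "(\<lambda>n. measure_pmf.expectation (Qs n) f) \<longlonglongrightarrow> measure_pmf.expectation Q f"
proof (subst tendsto_complex_iff, intro conjI)
  have int: "integrable (measure_pmf R) f" if "set_pmf R \<subseteq> S" for R
    by (rule complex_expectation_bounded[of _ _ B]) (use B that in auto)
  have "(\<lambda>n. measure_pmf.expectation (Qs n) (\<lambda>x. Re (f x))) \<longlonglongrightarrow> measure_pmf.expectation Q (\<lambda>x. Re (f x))"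
    by (rule Scheffe_expectation_on[OF lim _ S]) (use B abs_Re_le_cmod order_trans in blast)
  then show "(\<lambda>n. Re (measure_pmf.expectation (Qs n) f)) \<longlonglongrightarrow> Re (measure_pmf.expectation Q f)"
    using int S by simp
  have "(\<lambda>n. measure_pmf.expectation (Qs n) (\<lambda>x. Im (f x))) \<longlonglongrightarrow> measure_pmf.expectation Q (\<lambda>x. Im (f x))"
    by (rule Scheffe_expectation_on[OF lim _ S]) (use B abs_Im_le_cmod order_trans in blast)
  then show "(\<lambda>n. Im (measure_pmf.expectation (Qs n) f)) \<longlonglongrightarrow> Im (measure_pmf.expectation Q f)"
    using int S by simp
qed

lemma vdm_Suc: "vdm (Suc n) x = vdm n x * (\<Prod>i<n. x n - x i)"
  by (simp add: vdm_def)

lemma sum_cis_roots: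
  fixes n :: int
  assumes "\<bar>n\<bar> < int R" "R > 0"
  shows "(\<Sum>a<R. cis (2 * pi * real a / real R) powi n) = (if n = 0 then of_nat R else 0)"
proof (cases "n = 0")
  case False
  define w where "w = cis (2 * pi * of_int n / real R)"
  have "cis (2 * pi * real a / real R) powi n = w ^ a" for a
  proof -
    have "cis (2 * pi * real a / real R) powi n = cis (of_int n * (2 * pi * real a / real R))"
      by (simp add: cis_power_int)
    also have "\<dots> = cis (real a * (2 * pi * of_int n / real R))" by (simp add: mult_ac)
    also have "\<dots> = w ^ a" by (simp only: w_def Complex.DeMoivre)
    finally show ?thesis .
  qed
  then have "(\<Sum>a<R. cis (2 * pi * real a / real R) powi n) = (\<Sum>a<R. w ^ a)" by simp
  also have "\<dots> = 0"
  proof -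
    have "w ^ R = cis (real R * (2 * pi * of_int n / real R))" by (simp only: w_def Complex.DeMoivre)
    also have "\<dots> = cis (2 * pi * of_int n)" using assms(2) by simp
    finally have "w ^ R = cis (2 * pi * of_int n)" .
    then have "w ^ R = 1" by (simp add: cis_multiple_2pi)
    moreover have "w \<noteq> 1"
    proof
      assume "w = 1"
      then have "cos (2 * pi * of_int n / real R) = 1" by (simp add: w_def complex_eq_iff)
      then obtain z :: int where z: "2 * pi * of_int n / real R = of_int z * 2 * pi"
        using cos_one_2pi_int by auto
      then have "of_int n = of_int z * real R" using assms(2) by (simp add: field_simps)
      then have "n = z * int R" by (metis of_int_eq_iff of_int_mult of_int_of_nat_eq)
      then show False using assms(1) False by (auto simp: abs_mult)
    qed
    ultimately show ?thesis by (simp add: sum_gp_strict)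
  qed
  finally show ?thesis using False by simp
qed simp

text \<open>A permutation matching two increasing sequences is increasing, hence the identity. So
  the monomial with exponents l occurs in only one alternant, and there in only one Leibniz
  term.\<close>

lemma strict_seqs_perm_id:
  assumes m: "m \<in> strict_seqs k" and l: "l \<in> strict_seqs k" and p: "p permutes {0..<k}"
    and eq: "\<And>i. i < k \<Longrightarrow> m (p i) = l i"
  shows "p = id \<and> m = l"
proof -
  have pk: "p i < k" if "i < k" for i using permutes_in_image[OF p, of i] that by simp
  have mono: "p i < p j" if "i < j" "j < k" for i j
  proof (rule ccontr)
    assume "\<not> p i < p j"
    then have "p j < p i \<or> p j = p i" by auto
    then have "m (p j) \<le> m (p i)" using strict_seqs_less[OF m, of "p j" "p i"] pk[of i] that by auto
    then show False using eq[of i] eq[of j] strict_seqs_less[OF l that] that by auto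
  qed
  have ge: "i \<le> p i" if "i < k" for i
    using that
  proof (induction i)
    case (Suc i)
    then show ?case using mono[of i "Suc i"] by auto
  qed simp
  have le: "p i + (k - Suc i) \<le> k - 1" if "i < k" for i
    using that
  proof (induction "k - Suc i" arbitrary: i)
    case 0
    then show ?case using pk[of i] by simp
  next
    case (Suc d)
    then have "p (Suc i) + (k - Suc (Suc i)) \<le> k - 1" by (intro Suc.hyps(1)) auto
    moreover have "p i < p (Suc i)" by (rule mono) (use Suc.hyps(2) in auto)
    moreover have "k - Suc i = Suc (k - Suc (Suc i))" using Suc.hyps(2) by simp
    ultimately show ?case by linarith
  qed
  have "p i = i" for i
  proof (cases "i < k")
    case True
    then show ?thesis using ge[OF True] le[OF True] by simp
  next
    case False
    then show ?thesis using p by (simp add: permutes_def)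
  qed
  then have "p = id" by auto
  moreover have "m = l"
    by (rule extensionalityI[of _ "{..<k}"]) (use m l eq \<open>p = id\<close> in \<open>auto simp: strict_seqs_def\<close>)
  ultimately show ?thesis by simp
qed

context qpar begin

section \<open>Normalized alternants on a torus\<close>

definition torus :: "nat \<Rightarrow> (nat \<Rightarrow> complex) set" where
  "torus k = {x. \<forall>i<k. norm (x i) = pr i}"

lemma pr_less: "i < j \<Longrightarrow> pr i < pr j"
  unfolding pr_def by (rule powi_less) simp

lemma vdm_pr_pos: "vdm k pr > 0"
  unfolding vdm_def by (intro prod_pos) (simp add: pr_less)

text \<open>Divided by the Vandermonde product, an alternant is a Laurent polynomial with
  nonnegative coefficients, so on the torus its modulus is at most its value at the point
  \<open>pr\<close> of moduli. The induction reads this off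
  \<open>alternant_recursion\<close>.\<close>

lemma norm_alternant_le:
  assumes "x \<in> torus k" "m \<in> strict_seqs k"
  shows "norm (alternant k x m) \<le> norm (vdm k x) / vdm k pr * alternant k pr m"
  using assms
proof (induction k arbitrary: m)
  case 0
  then show ?case by (simp add: alternant_def detf_rows vdm_def)
next
  case (Suc n)
  have nx: "norm (x i) = pr i" if "i \<le> n" for i using Suc.prems(1) that by (simp add: torus_def)
  have xt: "x \<in> torus n" using Suc.prems(1) by (simp add: torus_def)
  have injx: "inj_on x {..n}" and injp: "inj_on pr {..n}"
  proof -
    show "inj_on pr {..n}" using pr_less by (intro linorder_inj_onI) (auto simp: less_imp_neq)
    then show "inj_on x {..n}" using nx by (auto simp: inj_on_def) (metis atMost_iff)
  qed
  let ?e = "\<lambda>m'. (\<Sum>j<Suc n. m j) - (\<Sum>j<n. m' j) - int n"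
  have x0: "x i \<noteq> 0" if "i \<le> n" for i
  proof
    assume "x i = 0"
    then show False using nx[OF that] pr_pos(2)[of i] by simp
  qed
  have "norm (alternant (Suc n) x m) = (\<Prod>i<n. norm (x n - x i)) *
     norm (\<Sum>m'\<in>box n (Suc n) m. x n powi ?e m' * alternant n x m')"
  proof -
    have "alternant (Suc n) x m = (\<Prod>i<n. x n - x i) * (\<Sum>m'\<in>box n (Suc n) m. x n powi ?e m' * alternant n x m')"
      by (rule alternant_recursion[OF Suc.prems(2) injx]) (rule x0)
    then show ?thesis by (simp only: norm_mult prod_norm)
  qed
  also have "\<dots> \<le> (\<Prod>i<n. norm (x n - x i)) *
     (\<Sum>m'\<in>box n (Suc n) m. pr n powi ?e m' * (norm (vdm n x) / vdm n pr * alternant n pr m'))"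
  proof (intro mult_left_mono order_trans[OF norm_sum] sum_mono prod_nonneg)
    fix m' assume "m' \<in> box n (Suc n) m"
    then have "m' \<in> strict_seqs n" by (rule box_subset[rotated]) simp
    then show "norm (x n powi ?e m' * alternant n x m') \<le> pr n powi ?e m' * (norm (vdm n x) / vdm n pr * alternant n pr m')"
      unfolding norm_mult norm_power_int nx[OF order_refl] using Suc.IH[OF xt]
      by (intro mult_left_mono) (simp_all add: less_imp_le)
  qed auto
  also have "\<dots> = (\<Prod>i<n. norm (x n - x i)) * (norm (vdm n x) / vdm n pr) *
     (\<Sum>m'\<in>box n (Suc n) m. pr n powi ?e m' * alternant n pr m')"
    unfolding sum_distrib_left by (intro sum.cong refl) (simp only: mult_ac)
  also have "(\<Sum>m'\<in>box n (Suc n) m. pr n powi ?e m' * alternant n pr m') = alternant (Suc n) pr m / (\<Prod>i<n. pr n - pr i)"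
  proof -
    have "(\<Prod>i<n. pr n - pr i) > 0" by (intro prod_pos) (simp add: pr_less)
    then have ne: "(\<Prod>i<n. pr n - pr i) \<noteq> 0" by linarith
    have eq: "alternant (Suc n) pr m = (\<Prod>i<n. pr n - pr i) * (\<Sum>m'\<in>box n (Suc n) m. pr n powi ?e m' * alternant n pr m')"
      by (rule alternant_recursion[OF Suc.prems(2) injp]) (rule pr_pos(2))
    show ?thesis unfolding eq nonzero_mult_div_cancel_left[OF ne] ..
  qed
  finally show ?case by (simp add: vdm_Suc norm_mult prod_norm mult_ac)
qed

text \<open>Comes from |x_j - x_i| <= |x_j| + |x_i| in each factor of the Vandermonde
  product.\<close>

definition torus_bound :: "nat \<Rightarrow> real" where
  "torus_bound k = (\<Prod>j<k. \<Prod>i<j. pr j + pr i) / vdm k pr"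

lemma norm_alternant_ratio_le:
  assumes "x \<in> torus k" "m \<in> strict_seqs k"
  shows "norm (alternant k x m / of_real (alternant k pr m)) \<le> torus_bound k"
proof -
  have "norm (vdm k x) \<le> (\<Prod>j<k. \<Prod>i<j. pr j + pr i)"
    unfolding vdm_def prod_norm[symmetric]
  proof (intro prod_mono conjI)
    fix j i assume "j \<in> {..<k}" "i \<in> {..<j}"
    then have "norm (x j) = pr j" "norm (x i) = pr i" using assms(1) by (auto simp: torus_def)
    then show "norm (x j - x i) \<le> pr j + pr i" using norm_triangle_ineq4[of "x j" "x i"] by simp
  qed (auto intro: prod_nonneg)
  then have "norm (vdm k x) / vdm k pr \<le> torus_bound k"
    unfolding torus_bound_def using vdm_pr_pos[of k] by (intro divide_right_mono) auto
  then have "norm (alternant k x m) \<le> torus_bound k * alternant k pr m"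
    using norm_alternant_le[OF assms] alternant_pr_pos[OF assms(2)] by (meson mult_right_mono less_imp_le order_trans)
  then show ?thesis using alternant_pr_pos[OF assms(2)] by (simp add: norm_divide divide_le_eq)
qed

definition gen_factor :: "nat \<Rightarrow> nat \<Rightarrow> (nat \<Rightarrow> complex) \<Rightarrow> complex" where
  "gen_factor k N x = (\<Prod>i<k. of_real (1 - q ^ (N - i)) / (1 - of_real (q ^ N) * x i))"

text \<open>With k <= N no coordinate is lost and no variable is appended, so for fixed x the
  normalized alternant is an eigenfunction of the kernel.\<close>

lemma step_gen:
  assumes L: "L \<in> strict_seqs k" and kN: "k \<le> N" and x: "x \<in> torus k"
  shows "measure_pmf.expectation (step_pmf N k L) (\<lambda>m. alternant k x m / of_real (alternant k pr m)) =
     gen_factor k N x * (alternant k x L / of_real (alternant k pr L))"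
proof -
  have k: "k = min k N" using kN by simp
  have u: "k \<le> Suc N" using kN by simp
  have S: "set_pmf (step_pmf N k L) \<subseteq> strict_seqs k" using set_pmf_step(2)[OF L u] kN by (simp add: min_absorb1)
  have int: "integrable (measure_pmf (step_pmf N k L)) (\<lambda>m. alternant k x m / of_real (alternant k pr m))"
    by (rule complex_expectation_bounded[of _ _ "torus_bound k"]) (use norm_alternant_ratio_le[OF x] S in auto)
  have "((\<lambda>m. of_real (pmf (step_pmf N k L) m) * (alternant k x m / of_real (alternant k pr m))) has_sum
     ((\<Prod>i<k. of_real (1 - q ^ (N - i)) / (1 - of_real (q ^ N) * x i)) *
       (alternant k (x(k := of_real (1 / q ^ N))) L / of_real (alternant k pr L)))) (strict_seqs k)"
  proof (rule has_sum_step[OF L u k])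
    fix i assume i: "i < k"
    have n: "norm (x i) = pr i" using x i by (simp add: torus_def)
    then show "x i \<noteq> 0" using pr_pos(2)[of i] by auto
    have "norm (of_real (q ^ N) * x i) = \<bar>q ^ N * pr i\<bar>"
      using q0 pr_pos(1)[of i] by (simp add: norm_mult n norm_power abs_mult abs_of_pos)
    then show "norm (of_real (q ^ N) * x i) < 1" using q_pr_bounds(3)[of i N] i kN by simp
    then show "of_real (q ^ N) * x i \<noteq> 1" by auto
  qed
  moreover have "alternant k (x(k := of_real (1 / q ^ N))) L = alternant k x L"
    by (rule alternant_cong) auto
  ultimately have "((\<lambda>m. pmf (step_pmf N k L) m *\<^sub>R (alternant k x m / of_real (alternant k pr m))) has_sum
     (gen_factor k N x * (alternant k x L / of_real (alternant k pr L)))) (strict_seqs k)"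
    by (simp add: scaleR_conv_of_real gen_factor_def)
  then show ?thesis using has_sum_pmf_integral[OF int S] has_sum_unique by blast
qed

lemma chain_gen:
  assumes "L \<in> strict_seqs k" "k \<le> N" "x \<in> torus k"
  shows "measure_pmf.expectation (chain_pmf N d k L) (\<lambda>m. alternant k x m / of_real (alternant k pr m)) =
     (\<Prod>r<d. gen_factor k (N + r) x) * (alternant k x L / of_real (alternant k pr L))"
  using assms(1)
proof (induction d arbitrary: L)
  case (Suc d)
  let ?H = "\<lambda>m. alternant k x m / of_real (alternant k pr m)"
  have kN: "k \<le> N + d" "min k (N + d) = k" "min k N = k" using assms(2) by auto
  have S: "set_pmf (step_pmf (N + d) k L) \<subseteq> strict_seqs k"
    using set_pmf_step(2)[OF Suc.prems, of "N + d"] kN by simp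
  have "measure_pmf.expectation (chain_pmf N (Suc d) k L) ?H =
     measure_pmf.expectation (step_pmf (N + d) k L) (\<lambda>m. measure_pmf.expectation (chain_pmf N d k m) ?H)"
    unfolding chain_pmf.simps kN(2)
  proof (rule expectation_bind_pmf_complex[of _ _ _ "torus_bound k"])
    fix m m' assume "m \<in> set_pmf (step_pmf (N + d) k L)" "m' \<in> set_pmf (chain_pmf N d k m)"
    then have "m' \<in> strict_seqs k" using set_pmf_chain[of m k N d] S kN by auto
    then show "norm (?H m') \<le> torus_bound k" by (rule norm_alternant_ratio_le[OF assms(3)])
  qed
  also have "\<dots> = measure_pmf.expectation (step_pmf (N + d) k L) (\<lambda>m. (\<Prod>r<d. gen_factor k (N + r) x) * ?H m)"
    by (rule integral_cong_AE) (use S Suc.IH in \<open>auto intro!: AE_pmfI\<close>)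
  also have "\<dots> = (\<Prod>r<d. gen_factor k (N + r) x) * measure_pmf.expectation (step_pmf (N + d) k L) ?H"
    by (rule integral_mult_right_zero)
  also have "\<dots> = (\<Prod>r<Suc d. gen_factor k (N + r) x) * ?H L"
    unfolding step_gen[OF Suc.prems kN(1) assms(3)] by simp
  finally show ?case .
qed simp

text \<open>On the torus |q^(N+r) x_i| = q^(N+r-i) with i < k <= N, so every factor is 1 +
  O(q^r).\<close>

lemma gen_factor_convergent:
  assumes "x \<in> torus k" "k \<le> N"
  shows "convergent_prod (\<lambda>r. gen_factor k (N + r) x)"
proof -
  let ?f = "\<lambda>i r. of_real (1 - q ^ (N + r - i)) / (1 - of_real (q ^ (N + r)) * x i)"
  have nz: "?f i r \<noteq> 0" if i: "i < k" for i r
  proof -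
    have "norm (of_real (q ^ (N + r)) * x i) = q ^ (N + r) * pr i"
      using assms(1) i q0 by (simp add: norm_mult torus_def norm_power)
    also have "\<dots> < 1" using q_pr_bounds(1)[of i "N + r"] i assms(2) by simp
    finally have "1 - of_real (q ^ (N + r)) * x i \<noteq> 0" by auto
    moreover have "of_real (1 - q ^ (N + r - i)) \<noteq> (0::complex)"
      unfolding of_real_eq_0_iff using qpow_less[of "N + r - i"] i assms(2) by simp
    ultimately show ?thesis unfolding divide_eq_0_iff by blast
  qed
  have conv: "convergent_prod (?f i)" if i: "i < k" for i
  proof (intro abs_convergent_prod_imp_convergent_prod summable_imp_abs_convergent_prod)
    have le: "norm (of_real (1 - q ^ (N + r - i)) / (1 - of_real (q ^ (N + r)) * x i) - 1) \<le> 2 / (1 - q) * q ^ r" for r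
    proof -
      define a where "a = q ^ (N + r - i)"
      define b where "b = of_real (q ^ (N + r)) * x i"
      have nb: "norm b = a"
      proof -
        have "norm b = q ^ (N + r) * pr i" using assms(1) i q0 by (simp add: b_def norm_mult torus_def norm_power)
        then show ?thesis using q_pr[of i "N + r"] i assms(2) by (simp add: a_def)
      qed
      have a0: "a \<ge> 0" using q0 by (simp add: a_def)
      have aq: "a \<le> q ^ Suc r" unfolding a_def by (rule power_decreasing) (use i assms(2) q0 q1 in auto)
      have "q ^ Suc r \<le> q" using power_decreasing[of 1 "Suc r" q] q0 q1 by simp
      then have a1: "a \<le> q" using aq by simp
      have nz: "norm (1 - b) \<ge> 1 - q" using norm_triangle_ineq2[of 1 b] nb a1 by simp
      then have "1 - b \<noteq> 0" using q1 by auto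
      then have "of_real (1 - a) / (1 - b) - 1 = (b - of_real a) / (1 - b)" by (simp add: field_simps)
      then have "norm (of_real (1 - a) / (1 - b) - 1) = norm (b - of_real a) / norm (1 - b)" by (simp add: norm_divide)
      also have "\<dots> \<le> (2 * a) / (1 - q)"
      proof (rule frac_le)
        show "norm (b - of_real a) \<le> 2 * a" using norm_triangle_ineq4[of b "of_real a"] nb a0 by simp
      qed (use nz q1 a0 in auto)
      also have "\<dots> \<le> 2 / (1 - q) * q ^ r"
      proof -
        have "q ^ Suc r \<le> q ^ r" using q0 q1 by (simp add: mult_left_le_one_le)
        then have "a \<le> q ^ r" using aq by simp
        then have "2 / (1 - q) * a \<le> 2 / (1 - q) * q ^ r" using q1 by (intro mult_left_mono) auto
        then show ?thesis by simp
      qed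
      finally show ?thesis by (simp add: a_def b_def)
    qed
    have "summable (\<lambda>r. 2 / (1 - q) * q ^ r)" using q0 q1 by (intro summable_mult summable_geometric) auto
    then show "summable (\<lambda>r. norm (of_real (1 - q ^ (N + r - i)) / (1 - of_real (q ^ (N + r)) * x i) - 1))"
      by (rule summable_comparison_test'[where N = 0]) (use le in simp)
  qed
  have "convergent_prod (\<lambda>r. \<Prod>i<n. ?f i r) \<and> (\<forall>r. (\<Prod>i<n. ?f i r) \<noteq> 0)" if "n \<le> k" for n
    using that
  proof (induction n)
    case (Suc n)
    then have IH: "convergent_prod (\<lambda>r. \<Prod>i<n. ?f i r)" "\<forall>r. (\<Prod>i<n. ?f i r) \<noteq> 0" and n: "n < k" by auto
    have "(\<lambda>r. (\<Prod>i<n. ?f i r) * ?f n r) has_prod (prodinf (\<lambda>r. \<Prod>i<n. ?f i r) * prodinf (?f n))"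
      by (intro has_prod_mult_nz convergent_prod_has_prod IH(1) conv n prodinf_nonzero)
         (use IH(2) nz[OF n] in auto)
    then have "convergent_prod (\<lambda>r. (\<Prod>i<n. ?f i r) * ?f n r)" by (simp add: has_prod_iff)
    then show ?case using IH(2) nz[OF n] by simp
  qed simp
  then show ?thesis unfolding gen_factor_def by simp
qed

text \<open>All k finite coordinates are present from level N on, so the starting configuration is
  the same for all d and only the scalar factors accumulate.\<close>

theorem Ebar_gen:
  assumes \<nu>: "\<nu> \<in> Nbar" and rk: "\<And>M. M \<ge> N \<Longrightarrow> rk \<nu> M = k" and x: "x \<in> torus k"
  shows "measure_pmf.expectation (Ebar \<nu> N) (\<lambda>m. alternant k x m / of_real (alternant k pr m)) =
     alternant k x (Nbar_coords \<nu> N) / of_real (alternant k pr (Nbar_coords \<nu> N)) * (\<Prod>r. gen_factor k (N + r) x)"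
proof -
  have kN: "k \<le> N" using rk_set(2)[OF \<nu>, of N] rk[of N] by simp
  let ?H = "\<lambda>m. alternant k x m / of_real (alternant k pr m)"
  have S: "set_pmf (pre_E \<nu> N d) \<subseteq> strict_seqs k" "set_pmf (Ebar \<nu> N) \<subseteq> strict_seqs k" for d
    using set_pre_E[OF \<nu>, of N d] set_Ebar[OF \<nu>, of N] rk[of N] by auto
  have lim: "(\<lambda>d. measure_pmf.expectation (pre_E \<nu> N d) ?H) \<longlonglongrightarrow> measure_pmf.expectation (Ebar \<nu> N) ?H"
    by (rule Scheffe_expectation_complex[OF Ebar_tendsto[OF \<nu>] norm_alternant_ratio_le[OF x] S])
  have LLs: "Nbar_coords \<nu> (N + d) = Nbar_coords \<nu> N" for d unfolding Nbar_coords_def using rk[of N] rk[of "N + d"] by simp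
  have Nbar_coords: "Nbar_coords \<nu> N \<in> strict_seqs k" using Nbar_coords_strict[OF \<nu>, of N] rk[of N] by simp
  have "measure_pmf.expectation (pre_E \<nu> N d) ?H = (\<Prod>r<d. gen_factor k (N + r) x) * ?H (Nbar_coords \<nu> N)" for d
    unfolding pre_E_def LLs using chain_gen[OF Nbar_coords kN x, of d] rk[of "N + d"] by simp
  moreover have "(\<lambda>d. \<Prod>r<d. gen_factor k (N + r) x) \<longlonglongrightarrow> (\<Prod>r. gen_factor k (N + r) x)"
  proof -
    have "(\<lambda>n. \<Prod>r\<le>n. gen_factor k (N + r) x) \<longlonglongrightarrow> (\<Prod>r. gen_factor k (N + r) x)"
      by (rule convergent_prod_LIMSEQ[OF gen_factor_convergent[OF x kN]])
    then show ?thesis by (intro LIMSEQ_imp_Suc[of "\<lambda>d. \<Prod>r<d. gen_factor k (N + r) x"]) (simp add: lessThan_Suc_atMost)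
  qed
  then have "(\<lambda>d. (\<Prod>r<d. gen_factor k (N + r) x) * ?H (Nbar_coords \<nu> N)) \<longlonglongrightarrow> (\<Prod>r. gen_factor k (N + r) x) * ?H (Nbar_coords \<nu> N)"
    by (rule tendsto_mult[OF _ tendsto_const])
  ultimately have "(\<lambda>d. measure_pmf.expectation (pre_E \<nu> N d) ?H) \<longlonglongrightarrow> (\<Prod>r. gen_factor k (N + r) x) * ?H (Nbar_coords \<nu> N)"
    by simp
  then show ?thesis using LIMSEQ_unique[OF lim] by (simp only: mult.commute)
qed

text \<open>Uniqueness: the coefficient of \<open>x\<^bsup>l\<^esup>\<close> is extracted by averaging over \<open>R\<close>-th roots of unity,
  which is exact on each fixed monomial once \<open>R\<close> is large.\<close>

definition root_point :: "nat \<Rightarrow> (nat \<Rightarrow> nat) \<Rightarrow> nat \<Rightarrow> complex" where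
  "root_point R a i = of_real (pr i) * cis (2 * pi * real (a i) / real R)"

lemma root_point_torus: "root_point R a \<in> torus k"
  by (simp add: torus_def root_point_def norm_mult less_imp_le abs_of_pos)

definition root_average :: "nat \<Rightarrow> nat \<Rightarrow> (nat \<Rightarrow> int) \<Rightarrow> (nat \<Rightarrow> int) \<Rightarrow> complex" where
  "root_average k R l m = (\<Sum>a\<in>PiE {..<k} (\<lambda>_. {..<R}). (\<Prod>i<k. root_point R a i powi (- l i)) *
     (alternant k (root_point R a) m / of_real (alternant k pr m))) / of_nat R ^ k"

lemma norm_root_average_le:
  assumes "m \<in> strict_seqs k" "R > 0"
  shows "norm (root_average k R l m) \<le> (\<Prod>i<k. pr i powi (- l i)) * torus_bound k"
proof -
  have rp: "norm (root_point R a i) = pr i" for a i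
    using root_point_torus[of R a "Suc i"] by (simp add: torus_def)
  have "norm (\<Sum>a\<in>PiE {..<k} (\<lambda>_. {..<R}). (\<Prod>i<k. root_point R a i powi (- l i)) *
     (alternant k (root_point R a) m / of_real (alternant k pr m))) \<le>
     (\<Sum>a\<in>PiE {..<k} (\<lambda>_. {..<R}). (\<Prod>i<k. pr i powi (- l i)) * torus_bound k)"
  proof (intro order_trans[OF norm_sum] sum_mono)
    fix a
    show "norm ((\<Prod>i<k. root_point R a i powi (- l i)) * (alternant k (root_point R a) m / of_real (alternant k pr m)))
       \<le> (\<Prod>i<k. pr i powi (- l i)) * torus_bound k"
      unfolding norm_mult prod_norm[symmetric] norm_power_int rp
      by (intro mult_left_mono norm_alternant_ratio_le[OF root_point_torus assms(1)] prod_nonneg) (auto simp: less_imp_le)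
  qed
  also have "\<dots> = of_nat R ^ k * ((\<Prod>i<k. pr i powi (- l i)) * torus_bound k)"
    by (simp add: card_PiE)
  finally show ?thesis
    unfolding root_average_def using assms(2) by (simp add: norm_divide norm_power divide_le_eq mult.commute)
qed

lemma root_average_eventually:
  assumes m: "m \<in> strict_seqs k" and l: "l \<in> strict_seqs k"
  shows "\<forall>\<^sub>F R in sequentially. root_average k R l m = (if m = l then 1 / of_real (alternant k pr l) else 0)"
proof -
  \<comment> \<open>For R > B no difference m_j - l_i is a nonzero multiple of R, so the average
    over R-th roots of unity is exact.\<close>
  define B where "B = nat (\<Sum>i<k. \<Sum>j<k. \<bar>m j - l i\<bar>)"
  have Bb: "\<bar>m j - l i\<bar> \<le> int B" if "i < k" "j < k" for i j
  proof -
    have "\<bar>m j - l i\<bar> \<le> (\<Sum>j<k. \<bar>m j - l i\<bar>)" by (rule member_le_sum) (use that in auto)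
    also have "\<dots> \<le> (\<Sum>i<k. \<Sum>j<k. \<bar>m j - l i\<bar>)"
      by (rule member_le_sum[of i _ "\<lambda>i. \<Sum>j<k. \<bar>m j - l i\<bar>"]) (use that in \<open>auto intro: sum_nonneg\<close>)
    also have "\<dots> \<le> int B" by (simp add: B_def)
    finally show ?thesis .
  qed
  show ?thesis
    using eventually_gt_at_top[of B]
  proof eventually_elim
    case (elim R)
    then have R: "R > 0" by simp
    have "(\<Sum>a\<in>PiE {..<k} (\<lambda>_. {..<R}). (\<Prod>i<k. root_point R a i powi (- l i)) * alternant k (root_point R a) m) =
      (\<Sum>p | p permutes {0..<k}. signof p * (\<Sum>a\<in>PiE {..<k} (\<lambda>_. {..<R}). \<Prod>i<k. root_point R a i powi (m (p i) - l i)))"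
    proof -
      have "(\<Prod>i<k. root_point R a i powi (- l i)) * alternant k (root_point R a) m =
         (\<Sum>p | p permutes {0..<k}. signof p * (\<Prod>i<k. root_point R a i powi (m (p i) - l i)))" for a
      proof -
        have "root_point R a i \<noteq> 0" for i by (simp add: root_point_def)
        then have "(\<Prod>i<k. root_point R a i powi (- l i)) * (\<Prod>i<k. root_point R a i powi m (p i)) =
            (\<Prod>i<k. root_point R a i powi (m (p i) - l i))" for p
          unfolding prod.distrib[symmetric] by (intro prod.cong refl) (simp flip: power_int_add)
        then show ?thesis unfolding alternant_def detf_rows sum_distrib_left
          by (intro sum.cong refl) (simp only: mult.left_commute)
      qed
      then have "(\<Sum>a\<in>PiE {..<k} (\<lambda>_. {..<R}). (\<Prod>i<k. root_point R a i powi (- l i)) * alternant k (root_point R a) m) =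
        (\<Sum>a\<in>PiE {..<k} (\<lambda>_. {..<R}). \<Sum>p | p permutes {0..<k}. signof p * (\<Prod>i<k. root_point R a i powi (m (p i) - l i)))"
        by (simp only:)
      also have "\<dots> = (\<Sum>p | p permutes {0..<k}. \<Sum>a\<in>PiE {..<k} (\<lambda>_. {..<R}). signof p * (\<Prod>i<k. root_point R a i powi (m (p i) - l i)))"
        by (rule sum.swap)
      finally show ?thesis by (simp only: sum_distrib_left)
    qed
    also have "\<dots> = (\<Sum>p | p permutes {0..<k}. signof p * (if \<forall>i<k. m (p i) = l i then of_nat R ^ k else 0))"
    proof (intro sum.cong refl arg_cong2[of _ _ _ _ "(*)"])
      fix p assume "p \<in> {p. p permutes {0..<k}}"
      then have pk: "p i < k" if "i < k" for i using permutes_in_image[of p "{0..<k}" i] that by simp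
      have "(\<Sum>a\<in>PiE {..<k} (\<lambda>_. {..<R}). \<Prod>i<k. root_point R a i powi (m (p i) - l i)) =
        (\<Sum>a\<in>PiE {..<k} (\<lambda>_. {..<R}). \<Prod>i<k. (\<lambda>i b. of_real (pr i) powi (m (p i) - l i) * cis (2 * pi * real b / real R) powi (m (p i) - l i)) i (a i))"
        by (simp add: root_point_def power_int_mult_distrib)
      also have "\<dots> = (\<Prod>i<k. \<Sum>b<R. of_real (pr i) powi (m (p i) - l i) * cis (2 * pi * real b / real R) powi (m (p i) - l i))"
        by (rule prod_sum_PiE[symmetric]) auto
      also have "\<dots> = (\<Prod>i<k. if m (p i) = l i then of_nat R else 0)"
      proof (rule prod.cong[OF refl])
        fix i assume "i \<in> {..<k}"
        then have "\<bar>m (p i) - l i\<bar> < int R" using Bb[of i "p i"] pk[of i] elim by simp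
        from sum_cis_roots[OF this R]
        show "(\<Sum>b<R. of_real (pr i) powi (m (p i) - l i) * cis (2 * pi * real b / real R) powi (m (p i) - l i)) = (if m (p i) = l i then of_nat R else (0::complex))"
          unfolding sum_distrib_left[symmetric] by simp
      qed
      also have "\<dots> = (if \<forall>i<k. m (p i) = l i then of_nat R ^ k else 0)"
        by (auto intro!: prod_zero)
      finally show "(\<Sum>a\<in>PiE {..<k} (\<lambda>_. {..<R}). \<Prod>i<k. root_point R a i powi (m (p i) - l i)) = (if \<forall>i<k. m (p i) = l i then of_nat R ^ k else 0)" .
    qed
    also have "\<dots> = (if m = l then of_nat R ^ k else 0)"
    proof (cases "m = l")
      case True
      have "(\<Sum>p | p permutes {0..<k}. signof p * (if \<forall>i<k. m (p i) = l i then of_nat R ^ k else 0)) =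
         (\<Sum>p\<in>{id}. signof p * (if \<forall>i<k. m (p i) = l i then of_nat R ^ k else (0::complex)))"
      proof (rule sum.mono_neutral_right)
        show "{id} \<subseteq> {p. p permutes {0..<k}}" by (simp add: permutes_id)
        show "\<forall>p\<in>{p. p permutes {0..<k}} - {id}. signof p * (if \<forall>i<k. m (p i) = l i then of_nat R ^ k else (0::complex)) = 0"
          using strict_seqs_perm_id[OF m l] by auto
      qed (simp add: finite_permutations)
      then show ?thesis using True by simp
    next
      case False
      have "\<not> (\<forall>i<k. m (p i) = l i)" if "p permutes {0..<k}" for p
        using strict_seqs_perm_id[OF m l that] False by blast
      then have "(\<Sum>p | p permutes {0..<k}. signof p * (if \<forall>i<k. m (p i) = l i then of_nat R ^ k else 0)) = (0::complex)"
        by (intro sum.neutral) auto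
      then show ?thesis using False by simp
    qed
    finally have S: "(\<Sum>a\<in>PiE {..<k} (\<lambda>_. {..<R}). (\<Prod>i<k. root_point R a i powi (- l i)) * alternant k (root_point R a) m) =
      (if m = l then of_nat R ^ k else 0)" .
    have "root_average k R l m = (\<Sum>a\<in>PiE {..<k} (\<lambda>_. {..<R}). (\<Prod>i<k. root_point R a i powi (- l i)) * alternant k (root_point R a) m)
       / of_real (alternant k pr m) / of_nat R ^ k"
      unfolding root_average_def by (simp add: sum_divide_distrib)
    then show ?case unfolding S using R by simp
  qed
qed

theorem torus_expectation_unique:
  assumes S: "set_pmf P \<subseteq> strict_seqs k" "set_pmf P' \<subseteq> strict_seqs k"
    and eq: "\<And>x. x \<in> torus k \<Longrightarrow> measure_pmf.expectation P (\<lambda>m. alternant k x m / of_real (alternant k pr m)) =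
       measure_pmf.expectation P' (\<lambda>m. alternant k x m / of_real (alternant k pr m))"
  shows "P = P'"
proof (rule pmf_eqI)
  fix l
  show "pmf P l = pmf P' l"
  proof (cases "l \<in> strict_seqs k")
    case False
    then have "pmf P l = 0" "pmf P' l = 0" using S by (auto simp: set_pmf_iff)
    then show ?thesis by simp
  next
    case l: True
    have int: "integrable (measure_pmf R) (\<lambda>m. alternant k x m / of_real (alternant k pr m))"
      if "set_pmf R \<subseteq> strict_seqs k" "x \<in> torus k" for R x
      by (rule complex_expectation_bounded[of _ _ "torus_bound k"]) (use norm_alternant_ratio_le[OF that(2)] that(1) in auto)
    have E: "measure_pmf.expectation Q (root_average k R l) =
      (\<Sum>a\<in>PiE {..<k} (\<lambda>_. {..<R}). (\<Prod>i<k. root_point R a i powi (- l i)) *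
        measure_pmf.expectation Q (\<lambda>m. alternant k (root_point R a) m / of_real (alternant k pr m))) / of_nat R ^ k"
      if "set_pmf Q \<subseteq> strict_seqs k" for Q R
    proof -
      have "measure_pmf.expectation Q (\<lambda>m. \<Sum>a\<in>PiE {..<k} (\<lambda>_. {..<R}). (\<Prod>i<k. root_point R a i powi (- l i)) *
          (alternant k (root_point R a) m / of_real (alternant k pr m))) =
        (\<Sum>a\<in>PiE {..<k} (\<lambda>_. {..<R}). measure_pmf.expectation Q (\<lambda>m. (\<Prod>i<k. root_point R a i powi (- l i)) *
          (alternant k (root_point R a) m / of_real (alternant k pr m))))"
        by (rule Bochner_Integration.integral_sum) (intro integrable_mult_right int that root_point_torus)
      also have "\<dots> = (\<Sum>a\<in>PiE {..<k} (\<lambda>_. {..<R}). (\<Prod>i<k. root_point R a i powi (- l i)) *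
          measure_pmf.expectation Q (\<lambda>m. alternant k (root_point R a) m / of_real (alternant k pr m)))"
        by (intro sum.cong refl integral_mult_right_zero)
      finally show ?thesis
        unfolding root_average_def integral_divide_zero by (simp only:)
    qed
    have lim: "(\<lambda>R. measure_pmf.expectation Q (root_average k R l)) \<longlonglongrightarrow> of_real (pmf Q l) / of_real (alternant k pr l)"
      if Q: "set_pmf Q \<subseteq> strict_seqs k" for Q
    proof -
      \<comment> \<open>The index is shifted because the dominating bound of
        \<open>norm_root_average_le\<close> requires R > 0.\<close>
      have "(\<lambda>R. measure_pmf.expectation Q (root_average k (Suc R) l)) \<longlonglongrightarrow>
         measure_pmf.expectation Q (\<lambda>m. if m = l then 1 / of_real (alternant k pr l) else 0)"
      proof (rule integral_dominated_convergence[where w = "\<lambda>_. (\<Prod>i<k. pr i powi (- l i)) * torus_bound k"])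
        show "AE m in measure_pmf Q. (\<lambda>R. root_average k (Suc R) l m) \<longlonglongrightarrow> (if m = l then 1 / of_real (alternant k pr l) else 0)"
        proof (rule AE_pmfI)
          fix m assume "m \<in> set_pmf Q"
          then have "m \<in> strict_seqs k" using Q by auto
          from root_average_eventually[OF this l]
          have "(\<lambda>R. root_average k R l m) \<longlonglongrightarrow> (if m = l then 1 / of_real (alternant k pr l) else 0)"
            by (rule tendsto_eventually)
          then show "(\<lambda>R. root_average k (Suc R) l m) \<longlonglongrightarrow> (if m = l then 1 / of_real (alternant k pr l) else 0)"
            by (rule LIMSEQ_Suc)
        qed
        show "AE m in measure_pmf Q. norm (root_average k (Suc R) l m) \<le> (\<Prod>i<k. pr i powi (- l i)) * torus_bound k" for R
          by (rule AE_pmfI) (use Q norm_root_average_le in auto)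
      qed auto
      also have "measure_pmf.expectation Q (\<lambda>m. if m = l then 1 / of_real (alternant k pr l) else 0) =
         measure_pmf.expectation Q (\<lambda>m. indicator {l} m *\<^sub>R (1 / of_real (alternant k pr l) :: complex))"
        by (rule Bochner_Integration.integral_cong) (auto simp: indicator_def)
      also have "\<dots> = of_real (pmf Q l) / of_real (alternant k pr l)"
        by (simp add: pmf.rep_eq scaleR_conv_of_real)
      finally show ?thesis by (rule LIMSEQ_imp_Suc)
    qed
    have "measure_pmf.expectation P (root_average k R l) = measure_pmf.expectation P' (root_average k R l)" for R
      unfolding E[OF S(1)] E[OF S(2)] using eq[OF root_point_torus] by simp
    then have "of_real (pmf P l) / of_real (alternant k pr l) = (of_real (pmf P' l) / of_real (alternant k pr l) :: complex)"
      using LIMSEQ_unique[OF lim[OF S(1)]] lim[OF S(2)] by simp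
    then show ?thesis using alternant_pr_pos[OF l] by simp
  qed
qed

end

section \<open>Links in terms of signatures\<close>

definition toL :: "nat \<Rightarrow> (nat \<Rightarrow> int) \<Rightarrow> nat \<Rightarrow> int" where
  "toL r l = (\<lambda>j\<in>{..<r}. l (r - j) + int j)"

definition toG :: "nat \<Rightarrow> (nat \<Rightarrow> int) \<Rightarrow> nat \<Rightarrow> int" where
  "toG r L = (\<lambda>i\<in>{1..r}. L (r - i) - int (r - i))"

lemma toL_strict:
  assumes "l \<in> GT r"
  shows "toL r l \<in> strict_seqs r"
proof (rule strict_seqs_SucI)
  fix j assume j: "Suc j < r"
  then have "l (r - j) \<le> l (r - Suc j)" using assms by (auto simp: signatures_def)
  then show "toL r l j < toL r l (Suc j)" using j by (simp add: toL_def)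
qed (simp add: toL_def)

lemma toG_GT:
  assumes "L \<in> strict_seqs r"
  shows "toG r L \<in> GT r"
  unfolding signatures_def
proof (safe)
  fix i j assume ij: "i \<in> {1..r}" "j \<in> {1..r}" "i \<le> j"
  have "L (r - j) + int (r - i - (r - j)) \<le> L (r - i)"
    by (rule strict_seqs_diff[OF assms]) (use ij in auto)
  then show "toG r L j \<le> toG r L i" using ij by (simp add: toG_def of_nat_diff)
qed (auto simp: toG_def)

lemma toG_toL:
  assumes "l \<in> GT r"
  shows "toG r (toL r l) = l"
proof (rule extensionalityI[of _ "{1..r}"])
  show "l \<in> extensional {1..r}" using assms by (auto simp: signatures_def PiE_def)
qed (auto simp: toG_def toL_def)

lemma toL_toG:
  assumes "L \<in> strict_seqs r"
  shows "toL r (toG r L) = L"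
proof (rule extensionalityI[of _ "{..<r}"])
  show "L \<in> extensional {..<r}" using assms by (auto simp: strict_seqs_def)
qed (auto simp: toG_def toL_def)

lemma bij_toG: "bij_betw (toG r) (strict_seqs r) (GT r)"
  by (rule bij_betw_byWitness[where f' = "toL r"]) (auto simp: toG_toL toL_toG toL_strict toG_GT)

lemma bij_toL: "bij_betw (toL r) (GT r) (strict_seqs r)"
  by (rule bij_betw_byWitness[where f' = "toG r"]) (auto simp: toG_toL toL_toG toL_strict toG_GT)

lemma revdet_Suc: "revdet (Suc N) = (-1) ^ N * (revdet N :: 'a::comm_ring_1)"
proof -
  let ?A = "Matrix.mat (Suc N) (Suc N) (\<lambda>(l, j). if l = Suc N - Suc j then 1 else (0::'a))"
  have "revdet (Suc N) = (\<Sum>j<Suc N. ?A $$ (N, j) * cofactor ?A N j)"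
    unfolding revdet_def detf_def by (rule laplace_expansion_row) auto
  also have "\<dots> = (\<Sum>j\<in>{0}. ?A $$ (N, j) * cofactor ?A N j)"
    by (rule sum.mono_neutral_right) auto
  also have "\<dots> = cofactor ?A N 0" by simp
  also have "mat_delete ?A N 0 = Matrix.mat N N (\<lambda>(l, j). if l = N - Suc j then 1 else 0)"
    by (rule eq_matI) (auto simp: mat_delete_def)
  then have "cofactor ?A N 0 = (-1) ^ N * revdet N"
    by (simp add: cofactor_def revdet_def detf_def)
  finally show ?thesis .
qed

text \<open>The factors are x_i - x_j with i < j here and x_j - x_i in \<open>vdm\<close>; the
  resulting sign is that of the reversal.\<close>

lemma vandermonde_product:
  fixes x :: "nat \<Rightarrow> 'a::comm_ring_1"
  shows "(\<Prod>(i, j)\<in>{(i, j). 1 \<le> i \<and> i < j \<and> j \<le> N}. x i - x j) = vdm N (\<lambda>i. x (Suc i)) * revdet N"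
proof (induction N)
  case 0
  have e: "{(i, j). 1 \<le> i \<and> i < j \<and> j \<le> (0::nat)} = {}" by auto
  show ?case unfolding e by (simp add: vdm_def revdet_def detf_rows)
next
  case (Suc N)
  let ?P = "\<lambda>N. {(i, j). 1 \<le> i \<and> i < j \<and> j \<le> (N::nat)}"
  have P: "?P (Suc N) = ?P N \<union> (\<lambda>i. (Suc i, Suc N)) ` {..<N}"
    by (auto simp: image_iff le_Suc_eq) (metis Suc_le_D Suc_le_lessD lessThan_iff Suc_less_eq)
  have "finite (?P N)" by (rule finite_subset[of _ "{..N} \<times> {..N}"]) auto
  then have "(\<Prod>(i, j)\<in>?P (Suc N). x i - x j) = (\<Prod>(i, j)\<in>?P N. x i - x j) * (\<Prod>(i, j)\<in>(\<lambda>i. (Suc i, Suc N)) ` {..<N}. x i - x j)"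
    unfolding P by (intro prod.union_disjoint) auto
  also have "(\<Prod>(i, j)\<in>(\<lambda>i. (Suc i, Suc N)) ` {..<N}. x i - x j) = (\<Prod>i<N. x (Suc i) - x (Suc N))"
    by (subst prod.reindex) (auto intro: inj_onI)
  also have "\<dots> = (\<Prod>i<N. (-1) * (x (Suc N) - x (Suc i)))" by (rule prod.cong) auto
  also have "\<dots> = (-1) ^ N * (\<Prod>i<N. x (Suc N) - x (Suc i))" by (simp only: prod.distrib prod_constant card_lessThan)
  finally show ?case unfolding Suc.IH vdm_Suc revdet_Suc by (simp add: mult_ac)
qed

text \<open>Signatures decrease and strict sequences increase, so the columns are reversed. The sign
  of this reversal cancels against the one from \<open>vandermonde_product\<close>.\<close>

lemma schur_alternant: "schur N l x = alternant N (\<lambda>i. x (Suc i)) (toL N l) / vdm N (\<lambda>i. x (Suc i))"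
proof -
  have "Determinant.det (Matrix.mat N N (\<lambda>(i, j). x (i + 1) powi (l (j + 1) + int N - int (j + 1)))) =
     detf N (\<lambda>i j. (\<lambda>i j. x (Suc i) powi toL N l j) i (N - Suc j))"
    unfolding detf_def[symmetric]
  proof (rule detf_cong)
    fix i j assume "i < N" "j < N"
    then have "toL N l (N - Suc j) = l (j + 1) + int N - int (j + 1)"
      by (auto simp: toL_def of_nat_diff)
    then show "x (i + 1) powi (l (j + 1) + int N - int (j + 1)) = x (Suc i) powi toL N l (N - Suc j)" by simp
  qed
  also have "\<dots> = alternant N (\<lambda>i. x (Suc i)) (toL N l) * revdet N"
    unfolding alternant_def by (rule detf_rev)
  finally have "schur N l x = (alternant N (\<lambda>i. x (Suc i)) (toL N l) * revdet N) / (vdm N (\<lambda>i. x (Suc i)) * revdet N)"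
    unfolding schur_def vandermonde_product by simp
  moreover have "revdet N \<noteq> (0::'a)" using revdet_square[of N, where 'a = 'a] by auto
  ultimately show ?thesis by simp
qed

lemma initial_segment_card:
  fixes L :: "nat \<Rightarrow> int"
  assumes "L \<in> strict_seqs k" "j < k"
  shows "L j \<le> c \<longleftrightarrow> j < card {j. j < k \<and> L j \<le> c}"
proof -
  define J where "J = {j. j < k \<and> L j \<le> c}"
  have fin: "finite J" by (simp add: J_def)
  have down: "i \<in> J" if "j \<in> J" "i \<le> j" for i j
    using that strict_seqs_less[OF assms(1), of i j] by (cases "i = j") (auto simp: J_def)
  show ?thesis
  proof
    assume "L j \<le> c"
    then have "{..j} \<subseteq> J" using down assms(2) by (auto simp: J_def)
    then have "card {..j} \<le> card J" by (rule card_mono[OF fin])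
    then show "j < card {j. j < k \<and> L j \<le> c}" by (simp add: J_def)
  next
    assume c: "j < card {j. j < k \<and> L j \<le> c}"
    show "L j \<le> c"
    proof (rule ccontr)
      assume "\<not> L j \<le> c"
      then have "j \<notin> J" by (simp add: J_def)
      then have "J \<subseteq> {..<j}" using down by (meson lessThan_iff not_le subsetI)
      then have "card J \<le> card {..<j}" by (rule card_mono[rotated]) simp
      then show False using c by (simp add: J_def)
    qed
  qed
qed

text \<open>Row i consists of f_i ones followed by zeros, and f is nondecreasing. Unless a row
  vanishes or two rows agree, 0 < f_0 < ... < f_(k-1) <= k forces f_i = i + 1, which is the
  interlacing condition; in that case the matrix is triangular with ones on the diagonal.\<close>

lemma detf_interlacing:
  assumes L: "L \<in> strict_seqs k" and M: "M \<in> strict_seqs k"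
  shows "detf k (\<lambda>i j. if L j \<le> M i then 1 else (0::'a::comm_ring_1)) = (if M \<in> box k k L then 1 else 0)"
proof (cases "M \<in> box k k L")
  case True
  have b: "L i \<le> M i" "Suc i < k \<Longrightarrow> M i < L (Suc i)" if "i < k" for i
    using PiE_mem[OF True[unfolded box_def], of i] that by auto
  have "detf k (\<lambda>i j. if L j \<le> M i then 1 else (0::'a)) = (\<Prod>i<k. if L i \<le> M i then 1 else 0)"
  proof (rule detf_lower_triangular)
    fix i j assume ij: "i < j" "j < k"
    then have "M i < L (Suc i)" using b(2)[of i] by simp
    also have "\<dots> \<le> L j" using strict_seqs_less[OF L, of "Suc i" j] ij by (cases "Suc i = j") auto
    finally show "(if L j \<le> M i then 1 else (0::'a)) = 0" by simp
  qed
  then show ?thesis using True b by simp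
next
  case False
  define f where "f i = card {j. j < k \<and> L j \<le> M i}" for i
  have f: "L j \<le> M i \<longleftrightarrow> j < f i" if "j < k" for i j
    unfolding f_def by (rule initial_segment_card[OF L that])
  have fk: "f i \<le> k" for i
  proof -
    have "f i \<le> card {..<k}" unfolding f_def by (rule card_mono) auto
    then show ?thesis by simp
  qed
  have fmono: "f i \<le> f j" if "i \<le> j" "j < k" for i j
    unfolding f_def using strict_seqs_less[OF M, of i j] that by (intro card_mono) (auto simp: le_less)
  show ?thesis
  proof (rule ccontr)
    assume "\<not> ?thesis"
    then have nz: "detf k (\<lambda>i j. if L j \<le> M i then 1 else (0::'a)) \<noteq> 0" using False by simp
    have ne: "f i \<noteq> f j" if "i < j" "j < k" for i j
    proof
      assume "f i = f j"
      then have "detf k (\<lambda>i j. if L j \<le> M i then 1 else (0::'a)) = 0"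
        by (intro detf_equal_rows[of i _ j]) (use that f in auto)
      then show False using nz by simp
    qed
    have less: "f i < f j" if "i < j" "j < k" for i j
      using fmono[of i j] ne[OF that] that by simp
    have pos: "f i > 0" if "i < k" for i
    proof (rule ccontr)
      assume "\<not> f i > 0"
      then have "detf k (\<lambda>i j. if L j \<le> M i then 1 else (0::'a)) = detf k (\<lambda>r j. (if r = i then 0 else 1) * (if L j \<le> M r then 1 else (0::'a)))"
        by (intro detf_cong) (auto simp: f)
      also have "\<dots> = 0"
      proof -
        have "(\<Prod>r<k. if r = i then 0 else (1::'a)) = 0" by (rule prod_zero) (use that in auto)
        then show ?thesis unfolding detf_scale_rows by simp
      qed
      finally show False using nz by simp
    qed
    have ge: "Suc i \<le> f i" if "i < k" for i
      using that
    proof (induction i)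
      case 0
      then show ?case using pos by (simp add: Suc_le_eq)
    next
      case (Suc i)
      then show ?case using less[of i "Suc i"] by auto
    qed
    have le: "f i + (k - Suc i) \<le> k" if "i < k" for i
      using that
    proof (induction "k - Suc i" arbitrary: i)
      case 0
      then show ?case using fk[of i] by simp
    next
      case (Suc d)
      then have "f (Suc i) + (k - Suc (Suc i)) \<le> k" by (intro Suc.hyps(1)) auto
      moreover have "f i < f (Suc i)" by (rule less) (use Suc.hyps(2) in auto)
      moreover have "k - Suc i = Suc (k - Suc (Suc i))" using Suc.hyps(2) by simp
      ultimately show ?case by linarith
    qed
    have fi: "f i = Suc i" if "i < k" for i using ge[OF that] le[OF that] that by linarith
    have "M \<in> box k k L"
      unfolding box_def
    proof (rule PiE_I)
      fix i assume "i \<in> {..<k}"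
      then have i: "i < k" by simp
      show "M i \<in> {m. L i \<le> m \<and> (Suc i < k \<longrightarrow> m < L (Suc i))}"
        using f[OF i, of i] f[of "Suc i" i] fi[OF i] by auto
    qed (use M in \<open>auto simp: strict_seqs_def extensional_def\<close>)
    then show False using False by simp
  qed
qed

context qpar begin

lemma schur_princ_alternant: "schur_princ q N l = alternant N pr (toL N l) / vdm N pr"
proof -
  have "q powi (1 - int (Suc i)) = pr i" for i by (simp add: pr_def)
  then show ?thesis unfolding schur_princ_def schur_alternant by simp
qed

lemma schur_ratio:
  fixes x :: "nat \<Rightarrow> complex"
  shows "schur k m x / of_real (schur_princ q k m) =
     of_real (vdm k pr) / vdm k (\<lambda>i. x (Suc i)) * (alternant k (\<lambda>i. x (Suc i)) (toL k m) / of_real (alternant k pr (toL k m)))"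
  unfolding schur_alternant schur_princ_alternant by simp

lemma sig_size_toL: "(\<Sum>j<r. toL r l j) = sig_size r l + int (\<Sum>j<r. j)"
proof -
  have "(\<Sum>j<r. toL r l j) = (\<Sum>j<r. l (r - j)) + (\<Sum>j<r. int j)"
    unfolding sum.distrib[symmetric] by (rule sum.cong) (auto simp: toL_def)
  also have "(\<Sum>j<r. l (r - j)) = (\<Sum>i=1..r. l i)"
    by (rule sum.reindex_bij_witness[of _ "\<lambda>i. r - i" "\<lambda>j. r - j"]) auto
  finally show ?thesis by (simp add: sig_size_def)
qed

lemma link_step:
  assumes l: "l \<in> GT (Suc N)" and m: "m \<in> GT N"
  shows "link q (Suc N) l m = pmf (step_pmf N (Suc N) (toL (Suc N) l)) (toL N m)"
proof -
  let ?L = "toL (Suc N) l" and ?M = "toL N m"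
  have inter: "interlaces (Suc N) l m \<longleftrightarrow> ?M \<in> box N (Suc N) ?L"
  proof
    assume i: "interlaces (Suc N) l m"
    show "?M \<in> box N (Suc N) ?L"
      unfolding box_def
    proof (rule PiE_I)
      fix j assume j: "j \<in> {..<N}"
      then have "N - j \<in> {1..<Suc N}" "Suc N - j = N - j + 1" by auto
      then show "?M j \<in> {a. ?L j \<le> a \<and> (Suc j < Suc N \<longrightarrow> a < ?L (Suc j))}"
        using i j by (auto simp: interlaces_def toL_def)
    qed (auto simp: toL_def)
  next
    assume b: "?M \<in> box N (Suc N) ?L"
    show "interlaces (Suc N) l m"
      unfolding interlaces_def
    proof
      fix i assume i: "i \<in> {1..<Suc N}"
      have "N - (N - i) = i" "Suc N - (N - i) = i + 1" "Suc N - Suc (N - i) = i" using i by auto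
      then show "m i \<le> l i \<and> l (i + 1) \<le> m i"
        using PiE_mem[OF b[unfolded box_def], of "N - i"] i by (auto simp: toL_def)
    qed
  qed
  have k: "min (Suc N) N = N" by simp
  show ?thesis
  proof (cases "?M \<in> box N (Suc N) ?L")
    case False
    then show ?thesis
      using inter pmf_step[OF toL_strict[OF l], of N ?M] by (simp add: link_def step_wt_def)
  next
    case True
    \<comment> \<open>Links are normalized by Schur functions, the kernel by alternants. The ratio
      of the two Vandermonde products supplies the product of the 1 - q^(N-i) and the power
      q^(-N^2), which compensates the staircase shift in the encodings of l and m.\<close>
    have vd: "vdm (Suc N) pr / vdm N pr = q powi (- int N * int N) * (\<Prod>i<N. 1 - q ^ (N - i))"
    proof -
      have "vdm (Suc N) pr / vdm N pr = (\<Prod>i<N. pr N - pr i)"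
        using vdm_pr_pos[of N] by (simp add: vdm_Suc)
      also have "\<dots> = (\<Prod>i<N. pr N * (1 - q ^ (N - i)))"
      proof (rule prod.cong[OF refl])
        fix i assume "i \<in> {..<N}"
        then have "pr N * q ^ (N - i) = pr N * (q ^ N * pr i)" using q_pr[of i N] by simp
        also have "\<dots> = pr i" using q0 by (simp add: pr_def power_int_minus)
        finally show "pr N - pr i = pr N * (1 - q ^ (N - i))" by (simp add: algebra_simps)
      qed
      also have "\<dots> = pr N ^ N * (\<Prod>i<N. 1 - q ^ (N - i))" by (simp add: prod.distrib)
      also have "pr N ^ N = q powi (- int N * int N)" unfolding pr_def by (simp only: power_int_mult power_int_of_nat)
      finally show ?thesis .
    qed
    have ex: "(\<Sum>j<N. ?M j) - (\<Sum>j<Suc N. ?L j) = - (sig_size (Suc N) l - sig_size N m) - int N"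
      unfolding sig_size_toL by simp
    have "(q ^ N) powi ((\<Sum>j<N. ?M j) - (\<Sum>j<Suc N. ?L j)) = q powi (int N * (- (sig_size (Suc N) l - sig_size N m) - int N))"
      unfolding ex by (simp only: power_int_mult power_int_of_nat)
    also have "int N * (- (sig_size (Suc N) l - sig_size N m) - int N) = (1 - int (Suc N)) * (sig_size (Suc N) l - sig_size N m) + (- int N * int N)"
      by (simp add: algebra_simps)
    also have "q powi \<dots> = q powi ((1 - int (Suc N)) * (sig_size (Suc N) l - sig_size N m)) * q powi (- int N * int N)"
      by (rule power_int_add) (use q0 in simp)
    finally have pw: "(q ^ N) powi ((\<Sum>j<N. ?M j) - (\<Sum>j<Suc N. ?L j)) =
       q powi ((1 - int (Suc N)) * (sig_size (Suc N) l - sig_size N m)) * q powi (- int N * int N)" using q0 by simp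
    have "link q (Suc N) l m = q powi ((1 - int (Suc N)) * (sig_size (Suc N) l - sig_size N m)) *
       (vdm (Suc N) pr / vdm N pr) * alternant N pr ?M / alternant (Suc N) pr ?L"
      using inter True by (simp add: link_def schur_princ_alternant)
    also have "\<dots> = (q ^ N) powi ((\<Sum>j<N. ?M j) - (\<Sum>j<Suc N. ?L j)) * (\<Prod>i<N. 1 - q ^ (N - i)) * alternant N pr ?M / alternant (Suc N) pr ?L"
      unfolding vd pw by (simp only: mult.assoc)
    also have "\<dots> = pmf (step_pmf N (Suc N) ?L) ?M"
      unfolding pmf_step[OF toL_strict[OF l] order_refl] step_wt_def Let_def k using True by simp
    finally show ?thesis .
  qed
qed

text \<open>Reversing both rows and columns costs the same sign twice. Then q^(N (M_i - L_j)) splits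
  into a row factor and a column factor, and the remaining 0/1 determinant is the interlacing
  indicator of \<open>detf_interlacing\<close>.\<close>

lemma ext_link_stratum:
  assumes l: "l \<in> GT k" and m: "m \<in> GT k" and k: "k \<le> N"
  shows "(\<Prod>i=1..k. 1 - q ^ (Suc N - i))
       * Determinant.det (Matrix.mat k k (\<lambda>(i, j).
           link_coeff q (Suc N) (m (i + 1) - int (i + 1) - l (j + 1) + int (j + 1))))
       * schur_princ q k m / schur_princ q k l = pmf (step_pmf N k (toL k l)) (toL k m)"
proof -
  let ?L = "toL k l" and ?M = "toL k m"
  have Ls: "?L \<in> strict_seqs k" "?M \<in> strict_seqs k" using toL_strict l m by auto
  define a where "a i j = link_coeff q (Suc N) (?M i - ?L j)" for i j
  have "Determinant.det (Matrix.mat k k (\<lambda>(i, j).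
           link_coeff q (Suc N) (m (i + 1) - int (i + 1) - l (j + 1) + int (j + 1)))) =
      detf k (\<lambda>i j. (\<lambda>i j. a (k - Suc i) j) i (k - Suc j))"
    unfolding detf_def[symmetric]
  proof (rule detf_cong)
    fix i j assume "i < k" "j < k"
    then have "?M (k - Suc i) = m (i + 1) + int (k - Suc i)" "?L (k - Suc j) = l (j + 1) + int (k - Suc j)"
      by (auto simp: toL_def)
    then have "m (i + 1) - int (i + 1) - l (j + 1) + int (j + 1) = ?M (k - Suc i) - ?L (k - Suc j)"
      using \<open>i < k\<close> \<open>j < k\<close> by (simp add: of_nat_diff)
    then show "link_coeff q (Suc N) (m (i + 1) - int (i + 1) - l (j + 1) + int (j + 1)) = a (k - Suc i) (k - Suc j)"
      by (simp add: a_def)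
  qed
  also have "\<dots> = detf k (\<lambda>i j. a (k - Suc i) j) * revdet k" by (rule detf_rev)
  also have "detf k (\<lambda>i j. a (k - Suc i) j) = detf k (\<lambda>i j. (\<lambda>i j. a j i) i (k - Suc j))"
    using detf_transpose[of k "\<lambda>i j. a (k - Suc i) j"] by simp
  also have "\<dots> = detf k (\<lambda>i j. a j i) * revdet k" by (rule detf_rev)
  also have "detf k (\<lambda>i j. a j i) = detf k a" by (rule detf_transpose)
  also have "detf k a * revdet k * revdet k = detf k a" using revdet_square[of k, where 'a = real] by (simp add: mult.assoc)
  also have "detf k a = detf k (\<lambda>i j. (q ^ N) powi ?M i * ((q ^ N) powi (- ?L j) * (if ?L j \<le> ?M i then 1 else 0)))"
  proof (rule detf_cong)
    fix i j
    have "q powi ((int (Suc N) - 1) * (?M i - ?L j)) = (q ^ N) powi (?M i + - ?L j)"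
      by (simp add: power_int_mult)
    also have "\<dots> = (q ^ N) powi ?M i * (q ^ N) powi (- ?L j)" using q0 by (subst power_int_add) auto
    finally show "a i j = (q ^ N) powi ?M i * ((q ^ N) powi (- ?L j) * (if ?L j \<le> ?M i then 1 else 0))"
      by (simp add: a_def link_coeff_def)
  qed
  also have "\<dots> = (\<Prod>i<k. (q ^ N) powi ?M i) * ((\<Prod>j<k. (q ^ N) powi (- ?L j)) * (if ?M \<in> box k k ?L then 1 else 0))"
    unfolding detf_scale_rows detf_scale_cols detf_interlacing[OF Ls] ..
  also have "\<dots> = (if ?M \<in> box k k ?L then (q ^ N) powi ((\<Sum>j<k. ?M j) - (\<Sum>j<k. ?L j)) else 0)"
    using q0 by (simp add: prod_powi sum_negf flip: power_int_add)
  finally have D: "Determinant.det (Matrix.mat k k (\<lambda>(i, j).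
           link_coeff q (Suc N) (m (i + 1) - int (i + 1) - l (j + 1) + int (j + 1)))) =
      (if ?M \<in> box k k ?L then (q ^ N) powi ((\<Sum>j<k. ?M j) - (\<Sum>j<k. ?L j)) else 0)" .
  have Pr: "(\<Prod>i=1..k. 1 - q ^ (Suc N - i)) = (\<Prod>i<k. 1 - q ^ (N - i))"
    by (rule prod.reindex_bij_witness[of _ Suc "\<lambda>i. i - 1"]) (auto simp: Suc_diff_le)
  have mk: "min k N = k" using k by simp
  have "schur_princ q k m / schur_princ q k l = alternant k pr ?M / alternant k pr ?L"
    unfolding schur_princ_alternant using vdm_pr_pos[of k] by simp
  then show ?thesis
    unfolding D Pr pmf_step[OF Ls(1) le_SucI[OF k]] step_wt_def Let_def mk
    by (simp flip: times_divide_eq_right)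
qed

lemma link_comp_chain:
  assumes "l \<in> GT (N + d)" "m \<in> GT N"
  shows "link_comp q N d l m = pmf (chain_pmf N d (N + d) (toL (N + d) l)) (toL N m)"
  using assms(1)
proof (induction d arbitrary: l)
  case 0
  have "toL N l = toL N m \<longleftrightarrow> l = m" using toG_toL[of l N] toG_toL[of m N] 0 assms(2) by (metis add_0_right)
  then show ?case by (simp add: indicator_def)
next
  case (Suc d)
  let ?L = "toL (N + Suc d) l"
  have Ls: "?L \<in> strict_seqs (Suc (N + d))" using toL_strict[OF Suc.prems] by simp
  have S: "set_pmf (step_pmf (N + d) (Suc (N + d)) ?L) \<subseteq> strict_seqs (N + d)"
    using set_pmf_step(2)[OF Ls order_refl] by simp
  have "link_comp q N (Suc d) l m = (\<Sum>\<^sub>\<infinity>\<kappa>\<in>GT (N + d). pmf (step_pmf (N + d) (Suc (N + d)) ?L) (toL (N + d) \<kappa>) *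
      pmf (chain_pmf N d (N + d) (toL (N + d) \<kappa>)) (toL N m))"
    unfolding link_comp.simps
    by (rule infsum_cong) (use link_step[of l "N + d"] Suc in simp)
  also have "\<dots> = (\<Sum>\<^sub>\<infinity>M\<in>strict_seqs (N + d). pmf (step_pmf (N + d) (Suc (N + d)) ?L) M * pmf (chain_pmf N d (N + d) M) (toL N m))"
    by (rule infsum_reindex_bij_betw[OF bij_toL])
  also have "\<dots> = measure_pmf.expectation (step_pmf (N + d) (Suc (N + d)) ?L) (\<lambda>M. pmf (chain_pmf N d (N + d) M) (toL N m))"
  proof (rule infsumI)
    have "integrable (measure_pmf (step_pmf (N + d) (Suc (N + d)) ?L)) (\<lambda>M. pmf (chain_pmf N d (N + d) M) (toL N m))"
      by (rule abs_expectation_le(1)[of _ _ 1]) (simp add: pmf_le_1)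
    from has_sum_pmf_integral[OF this S]
    show "((\<lambda>M. pmf (step_pmf (N + d) (Suc (N + d)) ?L) M * pmf (chain_pmf N d (N + d) M) (toL N m)) has_sum
       measure_pmf.expectation (step_pmf (N + d) (Suc (N + d)) ?L) (\<lambda>M. pmf (chain_pmf N d (N + d) M) (toL N m))) (strict_seqs (N + d))"
      by (simp only: real_scaleR_def)
  qed
  also have "\<dots> = pmf (chain_pmf N (Suc d) (N + Suc d) ?L) (toL N m)"
    by (simp add: pmf_bind min_absorb2)
  finally show ?case .
qed

lemma toL_rev_sig:
  assumes "rk \<nu> M = M"
  shows "toL M (rev_sig M \<nu>) = Nbar_coords \<nu> M"
  by (rule extensionalityI[of _ "{..<M}"]) (auto simp: toL_def rev_sig_def Nbar_coords_def assms Suc_diff_le)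

end

section \<open>Laws on extended signatures\<close>

lemma pmf_map_inj_on:
  assumes "inj_on f S" "set_pmf M \<subseteq> S" "x \<in> S"
  shows "pmf (map_pmf f M) (f x) = pmf M x"
proof -
  have "pmf (map_pmf f M) (f x) = measure_pmf.prob M (f -` {f x})" by (rule pmf_map)
  also have "\<dots> = measure_pmf.prob M {x}"
    by (rule measure_eq_AE) (use assms in \<open>auto intro!: AE_pmfI dest: inj_onD\<close>)
  finally show ?thesis by (simp add: pmf.rep_eq)
qed

lemma pmf_has_sum_prob: "(pmf Q has_sum measure_pmf.prob Q B) B"
proof -
  have "integrable (measure_pmf Q) (indicator B :: _ \<Rightarrow> real)"
    by (rule abs_expectation_le(1)[of _ _ 1]) (simp add: indicator_def)
  from has_sum_pmf_integral[OF this subset_UNIV]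
  have "((\<lambda>x. pmf Q x * indicator B x) has_sum measure_pmf.prob Q B) UNIV" by simp
  then show ?thesis
    by (rule has_sum_cong_neutral[THEN iffD1, rotated -1]) (auto simp: indicator_def)
qed

text \<open>For r <= N this is \<open>add_inf\<close> after \<open>toG\<close>; read from the right,
  the finite coordinates are the entries of L with the staircase removed.\<close>

definition emb :: "nat \<Rightarrow> nat \<Rightarrow> (nat \<Rightarrow> int) \<Rightarrow> nat \<Rightarrow> eint" where
  "emb N r L = (\<lambda>i\<in>{1..N}. if N - i < r then Fin (L (N - i) - int (N - i)) else PInf)"

lemma add_inf_toG:
  assumes "r \<le> N"
  shows "add_inf N r (toG r L) = emb N r L"
proof (rule extensionalityI[of _ "{1..N}"])
  fix i assume i: "i \<in> {1..N}"
  show "add_inf N r (toG r L) i = emb N r L i"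
  proof (cases "i \<le> N - r")
    case True
    then show ?thesis using i assms by (auto simp: add_inf_def emb_def)
  next
    case False
    then have "i - (N - r) \<in> {1..r}" "r - (i - (N - r)) = N - i" "N - i < r" using i assms by auto
    then show ?thesis using i False by (simp add: add_inf_def emb_def toG_def)
  qed
qed (auto simp: add_inf_def emb_def)

lemma emb_GTbar:
  assumes "L \<in> strict_seqs r"
  shows "emb N r L \<in> GTbar N"
  unfolding signatures_def
proof safe
  fix i j assume ij: "i \<in> {1..N}" "j \<in> {1..N}" "i \<le> j"
  show "emb N r L j \<le> emb N r L i"
  proof (cases "N - i < r")
    case True
    have "L (N - j) + int (N - i - (N - j)) \<le> L (N - i)"
      by (rule strict_seqs_diff[OF assms]) (use ij True in auto)
    then show ?thesis using ij True by (simp add: emb_def of_nat_diff)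
  next
    case False
    then show ?thesis using ij by (simp add: emb_def)
  qed
qed (auto simp: emb_def)

lemma emb_num:
  assumes "r \<le> N"
  shows "num_finite {1..N} (emb N r L) = r"
proof -
  have "{i \<in> {1..N}. emb N r L i \<noteq> PInf} = {N - r + 1..N}"
    using assms by (auto simp: emb_def)
  then show ?thesis using assms by (simp add: num_finite_def)
qed

lemma emb_nth: "r \<le> N \<Longrightarrow> j < r \<Longrightarrow> emb N r L (N - j) = Fin (L j - int j)"
  by (auto simp: emb_def)

lemma emb_inj: "r \<le> N \<Longrightarrow> inj_on (emb N r) (strict_seqs r)"
proof (rule inj_onI)
  fix L M assume r: "r \<le> N" and LM: "L \<in> strict_seqs r" "M \<in> strict_seqs r" and eq: "emb N r L = emb N r M"
  show "L = M"
  proof (rule extensionalityI[of _ "{..<r}"])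
    fix j assume "j \<in> {..<r}"
    then show "L j = M j" using emb_nth[OF r, of j L] emb_nth[OF r, of j M] eq by simp
  qed (use LM in \<open>auto simp: strict_seqs_def\<close>)
qed

lemma GTbar_emb:
  assumes w: "w \<in> GTbar N"
  shows "\<exists>r\<le>N. \<exists>L\<in>strict_seqs r. w = emb N r L"
proof -
  \<comment> \<open>Reversing w and continuing it by \<open>PInf\<close> gives a boundary point, so
    that \<open>rk\<close> and \<open>Nbar_coords\<close> can be reused.\<close>
  define \<nu> where "\<nu> = (\<lambda>i\<in>{1..}. if i \<le> N then w (N + 1 - i) else PInf)"
  have \<nu>: "\<nu> \<in> Nbar"
    unfolding Nbar_def
  proof safe
    fix i j :: nat assume "1 \<le> i" "i \<le> j"
    have "w (N + 1 - i) \<le> w (N + 1 - j)" if "j \<le> N"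
    proof -
      have "N + 1 - j \<in> {1..N}" "N + 1 - i \<in> {1..N}" "N + 1 - j \<le> N + 1 - i"
        using that \<open>1 \<le> i\<close> \<open>i \<le> j\<close> by auto
      then show ?thesis using w unfolding signatures_def by blast
    qed
    then show "\<nu> i \<le> \<nu> j" using \<open>1 \<le> i\<close> \<open>i \<le> j\<close> by (simp add: \<nu>_def)
  qed (auto simp: \<nu>_def split: if_splits)
  have "w = emb N (rk \<nu> N) (Nbar_coords \<nu> N)"
  proof (rule extensionalityI[of _ "{1..N}"])
    show "w \<in> extensional {1..N}" using w by (auto simp: signatures_def PiE_def)
    fix i assume i: "i \<in> {1..N}"
    have \<nu>i: "\<nu> (Suc (N - i)) = w i" using i by (auto simp: \<nu>_def)
    have "N - i < rk \<nu> N \<longleftrightarrow> w i \<noteq> PInf" using rk_iff[OF \<nu>, of "N - i" N] \<nu>i i by auto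
    then show "w i = emb N (rk \<nu> N) (Nbar_coords \<nu> N) i"
      using i \<nu>i by (cases "w i") (auto simp: emb_def Nbar_coords_def)
  qed (auto simp: emb_def)
  then show ?thesis using rk_set(2)[OF \<nu>] Nbar_coords_strict[OF \<nu>] by blast
qed

lemma drop_inf_emb:
  assumes "r \<le> N" "L \<in> strict_seqs r"
  shows "drop_inf N r (emb N r L) = toG r L"
proof (rule extensionalityI[of _ "{1..r}"])
  fix i assume i: "i \<in> {1..r}"
  then have "N - (r - i) = N - r + i" "r - i < r" using assms by auto
  then have "emb N r L (N - r + i) = Fin (L (r - i) - int (r - i))"
    using emb_nth[OF assms(1), of "r - i" L] by simp
  then show "drop_inf N r (emb N r L) i = toG r L i" using i by (simp add: drop_inf_def toG_def)
qed (auto simp: drop_inf_def toG_def)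

lemma Nfin_rk: "\<nu> \<in> Nfin \<Longrightarrow> rk \<nu> M = M"
proof -
  assume "\<nu> \<in> Nfin"
  then have "{i \<in> {1..M}. \<nu> i \<noteq> PInf} = {1..M}" by (auto simp: Nfin_def)
  then show ?thesis by (simp add: rk_def num_finite_def)
qed

lemma not_Nfin_rk:
  assumes \<nu>: "\<nu> \<in> Nbar" and "\<nu> \<notin> Nfin"
  shows "rk \<nu> M = min M (num_finite {1..} \<nu>)"
proof -
  obtain i0 where i0: "i0 \<ge> 1" "\<nu> i0 = PInf" using assms by (auto simp: Nfin_def)
  have "i < i0" if "i \<ge> 1" "\<nu> i \<noteq> PInf" for i
    using Nbar_finite_mono[OF \<nu> i0(1), of i] i0(2) that by (cases "i < i0") auto
  then have "{i \<in> {1..}. \<nu> i \<noteq> PInf} = {i \<in> {1..i0 + M}. \<nu> i \<noteq> PInf}" by force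
  then have "num_finite {1..} \<nu> = rk \<nu> (i0 + M)" by (simp add: rk_def num_finite_def)
  then show ?thesis using rk_min[OF \<nu>, of M "i0 + M"] by (simp add: min.commute)
qed

lemma E_rank_rk: "\<nu> \<in> Nbar \<Longrightarrow> E_rank \<nu> N = rk \<nu> N"
  by (simp add: E_rank_def Nfin_rk not_Nfin_rk)

context qpar begin

text \<open>Both branches of \<open>ext_link\<close> are the same kernel: \<open>u = Suc N\<close>
  by \<open>link_step\<close>, \<open>u \<le> N\<close> by \<open>ext_link_stratum\<close>.\<close>

lemma ext_link_emb:
  assumes L: "L \<in> strict_seqs u" and u: "u \<le> Suc N" and M: "M \<in> strict_seqs r" and r: "r \<le> N"
  shows "ext_link q (Suc N) (emb (Suc N) u L) (emb N r M) = (if r = min u N then pmf (step_pmf N u L) M else 0)"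
proof -
  have n: "num_finite {1..Suc N} (emb (Suc N) u L) = u" "num_finite {1..Suc N - 1} (emb N r M) = r"
    using emb_num[OF u] emb_num[OF r] by simp_all
  have d: "drop_inf (Suc N) u (emb (Suc N) u L) = toG u L" "drop_inf (Suc N - 1) r (emb N r M) = toG r M"
    using drop_inf_emb[OF u L] drop_inf_emb[OF r M] by simp_all
  show ?thesis
  proof (cases "u = Suc N")
    case True
    have "link q (Suc N) (toG u L) (toG r M) = pmf (step_pmf N u L) M" if "r = N"
      using link_step[of "toG u L" N "toG r M"] toG_GT[OF L] toG_GT[OF M] toL_toG[OF L] toL_toG[OF M] True that by simp
    then show ?thesis
      using n d True unfolding ext_link_def Let_def by auto
  next
    case False
    then have uN: "u \<le> N" "min u N = u" using u by auto
    show ?thesis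
    proof (cases "r = u")
      case True
      have "toG u M \<in> GT u" "toL u (toG u M) = M" using M toG_GT toL_toG True by auto
      then show ?thesis
        using n d False True uN ext_link_stratum[OF toG_GT[OF L] _ uN(1), of "toG u M"] toL_toG[OF L]
        unfolding ext_link_def Let_def by simp
    next
      case ne: False
      show ?thesis unfolding ext_link_def Let_def n uN(2) using ne False by simp
    qed
  qed
qed

definition Elaw :: "(nat \<Rightarrow> eint) \<Rightarrow> nat \<Rightarrow> (nat \<Rightarrow> eint) pmf" where
  "Elaw \<nu> N = map_pmf (emb N (rk \<nu> N)) (Ebar \<nu> N)"

lemma set_Ebar_strict: "\<nu> \<in> Nbar \<Longrightarrow> set_pmf (Ebar \<nu> N) \<subseteq> strict_seqs (rk \<nu> N)"
  using set_Ebar[of \<nu> N] by auto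

lemma set_Elaw: "\<nu> \<in> Nbar \<Longrightarrow> set_pmf (Elaw \<nu> N) \<subseteq> GTbar N"
  using set_Ebar_strict[of \<nu> N] emb_GTbar by (auto simp: Elaw_def)

lemma pmf_Elaw:
  assumes "\<nu> \<in> Nbar" "M \<in> strict_seqs r" "r \<le> N"
  shows "pmf (Elaw \<nu> N) (emb N r M) = (if r = rk \<nu> N then pmf (Ebar \<nu> N) M else 0)"
proof (cases "r = rk \<nu> N")
  case True
  then show ?thesis
    unfolding Elaw_def using pmf_map_inj_on[OF emb_inj[OF assms(3)] _ assms(2), of "Ebar \<nu> N"] set_Ebar_strict[OF assms(1), of N]
    by simp
next
  case False
  have "emb N r M \<notin> set_pmf (Elaw \<nu> N)"
  proof
    assume "emb N r M \<in> set_pmf (Elaw \<nu> N)"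
    then obtain L where "emb N r M = emb N (rk \<nu> N) L" by (auto simp: Elaw_def)
    then show False using emb_num[OF assms(3), of M] emb_num[OF rk_set(2)[OF assms(1)], of N L] False by simp
  qed
  then show ?thesis using False by (simp add: set_pmf_iff)
qed

lemma Elaw_coherent:
  assumes \<nu>: "\<nu> \<in> Nbar" and v: "v \<in> GTbar N"
  shows "((\<lambda>w. pmf (Elaw \<nu> (Suc N)) w * ext_link q (Suc N) w v) has_sum pmf (Elaw \<nu> N) v) (GTbar (Suc N))"
proof -
  obtain r M where r: "r \<le> N" and M: "M \<in> strict_seqs r" and vM: "v = emb N r M" using GTbar_emb[OF v] by blast
  define u where "u = rk \<nu> (Suc N)"
  have u: "u \<le> Suc N" unfolding u_def by (rule rk_set(2)[OF \<nu>])
  have uN: "min u N = rk \<nu> N" using rk_min[OF \<nu>, of N "Suc N"] by (simp add: u_def)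
  have S: "set_pmf (Ebar \<nu> (Suc N)) \<subseteq> strict_seqs u" unfolding u_def by (rule set_Ebar_strict[OF \<nu>])
  have val: "ext_link q (Suc N) (emb (Suc N) u L) v = (if r = rk \<nu> N then pmf (step_pmf N u L) M else 0)" if "L \<in> strict_seqs u" for L
    unfolding vM ext_link_emb[OF that u M r] uN ..
  have "integrable (measure_pmf (Elaw \<nu> (Suc N))) (\<lambda>w. ext_link q (Suc N) w v)"
  proof (rule abs_expectation_le(1)[of _ _ 1])
    fix w assume "w \<in> set_pmf (Elaw \<nu> (Suc N))"
    then obtain L where "L \<in> strict_seqs u" "w = emb (Suc N) u L" using S by (auto simp: Elaw_def u_def)
    then show "\<bar>ext_link q (Suc N) w v\<bar> \<le> 1" using val by (simp add: pmf_le_1)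
  qed
  from has_sum_pmf_integral[OF this set_Elaw[OF \<nu>]]
  have "((\<lambda>w. pmf (Elaw \<nu> (Suc N)) w * ext_link q (Suc N) w v) has_sum
     measure_pmf.expectation (Elaw \<nu> (Suc N)) (\<lambda>w. ext_link q (Suc N) w v)) (GTbar (Suc N))"
    by (simp only: real_scaleR_def)
  also have "measure_pmf.expectation (Elaw \<nu> (Suc N)) (\<lambda>w. ext_link q (Suc N) w v) =
     measure_pmf.expectation (Ebar \<nu> (Suc N)) (\<lambda>L. ext_link q (Suc N) (emb (Suc N) u L) v)"
    by (simp add: Elaw_def u_def)
  also have "\<dots> = measure_pmf.expectation (Ebar \<nu> (Suc N)) (\<lambda>L. if r = rk \<nu> N then pmf (step_pmf N u L) M else 0)"
    by (rule integral_cong_AE) (use val S in \<open>auto intro!: AE_pmfI\<close>)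
  also have "\<dots> = pmf (Elaw \<nu> N) v"
  proof (cases "r = rk \<nu> N")
    case True
    have "pmf (Ebar \<nu> N) M = measure_pmf.expectation (Ebar \<nu> (Suc N)) (\<lambda>L. pmf (step_pmf N u L) M)"
      unfolding u_def by (subst Ebar_coherent[OF \<nu>]) (rule pmf_bind)
    then show ?thesis unfolding vM pmf_Elaw[OF \<nu> M r] using True by simp
  next
    case False
    then show ?thesis unfolding vM pmf_Elaw[OF \<nu> M r] by simp
  qed
  finally show ?thesis .
qed

section \<open>Identification with the measures given by generating functions\<close>

lemma vdm_torus_nonzero:
  assumes "x \<in> torus k"
  shows "vdm k x \<noteq> 0"
proof -
  have "x j - x i \<noteq> 0" if "i < j" "j < k" for i j
  proof
    assume "x j - x i = 0"
    then have "norm (x j) = norm (x i)" by simp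
    then show False using assms that pr_less[of i j] by (simp add: torus_def)
  qed
  then show ?thesis unfolding vdm_def by auto
qed

lemma schur_generating_function:
  fixes x :: "nat \<Rightarrow> complex"
  assumes p: "set_pmf p \<subseteq> GT k" and x: "(\<lambda>i. x (Suc i)) \<in> torus k"
  shows "((\<lambda>m. of_real (pmf p m) * (schur k m x / of_real (schur_princ q k m))) has_sum
     (of_real (vdm k pr) / vdm k (\<lambda>i. x (Suc i)) *
       measure_pmf.expectation (map_pmf (toL k) p) (\<lambda>m. alternant k (\<lambda>i. x (Suc i)) m / of_real (alternant k pr m)))) (GT k)"
proof -
  let ?x = "\<lambda>i. x (Suc i)"
  let ?H = "\<lambda>m. alternant k ?x m / of_real (alternant k pr m)"
  have S: "set_pmf (map_pmf (toL k) p) \<subseteq> strict_seqs k" using p toL_strict by auto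
  have "integrable (measure_pmf (map_pmf (toL k) p)) ?H"
    by (rule complex_expectation_bounded[of _ _ "torus_bound k"]) (use norm_alternant_ratio_le[OF x] S in blast)
  from has_sum_pmf_integral[OF this S]
  have "((\<lambda>m. pmf (map_pmf (toL k) p) (toL k m) *\<^sub>R ?H (toL k m)) has_sum measure_pmf.expectation (map_pmf (toL k) p) ?H) (GT k)"
    by (subst has_sum_reindex_bij_betw[OF bij_toL])
  then have "((\<lambda>m. of_real (vdm k pr) / vdm k ?x * (pmf (map_pmf (toL k) p) (toL k m) *\<^sub>R ?H (toL k m))) has_sum
     (of_real (vdm k pr) / vdm k ?x * measure_pmf.expectation (map_pmf (toL k) p) ?H)) (GT k)"
    by (rule has_sum_cmult_right)
  then show ?thesis
  proof (rule has_sum_cong[THEN iffD1, rotated])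
    fix m assume m: "m \<in> GT k"
    have "pmf (map_pmf (toL k) p) (toL k m) = pmf p m"
      by (rule pmf_map_inj_on[OF _ p m]) (rule bij_betw_imp_inj_on[OF bij_toL])
    then show "of_real (vdm k pr) / vdm k ?x * (pmf (map_pmf (toL k) p) (toL k m) *\<^sub>R ?H (toL k m)) =
      of_real (pmf p m) * (schur k m x / of_real (schur_princ q k m))"
      unfolding schur_ratio scaleR_conv_of_real by (simp only: mult.left_commute)
  qed
qed

lemma map_toL_toG:
  assumes "set_pmf Q \<subseteq> strict_seqs k"
  shows "map_pmf (toL k) (map_pmf (toG k) Q) = Q"
proof -
  have "map_pmf (\<lambda>L. toL k (toG k L)) Q = map_pmf (\<lambda>L. L) Q"
    by (rule pmf.map_cong) (use assms toL_toG in auto)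
  then show ?thesis by (simp add: map_pmf_comp map_pmf_ident)
qed

lemma map_toG_toL:
  assumes "set_pmf p \<subseteq> GT k"
  shows "map_pmf (toG k) (map_pmf (toL k) p) = p"
proof -
  have "map_pmf (\<lambda>L. toG k (toL k L)) p = map_pmf (\<lambda>L. L) p"
    by (rule pmf.map_cong) (use assms toG_toL in auto)
  then show ?thesis by (simp add: map_pmf_comp map_pmf_ident)
qed

text \<open>Existence for the definite description is \<open>Ebar_gen\<close>, uniqueness is
  \<open>torus_expectation_unique\<close>. Schur quotients and alternant quotients differ by the
  factor \<open>vdm k pr / vdm k x\<close>, which is nonzero on the torus and cancels.\<close>

theorem stable_measure_Ebar:
  assumes \<nu>: "\<nu> \<in> Nbar" and rk: "\<And>M. M \<ge> k \<Longrightarrow> rk \<nu> M = k" and kN: "k \<le> N"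
  shows "stable_measure q k N (rev_sig k \<nu>) = map_pmf (toG k) (Ebar \<nu> N)"
proof -
  let ?l = "rev_sig k \<nu>"
  define s :: "(nat \<Rightarrow> complex) \<Rightarrow> complex" where "s x = schur k ?l x / of_real (schur_princ q k ?l)
           * (\<Prod>r. \<Prod>i=1..k. of_real (1 - q ^ (N + 1 + r - i)) / (1 - of_real (q ^ (N + r)) * x i))" for x
  have S: "set_pmf (Ebar \<nu> N) \<subseteq> strict_seqs k" using set_Ebar_strict[OF \<nu>, of N] rk[OF kN] by simp
  have toLl: "toL k ?l = Nbar_coords \<nu> N"
    using toL_rev_sig[of \<nu> k] rk[of k] rk[OF kN] by (simp add: Nbar_coords_def)
  have torus: "(\<lambda>i. x (Suc i)) \<in> torus k \<longleftrightarrow> (\<forall>i\<in>{1..k}. norm (x i) = q powi (1 - int i))" for x :: "nat \<Rightarrow> complex"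
  proof
    assume a: "(\<lambda>i. x (Suc i)) \<in> torus k"
    show "\<forall>i\<in>{1..k}. norm (x i) = q powi (1 - int i)"
    proof
      fix i assume "i \<in> {1..k}"
      then obtain j where "i = Suc j" "j < k" by (cases i) auto
      then show "norm (x i) = q powi (1 - int i)" using a by (simp add: torus_def pr_def)
    qed
  qed (simp add: torus_def pr_def)
  have sE: "s x = of_real (vdm k pr) / vdm k (\<lambda>i. x (Suc i)) *
      measure_pmf.expectation (Ebar \<nu> N) (\<lambda>m. alternant k (\<lambda>i. x (Suc i)) m / of_real (alternant k pr m))"
    if "(\<lambda>i. x (Suc i)) \<in> torus k" for x
  proof -
    have "(\<Prod>i=1..k. of_real (1 - q ^ (N + 1 + r - i)) / (1 - of_real (q ^ (N + r)) * x i)) = gen_factor k (N + r) (\<lambda>i. x (Suc i))" for r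
      unfolding gen_factor_def by (rule prod.reindex_bij_witness[of _ Suc "\<lambda>i. i - 1"]) (auto simp: Suc_diff_le)
    moreover have "measure_pmf.expectation (Ebar \<nu> N) (\<lambda>m. alternant k (\<lambda>i. x (Suc i)) m / of_real (alternant k pr m)) =
       alternant k (\<lambda>i. x (Suc i)) (Nbar_coords \<nu> N) / of_real (alternant k pr (Nbar_coords \<nu> N)) * (\<Prod>r. gen_factor k (N + r) (\<lambda>i. x (Suc i)))"
      by (rule Ebar_gen[OF \<nu> _ that]) (use rk kN in auto)
    ultimately show ?thesis unfolding s_def schur_ratio toLl by simp
  qed
  have "(THE p. set_pmf p \<subseteq> GT k \<and>
     (\<forall>x :: nat \<Rightarrow> complex. (\<forall>i\<in>{1..k}. norm (x i) = q powi (1 - int i)) \<longrightarrow>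
        ((\<lambda>m. of_real (pmf p m) * (schur k m x / of_real (schur_princ q k m))) has_sum s x) (GT k))) = map_pmf (toG k) (Ebar \<nu> N)"
  proof (rule the_equality)
    have "set_pmf (map_pmf (toG k) (Ebar \<nu> N)) \<subseteq> GT k" using S toG_GT by auto
    moreover from this have "((\<lambda>m. of_real (pmf (map_pmf (toG k) (Ebar \<nu> N)) m) * (schur k m x / of_real (schur_princ q k m))) has_sum s x) (GT k)"
      if "\<forall>i\<in>{1..k}. norm (x i) = q powi (1 - int i)" for x
      using schur_generating_function[of "map_pmf (toG k) (Ebar \<nu> N)" k x] that torus[of x] sE[of x] map_toL_toG[OF S] by simp
    ultimately show "set_pmf (map_pmf (toG k) (Ebar \<nu> N)) \<subseteq> GT k \<and>
     (\<forall>x :: nat \<Rightarrow> complex. (\<forall>i\<in>{1..k}. norm (x i) = q powi (1 - int i)) \<longrightarrow>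
        ((\<lambda>m. of_real (pmf (map_pmf (toG k) (Ebar \<nu> N)) m) * (schur k m x / of_real (schur_princ q k m))) has_sum s x) (GT k))"
      by blast
  next
    fix p assume p: "set_pmf p \<subseteq> GT k \<and>
     (\<forall>x :: nat \<Rightarrow> complex. (\<forall>i\<in>{1..k}. norm (x i) = q powi (1 - int i)) \<longrightarrow>
        ((\<lambda>m. of_real (pmf p m) * (schur k m x / of_real (schur_princ q k m))) has_sum s x) (GT k))"
    have "map_pmf (toL k) p = Ebar \<nu> N"
    proof (rule torus_expectation_unique[OF _ S])
      show "set_pmf (map_pmf (toL k) p) \<subseteq> strict_seqs k" using p toL_strict by auto
      fix y assume y: "y \<in> torus k"
      define x where "x i = y (i - 1)" for i
      have xy: "(\<lambda>i. x (Suc i)) = y" by (simp add: x_def)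
      have xt: "(\<lambda>i. x (Suc i)) \<in> torus k" using y xy by simp
      have "of_real (vdm k pr) / vdm k y * measure_pmf.expectation (map_pmf (toL k) p) (\<lambda>m. alternant k y m / of_real (alternant k pr m)) = s x"
        using has_sum_unique[OF schur_generating_function[OF _ xt, of p]] p xt torus[of x] unfolding xy by blast
      also have "\<dots> = of_real (vdm k pr) / vdm k y * measure_pmf.expectation (Ebar \<nu> N) (\<lambda>m. alternant k y m / of_real (alternant k pr m))"
        using sE[OF xt] unfolding xy .
      finally show "measure_pmf.expectation (map_pmf (toL k) p) (\<lambda>m. alternant k y m / of_real (alternant k pr m)) =
         measure_pmf.expectation (Ebar \<nu> N) (\<lambda>m. alternant k y m / of_real (alternant k pr m))"
        using vdm_torus_nonzero[OF y] vdm_pr_pos[of k] by simp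
    qed
    then show "p = map_pmf (toG k) (Ebar \<nu> N)" using map_toG_toL[of p k] p by simp
  qed
  then show ?thesis unfolding stable_measure_def s_def .
qed

text \<open>Three cases: for finite \<open>\<nu>\<close> the compositions of links are the laws
  \<open>pre_E\<close>; for k <= N finite coordinates \<open>stable_measure_Ebar\<close> applies;
  for k > N the law at level k is carried down by \<open>Ebar_chain\<close>.\<close>

lemma E_mass_Ebar:
  assumes \<nu>: "\<nu> \<in> Nbar" and m: "m \<in> GT (rk \<nu> N)"
  shows "E_mass q \<nu> N m = pmf (Ebar \<nu> N) (toL (rk \<nu> N) m)"
proof (cases "\<nu> \<in> Nfin")
  case True
  note rk = Nfin_rk[OF True]
  have mN: "m \<in> GT N" using m rk by simp
  have "link_comp q N d (rev_sig (N + d) \<nu>) m = pmf (pre_E \<nu> N d) (toL N m)" for d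
  proof -
    have "toL (N + d) (rev_sig (N + d) \<nu>) = Nbar_coords \<nu> (N + d)" by (rule toL_rev_sig[OF rk])
    moreover have "rev_sig (N + d) \<nu> \<in> GT (N + d)"
      unfolding signatures_def
    proof safe
      fix i j assume ij: "i \<in> {1..N + d}" "j \<in> {1..N + d}" "i \<le> j"
      have "\<nu> (N + d + 1 - j) \<le> \<nu> (N + d + 1 - i)" by (rule Nbar_mono[OF \<nu>]) (use ij in auto)
      moreover have "\<nu> (N + d + 1 - j) \<noteq> PInf" "\<nu> (N + d + 1 - i) \<noteq> PInf" using True ij by (auto simp: Nfin_def)
      ultimately show "rev_sig (N + d) \<nu> j \<le> rev_sig (N + d) \<nu> i"
        using ij by (cases "\<nu> (N + d + 1 - j)"; cases "\<nu> (N + d + 1 - i)") (auto simp: rev_sig_def)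
    qed (auto simp: rev_sig_def)
    ultimately show ?thesis using link_comp_chain[OF _ mN] by (simp add: pre_E_def rk)
  qed
  then show ?thesis using Ebar_tendsto[OF \<nu>, of N "toL N m"] True by (simp add: E_mass_def rk limI)
next
  case False
  define k where "k = num_finite {1..} \<nu>"
  have rk: "rk \<nu> M = min M k" for M unfolding k_def by (rule not_Nfin_rk[OF \<nu> False])
  have stable: "stable_measure q k M (rev_sig k \<nu>) = map_pmf (toG k) (Ebar \<nu> M)" if "k \<le> M" for M
    by (rule stable_measure_Ebar[OF \<nu> _ that]) (simp add: rk min_absorb2)
  have pmfE: "pmf (stable_measure q k M (rev_sig k \<nu>)) p = pmf (Ebar \<nu> M) (toL k p)" if "k \<le> M" "p \<in> GT k" for M p
  proof -
    have "pmf (map_pmf (toG k) (Ebar \<nu> M)) (toG k (toL k p)) = pmf (Ebar \<nu> M) (toL k p)"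
      by (rule pmf_map_inj_on[OF bij_betw_imp_inj_on[OF bij_toG] _ toL_strict[OF that(2)]])
         (use set_Ebar_strict[OF \<nu>, of M] that(1) in \<open>simp add: rk min_absorb2\<close>)
    then show ?thesis unfolding stable[OF that(1)] toG_toL[OF that(2)] .
  qed
  show ?thesis
  proof (cases "k \<le> N")
    case True
    then have "rk \<nu> N = k" by (simp add: rk)
    then show ?thesis
      using False True pmfE[OF True, of m] m unfolding E_mass_def Let_def k_def[symmetric] by simp
  next
    case kN: False
    then have rN: "rk \<nu> N = N" and rk_k: "rk \<nu> k = k" by (auto simp: rk)
    have mN: "m \<in> GT N" using m rN by simp
    have kNd: "N + (k - N) = k" using kN by simp
    have S: "set_pmf (Ebar \<nu> k) \<subseteq> strict_seqs k" using set_Ebar_strict[OF \<nu>, of k] rk_k by simp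
    have "E_mass q \<nu> N m = (\<Sum>\<^sub>\<infinity>p\<in>GT k. pmf (stable_measure q k k (rev_sig k \<nu>)) p * link_comp q N (k - N) p m)"
      using False kN by (simp add: E_mass_def Let_def k_def)
    also have "\<dots> = (\<Sum>\<^sub>\<infinity>p\<in>GT k. pmf (Ebar \<nu> k) (toL k p) * pmf (chain_pmf N (k - N) k (toL k p)) (toL N m))"
      by (rule infsum_cong) (use pmfE[of k] link_comp_chain[of _ N "k - N" m] mN kNd in simp)
    also have "\<dots> = (\<Sum>\<^sub>\<infinity>L\<in>strict_seqs k. pmf (Ebar \<nu> k) L * pmf (chain_pmf N (k - N) k L) (toL N m))"
      by (rule infsum_reindex_bij_betw[OF bij_toL])
    also have "\<dots> = measure_pmf.expectation (Ebar \<nu> k) (\<lambda>L. pmf (chain_pmf N (k - N) k L) (toL N m))"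
    proof (rule infsumI)
      have "integrable (measure_pmf (Ebar \<nu> k)) (\<lambda>L. pmf (chain_pmf N (k - N) k L) (toL N m))"
        by (rule abs_expectation_le(1)[of _ _ 1]) (simp add: pmf_le_1)
      from has_sum_pmf_integral[OF this S]
      show "((\<lambda>L. pmf (Ebar \<nu> k) L * pmf (chain_pmf N (k - N) k L) (toL N m)) has_sum
         measure_pmf.expectation (Ebar \<nu> k) (\<lambda>L. pmf (chain_pmf N (k - N) k L) (toL N m))) (strict_seqs k)"
        by (simp only: real_scaleR_def)
    qed
    also have "\<dots> = pmf (bind_pmf (Ebar \<nu> k) (chain_pmf N (k - N) k)) (toL N m)" by (rule pmf_bind[symmetric])
    also have "bind_pmf (Ebar \<nu> k) (chain_pmf N (k - N) k) = Ebar \<nu> N"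
      using Ebar_chain[OF \<nu>, of N "k - N"] kNd rk_k by simp
    finally show ?thesis using rN by simp
  qed
qed

theorem E_measure_Elaw:
  assumes \<nu>: "\<nu> \<in> Nbar"
  shows "E_measure q \<nu> N A = (if A \<in> borel_sets_of (GTbar_topology N) then measure_pmf.prob (Elaw \<nu> N) A else 0)"
proof -
  define r where "r = rk \<nu> N"
  have r: "r \<le> N" unfolding r_def by (rule rk_set(2)[OF \<nu>])
  have S: "set_pmf (Ebar \<nu> N) \<subseteq> strict_seqs r" unfolding r_def by (rule set_Ebar_strict[OF \<nu>])
  have "(\<Sum>\<^sub>\<infinity>m\<in>{m \<in> GT r. add_inf N r m \<in> A}. E_mass q \<nu> N m) = (\<Sum>\<^sub>\<infinity>m\<in>{m \<in> GT r. add_inf N r m \<in> A}. pmf (Ebar \<nu> N) (toL r m))"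
    by (rule infsum_cong) (use E_mass_Ebar[OF \<nu>, of _ N] in \<open>simp add: r_def\<close>)
  also have "\<dots> = (\<Sum>\<^sub>\<infinity>L\<in>{L \<in> strict_seqs r. emb N r L \<in> A}. pmf (Ebar \<nu> N) L)"
  proof (rule infsum_reindex_bij_betw, rule bij_betw_byWitness[where f' = "toG r"])
    show "toL r ` {m \<in> GT r. add_inf N r m \<in> A} \<subseteq> {L \<in> strict_seqs r. emb N r L \<in> A}"
      using toL_strict add_inf_toG[OF r] toG_toL by (auto simp flip: add_inf_toG[OF r])
    show "toG r ` {L \<in> strict_seqs r. emb N r L \<in> A} \<subseteq> {m \<in> GT r. add_inf N r m \<in> A}"
      using toG_GT add_inf_toG[OF r] by auto
  qed (auto simp: toG_toL toL_toG)
  also have "\<dots> = measure_pmf.prob (Ebar \<nu> N) {L \<in> strict_seqs r. emb N r L \<in> A}"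
    by (rule infsumI[OF pmf_has_sum_prob])
  also have "\<dots> = measure_pmf.prob (Ebar \<nu> N) (emb N r -` A)"
    by (rule measure_eq_AE) (use S in \<open>auto intro!: AE_pmfI\<close>)
  also have "\<dots> = measure_pmf.prob (Elaw \<nu> N) A" by (simp add: Elaw_def r_def)
  finally show ?thesis unfolding E_measure_def E_rank_rk[OF \<nu>] r_def by simp
qed

end

section \<open>The embedding\<close>

lemma topspace_GTbar [simp]: "topspace (GTbar_topology N) = GTbar N"
  by (auto simp: GTbar_topology_def signatures_def)

lemma openin_GTbar_coord:
  assumes "i \<in> {1..N}" "open U"
  shows "openin (GTbar_topology N) {w \<in> GTbar N. w i \<in> U}"
proof -
  have "continuous_map (GTbar_topology N) euclidean (\<lambda>w. w i)"
    unfolding GTbar_topology_def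
    by (rule continuous_map_from_subtopology[OF continuous_map_product_projection[OF assms(1)]])
  from openin_continuous_map_preimage[OF this, of U] show ?thesis using assms(2) by simp
qed

lemma open_eint_compl_singleton: "open (- {a :: eint})"
  unfolding open_eint_def by (cases a) (auto intro: exI[of _ "the_int a + 1"])

lemma open_eint_Fin: "open {Fin a}"
  unfolding open_eint_def by simp

lemma open_eint_ge: "open {x. Fin l \<le> x}" "open (- {x. Fin l \<le> x})"
  unfolding open_eint_def by auto

lemma singleton_borel:
  assumes "w \<in> GTbar N"
  shows "{w} \<in> borel_sets_of (GTbar_topology N)"
proof -
  have "openin (GTbar_topology N) (\<Union>i\<in>{1..N}. {w' \<in> GTbar N. w' i \<in> - {w i}})"
  proof (intro openin_Union ballI)
    fix S assume "S \<in> (\<lambda>i. {w' \<in> GTbar N. w' i \<in> - {w i}}) ` {1..N}"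
    then obtain i where i: "i \<in> {1..N}" "S = {w' \<in> GTbar N. w' i \<in> - {w i}}" by blast
    show "openin (GTbar_topology N) S"
      unfolding i(2) by (rule openin_GTbar_coord[OF i(1) open_eint_compl_singleton])
  qed
  then have "topspace (GTbar_topology N) - (\<Union>i\<in>{1..N}. {w' \<in> GTbar N. w' i \<in> - {w i}}) \<in> borel_sets_of (GTbar_topology N)"
    unfolding borel_sets_of_def by (intro sigma_sets.Compl sigma_sets.Basic) simp
  also have "topspace (GTbar_topology N) - (\<Union>i\<in>{1..N}. {w' \<in> GTbar N. w' i \<in> - {w i}}) = {w}"
  proof
    show "topspace (GTbar_topology N) - (\<Union>i\<in>{1..N}. {w' \<in> GTbar N. w' i \<in> - {w i}}) \<subseteq> {w}"
    proof
      fix w' assume w': "w' \<in> topspace (GTbar_topology N) - (\<Union>i\<in>{1..N}. {w' \<in> GTbar N. w' i \<in> - {w i}})"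
      then have "w' i = w i" if "i \<in> {1..N}" for i using that by auto
      moreover have "w' \<in> extensional {1..N}" "w \<in> extensional {1..N}"
        using w' assms by (auto simp: signatures_def PiE_def)
      ultimately have "w' = w" by (intro extensionalityI[of _ "{1..N}"]) auto
      then show "w' \<in> {w}" by simp
    qed
  qed (use assms in auto)
  finally show ?thesis .
qed

context qpar begin

section \<open>Test functions and continuity of the map\<close>

lemma powi_inj: "q powi a = q powi b \<Longrightarrow> a = b"
  using powi_less[of a b] powi_less[of b a] by (cases a b rule: linorder_cases) auto

text \<open>Inverse of the encoding of coordinate j, which sends the integer a to q^(a + j) and
  \<open>PInf\<close> to 0.\<close>

definition point_coord :: "nat \<Rightarrow> real \<Rightarrow> eint" where
  "point_coord j t = (if t = 0 then PInf else Fin ((THE a. q powi a = t) - int j))"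

lemma point_coord_powi: "point_coord j (q powi a) = Fin (a - int j)"
proof -
  have "(THE b. q powi b = q powi a) = a" by (rule the_equality) (auto intro: powi_inj)
  then show ?thesis using q0 by (simp add: point_coord_def)
qed

definition point_sig :: "nat \<Rightarrow> (nat \<Rightarrow> real) \<Rightarrow> nat \<Rightarrow> eint" where
  "point_sig N y = (\<lambda>i\<in>{1..N}. point_coord (N - i) (y (N - i)))"

lemma point_sig_ysq: "r \<le> N \<Longrightarrow> point_sig N (ysq r L) = emb N r L"
  by (auto simp: point_sig_def emb_def fun_eq_iff ysq_def point_coord_powi) (simp add: point_coord_def)

text \<open>Near 0 a small value means a large exponent, hence a coordinate close to
  \<open>PInf\<close>; at all other values the admissible points are isolated by
  \<open>powi_separated\<close>.\<close>

lemma continuous_map_point_coord: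
  assumes "j < N"
  shows "continuous_map (top_of_set (configs N l)) euclidean (\<lambda>y. point_coord j (y j))"
  unfolding continuous_map_def
proof (intro conjI allI impI)
  fix U :: "eint set" assume "openin euclidean U"
  then have U: "open U" by simp
  show "openin (top_of_set (configs N l)) {y \<in> topspace (top_of_set (configs N l)). point_coord j (y j) \<in> U}"
  proof (subst openin_subopen, safe)
    fix y assume y: "y \<in> topspace (top_of_set (configs N l))" "point_coord j (y j) \<in> U"
    have vals: "y' j \<in> vals l" if "y' \<in> configs N l" for y'
      using that assms by (auto simp: configs_def dest!: spec[of _ j])
    have coord_open: "openin (top_of_set (configs N l)) {y' \<in> configs N l. y' j \<in> V}" if "open V" for V :: "real set"
    proof -
      have "open ((\<lambda>y' :: nat \<Rightarrow> real. y' j) -` V)" by (rule open_vimage[OF that continuous_on_product_coordinates])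
      then show ?thesis by (auto simp: openin_open intro!: exI[of _ "(\<lambda>y' :: nat \<Rightarrow> real. y' j) -` V"])
    qed
    have "\<exists>V. open V \<and> y j \<in> V \<and> (\<forall>t\<in>vals l. t \<in> V \<longrightarrow> point_coord j t \<in> U)"
    proof (cases "y j = 0")
      case True
      then have "PInf \<in> U" using y(2) by (simp add: point_coord_def)
      then obtain b where b: "\<And>m. m \<ge> b \<Longrightarrow> Fin m \<in> U" using U by (auto simp: open_eint_def)
      have "point_coord j t \<in> U" if "t \<in> vals l" "t < q powi (b + int j)" for t
      proof (cases "t = 0")
        case False
        moreover note that(1)
        ultimately obtain n where n: "t = q powi (l + int n)" by (auto simp: vals_def)
        have "b + int j < l + int n"
        proof (rule ccontr)
          assume "\<not> b + int j < l + int n"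
          then have "q powi (b + int j) \<le> q powi (l + int n)" by (intro powi_le) simp
          then show False using that(2) n by simp
        qed
        then show ?thesis unfolding n point_coord_powi by (intro b) simp
      qed (use \<open>PInf \<in> U\<close> in \<open>simp add: point_coord_def\<close>)
      then show ?thesis using True q0 by (intro exI[of _ "{..<q powi (b + int j)}"]) auto
    next
      case False
      then obtain n where n: "y j = q powi (l + int n)" using vals y(1) by (auto simp: vals_def)
      define a where "a = l + int n"
      have "t = q powi a" if "t \<in> vals l" "\<bar>t - q powi a\<bar> < q powi a * (1 - q)" for t
      proof (cases "t = 0")
        case True
        have "0 < q powi a" "0 < q powi a * q" using q0 by auto
        then show ?thesis using that(2) True by (simp add: algebra_simps)
      next
        case False
        moreover note that(1)
        ultimately obtain n' where n': "t = q powi (l + int n')" by (auto simp: vals_def)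
        then show ?thesis using powi_separated[of a "l + int n'"] that(2) by (cases "a = l + int n'") auto
      qed
      then have "\<forall>t\<in>vals l. t \<in> ball (q powi a) (q powi a * (1 - q)) \<longrightarrow> point_coord j t \<in> U"
        using y(2) n by (auto simp: dist_real_def abs_minus_commute a_def)
      then show ?thesis using n q0 q1 by (intro exI[of _ "ball (q powi a) (q powi a * (1 - q))"]) (auto simp: a_def)
    qed
    then obtain V where V: "open V" "y j \<in> V" "\<forall>t\<in>vals l. t \<in> V \<longrightarrow> point_coord j t \<in> U" by blast
    show "\<exists>T. openin (top_of_set (configs N l)) T \<and> y \<in> T \<and> T \<subseteq> {y \<in> topspace (top_of_set (configs N l)). point_coord j (y j) \<in> U}"
      using coord_open[OF V(1)] V(2,3) y(1) vals by (intro exI[of _ "{y' \<in> configs N l. y' j \<in> V}"]) auto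
  qed
qed auto

text \<open>Turns a test function on \<open>GTbar N\<close> into a continuous function on the
  compact space of configurations, to which \<open>continuous_map_Ebar\<close> applies.\<close>

lemma continuous_on_point_sig:
  assumes f: "continuous_map (GTbar_topology N) euclideanreal f"
  shows "continuous_on (configs N l) (\<lambda>y. f (point_sig N y))"
proof -
  have "continuous_map (top_of_set (configs N l)) (product_topology (\<lambda>_. euclidean) {1..N}) (point_sig N)"
    unfolding continuous_map_componentwise
  proof (intro conjI ballI)
    show "point_sig N ` topspace (top_of_set (configs N l)) \<subseteq> extensional {1..N}" by (auto simp: point_sig_def)
    fix i assume i: "i \<in> {1..N}"
    then have "continuous_map (top_of_set (configs N l)) euclidean (\<lambda>y. point_coord (N - i) (y (N - i)))"
      by (intro continuous_map_point_coord) auto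
    then show "continuous_map (top_of_set (configs N l)) euclidean (\<lambda>y. point_sig N y i)"
      using i by (simp add: point_sig_def)
  qed
  moreover have "point_sig N y \<in> GTbar N" if "y \<in> configs N l" for y
  proof -
    have "\<exists>k\<le>N. \<exists>m\<in>lbseqs k l. y = ysq k m" by (rule configs_ysq[OF that])
    then obtain k m where "k \<le> N" "m \<in> lbseqs k l" "y = ysq k m" by blast
    then show ?thesis using emb_GTbar[of m k N] point_sig_ysq by (auto simp: lbseqs_def)
  qed
  ultimately have "continuous_map (top_of_set (configs N l)) (GTbar_topology N) (point_sig N)"
    unfolding GTbar_topology_def continuous_map_in_subtopology by auto
  from continuous_map_compose[OF this f] show ?thesis by (simp add: o_def)
qed

lemma E_measure_singleton:
  assumes "\<nu> \<in> Nbar" "w \<in> GTbar N"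
  shows "E_measure q \<nu> N {w} = pmf (Elaw \<nu> N) w"
  using E_measure_Elaw[OF assms(1), of N "{w}"] singleton_borel[OF assms(2)] by (simp add: pmf.rep_eq)

lemma infsum_E_measure:
  assumes \<nu>: "\<nu> \<in> Nbar" and f: "bounded (f ` GTbar N)"
  shows "(\<Sum>\<^sub>\<infinity>w\<in>GTbar N. f w * E_measure q \<nu> N {w}) = measure_pmf.expectation (Elaw \<nu> N) f"
proof -
  obtain B where B: "\<And>w. w \<in> GTbar N \<Longrightarrow> \<bar>f w\<bar> \<le> B" using f by (auto simp: bounded_iff)
  have "(\<Sum>\<^sub>\<infinity>w\<in>GTbar N. f w * E_measure q \<nu> N {w}) = (\<Sum>\<^sub>\<infinity>w\<in>GTbar N. pmf (Elaw \<nu> N) w * f w)"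
    by (rule infsum_cong) (simp add: E_measure_singleton[OF \<nu>] mult.commute)
  also have "\<dots> = measure_pmf.expectation (Elaw \<nu> N) f"
  proof (rule infsumI)
    have "integrable (measure_pmf (Elaw \<nu> N)) f"
      by (rule abs_expectation_le(1)[of _ _ B]) (use B set_Elaw[OF \<nu>] in blast)
    from has_sum_pmf_integral[OF this set_Elaw[OF \<nu>]]
    show "((\<lambda>w. pmf (Elaw \<nu> N) w * f w) has_sum measure_pmf.expectation (Elaw \<nu> N) f) (GTbar N)"
      by (simp only: real_scaleR_def)
  qed
  finally show ?thesis .
qed

lemma E_measure_proj_limit:
  assumes \<nu>: "\<nu> \<in> Nbar"
  shows "E_measure q \<nu> \<in> proj_limit q"
  unfolding proj_limit_def
proof (intro CollectI conjI allI impI ballI)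
  note E = E_measure_Elaw[OF \<nu>]
  fix N
  show "E_measure q \<nu> N \<in> signed_measures (GTbar_topology N)"
    unfolding signed_measures_def
  proof (intro CollectI conjI allI impI)
    fix A :: "nat \<Rightarrow> (nat \<Rightarrow> eint) set"
    assume A: "range A \<subseteq> borel_sets_of (GTbar_topology N)" "disjoint_family A"
    then have "(\<Union>i. A i) \<in> borel_sets_of (GTbar_topology N)"
      unfolding borel_sets_of_def by (intro sigma_sets.Union) auto
    moreover have "A i \<in> borel_sets_of (GTbar_topology N)" for i using A(1) by auto
    moreover have "(\<lambda>i. measure_pmf.prob (Elaw \<nu> N) (A i)) sums measure_pmf.prob (Elaw \<nu> N) (\<Union>i. A i)"
      by (rule measure_pmf.finite_measure_UNION) (use A(2) in auto)
    ultimately show "(\<lambda>i. E_measure q \<nu> N (A i)) sums E_measure q \<nu> N (\<Union>i. A i)" by (simp add: E)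
  qed (simp add: E)
next
  fix N v assume N: "N \<ge> 1" and v: "v \<in> GTbar (N - 1)"
  obtain n where n: "N = Suc n" using N by (cases N) auto
  have vn: "v \<in> GTbar n" using v n by simp
  have "(\<Sum>\<^sub>\<infinity>w\<in>GTbar (Suc n). E_measure q \<nu> (Suc n) {w} * ext_link q (Suc n) w v) =
     (\<Sum>\<^sub>\<infinity>w\<in>GTbar (Suc n). pmf (Elaw \<nu> (Suc n)) w * ext_link q (Suc n) w v)"
    by (rule infsum_cong) (simp add: E_measure_singleton[OF \<nu>])
  also have "\<dots> = pmf (Elaw \<nu> n) v" by (rule infsumI[OF Elaw_coherent[OF \<nu> vn]])
  finally show "E_measure q \<nu> (N - 1) {v} = (\<Sum>\<^sub>\<infinity>w\<in>GTbar N. E_measure q \<nu> N {w} * ext_link q N w v)"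
    using E_measure_singleton[OF \<nu> vn] n by simp
next
  have "tv_norm (GTbar_topology N) (E_measure q \<nu> N) \<le> 1" for N
    unfolding tv_norm_def
  proof (rule SUP_least)
    fix F assume "F \<in> {F. finite F \<and> F \<subseteq> borel_sets_of (GTbar_topology N) \<and> disjoint F}"
    then have F: "finite F" "F \<subseteq> borel_sets_of (GTbar_topology N)" "disjoint F" by auto
    have "(\<Sum>A\<in>F. ennreal \<bar>E_measure q \<nu> N A\<bar>) = (\<Sum>A\<in>F. ennreal (measure_pmf.prob (Elaw \<nu> N) A))"
      by (rule sum.cong) (use F(2) E_measure_Elaw[OF \<nu>] in auto)
    also have "\<dots> = ennreal (\<Sum>A\<in>F. measure_pmf.prob (Elaw \<nu> N) A)" by (rule sum_ennreal) simp
    also have "(\<Sum>A\<in>F. measure_pmf.prob (Elaw \<nu> N) A) = measure_pmf.prob (Elaw \<nu> N) (\<Union>A\<in>F. A)"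
      by (rule measure_pmf.finite_measure_finite_Union[symmetric])
         (use F in \<open>auto simp: disjoint_family_on_def disjoint_def\<close>)
    also have "ennreal \<dots> \<le> 1" by simp
    finally show "(\<Sum>A\<in>F. ennreal \<bar>E_measure q \<nu> N A\<bar>) \<le> 1" .
  qed
  then have "(SUP N. tv_norm (GTbar_topology N) (E_measure q \<nu> N)) \<le> 1" by (rule SUP_least)
  then show "(SUP N. tv_norm (GTbar_topology N) (E_measure q \<nu> N)) < \<infinity>"
    by (rule le_less_trans) simp
qed

lemma openin_weak_test:
  assumes "continuous_map (GTbar_topology N) euclideanreal f" "bounded (f ` GTbar N)" "open U"
  shows "openin (weak_topology q) {M \<in> proj_limit q. (\<Sum>\<^sub>\<infinity>w\<in>GTbar N. f w * M N {w}) \<in> U}"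
  unfolding weak_topology_def
  by (rule topology_generated_by_Basis) (use assms in blast)

lemma topspace_weak [simp]: "topspace (weak_topology q) = proj_limit q"
proof
  show "topspace (weak_topology q) \<subseteq> proj_limit q"
    unfolding weak_topology_def topology_generated_by_topspace by auto
  show "proj_limit q \<subseteq> topspace (weak_topology q)"
    using openin_subset[OF openin_weak_test[of 0 "\<lambda>_. 0" UNIV]] by (auto simp: bounded_iff image_iff)
qed

lemma openin_lower_Nbar: "openin (lower_Nbar l) U \<Longrightarrow> openin Nbar_topology U"
proof -
  assume "openin (lower_Nbar l) U"
  then obtain T where T: "openin Nbar_topology T" "U = T \<inter> {\<nu>. Fin l \<le> \<nu> 1}"
    unfolding lower_Nbar_def openin_subtopology by blast
  have "U = T \<inter> {\<nu> \<in> Nbar. Fin l \<le> \<nu> 1}" using T openin_subset[OF T(1)] by auto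
  moreover have "openin Nbar_topology {\<nu> \<in> Nbar. Fin l \<le> \<nu> 1}"
    using openin_Nbar_cylinder_tail[of 0] by simp
  ultimately show ?thesis using T(1) by auto
qed

lemma continuous_map_Elaw:
  assumes f: "continuous_map (GTbar_topology N) euclideanreal f"
  shows "continuous_map Nbar_topology euclideanreal (\<lambda>\<nu>. measure_pmf.expectation (Elaw \<nu> N) f)"
proof (rule continuous_map_realI)
  fix \<nu> and e :: real assume "\<nu> \<in> topspace Nbar_topology" and e: "e > 0"
  then have \<nu>: "\<nu> \<in> Nbar" by simp
  \<comment> \<open>Continuity is local, and the boundary points bounded below by l form an open set
    on which all laws live on one compact space.\<close>
  obtain l where l: "Fin l \<le> \<nu> 1" using Nbar_lower by blast
  have \<nu>l: "\<nu> \<in> topspace (lower_Nbar l)" using \<nu> l by (simp add: topspace_lower_Nbar)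
  let ?I = "\<lambda>\<nu>. measure_pmf.expectation (Elaw \<nu> N) f"
  have "?I \<nu> = measure_pmf.expectation (Ebar \<nu> N) (\<lambda>m. f (point_sig N (ysq (rk \<nu> N) m)))" if "\<nu> \<in> Nbar" for \<nu>
    unfolding Elaw_def by (simp add: point_sig_ysq[OF rk_set(2)[OF that]])
  then have c: "continuous_map (lower_Nbar l) euclideanreal ?I"
    by (intro continuous_map_eq[OF continuous_map_Ebar[OF continuous_on_point_sig[OF f]]]) (simp add: topspace_lower_Nbar)
  let ?U = "{\<nu>' \<in> topspace (lower_Nbar l). ?I \<nu>' \<in> ball (?I \<nu>) e}"
  have "openin (lower_Nbar l) ?U" by (rule openin_continuous_map_preimage[OF c]) simp
  then have "openin Nbar_topology ?U" by (rule openin_lower_Nbar)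
  then show "\<exists>U. openin Nbar_topology U \<and> \<nu> \<in> U \<and> (\<forall>\<nu>'\<in>U. \<bar>?I \<nu>' - ?I \<nu>\<bar> < e)"
    using \<nu>l e by (intro exI[of _ ?U]) (auto simp: dist_real_def abs_minus_commute)
qed

lemma continuous_map_E_measure: "continuous_map Nbar_topology (weak_topology q) (E_measure q)"
  unfolding weak_topology_def
proof (rule continuous_on_generated_topo)
  fix S assume "S \<in> {{M \<in> proj_limit q. (\<Sum>\<^sub>\<infinity>w\<in>GTbar N. f w * M N {w}) \<in> U} | N f U.
        continuous_map (GTbar_topology N) euclideanreal f \<and> bounded (f ` GTbar N) \<and> open U}"
  then obtain N f U where S: "S = {M \<in> proj_limit q. (\<Sum>\<^sub>\<infinity>w\<in>GTbar N. f w * M N {w}) \<in> U}"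
    and f: "continuous_map (GTbar_topology N) euclideanreal f" "bounded (f ` GTbar N)" and U: "open U" by blast
  have "E_measure q -` S \<inter> topspace Nbar_topology = {\<nu> \<in> topspace Nbar_topology. measure_pmf.expectation (Elaw \<nu> N) f \<in> U}"
    using E_measure_proj_limit infsum_E_measure[OF _ f(2)] by (auto simp: S)
  also have "openin Nbar_topology \<dots>"
    by (rule openin_continuous_map_preimage[OF continuous_map_Elaw[OF f(1)]]) (use U in simp)
  finally show "openin Nbar_topology (E_measure q -` S \<inter> topspace Nbar_topology)" .
next
  show "E_measure q ` topspace Nbar_topology \<subseteq> \<Union> {{M \<in> proj_limit q. (\<Sum>\<^sub>\<infinity>w\<in>GTbar N. f w * M N {w}) \<in> U} | N f U.
        continuous_map (GTbar_topology N) euclideanreal f \<and> bounded (f ` GTbar N) \<and> open U}"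
    using topspace_weak E_measure_proj_limit unfolding weak_topology_def topology_generated_by_topspace by auto
qed

section \<open>Recovery of the coordinates and continuity of the inverse\<close>

lemma Elaw_concentration:
  assumes \<nu>: "\<nu> \<in> Nbar" and "n < N"
  shows "measure_pmf.prob (Elaw \<nu> N) {w. w (N - n) = \<nu> (Suc n)} \<ge> 1 - mean_const n / (1 - q) * q ^ (N - n)"
proof (cases "n < rk \<nu> N")
  case True
  then have "\<nu> (Suc n) \<noteq> PInf" using rk_iff[OF \<nu> assms(2)] by simp
  then have Nbar_coords: "\<nu> (Suc n) = Fin (Nbar_coords \<nu> N n - int n)" using True by (cases "\<nu> (Suc n)") (auto simp: Nbar_coords_def)
  have "measure_pmf.prob (Ebar \<nu> N) {m. m n = Nbar_coords \<nu> N n} \<le> measure_pmf.prob (Ebar \<nu> N) (emb N (rk \<nu> N) -` {w. w (N - n) = \<nu> (Suc n)})"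
    by (rule measure_pmf.finite_measure_mono) (use Nbar_coords emb_nth[OF rk_set(2)[OF \<nu>] True] in auto)
  then show ?thesis using Ebar_concentration[OF \<nu> True] by (simp add: Elaw_def)
next
  \<comment> \<open>An infinite coordinate of \<open>\<nu>\<close> is infinite in every
    configuration of the stratum, so the event is certain.\<close>
  case False
  then have "\<nu> (Suc n) = PInf" using rk_iff[OF \<nu> assms(2)] by simp
  moreover have "emb N (rk \<nu> N) L (N - n) = PInf" for L using False assms(2) by (auto simp: emb_def)
  ultimately have "emb N (rk \<nu> N) -` {w. w (N - n) = \<nu> (Suc n)} = UNIV" by auto
  then have "measure_pmf.prob (Elaw \<nu> N) {w. w (N - n) = \<nu> (Suc n)} = 1" by (simp add: Elaw_def)
  then show ?thesis using mean_const_pos[of n] q0 q1 by simp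
qed

lemma continuous_map_clopen_indicator:
  assumes "openin X {x \<in> topspace X. P x}" "openin X {x \<in> topspace X. \<not> P x}"
  shows "continuous_map X euclideanreal (\<lambda>x. if P x then 1 else 0)"
proof (rule continuous_map_realI)
  fix x and e :: real assume "x \<in> topspace X" "e > 0"
  then show "\<exists>U. openin X U \<and> x \<in> U \<and> (\<forall>y\<in>U. \<bar>(if P y then 1 else 0) - (if P x then 1 else 0)\<bar> < e)"
    using assms by (cases "P x") (auto intro!: exI[of _ "{y \<in> topspace X. P y = P x}"])
qed

text \<open>The coordinates of \<open>\<nu>\<close> are read off from the measures on a high level, where they carry
  more than half of the mass.\<close>

lemma weak_separation:
  assumes \<nu>: "\<nu> \<in> Nbar" and C: "open C" "open (- C)" and \<nu>C: "\<nu> (Suc n) \<in> C"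
  shows "\<exists>V. openin (weak_topology q) V \<and> E_measure q \<nu> \<in> V \<and> (\<forall>\<nu>'\<in>Nbar. E_measure q \<nu>' \<in> V \<longrightarrow> \<nu>' (Suc n) \<in> C)"
proof -
  have "(\<lambda>d. mean_const n / (1 - q) * q ^ Suc d) \<longlonglongrightarrow> mean_const n / (1 - q) * 0"
    by (intro tendsto_intros LIMSEQ_Suc LIMSEQ_realpow_zero) (use q0 q1 in auto)
  then have "\<forall>\<^sub>F d in sequentially. mean_const n / (1 - q) * q ^ Suc d < 1 / 4" by (rule order_tendstoD) simp
  then obtain d where d: "mean_const n / (1 - q) * q ^ Suc d < 1 / 4" by (auto simp: eventually_sequentially)
  \<comment> \<open>With an error below 1/4, the true coordinate carries more than 3/4 of the mass,
    for every boundary point at this same N. An event of mass above 1/2 therefore cannot be disjoint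
    from it.\<close>
  define N where "N = n + Suc d"
  have N: "n < N" "N - n = Suc d" "N - n \<in> {1..N}" by (auto simp: N_def)
  define f where "f w = (if w (N - n) \<in> C then 1 else 0 :: real)" for w :: "nat \<Rightarrow> eint"
  have "continuous_map (GTbar_topology N) euclideanreal f"
    unfolding f_def
  proof (rule continuous_map_clopen_indicator)
    show "openin (GTbar_topology N) {w \<in> topspace (GTbar_topology N). w (N - n) \<in> C}"
      using openin_GTbar_coord[OF N(3) C(1)] by simp
    show "openin (GTbar_topology N) {w \<in> topspace (GTbar_topology N). w (N - n) \<notin> C}"
      using openin_GTbar_coord[OF N(3) C(2)] by simp
  qed
  moreover have b: "bounded (f ` GTbar N)" by (auto simp: bounded_iff f_def intro!: exI[of _ 1])
  ultimately have V: "openin (weak_topology q) {M \<in> proj_limit q. (\<Sum>\<^sub>\<infinity>w\<in>GTbar N. f w * M N {w}) \<in> {1/2<..}}"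
    by (rule openin_weak_test) simp
  have I: "(\<Sum>\<^sub>\<infinity>w\<in>GTbar N. f w * E_measure q \<nu>' N {w}) = measure_pmf.prob (Elaw \<nu>' N) {w. w (N - n) \<in> C}" if "\<nu>' \<in> Nbar" for \<nu>'
  proof -
    have "f = indicator {w. w (N - n) \<in> C}" by (auto simp: f_def indicator_def fun_eq_iff)
    then show ?thesis unfolding infsum_E_measure[OF that b] by simp
  qed
  have conc: "measure_pmf.prob (Elaw \<nu>' N) {w. w (N - n) = \<nu>' (Suc n)} > 3 / 4" if "\<nu>' \<in> Nbar" for \<nu>'
    using Elaw_concentration[OF that N(1)] d N(2) by simp
  have "measure_pmf.prob (Elaw \<nu> N) {w. w (N - n) = \<nu> (Suc n)} \<le> measure_pmf.prob (Elaw \<nu> N) {w. w (N - n) \<in> C}"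
    by (rule measure_pmf.finite_measure_mono) (use \<nu>C in auto)
  then have "measure_pmf.prob (Elaw \<nu> N) {w. w (N - n) \<in> C} > 1 / 2" using conc[OF \<nu>] by simp
  then have "E_measure q \<nu> \<in> {M \<in> proj_limit q. (\<Sum>\<^sub>\<infinity>w\<in>GTbar N. f w * M N {w}) \<in> {1/2<..}}"
    using E_measure_proj_limit[OF \<nu>] I[OF \<nu>] by simp
  moreover have "\<nu>' (Suc n) \<in> C"
    if \<nu>': "\<nu>' \<in> Nbar" and m: "E_measure q \<nu>' \<in> {M \<in> proj_limit q. (\<Sum>\<^sub>\<infinity>w\<in>GTbar N. f w * M N {w}) \<in> {1/2<..}}" for \<nu>'
  proof (rule ccontr)
    assume n: "\<nu>' (Suc n) \<notin> C"
    let ?A = "{w :: nat \<Rightarrow> eint. w (N - n) \<in> C}" and ?B = "{w. w (N - n) = \<nu>' (Suc n)}"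
    have "measure_pmf.prob (Elaw \<nu>' N) (?A \<union> ?B) = measure_pmf.prob (Elaw \<nu>' N) ?A + measure_pmf.prob (Elaw \<nu>' N) ?B"
      by (rule measure_pmf.finite_measure_Union) (use n in auto)
    moreover have "measure_pmf.prob (Elaw \<nu>' N) ?A > 1 / 2" using m I[OF \<nu>'] by simp
    moreover have "measure_pmf.prob (Elaw \<nu>' N) (?A \<union> ?B) \<le> 1" by simp
    ultimately show False using conc[OF \<nu>'] by linarith
  qed
  ultimately show ?thesis using V by blast
qed

lemma weak_separation_Fin:
  assumes "\<nu> \<in> Nbar" "1 \<le> i" "\<nu> i = Fin a"
  shows "\<exists>V. openin (weak_topology q) V \<and> E_measure q \<nu> \<in> V \<and> (\<forall>\<nu>'\<in>Nbar. E_measure q \<nu>' \<in> V \<longrightarrow> \<nu>' i = Fin a)"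
proof -
  obtain n where "i = Suc n" using assms(2) by (cases i) auto
  then show ?thesis
    using weak_separation[OF assms(1) open_eint_Fin[of a] open_eint_compl_singleton, of n] assms(3) by simp
qed

text \<open>Separating finite values suffices: where two sequences differ, at least one of the two
  coordinates is finite.\<close>

lemma inj_on_E_measure: "inj_on (E_measure q) Nbar"
proof (rule inj_onI)
  fix \<nu> \<nu>' assume \<nu>: "\<nu> \<in> Nbar" "\<nu>' \<in> Nbar" and eq: "E_measure q \<nu> = E_measure q \<nu>'"
  show "\<nu> = \<nu>'"
  proof (rule extensionalityI[of _ "{1..}"])
    fix i :: nat assume i: "i \<in> {1..}"
    have "\<nu>' i = Fin a" if "\<nu> i = Fin a" for a
      using weak_separation_Fin[OF \<nu>(1) _ that] i \<nu>(2) eq by auto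
    moreover have "\<nu> i = Fin a" if "\<nu>' i = Fin a" for a
      using weak_separation_Fin[OF \<nu>(2) _ that] i \<nu>(1) eq by auto
    ultimately show "\<nu> i = \<nu>' i" by (cases "\<nu> i"; cases "\<nu>' i") auto
  qed (use \<nu> in \<open>auto simp: Nbar_def PiE_def\<close>)
qed

lemma openin_image_E_measure:
  assumes U: "U \<subseteq> Nbar"
    and sep: "\<And>\<nu>. \<nu> \<in> U \<Longrightarrow> \<exists>V. openin (weak_topology q) V \<and> E_measure q \<nu> \<in> V \<and> (\<forall>\<nu>'\<in>Nbar. E_measure q \<nu>' \<in> V \<longrightarrow> \<nu>' \<in> U)"
  shows "openin (subtopology (weak_topology q) (E_measure q ` Nbar)) (E_measure q ` U)"
proof (subst openin_subopen, safe)
  fix \<nu> assume "\<nu> \<in> U"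
  from sep[OF this] obtain V where V: "openin (weak_topology q) V" "E_measure q \<nu> \<in> V"
    "\<forall>\<nu>'\<in>Nbar. E_measure q \<nu>' \<in> V \<longrightarrow> \<nu>' \<in> U" by blast
  have "openin (subtopology (weak_topology q) (E_measure q ` Nbar)) (V \<inter> E_measure q ` Nbar)"
    using V(1) by (auto simp: openin_subtopology)
  then show "\<exists>T. openin (subtopology (weak_topology q) (E_measure q ` Nbar)) T \<and> E_measure q \<nu> \<in> T \<and> T \<subseteq> E_measure q ` U"
    using V(2,3) U \<open>\<nu> \<in> U\<close> by (intro exI[of _ "V \<inter> E_measure q ` Nbar"]) auto
qed

lemma weak_separation_cylinder:
  assumes \<nu>: "\<nu> \<in> Nbar" and "\<And>i. i \<in> {1..k} \<Longrightarrow> \<nu> i = Fin (\<eta> i)"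
  shows "\<exists>V. openin (weak_topology q) V \<and> E_measure q \<nu> \<in> V \<and>
    (\<forall>\<nu>'\<in>Nbar. E_measure q \<nu>' \<in> V \<longrightarrow> (\<forall>i\<in>{1..k}. \<nu>' i = Fin (\<eta> i)))"
  using assms(2)
proof (induction k)
  case 0
  then show ?case using E_measure_proj_limit[OF \<nu>] by (intro exI[of _ "proj_limit q"]) (auto simp: openin_topspace[of "weak_topology q", simplified])
next
  case (Suc k)
  obtain V where V: "openin (weak_topology q) V" "E_measure q \<nu> \<in> V"
    "\<forall>\<nu>'\<in>Nbar. E_measure q \<nu>' \<in> V \<longrightarrow> (\<forall>i\<in>{1..k}. \<nu>' i = Fin (\<eta> i))" using Suc by auto
  obtain W where W: "openin (weak_topology q) W" "E_measure q \<nu> \<in> W"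
    "\<forall>\<nu>'\<in>Nbar. E_measure q \<nu>' \<in> W \<longrightarrow> \<nu>' (Suc k) = Fin (\<eta> (Suc k))"
    using weak_separation_Fin[OF \<nu>, of "Suc k" "\<eta> (Suc k)"] Suc.prems by auto
  show ?case
    using V W by (intro exI[of _ "V \<inter> W"]) (auto simp: le_Suc_eq)
qed

theorem embedding_map_E_measure: "embedding_map Nbar_topology (weak_topology q) (E_measure q)"
proof -
  let ?E = "E_measure q"
  let ?Y = "subtopology (weak_topology q) (?E ` Nbar)"
  define g where "g = inv_into Nbar ?E"
  have gE: "g (?E \<nu>) = \<nu>" if "\<nu> \<in> Nbar" for \<nu>
    unfolding g_def by (rule inv_into_f_f[OF inj_on_E_measure that])
  have tY: "topspace ?Y = ?E ` Nbar"
    using E_measure_proj_limit by (auto simp: topspace_subtopology)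
  have "continuous_map ?Y Nbar_topology g"
    unfolding Nbar_topology_def
  proof (rule continuous_on_generated_topo)
    fix U assume U: "U \<in> {{\<nu> \<in> Nbar. \<forall>i\<in>{1..k}. \<nu> i = Fin (\<eta> i)} | k \<eta>. True} \<union>
      {{\<nu> \<in> Nbar. (\<forall>i\<in>{1..k}. \<nu> i = Fin (\<eta> i)) \<and> \<nu> (k + 1) \<ge> Fin l} | k \<eta> l. True}"
    then have UN: "U \<subseteq> Nbar" by auto
    have "g -` U \<inter> topspace ?Y = ?E ` U"
      unfolding tY using gE UN by auto
    moreover have "openin ?Y (?E ` U)"
    proof (rule openin_image_E_measure[OF UN])
      fix \<nu> assume \<nu>U: "\<nu> \<in> U"
      then have \<nu>: "\<nu> \<in> Nbar" using UN by auto
      from U consider (a) k \<eta> where "U = {\<nu> \<in> Nbar. \<forall>i\<in>{1..k}. \<nu> i = Fin (\<eta> i)}"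
        | (b) k \<eta> l where "U = {\<nu> \<in> Nbar. (\<forall>i\<in>{1..k}. \<nu> i = Fin (\<eta> i)) \<and> \<nu> (k + 1) \<ge> Fin l}" by blast
      then show "\<exists>V. openin (weak_topology q) V \<and> ?E \<nu> \<in> V \<and> (\<forall>\<nu>'\<in>Nbar. ?E \<nu>' \<in> V \<longrightarrow> \<nu>' \<in> U)"
      proof cases
        case a
        then show ?thesis using weak_separation_cylinder[OF \<nu>, of k \<eta>] \<nu>U by auto
      next
        case b
        obtain V where V: "openin (weak_topology q) V" "?E \<nu> \<in> V"
          "\<forall>\<nu>'\<in>Nbar. ?E \<nu>' \<in> V \<longrightarrow> (\<forall>i\<in>{1..k}. \<nu>' i = Fin (\<eta> i))"
          using weak_separation_cylinder[OF \<nu>, of k \<eta>] \<nu>U b by auto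
        obtain W where W: "openin (weak_topology q) W" "?E \<nu> \<in> W" "\<forall>\<nu>'\<in>Nbar. ?E \<nu>' \<in> W \<longrightarrow> Fin l \<le> \<nu>' (Suc k)"
          using weak_separation[OF \<nu> open_eint_ge[of l], of k] \<nu>U b by auto
        show ?thesis using V W b by (intro exI[of _ "V \<inter> W"]) auto
      qed
    qed
    ultimately show "openin ?Y (g -` U \<inter> topspace ?Y)" by simp
  next
    show "g ` topspace ?Y \<subseteq> \<Union> ({{\<nu> \<in> Nbar. \<forall>i\<in>{1..k}. \<nu> i = Fin (\<eta> i)} | k \<eta>. True} \<union>
      {{\<nu> \<in> Nbar. (\<forall>i\<in>{1..k}. \<nu> i = Fin (\<eta> i)) \<and> \<nu> (k + 1) \<ge> Fin l} | k \<eta> l. True})"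
      using topspace_Nbar gE unfolding tY Nbar_topology_def topology_generated_by_topspace by auto
  qed
  moreover have "continuous_map Nbar_topology ?Y ?E"
    using continuous_map_E_measure by (simp add: continuous_map_in_subtopology)
  ultimately have "homeomorphic_maps Nbar_topology ?Y ?E g"
    unfolding homeomorphic_maps_def tY using gE by auto
  then have "homeomorphic_map Nbar_topology ?Y ?E" by (simp only: homeomorphic_maps_map)
  then show ?thesis by (simp add: embedding_map_def)
qed

end

theorem theorem6p4:
  fixes q :: real
  assumes "0 < q" and "q < 1"
  shows "embedding_map Nbar_topology (weak_topology q) (E_measure q)"
proof -
  interpret qpar q by standard (use assms in auto)
  show ?thesis by (rule embedding_map_E_measure)
qed

end
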